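(* Let $M_t$ be a family of smooth $m$-dimensional submanifolds of $\mathbb{R}^n$ moving under the mean curvature flow, with $M_0=M$. Let $\sigma_t=[M_t]_s\wedge\beta^m/m!$ be their volume forms, $\sigma=\sigma_0$, let $S=[M]_s\wedge\beta^{m-1}/(m-1)!$, and let $\vec H$ be the mean curvature vector of $M$. Then, as supercurrents, $$\frac{d\sigma_t}{dt}\Big|_{t=0}=-|\vec H|^2\sigma-dd^{\#}S.$$
   Context: Superforms: let $x=(x_1,\dots,x_n)$ be orthonormal coordinates on $\mathbb{R}^n$ and $\xi=(\xi_1,\dots,\xi_n)$ coordinates on a second copy of $\mathbb{R}^n$. A superform is a differential form $a=\sum a_{I,J}(x)\,dx_I\wedge d\xi_J$ on $\mathbb{R}^n_s=\mathbb{R}^n\oplus\mathbb{R}^n$ whose coefficients do not depend on $\xi$; it has bidegree $(p,q)$ if $|I|=p$, $|J|=q$. $J$ is the multiplicative operator on forms with $J(dx_i)=d\xi_i$, $J(d\xi_i)=-dx_i$; for $a$ of bidegree $(p,0)$ write $a^{\#}=J(a)$. Put $da=\sum \frac{\partial a_{I,J}}{\partial x_k}dx_k\wedge dx_I\wedge d\xi_J$ and $d^{\#}a=\sum \frac{\partial a_{I,J}}{\partial x_k}d\xi_k\wedge dx_I\wedge d\xi_J$. The superintegral of an $(n,n)$-form is $\int_{\mathbb{R}^n_s}a_0\,dx_1\wedge d\xi_1\wedge\dots\wedge dx_n\wedge d\xi_n=\int_{\mathbb{R}^n}a_0\,d\lambda$ ($\lambda$ Lebesgue measure). Supercurrents of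 bidegree $(p,q)$ (bidimension $(n-p,n-q)$) are the continuous linear functionals on smooth superforms of bidegree $(n-p,n-q)$ with compact support in $x$; equivalently superforms with distribution coefficients, acting by $T.\alpha=\int T\wedge\alpha$. The operators $d,d^{\#}$ extend to supercurrents coefficientwise. $\beta=\sum_j dx_j\wedge d\xi_j$. The supercurrent $[M]_s$: let $M\subset\mathbb{R}^n$ be a smooth submanifold (without boundary, closed in the open set considered, so that its current of integration is $d$-closed) of dimension $m$ and codimension $p=n-m$. Locally choose defining functions $\rho_1,\dots,\rho_p$ such that $n_j:=d\rho_j$ are orthonormal at the points of $M$; put $n=n_1\wedge\dots\wedge n_p$, $c_p=(-1)^{p(p-1)/2}$. Then $[M]_s=c_p\,n\wedge n^{\#}*dS_M$, where $dS_M$ is surface measure on $M$ and, for a measure $\mu$, $*\mu$ is the bidegree $(0,0)$ supercurrent with $*\mu.(\alpha_0\,dx_1\wedge d\xi_1\wedge\dots\wedge dx_n\wedge d\xi_n)=\int\alpha_0\,d\mu$. This does not depend on the choice of $\rho_j$. Mean curvature: $F_j:=d n_j^{\#}$; $H_j$ is the trace of the restriction of $F_j$ to the tangent spaces of $M$, equivalently $F_j\wedge[M]_s\wedge\beta^{m-1}/(m-1)!=H_j\,[M]_s\wedge\beta^m/m!$; the mean curvature vector is $\vec H=\sum_jH_j\vec n_j$, with $\vec n_j$ the vector dual to $n_j$ (with this sign convention the mean curvature vector of a sphere points outwards). Mean curvature flow: a family $M_t$ of smooth submanifolds of $\mathbb{R}^n$ moves by the mean curvature flow if there is a vector field $\vec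 H$ on the ambient space which restricts to the mean curvature vector field of $M_t$ on each $M_t$ and such that $F_t(M_0)=M_t$, where $F_t$ is the flow of $-\vec H$. *)

theory Defs
  imports "HOL-Analysis.Analysis"
begin

text \<open>
  The dimension \<open>n\<close> of the ambient space is \<open>CARD('n)\<close>.  The index type is linearly ordered so that
  \<open>dx\<^sub>I \<and> d\<xi>\<^sub>J\<close> (both index sets in increasing order) makes sense for \<open>I, J :: 'n set\<close>;
  every finite linear order is a well-order.
\<close>

section \<open>The exterior algebra of constant superforms\<close>

text \<open>The component at \<open>(I, J)\<close> is the coefficient of \<open>dx\<^sub>I \<and> d\<xi>\<^sub>J\<close>.\<close>

type_synonym 'n superalg = "real ^ ('n set \<times> 'n set)"

definition inversions :: "'n::linorder set \<Rightarrow> 'n set \<Rightarrow> nat" where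
  "inversions I K = card {(i, k). i \<in> I \<and> k \<in> K \<and> k < i}"

text \<open>
  \<open>(dx\<^sub>I \<and> d\<xi>\<^sub>J) \<and> (dx\<^sub>K \<and> d\<xi>\<^sub>L) = \<plusminus> dx\<^bsub>I \<union> K\<^esub> \<and> d\<xi>\<^bsub>J \<union> L\<^esub>\<close> for \<open>I \<inter> K = J \<inter> L = {}\<close>, where the
  sign comes from moving \<open>dx\<^sub>K\<close> across \<open>d\<xi>\<^sub>J\<close> and then sorting.
\<close>

definition wedge_sign :: "'n::linorder set \<Rightarrow> 'n set \<Rightarrow> 'n set \<Rightarrow> 'n set \<Rightarrow> real" where
  "wedge_sign I J K L = (- 1) ^ (card J * card K + inversions I K + inversions J L)"

definition wedge ::
  "'n::{finite,wellorder} superalg \<Rightarrow> 'n superalg \<Rightarrow> 'n superalg"  (infixr "\<and>\<^sub>s" 75) where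
  "a \<and>\<^sub>s b = (\<chi> P. \<Sum>I\<in>Pow (fst P). \<Sum>J\<in>Pow (snd P).
      wedge_sign I J (fst P - I) (snd P - J) * (a $ (I, J) * b $ (fst P - I, snd P - J)))"

definition sbasis :: "'n::finite set \<Rightarrow> 'n set \<Rightarrow> 'n superalg" where
  "sbasis I J = axis (I, J) 1"

abbreviation sone :: "'n::finite superalg" where "sone \<equiv> sbasis {} {}"
abbreviation dx :: "'n::finite \<Rightarrow> 'n superalg" where "dx k \<equiv> sbasis {k} {}"
abbreviation d\<xi> :: "'n::finite \<Rightarrow> 'n superalg" where "d\<xi> k \<equiv> sbasis {} {k}"

fun wedge_power :: "'n::{finite,wellorder} superalg \<Rightarrow> nat \<Rightarrow> 'n superalg" where
  "wedge_power a 0 = sone"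
| "wedge_power a (Suc k) = a \<and>\<^sub>s wedge_power a k"

definition wedge_list :: "'n::{finite,wellorder} superalg list \<Rightarrow> 'n superalg" where
  "wedge_list as = foldr wedge as sone"

definition \<beta> :: "'n::{finite,wellorder} superalg" where
  "\<beta> = (\<Sum>j\<in>UNIV. dx j \<and>\<^sub>s d\<xi> j)"

text \<open>
  \<open>J (dx\<^sub>B \<and> d\<xi>\<^sub>A) = d\<xi>\<^sub>B \<and> (-1)\<^bsup>|A|\<^esup> dx\<^sub>A = (-1)\<^bsup>|A| + |A| |B|\<^esup> dx\<^sub>A \<and> d\<xi>\<^sub>B\<close>.
\<close>

definition Jop :: "'n::finite superalg \<Rightarrow> 'n superalg" where
  "Jop a = (\<chi> P. (- 1) ^ (card (fst P) + card (fst P) * card (snd P)) * a $ (snd P, fst P))"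

section \<open>Superforms\<close>

type_synonym 'n superform = "real ^ 'n \<Rightarrow> 'n superalg"

definition partial :: "'n::finite \<Rightarrow> (real ^ 'n \<Rightarrow> 'b::real_normed_vector) \<Rightarrow> real ^ 'n \<Rightarrow> 'b" where
  "partial k f x = frechet_derivative f (at x) (axis k 1)"

text \<open>Only meaningful for open \<open>U\<close>, where \<open>partial\<close> is determined by \<open>f\<close> on \<open>U\<close>.\<close>

fun Ck_on :: "nat \<Rightarrow> (real ^ 'n::finite) set \<Rightarrow> (real ^ 'n \<Rightarrow> 'b::real_normed_vector) \<Rightarrow> bool" where
  "Ck_on 0 U f \<longleftrightarrow> continuous_on U f"
| "Ck_on (Suc r) U f \<longleftrightarrow> (\<forall>x\<in>U. f differentiable (at x)) \<and> (\<forall>k. Ck_on r U (partial k f))"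

definition smooth_on :: "(real ^ 'n::finite) set \<Rightarrow> (real ^ 'n \<Rightarrow> 'b::real_normed_vector) \<Rightarrow> bool" where
  "smooth_on U f \<longleftrightarrow> open U \<and> (\<forall>r. Ck_on r U f)"

definition ext_d :: "'n::{finite,wellorder} superform \<Rightarrow> 'n superform" where
  "ext_d a x = (\<Sum>k\<in>UNIV. dx k \<and>\<^sub>s partial k a x)"

definition test_form :: "nat \<Rightarrow> nat \<Rightarrow> 'n::finite superform \<Rightarrow> bool" where
  "test_form p q \<alpha> \<longleftrightarrow>
     smooth_on UNIV \<alpha> \<and> (\<exists>K. compact K \<and> (\<forall>x. x \<notin> K \<longrightarrow> \<alpha> x = 0)) \<and>
     (\<forall>x I J. \<alpha> x $ (I, J) \<noteq> 0 \<longrightarrow> card I = p \<and> card J = q)"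

section \<open>Supercurrents\<close>

text \<open>
  A supercurrent is a superform \<open>\<Sum> T\<^bsub>I,J\<^esub> dx\<^sub>I \<and> d\<xi>\<^sub>J\<close> with distribution coefficients.  It is
  represented by the map \<open>\<phi> \<mapsto> \<Sum> T\<^bsub>I,J\<^esub>(\<phi>) dx\<^sub>I \<and> d\<xi>\<^sub>J\<close> on test functions \<open>\<phi>\<close>; a superform \<open>a\<close>
  corresponds to \<open>\<phi> \<mapsto> \<integral> \<phi> a d\<lambda>\<close>.  Values at functions that are not test functions are
  irrelevant.
\<close>

type_synonym 'n supercurrent = "(real ^ 'n \<Rightarrow> real) \<Rightarrow> 'n superalg"

definition fmult :: "(real ^ 'n::finite \<Rightarrow> real) \<Rightarrow> 'n::finite supercurrent \<Rightarrow> 'n supercurrent" where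
  "fmult f T = (\<lambda>\<phi>. T (\<lambda>x. f x * \<phi> x))"

definition current_wedge ::
  "'n::{finite,wellorder} supercurrent \<Rightarrow> 'n superform \<Rightarrow> 'n supercurrent"  (infixl "\<and>\<^sub>c" 74) where
  "(T \<and>\<^sub>c \<omega>) = (\<lambda>\<phi>. \<Sum>(I, J)\<in>UNIV. fmult (\<lambda>x. \<omega> x $ (I, J)) T \<phi> \<and>\<^sub>s sbasis I J)"

definition current_partial :: "'n::finite \<Rightarrow> 'n supercurrent \<Rightarrow> 'n supercurrent" where
  "current_partial k T = (\<lambda>\<phi>. - T (partial k \<phi>))"

definition current_d :: "'n::{finite,wellorder} supercurrent \<Rightarrow> 'n supercurrent" where
  "current_d T = (\<lambda>\<phi>. \<Sum>k\<in>UNIV. dx k \<and>\<^sub>s current_partial k T \<phi>)"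

definition current_dsharp :: "'n::{finite,wellorder} supercurrent \<Rightarrow> 'n supercurrent" where
  "current_dsharp T = (\<lambda>\<phi>. \<Sum>k\<in>UNIV. d\<xi> k \<and>\<^sub>s current_partial k T \<phi>)"

text \<open>
  The superintegral of a supercurrent whose coefficients have compact support, which are thus
  applied to the constant \<open>1\<close>.  The sign comes from
  \<open>dx\<^sub>1 \<and> d\<xi>\<^sub>1 \<and> \<dots> \<and> dx\<^sub>n \<and> d\<xi>\<^sub>n = (-1)\<^bsup>n(n-1)/2\<^esup> dx\<^sub>1 \<and> \<dots> \<and> dx\<^sub>n \<and> d\<xi>\<^sub>1 \<and> \<dots> \<and> d\<xi>\<^sub>n\<close>.
\<close>

definition superintegral :: "'n::finite supercurrent \<Rightarrow> real" where
  "superintegral T = (- 1) ^ (CARD('n) * (CARD('n) - 1) div 2) * T (\<lambda>_. 1) $ (UNIV, UNIV)"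

definition current_act :: "'n::{finite,wellorder} supercurrent \<Rightarrow> 'n superform \<Rightarrow> real" where
  "current_act T \<alpha> = superintegral (T \<and>\<^sub>c \<alpha>)"

text \<open>
  \<open>form_measure \<omega> \<mu>\<close> is \<open>\<omega> *\<mu>\<close>, for a form \<open>\<omega>\<close> given at the points of the space of \<open>\<mu>\<close>.
\<close>

definition form_measure :: "'n::finite superform \<Rightarrow> (real ^ 'n) measure \<Rightarrow> 'n supercurrent" where
  "form_measure \<omega> \<mu> = (\<lambda>\<phi>. LINT x|\<mu>. \<phi> x *\<^sub>R \<omega> x)"

text \<open>
  The time derivative of a family of supercurrents of bidegree \<open>(p, q)\<close>, in the weak sense.
\<close>

definition has_current_derivative ::
  "nat \<Rightarrow> nat \<Rightarrow> (real \<Rightarrow> 'n::{finite,wellorder} supercurrent) \<Rightarrow> 'n supercurrent \<Rightarrow> real filter \<Rightarrow> bool" where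
  "has_current_derivative p q T T' F \<longleftrightarrow>
     (\<forall>\<alpha>. test_form (CARD('n) - p) (CARD('n) - q) \<alpha> \<longrightarrow>
        ((\<lambda>t. current_act (T t) \<alpha>) has_real_derivative current_act T' \<alpha>) F)"

section \<open>Submanifolds and their normals\<close>

definition fun_form :: "(real ^ 'n::finite \<Rightarrow> real) \<Rightarrow> 'n::finite superform" where
  "fun_form f = (\<lambda>x. f x *\<^sub>R sone)"

definition conormal :: "(real ^ 'n::{finite,wellorder} \<Rightarrow> real) \<Rightarrow> 'n superform" where
  "conormal \<rho> = ext_d (fun_form \<rho>)"

text \<open>The vector dual to a form of bidegree \<open>(1, 0)\<close>.\<close>

definition dual_vec :: "'n::finite superalg \<Rightarrow> real ^ 'n" where
  "dual_vec \<nu> = (\<chi> k. \<nu> $ ({k}, {}))"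

definition defining_functions ::
  "nat \<Rightarrow> (real ^ 'n::{finite,wellorder}) set \<Rightarrow> (real ^ 'n::_) set \<Rightarrow> (nat \<Rightarrow> real ^ 'n::_ \<Rightarrow> real) \<Rightarrow> bool" where
  "defining_functions p M U \<rho> \<longleftrightarrow>
     open U \<and> (\<forall>j<p. smooth_on U (\<rho> j)) \<and> M \<inter> U = {x \<in> U. \<forall>j<p. \<rho> j x = 0} \<and>
     (\<forall>x\<in>M \<inter> U. \<forall>c. (\<Sum>j<p. c j *\<^sub>R conormal (\<rho> j) x) = 0 \<longrightarrow> (\<forall>j<p. c j = 0))"

text \<open>Smooth \<open>m\<close>-dimensional embedded submanifold of \<open>\<real>\<^sup>n\<close>, without boundary and closed in \<open>\<real>\<^sup>n\<close>.\<close>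

definition submanifold :: "nat \<Rightarrow> (real ^ 'n::{finite,wellorder}) set \<Rightarrow> bool" where
  "submanifold m M \<longleftrightarrow> closed M \<and> m \<le> CARD('n) \<and>
     (\<forall>x\<in>M. \<exists>U \<rho>. x \<in> U \<and> defining_functions (CARD('n) - m) M U \<rho>)"

definition orthonormal_defining ::
  "nat \<Rightarrow> (real ^ 'n::{finite,wellorder}) set \<Rightarrow> (real ^ 'n::_) set \<Rightarrow> (nat \<Rightarrow> real ^ 'n::_ \<Rightarrow> real) \<Rightarrow> bool" where
  "orthonormal_defining p M U \<rho> \<longleftrightarrow> defining_functions p M U \<rho> \<and>
     (\<forall>x\<in>M \<inter> U. \<forall>i<p. \<forall>j<p.
        dual_vec (conormal (\<rho> i) x) \<bullet> dual_vec (conormal (\<rho> j) x) = (if i = j then 1 else 0))"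

text \<open>
  \<open>n = n\<^sub>1 \<and> \<dots> \<and> n\<^sub>p\<close> itself is determined only up to sign, but \<open>n \<and> n\<^sup>#\<close> does not depend on the choice.
\<close>

definition normal_form :: "nat \<Rightarrow> (real ^ 'n::{finite,wellorder}) set \<Rightarrow> 'n superform" where
  "normal_form p M x = (SOME \<omega>. \<exists>U \<rho> \<nu>. x \<in> U \<and> orthonormal_defining p M U \<rho> \<and>
     \<nu> = wedge_list (map (\<lambda>j. conormal (\<rho> j) x) [0..<p]) \<and> \<omega> = \<nu> \<and>\<^sub>s Jop \<nu>)"

section \<open>Surface measure\<close>

definition local_param ::
  "(real ^ 'n::finite) set \<Rightarrow> (real ^ 'm::finite) set \<Rightarrow> (real ^ 'm::finite \<Rightarrow> real ^ 'n::finite) \<Rightarrow> bool" where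
  "local_param M V \<psi> \<longleftrightarrow> smooth_on V \<psi> \<and> (\<forall>u\<in>V. inj (frechet_derivative \<psi> (at u))) \<and>
     openin (top_of_set M) (\<psi> ` V) \<and> (\<exists>\<theta>. homeomorphism V (\<psi> ` V) \<psi> \<theta>)"

definition area_factor :: "(real ^ 'm::finite \<Rightarrow> real ^ 'n::finite) \<Rightarrow> real ^ 'm \<Rightarrow> real" where
  "area_factor \<psi> u = (let A = matrix (frechet_derivative \<psi> (at u)) in sqrt (det (transpose A ** A)))"

text \<open>
  The surface measure of a submanifold of dimension \<open>CARD('m)\<close> is the unique Borel measure on \<open>M\<close>
  (a measure with space \<open>M\<close>) that is given by the area formula in every local parametrization.
\<close>

definition surface_measure ::
  "'m::{finite,wellorder} itself \<Rightarrow> (real ^ 'n::finite) set \<Rightarrow> (real ^ 'n) measure" where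
  "surface_measure _ M = (SOME \<mu>. sets \<mu> = sets (restrict_space borel M) \<and>
     (\<forall>V (\<psi> :: real ^ 'm::_ \<Rightarrow> real ^ 'n). local_param M V \<psi> \<longrightarrow>
        (\<forall>A\<in>sets borel. A \<subseteq> V \<longrightarrow>
           emeasure \<mu> (\<psi> ` A) = (\<integral>\<^sup>+u\<in>A. ennreal (area_factor \<psi> u) \<partial>lborel))))"

section \<open>The supercurrent of a submanifold\<close>

definition submanifold_current ::
  "'m::{finite,wellorder} itself \<Rightarrow> (real ^ 'n::{finite,wellorder}) set \<Rightarrow> 'n supercurrent" where
  "submanifold_current T M =
     (let p = CARD('n) - CARD('m)
      in form_measure (\<lambda>x. (- 1) ^ (p * (p - 1) div 2) *\<^sub>R normal_form p M x) (surface_measure T M))"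

text \<open>\<open>[M]\<^sub>s \<and> \<beta>\<^sup>k / k!\<close>\<close>

definition submanifold_current_beta ::
  "'m::{finite,wellorder} itself \<Rightarrow> (real ^ 'n::{finite,wellorder}) set \<Rightarrow> nat \<Rightarrow> 'n supercurrent" where
  "submanifold_current_beta T M k =
     submanifold_current T M \<and>\<^sub>c (\<lambda>_. wedge_power \<beta> k /\<^sub>R fact k)"

section \<open>Mean curvature\<close>

text \<open>A form \<open>\<Sum> F\<^bsub>k,l\<^esub> dx\<^sub>k \<and> d\<xi>\<^sub>l\<close> of bidegree \<open>(1, 1)\<close> as a bilinear form.\<close>

definition bilin_of :: "'n::finite superalg \<Rightarrow> real ^ 'n \<Rightarrow> real ^ 'n \<Rightarrow> real" where
  "bilin_of F u v = (\<Sum>k\<in>UNIV. \<Sum>l\<in>UNIV. F $ ({k}, {l}) * u $ k * v $ l)"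

definition trace_on :: "'a::euclidean_space set \<Rightarrow> ('a \<Rightarrow> 'a \<Rightarrow> real) \<Rightarrow> real" where
  "trace_on S b = (SOME r. \<exists>B. pairwise orthogonal B \<and> (\<forall>e\<in>B. norm e = 1) \<and> span B = S \<and>
     r = (\<Sum>e\<in>B. b e e))"

definition tangent_space ::
  "nat \<Rightarrow> (nat \<Rightarrow> real ^ 'n::{finite,wellorder} \<Rightarrow> real) \<Rightarrow> real ^ 'n::_ \<Rightarrow> (real ^ 'n::_) set" where
  "tangent_space p \<rho> x = {v. \<forall>j<p. dual_vec (conormal (\<rho> j) x) \<bullet> v = 0}"

text \<open>\<open>H\<^sub>j\<close>, with \<open>F\<^sub>j = d n\<^sub>j\<^sup>#\<close>.\<close>

definition mean_curvature_component ::
  "nat \<Rightarrow> (nat \<Rightarrow> real ^ 'n::{finite,wellorder} \<Rightarrow> real) \<Rightarrow> nat \<Rightarrow> real ^ 'n::_ \<Rightarrow> real" where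
  "mean_curvature_component p \<rho> j x =
     trace_on (tangent_space p \<rho> x) (bilin_of (ext_d (\<lambda>y. Jop (conormal (\<rho> j) y)) x))"

definition mean_curvature_vector ::
  "nat \<Rightarrow> (real ^ 'n::{finite,wellorder}) set \<Rightarrow> real ^ 'n::_ \<Rightarrow> real ^ 'n::_" where
  "mean_curvature_vector m M x = (let p = CARD('n) - m in
     SOME h. \<exists>U \<rho>. x \<in> U \<and> orthonormal_defining p M U \<rho> \<and>
       h = (\<Sum>j<p. mean_curvature_component p \<rho> j x *\<^sub>R dual_vec (conormal (\<rho> j) x)))"

section \<open>Mean curvature flow\<close>

text \<open>
  \<open>I\<close> is the time interval; \<open>\<lambda>t. F t x\<close> is the integral curve of \<open>- H\<close> starting at \<open>x\<close>, which is
  required to exist on \<open>I\<close> only for \<open>x \<in> M 0\<close>.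
\<close>

definition mean_curvature_flow ::
  "nat \<Rightarrow> real set \<Rightarrow> (real \<Rightarrow> (real ^ 'n::{finite,wellorder}) set) \<Rightarrow> bool" where
  "mean_curvature_flow m I M \<longleftrightarrow>
     (\<forall>t\<in>I. submanifold m (M t)) \<and>
     (\<exists>(H :: real ^ 'n::_ \<Rightarrow> real ^ 'n::_) F.
        smooth_on UNIV H \<and>
        (\<forall>t\<in>I. \<forall>x\<in>M t. H x = mean_curvature_vector m (M t) x) \<and>
        (\<forall>x\<in>M 0. F 0 x = x \<and>
           (\<forall>t\<in>I. ((\<lambda>s. F s x) has_vector_derivative - H (F t x)) (at t within I))) \<and>
        (\<forall>t\<in>I. F t ` M 0 = M t))"

end

theory Submission
  imports Defs
begin

text \<open>
  For a test function \<open>f\<close>, identified with a test form of bidegree \<open>(0, 0)\<close>, the multilinear algebra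
  of orthonormal frames gives \<open>\<sigma>\<^sub>t(f) = \<integral>\<^bsub>M\<^sub>t\<^esub> f dS\<close> and
  \<open>dd\<^sup>#S(f) = \<integral>\<^bsub>M\<^esub> \<Sum> P\<^bsub>k l\<^esub> \<partial>\<^sub>k\<partial>\<^sub>l f dS\<close>, where \<open>P\<close> is the orthogonal projection onto the
  tangent space of \<open>M\<close>.  In a parametrization \<open>\<psi>\<close> of \<open>M\<close>, the surface \<open>M\<^sub>t\<close> is parametrized by
  \<open>F\<^sub>t \<circ> \<psi>\<close>, whose Jacobian solves the variational equation of the flow; differentiating
  its Gram determinant yields
  \<open>d/dt \<integral>\<^bsub>M\<^sub>t\<^esub> f dS = - \<integral>\<^bsub>M\<^esub> (\<nabla>f \<bullet> H + f div\<^sub>M H) dS\<close>, and \<open>div\<^sub>M H = |H|\<^sup>2\<close> because \<open>H\<close> is normal.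
  Finally the divergence theorem on \<open>M\<close> turns \<open>\<integral>\<^bsub>M\<^esub> \<nabla>f \<bullet> H dS\<close> into
  \<open>\<integral>\<^bsub>M\<^esub> div\<^sub>M \<nabla>f dS = \<integral>\<^bsub>M\<^esub> \<Sum> P\<^bsub>k l\<^esub> \<partial>\<^sub>k\<partial>\<^sub>l f dS\<close>.
\<close>

section \<open>Functions of class \<open>C\<^sup>k\<close>\<close>

text \<open>Surface measure, normal form and mean curvature vector are all given by a choice. The
  measure is built from a countable atlas. The normal form turns out to be a function of the
  tangential projection, which a chart computes without defining functions. The mean curvature
  vector enters the computation through being normal and through
  \<open>Z \<bullet> H = div Z\<close> for normal fields \<open>Z\<close>.

  The flow \<open>F\<close> is merely a family of integral curves starting on \<open>M 0\<close>;
  nothing is given about how it depends on the starting point. Its derivative in a chart must be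
  produced from the variational equation, by Gronwall estimates on a time interval so short that
  Lipschitz constant times length is at most 1/2. This makes the flowed charts C^1 and no more,
  which is why the area formula is proved for C^1 immersions.

  As \<open>M 0\<close> may be noncompact and \<open>H\<close> unbounded, no estimate is uniform
  over \<open>M 0\<close>. The variation is computed for functions supported in a small ball, with
  radius and time interval depending on its centre, and a finite partition of class C^2 glues the
  results.\<close>

lemma partial_eqI: "(f has_derivative D) (at x) \<Longrightarrow> partial k f x = D (axis k 1)"
  using frechet_derivative_at[of f D x] by (simp add: partial_def)

lemma sum_axis_scaleR:
  fixes g :: "'n::finite \<Rightarrow> 'b::real_vector"
  shows "(\<Sum>j\<in>UNIV. axis k (1::real) $ j *\<^sub>R g j) = g k"
proof -
  have "(\<Sum>j\<in>UNIV. axis k (1::real) $ j *\<^sub>R g j) = (\<Sum>j\<in>UNIV. if j = k then g j else 0)"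
    by (intro sum.cong) (auto simp: axis_def)
  then show ?thesis by simp
qed

lemmas sum_axis_mult = sum_axis_scaleR[where 'b = real, unfolded real_scaleR_def]

lemma linear_axis_expansion:
  fixes h :: "real ^ 'n"
  assumes "linear L"
  shows "L h = (\<Sum>k\<in>UNIV. h $ k *\<^sub>R L (axis k 1))"
proof -
  interpret linear L by fact
  have "L h = L (\<Sum>k\<in>UNIV. h $ k *\<^sub>R axis k 1)"
    by (metis basis_expansion scalar_mult_eq_scaleR)
  also have "\<dots> = (\<Sum>k\<in>UNIV. h $ k *\<^sub>R L (axis k 1))"
    by (simp add: sum scaleR)
  finally show ?thesis .
qed

lemma has_derivative_partials:
  fixes f :: "real ^ 'n \<Rightarrow> 'b::real_normed_vector"
  assumes "f differentiable (at x)"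
  shows "(f has_derivative (\<lambda>h. \<Sum>k\<in>UNIV. h $ k *\<^sub>R partial k f x)) (at x)"
proof -
  have D: "(f has_derivative frechet_derivative f (at x)) (at x)"
    using assms by (simp add: frechet_derivative_works)
  then have "linear (frechet_derivative f (at x))"
    by (simp add: has_derivative_linear)
  then have "frechet_derivative f (at x) = (\<lambda>h. \<Sum>k\<in>UNIV. h $ k *\<^sub>R partial k f x)"
    unfolding partial_def by (intro ext linear_axis_expansion)
  with D show ?thesis by simp
qed

lemma partial_cong_open:
  assumes "open U" "x \<in> U" "\<And>y. y \<in> U \<Longrightarrow> f y = g y" "f differentiable (at x)"
  shows "partial k f x = partial k g x"
  unfolding partial_def
  using frechet_derivative_transform_within_open[OF assms(4,1,2,3)] by simp

text \<open>Near a point of an open set the derivative depends only on values in that set. The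
  closure rules below all use this: an explicit formula for the new partials is of class C^r, and it
  agrees with \<open>partial\<close> on \<open>U\<close> only.\<close>

lemma Ck_on_cong:
  assumes "open U" "\<And>x. x \<in> U \<Longrightarrow> f x = g x" "Ck_on r U f"
  shows "Ck_on r U g"
  using assms
proof (induction r arbitrary: f g)
  case 0
  then show ?case by (simp cong: continuous_on_cong)
next
  case (Suc r)
  have "g differentiable (at x)" if "x \<in> U" for x
  proof -
    have "f differentiable (at x)" using Suc.prems(3) that by simp
    then obtain D where "(f has_derivative D) (at x)" unfolding differentiable_def by blast
    then have "(g has_derivative D) (at x)"
      by (rule has_derivative_transform_within_open[where f = f and s = U])
        (simp_all add: Suc.prems(1,2) that)
    then show ?thesis by (rule differentiableI)
  qed
  moreover have "Ck_on r U (partial k g)" for k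
  proof (rule Suc.IH[OF Suc.prems(1)])
    show "Ck_on r U (partial k f)" using Suc.prems(3) by simp
    fix x assume "x \<in> U"
    then show "partial k f x = partial k g x"
      using Suc.prems by (intro partial_cong_open[where U = U]) simp_all
  qed
  ultimately show ?case by simp
qed

lemma Ck_on_subset: "Ck_on r U f \<Longrightarrow> V \<subseteq> U \<Longrightarrow> Ck_on r V f"
  by (induction r arbitrary: f) (auto intro: continuous_on_subset)

lemma Ck_on_differentiable: "Ck_on (Suc r) U f \<Longrightarrow> x \<in> U \<Longrightarrow> f differentiable (at x)"
  by simp

lemma Ck_on_partial: "Ck_on (Suc r) U f \<Longrightarrow> Ck_on r U (partial k f)"
  by simp

lemma Ck_on_Suc_imp: "Ck_on (Suc r) U f \<Longrightarrow> Ck_on r U f"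
proof (induction r arbitrary: f)
  case 0
  then show ?case
    by (auto intro!: continuous_at_imp_continuous_on differentiable_imp_continuous_within)
next
  case (Suc r)
  then show ?case using Ck_on.simps(2) by blast
qed

lemma Ck_on_mono: "Ck_on s U f \<Longrightarrow> r \<le> s \<Longrightarrow> Ck_on r U f"
  by (induction s) (auto simp: le_Suc_eq simp del: Ck_on.simps dest: Ck_on_Suc_imp)

lemma Ck_on_continuous: "Ck_on r U f \<Longrightarrow> continuous_on U f"
  using Ck_on_mono[of r U f 0] by simp

lemma Ck_on_bounded_linear:
  assumes "bounded_linear L" "open U" "Ck_on r U f"
  shows "Ck_on r U (\<lambda>x. L (f x))"
  using assms(3)
proof (induction r arbitrary: f)
  case 0
  then show ?case
    using assms(1) by (auto intro: bounded_linear.continuous_on)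
next
  case (Suc r)
  have D: "((\<lambda>x. L (f x)) has_derivative (\<lambda>h. L (\<Sum>k\<in>UNIV. h $ k *\<^sub>R partial k f x))) (at x)"
    if "x \<in> U" for x
    using Suc.prems that
    by (intro bounded_linear.has_derivative[OF assms(1)] has_derivative_partials) auto
  have "Ck_on r U (partial k (\<lambda>x. L (f x)))" for k
  proof (rule Ck_on_cong[OF assms(2)])
    show "Ck_on r U (\<lambda>x. L (partial k f x))" using Suc by auto
    fix x assume "x \<in> U"
    show "L (partial k f x) = partial k (\<lambda>x. L (f x)) x"
      using partial_eqI[OF D[OF \<open>x \<in> U\<close>], of k] by (simp add: sum_axis_scaleR sum_axis_mult)
  qed
  then show ?case using D by (auto simp: differentiable_def)
qed

lemma Ck_on_const:
  fixes U :: "(real ^ 'n) set"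
  shows "Ck_on r U (\<lambda>_. c)"
proof (induction r arbitrary: c)
  case (Suc r)
  have "partial k (\<lambda>_. c) = (\<lambda>_. 0)" for k :: 'n
    by (auto simp: partial_def fun_eq_iff)
  then have "Ck_on r U (partial k (\<lambda>_. c))" for k :: 'n
    using Suc.IH[of 0] by simp
  then show ?case by simp
qed simp

lemma Ck_on_add:
  assumes "open U" "Ck_on r U f" "Ck_on r U g"
  shows "Ck_on r U (\<lambda>x. f x + g x)"
  using assms(2,3)
proof (induction r arbitrary: f g)
  case 0
  then show ?case by (auto intro: continuous_on_add)
next
  case (Suc r)
  have D: "((\<lambda>x. f x + g x) has_derivative (\<lambda>h. (\<Sum>k\<in>UNIV. h $ k *\<^sub>R partial k f x) +
      (\<Sum>k\<in>UNIV. h $ k *\<^sub>R partial k g x))) (at x)" if "x \<in> U" for x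
    using Suc.prems that by (intro has_derivative_add has_derivative_partials) auto
  have "Ck_on r U (partial k (\<lambda>x. f x + g x))" for k
  proof (rule Ck_on_cong[OF assms(1)])
    show "Ck_on r U (\<lambda>x. partial k f x + partial k g x)" using Suc by auto
    fix x assume "x \<in> U"
    show "partial k f x + partial k g x = partial k (\<lambda>x. f x + g x) x"
      using partial_eqI[OF D[OF \<open>x \<in> U\<close>], of k] by (simp add: sum_axis_scaleR sum_axis_mult)
  qed
  then show ?case using D by (auto simp: differentiable_def)
qed

lemma Ck_on_bilinear:
  assumes bl: "bounded_bilinear pr" and U: "open U" and "Ck_on r U f" "Ck_on r U g"
  shows "Ck_on r U (\<lambda>x. pr (f x) (g x))"
  using assms(3,4)
proof (induction r arbitrary: f g)
  case 0
  then show ?case using bl by (auto intro: bounded_bilinear.continuous_on)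
next
  case (Suc r)
  interpret bounded_bilinear pr by fact
  have D: "((\<lambda>x. pr (f x) (g x)) has_derivative
      (\<lambda>h. pr (f x) (\<Sum>k\<in>UNIV. h $ k *\<^sub>R partial k g x) +
           pr (\<Sum>k\<in>UNIV. h $ k *\<^sub>R partial k f x) (g x))) (at x)" if "x \<in> U" for x
    using Suc.prems that by (intro FDERIV has_derivative_partials) auto
  have "Ck_on r U (partial k (\<lambda>x. pr (f x) (g x)))" for k
  proof (rule Ck_on_cong[OF U])
    have "Ck_on r U f" "Ck_on r U g" using Suc.prems Ck_on_Suc_imp by blast+
    then show "Ck_on r U (\<lambda>x. pr (f x) (partial k g x) + pr (partial k f x) (g x))"
      using Suc.prems by (intro Ck_on_add[OF U] Suc.IH) auto
    fix x assume "x \<in> U"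
    show "pr (f x) (partial k g x) + pr (partial k f x) (g x) = partial k (\<lambda>x. pr (f x) (g x)) x"
      using partial_eqI[OF D[OF \<open>x \<in> U\<close>], of k] by (simp add: sum_axis_scaleR sum_axis_mult)
  qed
  then show ?case using D by (auto simp: differentiable_def)
qed

lemmas Ck_on_mult = Ck_on_bilinear[OF bounded_bilinear_mult]
lemmas Ck_on_scaleR = Ck_on_bilinear[OF bounded_bilinear_scaleR]
lemmas Ck_on_inner = Ck_on_bilinear[OF bounded_bilinear_inner]
lemmas Ck_on_nth = Ck_on_bounded_linear[OF bounded_linear_vec_nth]

lemma Ck_on_uminus: "open U \<Longrightarrow> Ck_on r U f \<Longrightarrow> Ck_on r U (\<lambda>x. - f x)"
  using Ck_on_bounded_linear[OF bounded_linear_minus[OF bounded_linear_ident]] by blast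

lemma Ck_on_diff: "open U \<Longrightarrow> Ck_on r U f \<Longrightarrow> Ck_on r U g \<Longrightarrow> Ck_on r U (\<lambda>x. f x - g x)"
  using Ck_on_add[of U r f "\<lambda>x. - g x"] Ck_on_uminus by auto

lemma Ck_on_sum:
  "open U \<Longrightarrow> (\<And>i. i \<in> A \<Longrightarrow> Ck_on r U (f i)) \<Longrightarrow> Ck_on r U (\<lambda>x. \<Sum>i\<in>A. f i x)"
  by (induction A rule: infinite_finite_induct) (auto intro: Ck_on_add Ck_on_const)

lemma Ck_on_prod:
  fixes f :: "'i \<Rightarrow> real ^ 'n \<Rightarrow> real"
  shows "open U \<Longrightarrow> (\<And>i. i \<in> A \<Longrightarrow> Ck_on r U (f i)) \<Longrightarrow> Ck_on r U (\<lambda>x. \<Prod>i\<in>A. f i x)"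
  by (induction A rule: infinite_finite_induct) (auto intro: Ck_on_mult Ck_on_const)

lemma Ck_on_vecI:
  fixes f :: "real ^ 'n \<Rightarrow> real ^ 'k"
  assumes "open U" "\<And>i. Ck_on r U (\<lambda>x. f x $ i)"
  shows "Ck_on r U f"
proof -
  have "(\<lambda>x. \<Sum>i\<in>UNIV. f x $ i *\<^sub>R axis i 1) = f"
    using basis_expansion[where 'a=real and 'n='k] by (simp add: scalar_mult_eq_scaleR)
  moreover have "Ck_on r U (\<lambda>x. \<Sum>i\<in>UNIV. f x $ i *\<^sub>R (axis i 1 :: real ^ 'k))"
    using assms by (intro Ck_on_sum Ck_on_scaleR Ck_on_const)
  ultimately show ?thesis by (simp only:)
qed

lemma Ck_on_ident: "open U \<Longrightarrow> Ck_on r U (\<lambda>x. x)"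
proof (cases r)
  case (Suc s)
  have "partial k (\<lambda>x. x) = (\<lambda>_. axis k 1)" for k :: 'a
    by (auto simp: partial_def fun_eq_iff)
  then show ?thesis unfolding Suc by (simp add: Ck_on_const)
qed simp

text \<open>The partials contain the inverse itself as a factor. The induction therefore keeps
  \<open>f\<close> fixed and takes the class of that factor from its hypothesis;
  \<open>Ck_on_sqrt\<close> works the same way.\<close>

lemma Ck_on_inverse:
  fixes f :: "real ^ 'n \<Rightarrow> real"
  assumes U: "open U" and "Ck_on r U f" "\<And>x. x \<in> U \<Longrightarrow> f x \<noteq> 0"
  shows "Ck_on r U (\<lambda>x. inverse (f x))"
  using assms(2)
proof (induction r)
  case 0
  then show ?case using assms(3) by (auto intro: continuous_on_inverse)
next
  case (Suc r)
  have D: "((\<lambda>x. inverse (f x)) has_derivative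
      (\<lambda>h. - (inverse (f x) * (\<Sum>k\<in>UNIV. h $ k *\<^sub>R partial k f x) * inverse (f x)))) (at x)"
    if "x \<in> U" for x
    using Suc.prems that assms(3) by (intro Deriv.has_derivative_inverse has_derivative_partials) auto
  have "Ck_on r U (partial k (\<lambda>x. inverse (f x)))" for k
  proof (rule Ck_on_cong[OF U])
    have "Ck_on r U (\<lambda>x. inverse (f x))" using Suc Ck_on_Suc_imp by blast
    then show "Ck_on r U (\<lambda>x. - (inverse (f x) * partial k f x * inverse (f x)))"
      using Suc.prems by (intro Ck_on_uminus Ck_on_mult U) auto
    fix x assume "x \<in> U"
    show "- (inverse (f x) * partial k f x * inverse (f x)) = partial k (\<lambda>x. inverse (f x)) x"
      using partial_eqI[OF D[OF \<open>x \<in> U\<close>], of k] by (simp add: sum_axis_scaleR sum_axis_mult)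
  qed
  then show ?case using D by (auto simp: differentiable_def)
qed

lemma Ck_on_divide:
  fixes f g :: "real ^ 'n \<Rightarrow> real"
  assumes "open U" "Ck_on r U f" "Ck_on r U g" "\<And>x. x \<in> U \<Longrightarrow> g x \<noteq> 0"
  shows "Ck_on r U (\<lambda>x. f x / g x)"
  unfolding divide_inverse using assms by (intro Ck_on_mult Ck_on_inverse)

lemma Ck_on_sqrt:
  fixes f :: "real ^ 'n \<Rightarrow> real"
  assumes U: "open U" and "Ck_on r U f" "\<And>x. x \<in> U \<Longrightarrow> f x > 0"
  shows "Ck_on r U (\<lambda>x. sqrt (f x))"
  using assms(2)
proof (induction r)
  case 0
  then show ?case by (auto intro: continuous_intros)
next
  case (Suc r)
  have D: "((\<lambda>x. sqrt (f x)) has_derivative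
      (\<lambda>h. (\<Sum>k\<in>UNIV. h $ k *\<^sub>R partial k f x) * (inverse (sqrt (f x)) / 2))) (at x)"
    if "x \<in> U" for x
  proof -
    have "(sqrt has_derivative (\<lambda>h. h * (inverse (sqrt (f x)) / 2))) (at (f x))"
      using DERIV_real_sqrt[OF assms(3)[OF that]] unfolding has_field_derivative_def
      by (rule has_derivative_eq_rhs) (simp add: fun_eq_iff)
    moreover have "f differentiable (at x)" using Suc.prems that by simp
    ultimately show ?thesis
      using has_derivative_compose has_derivative_partials by blast
  qed
  have "Ck_on r U (partial k (\<lambda>x. sqrt (f x)))" for k
  proof (rule Ck_on_cong[OF U])
    have "Ck_on r U (\<lambda>x. sqrt (f x))" using Suc Ck_on_Suc_imp by blast
    then show "Ck_on r U (\<lambda>x. partial k f x * (inverse (sqrt (f x)) / 2))"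
      using Suc.prems assms(3)
      by (intro Ck_on_mult Ck_on_inverse Ck_on_divide Ck_on_const U)
        (auto simp: less_imp_neq[symmetric] dest: less_imp_neq)
    fix x assume "x \<in> U"
    show "partial k f x * (inverse (sqrt (f x)) / 2) = partial k (\<lambda>x. sqrt (f x)) x"
      using partial_eqI[OF D[OF \<open>x \<in> U\<close>], of k] by (simp add: sum_axis_scaleR sum_axis_mult)
  qed
  then show ?case using D by (auto simp: differentiable_def)
qed

lemma has_derivative_compose_partials:
  fixes g :: "real ^ 'a \<Rightarrow> real ^ 'b" and f :: "real ^ 'b \<Rightarrow> 'c::real_normed_vector"
  assumes "f differentiable (at (g x))" "g differentiable (at x)"
  shows "((\<lambda>x. f (g x)) has_derivative (\<lambda>h. \<Sum>k\<in>UNIV. h $ k *\<^sub>R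
           (\<Sum>j\<in>UNIV. partial k g x $ j *\<^sub>R partial j f (g x)))) (at x)"
proof -
  have "((\<lambda>x. f (g x)) has_derivative (\<lambda>h. \<Sum>j\<in>UNIV. (\<Sum>k\<in>UNIV. h $ k *\<^sub>R partial k g x) $ j
          *\<^sub>R partial j f (g x))) (at x)"
    by (rule has_derivative_compose[OF has_derivative_partials has_derivative_partials]) (use assms in auto)
  also have "(\<lambda>h :: real ^ 'a. \<Sum>j\<in>UNIV. (\<Sum>k\<in>UNIV. h $ k *\<^sub>R partial k g x) $ j *\<^sub>R partial j f (g x)) =
    (\<lambda>h. \<Sum>k\<in>UNIV. h $ k *\<^sub>R (\<Sum>j\<in>UNIV. partial k g x $ j *\<^sub>R partial j f (g x)))"
    by (auto simp: fun_eq_iff scaleR_sum_left scaleR_sum_right intro: sum.swap)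
  finally show ?thesis .
qed

lemma partial_compose:
  fixes g :: "real ^ 'a \<Rightarrow> real ^ 'b" and f :: "real ^ 'b \<Rightarrow> 'c::real_normed_vector"
  assumes "f differentiable (at (g x))" "g differentiable (at x)"
  shows "partial k (\<lambda>x. f (g x)) x = (\<Sum>j\<in>UNIV. partial k g x $ j *\<^sub>R partial j f (g x))"
  using partial_eqI[OF has_derivative_compose_partials[OF assms], of k]
  by (simp add: sum_axis_scaleR sum_axis_mult)

text \<open>The chain rule leaves compositions of partials of \<open>f\<close> with the unchanged
  \<open>g\<close>, so the induction generalizes over \<open>f\<close> alone.\<close>

lemma Ck_on_compose:
  fixes g :: "real ^ 'a \<Rightarrow> real ^ 'b" and f :: "real ^ 'b \<Rightarrow> 'c::real_normed_vector"
  assumes U: "open U" and "Ck_on r U g" "g ` U \<subseteq> W" "Ck_on r W f"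
  shows "Ck_on r U (\<lambda>x. f (g x))"
  using assms(2,4)
proof (induction r arbitrary: f)
  case 0
  then show ?case
    using assms(3) continuous_on_compose2 by auto
next
  case (Suc r)
  have df: "f differentiable (at (g x))" "g differentiable (at x)" if "x \<in> U" for x
    using Suc.prems that assms(3) by auto
  have "Ck_on r U (partial k (\<lambda>x. f (g x)))" for k
  proof (rule Ck_on_cong[OF U])
    have "Ck_on r U g" using Suc.prems Ck_on_Suc_imp by blast
    then show "Ck_on r U (\<lambda>x. \<Sum>j\<in>UNIV. partial k g x $ j *\<^sub>R partial j f (g x))"
      using Suc.prems by (intro Ck_on_sum Ck_on_scaleR Ck_on_nth Suc.IH U) auto
  qed (simp add: partial_compose df)
  moreover have "(\<lambda>x. f (g x)) differentiable (at x)" if "x \<in> U" for x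
    using has_derivative_compose_partials[OF df[OF that]] by (auto simp: differentiable_def)
  ultimately show ?case by auto
qed

section \<open>Symmetry of second partial derivatives\<close>

lemma has_vector_derivative_along_axis:
  fixes f :: "real ^ 'n \<Rightarrow> 'b::real_normed_vector"
  assumes "f differentiable (at (x + s *\<^sub>R axis k 1))"
  shows "((\<lambda>s. f (x + s *\<^sub>R axis k 1)) has_vector_derivative partial k f (x + s *\<^sub>R axis k 1)) (at s)"
proof -
  have "((\<lambda>s. x + s *\<^sub>R axis k 1) has_derivative (\<lambda>h. h *\<^sub>R axis k 1)) (at s)"
    by (auto intro!: derivative_eq_intros)
  from has_derivative_compose[OF this has_derivative_partials[OF assms]] show ?thesis
    by (simp add: has_vector_derivative_def sum_axis_scaleR scaleR_sum_right[symmetric]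
        flip: scaleR_scaleR)
qed

text \<open>The mean value theorem is applied twice, first in direction \<open>j\<close> to the
  difference \<open>\<phi>\<close>, then in direction \<open>k\<close> to \<open>\<eta>\<close>. The
  left-hand side is symmetric in \<open>j\<close> and \<open>k\<close>, which is what the symmetry
  of mixed partials rests on.\<close>

lemma second_difference_mean_value:
  fixes f :: "real ^ 'n \<Rightarrow> real"
  assumes "0 < h" and sub: "\<And>s t. 0 \<le> s \<Longrightarrow> s \<le> h \<Longrightarrow> 0 \<le> t \<Longrightarrow> t \<le> h \<Longrightarrow>
      x + s *\<^sub>R axis j 1 + t *\<^sub>R axis k 1 \<in> U"
    and f: "Ck_on 2 U f"
  obtains s t where "0 < s" "s < h" "0 < t" "t < h"
    "f (x + h *\<^sub>R axis j 1 + h *\<^sub>R axis k 1) - f (x + h *\<^sub>R axis j 1) - f (x + h *\<^sub>R axis k 1) + f x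
      = h\<^sup>2 * partial k (partial j f) (x + s *\<^sub>R axis j 1 + t *\<^sub>R axis k 1)"
proof -
  let ?j = "axis j 1 :: real ^ 'n" and ?k = "axis k 1 :: real ^ 'n"
  have d1: "f differentiable (at y)" and d2: "partial j f differentiable (at y)" if "y \<in> U" for y
    using f that by (auto simp: numeral_2_eq_2)
  define \<phi> where "\<phi> s = f ((x + h *\<^sub>R ?k) + s *\<^sub>R ?j) - f (x + s *\<^sub>R ?j)" for s
  have in1: "(x + h *\<^sub>R ?k) + s *\<^sub>R ?j \<in> U" "x + s *\<^sub>R ?j \<in> U" if "0 \<le> s" "s \<le> h" for s
    using sub[OF that, of h] sub[OF that, of 0] \<open>0 < h\<close> by (auto simp: algebra_simps)
  have D\<phi>: "(\<phi> has_real_derivative (partial j f ((x + h *\<^sub>R ?k) + s *\<^sub>R ?j) - partial j f (x + s *\<^sub>R ?j))) (at s)"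
    if "0 \<le> s" "s \<le> h" for s
    unfolding \<phi>_def has_real_derivative_iff_has_vector_derivative
    by (intro has_vector_derivative_diff has_vector_derivative_along_axis d1 in1 that)
  from MVT2[OF \<open>0 < h\<close> D\<phi>] obtain s where s: "0 < s" "s < h"
    "\<phi> h - \<phi> 0 = h * (partial j f ((x + h *\<^sub>R ?k) + s *\<^sub>R ?j) - partial j f (x + s *\<^sub>R ?j))" by auto
  define \<eta> where "\<eta> t = partial j f ((x + s *\<^sub>R ?j) + t *\<^sub>R ?k)" for t
  have D\<eta>: "(\<eta> has_real_derivative partial k (partial j f) ((x + s *\<^sub>R ?j) + t *\<^sub>R ?k)) (at t)"
    if "0 \<le> t" "t \<le> h" for t
    unfolding \<eta>_def has_real_derivative_iff_has_vector_derivative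
    using sub[of s t] s that by (intro has_vector_derivative_along_axis d2) auto
  from MVT2[OF \<open>0 < h\<close> D\<eta>] obtain t where t: "0 < t" "t < h"
    "\<eta> h - \<eta> 0 = h * partial k (partial j f) ((x + s *\<^sub>R ?j) + t *\<^sub>R ?k)" by auto
  have "\<phi> h - \<phi> 0 = h * (\<eta> h - \<eta> 0)"
    unfolding s(3) by (simp add: \<eta>_def algebra_simps)
  then have "\<phi> h - \<phi> 0 = h\<^sup>2 * partial k (partial j f) ((x + s *\<^sub>R ?j) + t *\<^sub>R ?k)"
    unfolding t(3) by (simp add: power2_eq_square)
  with s t show ?thesis
    by (intro that[of s t]) (auto simp: \<phi>_def algebra_simps)
qed

text \<open>One second difference, divided by the square of \<open>h\<close>, is a value of either
  mixed partial at a point of the same small square. Continuity at \<open>x\<close> then excludes a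
  gap; \<open>e\<close> is half of the supposed gap.\<close>

lemma partial_commute_real:
  fixes f :: "real ^ 'n \<Rightarrow> real"
  assumes U: "open U" "x \<in> U" and f: "Ck_on 2 U f"
  shows "partial j (partial k f) x = partial k (partial j f) x"
proof (rule ccontr)
  let ?j = "axis j 1 :: real ^ 'n" and ?k = "axis k 1 :: real ^ 'n"
  let ?a = "partial k (partial j f)" and ?b = "partial j (partial k f)"
  assume neq: "?b x \<noteq> ?a x"
  define e where "e = \<bar>?b x - ?a x\<bar> / 2"
  have e: "e > 0" using neq by (simp add: e_def)
  have "continuous_on U ?a" "continuous_on U ?b"
    using f by (auto simp: numeral_2_eq_2)
  then have "continuous (at x) ?a" "continuous (at x) ?b"
    using U continuous_on_eq_continuous_at by blast+
  then obtain d1 d2 where d: "d1 > 0" "d2 > 0"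
    "\<And>y. dist y x < d1 \<Longrightarrow> dist (?a y) (?a x) < e" "\<And>y. dist y x < d2 \<Longrightarrow> dist (?b y) (?b x) < e"
    using e unfolding continuous_at_eps_delta by metis
  obtain d3 where d3: "d3 > 0" "ball x d3 \<subseteq> U" using U open_contains_ball by blast
  \<comment> \<open>Points of the square of side \<open>h\<close> lie within \<open>2 * h\<close> of
    \<open>x\<close>, so \<open>2 * h\<close> must be below all three radii.\<close>
  define h where "h = min d1 (min d2 d3) / 4"
  have h: "h > 0" "2 * h < d1" "2 * h < d2" "2 * h < d3" using d d3 by (auto simp: h_def min_def)
  have near: "dist (x + s *\<^sub>R axis i 1 + t *\<^sub>R axis l 1) x \<le> 2 * h"
    if "0 \<le> s" "s \<le> h" "0 \<le> t" "t \<le> h" for s t and i l :: 'n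
  proof -
    have "norm (s *\<^sub>R axis i 1 + t *\<^sub>R axis l 1 :: real ^ 'n) \<le> \<bar>s\<bar> + \<bar>t\<bar>"
      by (rule norm_triangle_le) (simp add: norm_axis_1)
    then show ?thesis using that by (simp add: dist_norm add.assoc)
  qed
  have inU: "x + s *\<^sub>R axis i 1 + t *\<^sub>R axis l 1 \<in> U"
    if "0 \<le> s" "s \<le> h" "0 \<le> t" "t \<le> h" for s t i l
    using le_less_trans[OF near[OF that] h(4)] d3(2) by (auto simp: subset_iff dist_commute)
  obtain s t where st: "0 < s" "s < h" "0 < t" "t < h"
    "f (x + h *\<^sub>R ?j + h *\<^sub>R ?k) - f (x + h *\<^sub>R ?j) - f (x + h *\<^sub>R ?k) + f x
      = h\<^sup>2 * ?a (x + s *\<^sub>R ?j + t *\<^sub>R ?k)"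
    using second_difference_mean_value[OF h(1) inU f] by blast
  obtain s' t' where st': "0 < s'" "s' < h" "0 < t'" "t' < h"
    "f (x + h *\<^sub>R ?k + h *\<^sub>R ?j) - f (x + h *\<^sub>R ?k) - f (x + h *\<^sub>R ?j) + f x
      = h\<^sup>2 * ?b (x + s' *\<^sub>R ?k + t' *\<^sub>R ?j)"
    using second_difference_mean_value[OF h(1) inU f] by blast
  have "h\<^sup>2 * ?a (x + s *\<^sub>R ?j + t *\<^sub>R ?k) = h\<^sup>2 * ?b (x + s' *\<^sub>R ?k + t' *\<^sub>R ?j)"
    using st(5) st'(5) by (simp add: algebra_simps)
  then have "?a (x + s *\<^sub>R ?j + t *\<^sub>R ?k) = ?b (x + s' *\<^sub>R ?k + t' *\<^sub>R ?j)"
    using h(1) by simp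
  moreover have "dist (?a (x + s *\<^sub>R ?j + t *\<^sub>R ?k)) (?a x) < e"
    using st near[of s t j k] h by (intro d(3)) auto
  moreover have "dist (?b (x + s' *\<^sub>R ?k + t' *\<^sub>R ?j)) (?b x) < e"
    using st' near[of s' t' k j] h by (intro d(4)) auto
  ultimately have "\<bar>?b x - ?a x\<bar> < 2 * e"
    by (auto simp: dist_real_def)
  then show False by (simp add: e_def)
qed

lemma partial_bounded_linear:
  assumes "bounded_linear L" "f differentiable (at x)"
  shows "partial k (\<lambda>x. L (f x)) x = L (partial k f x)"
  using partial_eqI[OF bounded_linear.has_derivative[OF assms(1) has_derivative_partials[OF assms(2)]], of k]
  by (simp add: sum_axis_scaleR sum_axis_mult)

lemma partial_nth:
  "f differentiable (at x) \<Longrightarrow> partial k (\<lambda>x. f x $ i) x = partial k f x $ i"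
  using partial_bounded_linear[OF bounded_linear_vec_nth] by blast

lemma partial_commute:
  fixes f :: "real ^ 'n \<Rightarrow> real ^ 'l"
  assumes U: "open U" "x \<in> U" and f: "Ck_on 2 U f"
  shows "partial j (partial k f) x = partial k (partial j f) x"
proof (rule vec_eq_iff[THEN iffD2], rule allI)
  fix i
  have d: "f differentiable (at y)" "partial k f differentiable (at y)" if "y \<in> U" for y k
    using f that by (auto simp: numeral_2_eq_2)
  have *: "partial j (partial k f) x $ i = partial j (partial k (\<lambda>x. f x $ i)) x" for j k
  proof -
    have "partial j (partial k f) x $ i = partial j (\<lambda>x. partial k f x $ i) x"
      using U by (simp add: partial_nth d)
    also have "\<dots> = partial j (partial k (\<lambda>x. f x $ i)) x"
    proof (rule partial_cong_open[OF U])
      show "(\<lambda>x. partial k f x $ i) differentiable (at x)"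
        using bounded_linear.has_derivative[OF bounded_linear_vec_nth has_derivative_partials[OF d(2)[OF U(2)]]]
        unfolding differentiable_def by blast
    qed (simp add: partial_nth d)
    finally show ?thesis .
  qed
  show "partial j (partial k f) x $ i = partial k (partial j f) x $ i"
    unfolding * using partial_commute_real[OF U Ck_on_nth[OF U(1) f]] .
qed

section \<open>Gram determinants and tangential projections\<close>

lemma matrix_inv_mult:
  fixes A :: "real ^ 'n ^ 'n"
  assumes "det A \<noteq> 0"
  shows "A ** matrix_inv A = mat 1" "matrix_inv A ** A = mat 1"
proof -
  have "\<exists>B. A ** B = mat 1 \<and> B ** A = mat 1"
    using assms unfolding invertible_det_nz[symmetric] invertible_def by blast
  then have "A ** matrix_inv A = mat 1 \<and> matrix_inv A ** A = mat 1"
    unfolding matrix_inv_def by (rule someI_ex)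
  then show "A ** matrix_inv A = mat 1" "matrix_inv A ** A = mat 1" by auto
qed

lemma matrix_inv_eqI:
  fixes A B :: "real ^ 'n ^ 'n"
  assumes "B ** A = mat 1"
  shows "matrix_inv A = B"
proof -
  have "det B * det A = 1" by (metis assms det_mul det_I)
  then have "det A \<noteq> 0" by auto
  have "matrix_inv A = (B ** A) ** matrix_inv A" by (simp add: assms)
  also have "\<dots> = B" using matrix_inv_mult[OF \<open>det A \<noteq> 0\<close>] by (simp add: matrix_mul_assoc[symmetric])
  finally show ?thesis .
qed

text \<open>Writing the entries of the inverse as quotients of determinants makes their
  differentiability class visible; see \<open>Ck_on_matrix_inv\<close>.\<close>

lemma matrix_inv_cramer:
  fixes A :: "real ^ 'n ^ 'n"
  assumes "det A \<noteq> 0"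
  shows "matrix_inv A $ k $ l = det (\<chi> i j. if j = k then (if i = l then 1 else 0) else A $ i $ j) / det A"
proof -
  let ?b = "axis l 1 :: real ^ 'n"
  have "A *v (matrix_inv A *v ?b) = ?b"
    using matrix_inv_mult[OF assms] by (simp add: matrix_vector_mul_assoc)
  then have "matrix_inv A *v ?b = (\<chi> k. det (\<chi> i j. if j = k then ?b $ i else A $ i $ j) / det A)"
    using cramer[OF assms] by blast
  then have "(matrix_inv A *v ?b) $ k = det (\<chi> i j. if j = k then ?b $ i else A $ i $ j) / det A"
    by simp
  moreover have "(matrix_inv A *v ?b) $ k = matrix_inv A $ k $ l"
    by (simp add: matrix_vector_mult_def axis_def if_distrib cong: if_cong)
  moreover have "(\<chi> i j. if j = k then ?b $ i else A $ i $ j) =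
      (\<chi> i j. if j = k then (if i = l then 1 else 0) else A $ i $ j)"
    by (auto simp: axis_def vec_eq_iff)
  ultimately show ?thesis by (simp only:)
qed

section \<open>Jacobi's formula for the derivative of a determinant\<close>

lemma permutes_fixes_last:
  assumes "p permutes UNIV" "\<And>j. j \<noteq> i \<Longrightarrow> p j = j"
  shows "p = id"
proof
  fix j
  have "p i = i"
  proof (rule ccontr)
    assume "p i \<noteq> i"
    then have "p (p i) = p i" using assms(2) by blast
    then show False using \<open>p i \<noteq> i\<close> permutes_inj[OF assms(1)] by (auto dest: injD)
  qed
  then show "p j = id j" using assms(2)[of j] by (cases "j = i") auto
qed

text \<open>Differentiating one factor of a Leibniz term leaves the product of the others. At the
  identity matrix it vanishes unless the permutation fixes all but one point, and then it is the
  identity.\<close>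

lemma det_derivative_at_one:
  fixes C :: "real \<Rightarrow> real ^ 'n ^ 'n"
  assumes C: "\<And>i j. ((\<lambda>t. C t $ i $ j) has_real_derivative C' $ i $ j) (at s within S)" and "C s = mat 1"
  shows "((\<lambda>t. det (C t)) has_real_derivative trace C') (at s within S)"
proof -
  let ?P = "{p. p permutes (UNIV :: 'n set)}"
  have "((\<lambda>t. det (C t)) has_derivative (\<lambda>h. \<Sum>p\<in>?P. of_int (sign p) *
      (\<Sum>i\<in>UNIV. (C' $ i $ p i * h) * (\<Prod>j\<in>UNIV - {i}. C s $ j $ p j)))) (at s within S)"
    unfolding det_def
    by (intro has_derivative_sum has_derivative_mult_right has_derivative_prod
        has_field_derivative_imp_has_derivative C)
  moreover have "(\<Sum>p\<in>?P. of_int (sign p) *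
      (\<Sum>i\<in>UNIV. (C' $ i $ p i * h) * (\<Prod>j\<in>UNIV - {i}. C s $ j $ p j))) = trace C' * h" for h
  proof -
    have *: "(\<Prod>j\<in>UNIV - {i}. C s $ j $ p j) = (if p = id then 1 else 0)" if "p \<in> ?P" for p i
    proof (cases "p = id")
      case False
      then obtain j where "j \<noteq> i" "p j \<noteq> j" using permutes_fixes_last[of p i] \<open>p \<in> ?P\<close> by auto
      then have "\<exists>j\<in>UNIV - {i}. C s $ j $ p j = 0"
        using assms(2) by (intro bexI[of _ j]) (auto simp: mat_def)
      then have "(\<Prod>j\<in>UNIV - {i}. C s $ j $ p j) = 0" by (intro prod_zero) auto
      then show ?thesis using False by simp
    qed (auto simp: assms(2) mat_def)
    have "(\<Sum>p\<in>?P. of_int (sign p) *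
        (\<Sum>i\<in>UNIV. (C' $ i $ p i * h) * (\<Prod>j\<in>UNIV - {i}. C s $ j $ p j))) =
      (\<Sum>p\<in>?P. if p = id then (\<Sum>i\<in>UNIV. C' $ i $ i * h) else 0)"
      by (intro sum.cong refl) (simp add: * cong: if_cong)
    also have "\<dots> = (\<Sum>i\<in>UNIV. C' $ i $ i * h)"
      using permutes_id[of "UNIV :: 'n set"] finite_permutations[of "UNIV :: 'n set"]
      by (simp add: sum.delta)
    finally show ?thesis by (simp add: trace_def sum_distrib_right)
  qed
  ultimately show ?thesis by (simp add: has_field_derivative_def)
qed

lemma matrix_mult_left_derivative:
  fixes C :: "real \<Rightarrow> real ^ 'n ^ 'm"
  assumes "\<And>i j. ((\<lambda>t. C t $ i $ j) has_real_derivative C' $ i $ j) (at s within S)"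
  shows "((\<lambda>t. (B ** C t) $ i $ j) has_real_derivative (B ** C') $ i $ j) (at s within S)"
proof -
  have "((\<lambda>t. \<Sum>k\<in>UNIV. B $ i $ k * C t $ k $ j) has_real_derivative
      (\<Sum>k\<in>UNIV. B $ i $ k * C' $ k $ j)) (at s within S)"
    by (intro DERIV_sum DERIV_cmult assms)
  then show ?thesis by (simp add: matrix_matrix_mult_def)
qed

text \<open>Multiplication by the constant matrix \<open>matrix_inv (C s)\<close> moves the base
  point to the identity matrix.\<close>

lemma det_derivative:
  fixes C :: "real \<Rightarrow> real ^ 'n ^ 'n"
  assumes C: "\<And>i j. ((\<lambda>t. C t $ i $ j) has_real_derivative C' $ i $ j) (at s within S)"
    and nz: "det (C s) \<noteq> 0"
  shows "((\<lambda>t. det (C t)) has_real_derivative det (C s) * trace (matrix_inv (C s) ** C')) (at s within S)"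
proof -
  have "((\<lambda>t. det (matrix_inv (C s) ** C t)) has_real_derivative trace (matrix_inv (C s) ** C')) (at s within S)"
    by (intro det_derivative_at_one matrix_mult_left_derivative C matrix_inv_mult(2) nz)
  then have "((\<lambda>t. det (C s) * det (matrix_inv (C s) ** C t)) has_real_derivative
      det (C s) * trace (matrix_inv (C s) ** C')) (at s within S)"
    by (rule DERIV_cmult)
  moreover have "det (C s) * det (matrix_inv (C s) ** C t) = det (C t)" for t
    by (simp add: det_mul[symmetric] matrix_mul_assoc matrix_inv_mult[OF nz])
  ultimately show ?thesis by simp
qed

definition gram :: "real ^ 'm ^ 'n \<Rightarrow> real ^ 'm ^ 'm" where
  "gram A = transpose A ** A"

definition area :: "real ^ 'm ^ 'n \<Rightarrow> real" where
  "area A = sqrt (det (gram A))"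

text \<open>The orthogonal projection onto the column space of \<open>A\<close>.\<close>

definition tproj :: "real ^ 'm ^ 'n \<Rightarrow> real ^ 'n ^ 'n" where
  "tproj A = A ** matrix_inv (gram A) ** transpose A"

text \<open>
  If \<open>A\<close> is the Jacobian of a parametrization \<open>\<psi>\<close> and \<open>B\<close> that of \<open>Z \<circ> \<psi>\<close>, this is the
  divergence \<open>\<Sum> g\<^sup>i\<^sup>j \<partial>\<^sub>i\<psi> \<bullet> \<partial>\<^sub>jZ\<close> of \<open>Z\<close> along the submanifold.
\<close>

definition tdiv :: "real ^ 'm ^ 'n \<Rightarrow> real ^ 'm ^ 'n \<Rightarrow> real" where
  "tdiv A B = trace (matrix_inv (gram A) ** (transpose A ** B))"

lemma gram_nth: "gram A $ i $ j = column i A \<bullet> column j A"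
  by (simp add: gram_def matrix_matrix_mult_def transpose_def column_def inner_vec_def)

lemma transpose_gram [simp]: "transpose (gram A) = gram A"
  by (simp add: gram_def matrix_transpose_mul)

lemma inner_gram: "v \<bullet> (gram A *v v) = (norm (A *v v))\<^sup>2"
proof -
  have "gram A *v v = (A *v v) v* A"
    by (simp add: gram_def matrix_vector_mul_assoc[symmetric] transpose_matrix_vector)
  then show ?thesis
    by (simp add: inner_commute[of v] dot_lmul_matrix power2_norm_eq_inner)
qed

text \<open>All matrices on the segment \<open>G\<close> from the identity to \<open>gram A\<close>
  are positive definite. The determinant is continuous along it, never 0, and starts at 1.\<close>

lemma det_gram_pos:
  fixes A :: "real ^ 'm ^ 'n"
  assumes inj: "\<And>v. A *v v = 0 \<Longrightarrow> v = 0"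
  shows "det (gram A) > 0"
proof -
  define G where "G s = (1 - s) *\<^sub>R mat 1 + s *\<^sub>R gram A" for s :: real
  have nz: "det (G s) \<noteq> 0" if "0 \<le> s" "s \<le> 1" for s
  proof
    assume "det (G s) = 0"
    then have "\<not> inj ((*v) (G s))"
      by (simp add: det_nz_iff_inj[symmetric])
    then obtain v where v: "G s *v v = 0" "v \<noteq> 0"
      by (metis linear_injective_0 matrix_vector_mul_linear)
    have "0 = v \<bullet> (G s *v v)" using v by simp
    also have "\<dots> = (1 - s) * (norm v)\<^sup>2 + s * (norm (A *v v))\<^sup>2"
      unfolding G_def
      by (simp add: matrix_vector_mult_add_rdistrib inner_add_right scaleR_matrix_vector_assoc[symmetric]
          inner_gram power2_norm_eq_inner)
    finally have "(1 - s) * (norm v)\<^sup>2 = 0 \<and> s * (norm (A *v v))\<^sup>2 = 0"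
      using that by (smt (verit) zero_le_mult_iff zero_le_power2)
    then show False using v inj by auto
  qed
  have "continuous_on {0..1} (\<lambda>s. det (G s))"
    unfolding det_def G_def by (auto intro!: continuous_intros)
  moreover have "det (G 0) = 1" "det (G 1) = det (gram A)"
    by (simp_all add: G_def)
  ultimately show ?thesis
    using IVT2'[of "\<lambda>s. det (G s)" 1 0 0] nz by force
qed

lemma area_pos:
  "(\<And>v. A *v v = 0 \<Longrightarrow> v = 0) \<Longrightarrow> area A > 0"
  by (simp add: area_def det_gram_pos)

lemma area_matrix_mult: "area (A ** B) = area A * \<bar>det B\<bar>" for B :: "real ^ 'm ^ 'm"
proof -
  have "gram (A ** B) = transpose B ** (gram A ** B)"
    by (simp add: gram_def matrix_transpose_mul matrix_mul_assoc)
  then have "det (gram (A ** B)) = det (gram A) * (det B)\<^sup>2"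
    by (simp add: det_mul power2_eq_square)
  then show ?thesis by (simp add: area_def real_sqrt_mult)
qed

text \<open>The derivative of the Gram matrix is \<open>?B + transpose ?B\<close>. Both summands
  give the same trace because the inverse Gram matrix is symmetric, and the factor 2 cancels the one
  from the square root.\<close>

lemma area_derivative:
  fixes A :: "real \<Rightarrow> real ^ 'm ^ 'n"
  assumes A: "\<And>i j. ((\<lambda>t. A t $ i $ j) has_real_derivative A' $ i $ j) (at s within S)"
    and inj: "\<And>v. A s *v v = 0 \<Longrightarrow> v = 0"
  shows "((\<lambda>t. area (A t)) has_real_derivative area (A s) * tdiv (A s) A') (at s within S)"
proof -
  let ?G = "gram (A s)"
  let ?B = "transpose (A s) ** A'"
  have pos: "det ?G > 0" using inj by (rule det_gram_pos)
  have "((\<lambda>t. gram (A t) $ i $ j) has_real_derivative (?B + transpose ?B) $ i $ j) (at s within S)" for i j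
  proof -
    have "((\<lambda>t. \<Sum>k\<in>UNIV. A t $ k $ i * A t $ k $ j) has_real_derivative
        (\<Sum>k\<in>UNIV. A' $ k $ i * A s $ k $ j + A' $ k $ j * A s $ k $ i)) (at s within S)"
      by (intro DERIV_sum DERIV_mult A)
    then show ?thesis
      by (simp add: gram_def matrix_matrix_mult_def transpose_def sum.distrib mult.commute add.commute)
  qed
  from det_derivative[OF this] pos
  have "((\<lambda>t. det (gram (A t))) has_real_derivative
      det ?G * trace (matrix_inv ?G ** (?B + transpose ?B))) (at s within S)"
    by simp
  moreover have "trace (matrix_inv ?G ** (?B + transpose ?B)) = 2 * tdiv (A s) A'"
  proof -
    have sym: "transpose (matrix_inv ?G) = matrix_inv ?G"
    proof (rule matrix_inv_eqI[symmetric])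
      have "transpose (matrix_inv ?G) ** ?G = transpose (?G ** matrix_inv ?G)"
        by (simp add: matrix_transpose_mul)
      then show "transpose (matrix_inv ?G) ** ?G = mat 1"
        using pos by (simp add: matrix_inv_mult transpose_mat)
    qed
    have "trace (matrix_inv ?G ** transpose ?B) = trace (transpose (?B ** matrix_inv ?G))"
      by (simp add: matrix_transpose_mul sym)
    also have "\<dots> = trace (?B ** matrix_inv ?G)"
      by (simp add: trace_def transpose_def)
    also have "\<dots> = trace (matrix_inv ?G ** ?B)" by (rule trace_mul_sym)
    finally show ?thesis
      by (simp add: tdiv_def matrix_add_ldistrib trace_add)
  qed
  ultimately have "((\<lambda>t. det (gram (A t))) has_real_derivative det ?G * (2 * tdiv (A s) A')) (at s within S)"
    by simp
  from DERIV_chain2[OF DERIV_real_sqrt[OF pos] this]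
  have "((\<lambda>t. sqrt (det (gram (A t)))) has_real_derivative
      inverse (sqrt (det ?G)) / 2 * (det ?G * (2 * tdiv (A s) A'))) (at s within S)" .
  moreover have "inverse (sqrt (det ?G)) / 2 * (det ?G * (2 * tdiv (A s) A')) = sqrt (det ?G) * tdiv (A s) A'"
    using pos by (simp add: field_simps real_div_sqrt flip: real_sqrt_mult)
  ultimately show ?thesis by (simp only: area_def)
qed

lemma transpose_matrix_inv_gram:
  assumes "det (gram A) \<noteq> 0"
  shows "transpose (matrix_inv (gram A)) = matrix_inv (gram A)"
proof (rule matrix_inv_eqI[symmetric])
  have "transpose (matrix_inv (gram A)) ** gram A = transpose (gram A ** matrix_inv (gram A))"
    by (simp add: matrix_transpose_mul)
  then show "transpose (matrix_inv (gram A)) ** gram A = mat 1"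
    using assms by (simp add: matrix_inv_mult transpose_mat)
qed

lemma tproj_props:
  fixes A :: "real ^ 'm ^ 'n"
  assumes "det (gram A) \<noteq> 0"
  shows "transpose (tproj A) = tproj A" "tproj A ** tproj A = tproj A" "tproj A ** A = A"
    "trace (tproj A) = CARD('m)" "transpose A ** tproj A = transpose A"
proof -
  let ?I = "matrix_inv (gram A)"
  have I: "?I ** gram A = mat 1" "gram A ** ?I = mat 1" using assms by (simp_all add: matrix_inv_mult)
  show 1: "transpose (tproj A) = tproj A"
    by (simp add: tproj_def matrix_transpose_mul transpose_matrix_inv_gram assms matrix_mul_assoc)
  have "tproj A ** A = A ** (?I ** gram A)"
    by (simp add: tproj_def gram_def matrix_mul_assoc)
  then show 2: "tproj A ** A = A" using I by simp
  have "tproj A ** tproj A = (tproj A ** A) ** ?I ** transpose A"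
    by (simp add: tproj_def matrix_mul_assoc)
  then show "tproj A ** tproj A = tproj A" by (simp add: 2) (simp add: tproj_def)
  have "trace (tproj A) = trace ((A ** ?I) ** transpose A)"
    by (simp add: tproj_def)
  also have "\<dots> = trace (transpose A ** (A ** ?I))" by (rule trace_mul_sym)
  also have "\<dots> = trace (gram A ** ?I)" by (simp add: gram_def matrix_mul_assoc)
  finally show "trace (tproj A) = CARD('m)" using I by (simp add: trace_I)
  show "transpose A ** tproj A = transpose A"
    using arg_cong[OF 2, of transpose] by (simp add: matrix_transpose_mul 1)
qed

text \<open>A diagonal entry is the sum of the squares of its row. It thus dominates its own square,
  hence is at most 1, and it dominates the square of every entry of the row.\<close>

lemma symmetric_idempotent_entry_le_1:
  fixes P :: "real ^ 'n ^ 'n"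
  assumes "transpose P = P" "P ** P = P"
  shows "\<bar>P $ k $ l\<bar> \<le> 1"
proof -
  have sym: "P $ i $ j = P $ j $ i" for i j
    using arg_cong[OF assms(1), of "\<lambda>M. M $ i $ j"] by (simp add: transpose_def)
  have diag: "P $ k $ k = (\<Sum>j\<in>UNIV. (P $ k $ j)\<^sup>2)" for k
  proof -
    have "P $ k $ k = (P ** P) $ k $ k" by (simp add: assms(2))
    also have "\<dots> = (\<Sum>j\<in>UNIV. P $ k $ j * P $ j $ k)" by (simp add: matrix_matrix_mult_def)
    also have "\<dots> = (\<Sum>j\<in>UNIV. (P $ k $ j)\<^sup>2)"
    proof (intro sum.cong refl)
      fix j show "P $ k $ j * P $ j $ k = (P $ k $ j)\<^sup>2"
        using sym[of j k] by (simp add: power2_eq_square)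
    qed
    finally show ?thesis .
  qed
  have le: "(P $ k $ l)\<^sup>2 \<le> P $ k $ k" for k l
    unfolding diag[of k] by (rule member_le_sum) auto
  have "P $ k $ k \<le> 1"
  proof (rule ccontr)
    assume "\<not> P $ k $ k \<le> 1"
    then have "1 < P $ k $ k" by simp
    then have "P $ k $ k * 1 < P $ k $ k * P $ k $ k" by (intro mult_strict_left_mono) auto
    with le[of k k] show False by (simp add: power2_eq_square)
  qed
  with le[of k l] have "(P $ k $ l)\<^sup>2 \<le> 1" by linarith
  then show ?thesis using abs_square_le_1 by blast
qed

lemma matrix_mult_diff_ldistrib: "A ** (B - C) = A ** B - A ** C"
  for A :: "real ^ 'm ^ 'n"
  by (simp add: matrix_matrix_mult_def vec_eq_iff right_diff_distrib sum_subtractf)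

lemma matrix_mult_diff_rdistrib: "(A - B) ** C = A ** C - B ** C"
  for A :: "real ^ 'm ^ 'n"
  by (simp add: matrix_matrix_mult_def vec_eq_iff left_diff_distrib sum_subtractf)

text \<open>The complement \<open>mat 1 - P\<close> is a projection too, so its trace is the sum of
  the squares of its entries, and this trace is 0. Completeness of orthonormal frames and the
  splitting into tangential and normal part are derived from this.\<close>

lemma symmetric_idempotent_full_trace:
  fixes P :: "real ^ 'n ^ 'n"
  assumes "transpose P = P" "P ** P = P" "trace P = CARD('n)"
  shows "P = mat 1"
proof -
  let ?Q = "mat 1 - P"
  have "transpose ?Q = ?Q"
    using assms(1) by (simp add: transpose_def vec_eq_iff mat_def)
  moreover have "?Q ** ?Q = ?Q"
    using assms(2) by (simp add: matrix_mult_diff_ldistrib matrix_mult_diff_rdistrib)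
  ultimately have "?Q ** transpose ?Q = ?Q" by simp
  then have "trace (?Q ** transpose ?Q) = 0"
    by (simp add: trace_sub trace_I assms(3))
  then have "(\<Sum>k\<in>UNIV. \<Sum>l\<in>UNIV. (?Q $ k $ l)\<^sup>2) = 0"
    by (simp add: trace_def matrix_matrix_mult_def transpose_def power2_eq_square)
  then have "\<forall>k. (\<Sum>l\<in>UNIV. (?Q $ k $ l)\<^sup>2) = 0"
    by (subst (asm) sum_nonneg_eq_0_iff) (auto intro: sum_nonneg)
  then have "\<forall>k l. (?Q $ k $ l)\<^sup>2 = 0"
    by (subst (asm) sum_nonneg_eq_0_iff) auto
  then show ?thesis by (auto simp: vec_eq_iff)
qed

text \<open>By cyclicity of the trace. For the restriction of an ambient field, whose Jacobian is
  \<open>B ** A\<close> by the chain rule, the divergence depends on the chart only through the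
  projection.\<close>

lemma tdiv_matrix_mult:
  "tdiv A (B ** A) = (\<Sum>k\<in>UNIV. \<Sum>l\<in>UNIV. tproj A $ k $ l * B $ l $ k)"
proof -
  have "tdiv A (B ** A) = trace (matrix_inv (gram A) ** transpose A ** B ** A)"
    by (simp add: tdiv_def matrix_mul_assoc)
  also have "\<dots> = trace (A ** (matrix_inv (gram A) ** transpose A ** B))"
    by (rule trace_mul_sym)
  also have "\<dots> = trace (tproj A ** B)"
    by (simp add: tproj_def matrix_mul_assoc)
  finally show ?thesis by (simp add: trace_def matrix_matrix_mult_def)
qed

lemma tdiv_sum:
  "tdiv A B = (\<Sum>i\<in>UNIV. \<Sum>j\<in>UNIV. matrix_inv (gram A) $ i $ j * (column j A \<bullet> column i B))"
  by (simp add: tdiv_def trace_def matrix_matrix_mult_def transpose_def column_def inner_vec_def)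

section \<open>Superforms with constant coefficients\<close>

lemma superalg_basis_expansion: "a = (\<Sum>P\<in>UNIV. a $ P *\<^sub>R sbasis (fst P) (snd P))"
  for a :: "'n::finite superalg"
  using basis_expansion[of a] by (simp add: sbasis_def scalar_mult_eq_scaleR)

lemma linear_eq_sbasis:
  fixes f g :: "'n::finite superalg \<Rightarrow> 'b::real_vector"
  assumes "linear f" "linear g" "\<And>I J. f (sbasis I J) = g (sbasis I J)"
  shows "f a = g a"
proof -
  have "f a = (\<Sum>P\<in>UNIV. a $ P *\<^sub>R f (sbasis (fst P) (snd P)))"
    by (subst superalg_basis_expansion[of a]) (simp add: linear_sum[OF assms(1)] linear_cmul[OF assms(1)])
  also have "\<dots> = (\<Sum>P\<in>UNIV. a $ P *\<^sub>R g (sbasis (fst P) (snd P)))"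
    by (simp add: assms(3))
  also have "\<dots> = g a"
    by (subst (2) superalg_basis_expansion[of a]) (simp add: linear_sum[OF assms(2)] linear_cmul[OF assms(2)])
  finally show ?thesis .
qed

lemma bilinear_wedge: "bilinear (wedge :: 'n::{finite,wellorder} superalg \<Rightarrow> _)"
  unfolding bilinear_def
  by (intro conjI allI linearI)
    (simp_all add: wedge_def vec_eq_iff algebra_simps sum.distrib sum_distrib_left)

lemma bounded_bilinear_wedge: "bounded_bilinear (wedge :: 'n::{finite,wellorder} superalg \<Rightarrow> _)"
  using bilinear_wedge by (simp add: bilinear_conv_bounded_bilinear)

interpretation wedge: bounded_bilinear "wedge :: 'n::{finite,wellorder} superalg \<Rightarrow> _"
  by (rule bounded_bilinear_wedge)

lemma linear_wedge_left: "linear (\<lambda>a. a \<and>\<^sub>s b)" and linear_wedge_right: "linear (\<lambda>b. a \<and>\<^sub>s b)"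
  using bilinear_wedge by (auto simp: bilinear_def)

lemma sbasis_wedge:
  "sbasis I J \<and>\<^sub>s sbasis K L =
    (if I \<inter> K = {} \<and> J \<inter> L = {} then wedge_sign I J K L *\<^sub>R sbasis (I \<union> K) (J \<union> L) else 0)"
  for I J K L :: "'n::{finite,wellorder} set"
proof (rule vec_eq_iff[THEN iffD2], rule allI)
  fix P :: "'n set \<times> 'n set"
  obtain A B where P: "P = (A, B)" by force
  have ax: "(sbasis I J :: 'n superalg) $ (I', J') = (if I' = I \<and> J' = J then 1 else 0)" for I' J' I J
    by (auto simp: sbasis_def axis_def)
  have "(sbasis I J \<and>\<^sub>s sbasis K L) $ P = (\<Sum>I'\<in>Pow A. \<Sum>J'\<in>Pow B. if I' = I then (if J' = J then
      wedge_sign I J (A - I) (B - J) * (if A - I = K \<and> B - J = L then 1 else 0) else 0) else 0)"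
    unfolding wedge_def P vec_lambda_beta fst_conv snd_conv by (intro sum.cong refl) (simp add: ax)
  also have "\<dots> = (\<Sum>I'\<in>Pow A. if I' = I then (if J \<in> Pow B then
      wedge_sign I J (A - I) (B - J) * (if A - I = K \<and> B - J = L then 1 else 0) else 0) else 0)"
    by (intro sum.cong refl) (simp add: sum.delta)
  also have "\<dots> = (if I \<subseteq> A \<and> J \<subseteq> B \<and> A - I = K \<and> B - J = L then wedge_sign I J K L else 0)"
    by (simp add: sum.delta)
  also have "\<dots> = (if I \<inter> K = {} \<and> J \<inter> L = {} then wedge_sign I J K L *\<^sub>R sbasis (I \<union> K) (J \<union> L) else 0) $ P"
  proof (cases "I \<subseteq> A \<and> J \<subseteq> B \<and> A - I = K \<and> B - J = L")
    case True
    then have "I \<inter> K = {}" "J \<inter> L = {}" "A = I \<union> K" "B = J \<union> L" by auto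
    with True show ?thesis by (simp add: P ax)
  next
    case False
    then have "\<not> (I \<inter> K = {} \<and> J \<inter> L = {} \<and> A = I \<union> K \<and> B = J \<union> L)" by auto
    with False show ?thesis by (auto simp: P ax)
  qed
  finally show "(sbasis I J \<and>\<^sub>s sbasis K L) $ P =
      (if I \<inter> K = {} \<and> J \<inter> L = {} then wedge_sign I J K L *\<^sub>R sbasis (I \<union> K) (J \<union> L) else 0) $ P" .
qed

lemma inversions_Un_left:
  "I \<inter> K = {} \<Longrightarrow> inversions (I \<union> K) A = inversions I A + inversions K A"
  for I K :: "'n::{finite,linorder} set"
  unfolding inversions_def
  by (subst card_Un_disjoint[symmetric]) (auto intro!: arg_cong[of _ _ card])

lemma inversions_Un_right:
  "K \<inter> A = {} \<Longrightarrow> inversions I (K \<union> A) = inversions I K + inversions I A"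
  for I K :: "'n::{finite,linorder} set"
  unfolding inversions_def
  by (subst card_Un_disjoint[symmetric]) (auto intro!: arg_cong[of _ _ card])

lemma inversions_empty [simp]: "inversions {} K = 0" "inversions K {} = 0"
  by (auto simp: inversions_def)

lemma inversions_swap:
  fixes I :: "'n::{finite,linorder} set"
  assumes "k \<notin> I"
  shows "inversions {k} I + inversions I {k} = card I"
proof -
  have "inversions {k} I = card {i\<in>I. i < k}" "inversions I {k} = card {i\<in>I. k < i}"
    unfolding inversions_def
    by (rule bij_betw_same_card[of snd], force simp: bij_betw_def inj_on_def image_def)
      (rule bij_betw_same_card[of fst], force simp: bij_betw_def inj_on_def image_def)
  moreover have "x < k \<or> k < x" if "x \<in> I" for x
    using assms that by (metis linorder_neqE)
  then have I: "I = {i\<in>I. i < k} \<union> {i\<in>I. k < i}"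
    by blast
  have "card ({i\<in>I. i < k} \<union> {i\<in>I. k < i}) = card {i\<in>I. i < k} + card {i\<in>I. k < i}"
    by (rule card_Un_disjoint) auto
  then have "card I = card {i\<in>I. i < k} + card {i\<in>I. k < i}"
    by (rule trans[OF arg_cong[OF I, of card]])
  ultimately show ?thesis by simp
qed

text \<open>The exponents are additive over disjoint unions, and both sides count the same pairs.
  This is associativity of the wedge product at the level of signs.\<close>

lemma wedge_sign_cocycle:
  fixes I :: "'n::{finite,linorder} set"
  assumes "I \<inter> K = {}" "J \<inter> L = {}" "K \<inter> A = {}" "L \<inter> B = {}"
  shows "wedge_sign I J K L * wedge_sign (I \<union> K) (J \<union> L) A B =
    wedge_sign K L A B * wedge_sign I J (K \<union> A) (L \<union> B)"
  using assms
  by (simp add: wedge_sign_def power_add[symmetric] inversions_Un_left inversions_Un_right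
      card_Un_disjoint algebra_simps)

lemma wedge_assoc_sbasis:
  fixes I :: "'n::{finite,wellorder} set"
  shows "(sbasis I J \<and>\<^sub>s sbasis K L) \<and>\<^sub>s sbasis A B = sbasis I J \<and>\<^sub>s (sbasis K L \<and>\<^sub>s sbasis A B)"
proof (cases "I \<inter> K = {} \<and> J \<inter> L = {} \<and> K \<inter> A = {} \<and> L \<inter> B = {} \<and> I \<inter> A = {} \<and> J \<inter> B = {}")
  case True
  then have "(I \<union> K) \<inter> A = {}" "(J \<union> L) \<inter> B = {}" "I \<inter> (K \<union> A) = {}" "J \<inter> (L \<union> B) = {}" by auto
  with True show ?thesis
    by (simp add: sbasis_wedge wedge.scaleR_left wedge.scaleR_right wedge_sign_cocycle Un_assoc)
next
  case False
  have "(sbasis I J \<and>\<^sub>s sbasis K L) \<and>\<^sub>s sbasis A B = 0"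
    using False by (auto simp: sbasis_wedge wedge.scaleR_left wedge.zero_left)
  moreover have "sbasis I J \<and>\<^sub>s (sbasis K L \<and>\<^sub>s sbasis A B) = 0"
    using False by (auto simp: sbasis_wedge wedge.scaleR_right wedge.zero_right)
  ultimately show ?thesis by simp
qed

lemma wedge_assoc: "(a \<and>\<^sub>s b) \<and>\<^sub>s c = a \<and>\<^sub>s (b \<and>\<^sub>s c)" for a :: "'n::{finite,wellorder} superalg"
proof (rule linear_eq_sbasis[of "\<lambda>a. (a \<and>\<^sub>s b) \<and>\<^sub>s c" "\<lambda>a. a \<and>\<^sub>s (b \<and>\<^sub>s c)"])
  fix I J :: "'n set"
  show "(sbasis I J \<and>\<^sub>s b) \<and>\<^sub>s c = sbasis I J \<and>\<^sub>s (b \<and>\<^sub>s c)"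
  proof (rule linear_eq_sbasis[of "\<lambda>b. (sbasis I J \<and>\<^sub>s b) \<and>\<^sub>s c" "\<lambda>b. sbasis I J \<and>\<^sub>s (b \<and>\<^sub>s c)"])
    fix K L :: "'n set"
    show "(sbasis I J \<and>\<^sub>s sbasis K L) \<and>\<^sub>s c = sbasis I J \<and>\<^sub>s (sbasis K L \<and>\<^sub>s c)"
      by (rule linear_eq_sbasis[of "\<lambda>c. (sbasis I J \<and>\<^sub>s sbasis K L) \<and>\<^sub>s c"])
        (auto intro!: linearI simp: wedge.add_right wedge.scaleR_right wedge_assoc_sbasis)
  qed (auto intro!: linearI simp: wedge.add_left wedge.add_right wedge.scaleR_left wedge.scaleR_right)
qed (auto intro!: linearI simp: wedge.add_left wedge.scaleR_left)

lemma sone_wedge [simp]: "sone \<and>\<^sub>s a = a" and wedge_sone [simp]: "a \<and>\<^sub>s sone = a"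
proof -
  show "sone \<and>\<^sub>s a = a"
    by (rule linear_eq_sbasis[of "\<lambda>a. sone \<and>\<^sub>s a" "\<lambda>a. a"])
      (auto intro!: linearI simp: wedge.add_right wedge.scaleR_right sbasis_wedge wedge_sign_def)
  show "a \<and>\<^sub>s sone = a"
    by (rule linear_eq_sbasis[of "\<lambda>a. a \<and>\<^sub>s sone" "\<lambda>a. a"])
      (auto intro!: linearI simp: wedge.add_left wedge.scaleR_left sbasis_wedge wedge_sign_def)
qed

lemma dx_wedge_d\<xi>: "dx k \<and>\<^sub>s d\<xi> l = sbasis {k} {l}"
  by (simp add: sbasis_wedge wedge_sign_def)

text \<open>Forms of even degree commute with everything. On basis forms the exponents of the two
  signs add up to \<open>2 * (card I + card J)\<close>, so they have the same parity.\<close>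

lemma sbasis_two_central: "sbasis {k} {l} \<and>\<^sub>s a = a \<and>\<^sub>s sbasis {k} {l}"
  for k l :: "'n::{finite,wellorder}"
proof (rule linear_eq_sbasis[of "\<lambda>a. sbasis {k} {l} \<and>\<^sub>s a" "\<lambda>a. a \<and>\<^sub>s sbasis {k} {l}"])
  fix I J :: "'n set"
  show "sbasis {k} {l} \<and>\<^sub>s sbasis I J = sbasis I J \<and>\<^sub>s sbasis {k} {l}"
  proof (cases "k \<notin> I \<and> l \<notin> J")
    case True
    have "card I + (inversions {k} I + inversions {l} J) + (card J + (inversions I {k} + inversions J {l})) =
        2 * (card I + card J)"
      using inversions_swap[of k I] inversions_swap[of l J] True by simp
    then have "even (card I + (inversions {k} I + inversions {l} J) + (card J + (inversions I {k} + inversions J {l})))"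
      by (simp only: dvd_triv_left)
    moreover have "(- 1 :: real) ^ a = (- 1) ^ b" if "even (a + b)" for a b
      using that by (auto simp: minus_one_power_iff)
    ultimately have "wedge_sign {k} {l} I J = wedge_sign I J {k} {l}"
      unfolding wedge_sign_def by (metis (no_types, lifting) One_nat_def add.assoc card.empty
          card_insert_disjoint empty_iff finite.emptyI mult.right_neutral mult_1)
    with True show ?thesis by (simp add: sbasis_wedge Un_commute)
  qed (auto simp: sbasis_wedge)
qed (auto intro!: linearI simp: wedge.add_left wedge.add_right wedge.scaleR_left wedge.scaleR_right)

subsection \<open>One-forms of a vector\<close>

definition xform :: "real ^ 'n::finite \<Rightarrow> 'n superalg" where
  "xform v = (\<Sum>k\<in>UNIV. v $ k *\<^sub>R dx k)"

definition xiform :: "real ^ 'n::finite \<Rightarrow> 'n superalg" where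
  "xiform v = (\<Sum>k\<in>UNIV. v $ k *\<^sub>R d\<xi> k)"

definition twoform :: "real ^ 'n::{finite,wellorder} \<Rightarrow> 'n superalg" where
  "twoform v = xform v \<and>\<^sub>s xiform v"

lemma linear_xform: "linear xform" and linear_xiform: "linear xiform"
  by (auto intro!: linearI simp: xform_def xiform_def scaleR_sum_right sum.distrib scaleR_add_left)

lemma xform_axis [simp]: "xform (axis k 1) = dx k" and xiform_axis [simp]: "xiform (axis k 1) = d\<xi> k"
  by (simp_all add: xform_def xiform_def sum_axis_scaleR)

lemma xform_wedge_xiform: "xform v \<and>\<^sub>s xiform w = (\<Sum>k\<in>UNIV. \<Sum>l\<in>UNIV. (v $ k * w $ l) *\<^sub>R sbasis {k} {l})"
  for v :: "real ^ 'n::{finite,wellorder}"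
  by (subst sum.swap) (simp add: xform_def xiform_def wedge.sum_left wedge.sum_right wedge.scaleR_left
      wedge.scaleR_right dx_wedge_d\<xi> scaleR_sum_right mult.commute)

lemma twoform_central: "twoform v \<and>\<^sub>s a = a \<and>\<^sub>s twoform v" for v :: "real ^ 'n::{finite,wellorder}"
  by (simp add: twoform_def xform_wedge_xiform wedge.sum_left wedge.sum_right wedge.scaleR_left
      wedge.scaleR_right sbasis_two_central)

lemma twoform_left_commute: "a \<and>\<^sub>s twoform v \<and>\<^sub>s b = twoform v \<and>\<^sub>s a \<and>\<^sub>s b"
  for v :: "real ^ 'n::{finite,wellorder}"
  by (metis twoform_central wedge_assoc)

lemma inversions_singletons: "inversions {k} {l} = (if l < k then 1 else 0)"
  for k :: "'n::linorder"
proof -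
  have "{(i, j). i \<in> {k} \<and> j \<in> {l} \<and> j < i} = (if l < k then {(k, l)} else {})" by auto
  then show ?thesis by (simp add: inversions_def)
qed

lemma sum_wedge_anticommute:
  fixes f g :: "'i \<Rightarrow> 'n::{finite,wellorder} superalg"
  assumes anti: "\<And>k l. f k \<and>\<^sub>s g l = - (g l \<and>\<^sub>s f k)"
  shows "(\<Sum>k\<in>A. v k *\<^sub>R f k) \<and>\<^sub>s (\<Sum>l\<in>B. w l *\<^sub>R g l) = - ((\<Sum>l\<in>B. w l *\<^sub>R g l) \<and>\<^sub>s (\<Sum>k\<in>A. v k *\<^sub>R f k))"
proof -
  have "(\<Sum>k\<in>A. v k *\<^sub>R f k) \<and>\<^sub>s (\<Sum>l\<in>B. w l *\<^sub>R g l) = (\<Sum>k\<in>A. \<Sum>l\<in>B. - ((w l * v k) *\<^sub>R (g l \<and>\<^sub>s f k)))"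
    by (subst sum.swap) (simp add: wedge.sum_left wedge.sum_right wedge.scaleR_left wedge.scaleR_right anti
        scaleR_sum_right sum_negf)
  also have "\<dots> = - (\<Sum>l\<in>B. \<Sum>k\<in>A. (w l * v k) *\<^sub>R (g l \<and>\<^sub>s f k))"
    by (subst sum.swap) (simp add: sum_negf)
  also have "(\<Sum>l\<in>B. \<Sum>k\<in>A. (w l * v k) *\<^sub>R (g l \<and>\<^sub>s f k)) = (\<Sum>l\<in>B. w l *\<^sub>R g l) \<and>\<^sub>s (\<Sum>k\<in>A. v k *\<^sub>R f k)"
    by (subst sum.swap) (simp add: wedge.sum_left wedge.sum_right wedge.scaleR_left wedge.scaleR_right
        scaleR_sum_right mult.commute)
  finally show ?thesis .
qed

lemma xform_anticommute: "xform v \<and>\<^sub>s xform w = - (xform w \<and>\<^sub>s xform v)"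
  and xiform_anticommute: "xiform v \<and>\<^sub>s xiform w = - (xiform w \<and>\<^sub>s xiform v)"
  and xform_xiform_anticommute: "xform v \<and>\<^sub>s xiform w = - (xiform w \<and>\<^sub>s xform v)"
  for v w :: "real ^ 'n::{finite,wellorder}"
  unfolding xform_def xiform_def
  by (rule sum_wedge_anticommute, auto simp: sbasis_wedge wedge_sign_def inversions_singletons insert_commute)+

lemma xform_self [simp]: "xform v \<and>\<^sub>s xform v = 0" and xiform_self [simp]: "xiform v \<and>\<^sub>s xiform v = 0"
  for v :: "real ^ 'n::{finite,wellorder}"
proof -
  have *: "a = 0" if "a = - a" for a :: "'n superalg"
  proof -
    have "2 *\<^sub>R a = 0" using that by (simp add: scaleR_2 eq_neg_iff_add_eq_0)
    then show ?thesis by (simp only: scaleR_eq_0_iff) simp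
  qed
  show "xform v \<and>\<^sub>s xform v = 0" "xiform v \<and>\<^sub>s xiform v = 0"
    by (rule *, rule xform_anticommute, rule *, rule xiform_anticommute)
qed

lemma xform_twoform [simp]: "xform v \<and>\<^sub>s twoform v \<and>\<^sub>s a = 0"
  and xiform_twoform [simp]: "xiform v \<and>\<^sub>s twoform v \<and>\<^sub>s a = 0"
  and twoform_self [simp]: "twoform v \<and>\<^sub>s twoform v \<and>\<^sub>s a = 0"
  for v :: "real ^ 'n::{finite,wellorder}"
proof -
  have 1: "xform v \<and>\<^sub>s twoform v = 0"
    by (simp add: twoform_def wedge_assoc[symmetric] wedge.zero_left)
  have 2: "xiform v \<and>\<^sub>s twoform v = 0"
    unfolding twoform_def xform_xiform_anticommute
    by (simp add: wedge.minus_right wedge_assoc[symmetric] wedge.zero_left)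
  have 3: "twoform v \<and>\<^sub>s twoform v = 0"
    by (subst twoform_def) (simp add: wedge_assoc 2 wedge.zero_right)
  show "xform v \<and>\<^sub>s twoform v \<and>\<^sub>s a = 0" "xiform v \<and>\<^sub>s twoform v \<and>\<^sub>s a = 0" "twoform v \<and>\<^sub>s twoform v \<and>\<^sub>s a = 0"
    by (simp_all add: wedge_assoc[symmetric] 1 2 3 wedge.zero_left)
qed

lemmas xform_twoform_commute = twoform_left_commute[of "xform u" for u]
lemmas xiform_twoform_commute = twoform_left_commute[of "xiform u" for u]

lemma twoform_xform [simp]: "twoform v \<and>\<^sub>s xform v \<and>\<^sub>s a = 0"
  and twoform_xiform_self [simp]: "twoform v \<and>\<^sub>s xiform v \<and>\<^sub>s a = 0"
  and twoform_xiform [simp]: "twoform v \<and>\<^sub>s xform b \<and>\<^sub>s xiform v \<and>\<^sub>s a = 0"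
  for v :: "real ^ 'n::{finite,wellorder}"
proof -
  show 1: "twoform v \<and>\<^sub>s xform v \<and>\<^sub>s a = 0"
    by (simp only: xform_twoform_commute[symmetric] xform_twoform)
  show "twoform v \<and>\<^sub>s xiform v \<and>\<^sub>s a = 0"
    by (simp only: xiform_twoform_commute[symmetric] xiform_twoform)
  have "twoform v \<and>\<^sub>s xform b \<and>\<^sub>s xiform v \<and>\<^sub>s a = xform b \<and>\<^sub>s xiform v \<and>\<^sub>s twoform v \<and>\<^sub>s a"
    by (simp only: xform_twoform_commute xiform_twoform_commute)
  then show "twoform v \<and>\<^sub>s xform b \<and>\<^sub>s xiform v \<and>\<^sub>s a = 0"
    by (simp add: wedge.zero_right)
qed

subsection \<open>Divided powers\<close>

definition divpow :: "'n::{finite,wellorder} superalg \<Rightarrow> nat \<Rightarrow> 'n superalg" where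
  "divpow s k = wedge_power s k /\<^sub>R fact k"

definition sum_twoforms :: "(real ^ 'n::{finite,wellorder}) list \<Rightarrow> 'n superalg" where
  "sum_twoforms vs = sum_list (map twoform vs)"

definition prod_twoforms :: "(real ^ 'n::{finite,wellorder}) list \<Rightarrow> 'n superalg" where
  "prod_twoforms vs = wedge_list (map twoform vs)"

lemma sum_twoforms_simps [simp]:
  "sum_twoforms [] = 0" "sum_twoforms (v # vs) = twoform v + sum_twoforms vs"
  by (simp_all add: sum_twoforms_def)

lemma prod_twoforms_simps [simp]:
  "prod_twoforms [] = sone" "prod_twoforms (v # vs) = twoform v \<and>\<^sub>s prod_twoforms vs"
  by (simp_all add: prod_twoforms_def wedge_list_def)

lemma prod_twoforms_append: "prod_twoforms (us @ vs) = prod_twoforms us \<and>\<^sub>s prod_twoforms vs"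
  by (induction us) (simp_all add: wedge_assoc)

lemma divpow_0 [simp]: "divpow s 0 = sone"
  by (simp add: divpow_def)

text \<open>\<open>twoform v\<close> is central with square 0, so the binomial expansion stops after
  the linear term.\<close>

lemma wedge_power_add_twoform:
  "wedge_power (twoform v + s) (Suc k) = wedge_power s (Suc k) + real (Suc k) *\<^sub>R (twoform v \<and>\<^sub>s wedge_power s k)"
proof (induction k)
  case 0
  then show ?case by simp
next
  case (Suc k)
  have add_diff_assoc: "X + Y + (Z - Y) = X + Z" for X Y Z :: "'b::finite superalg"
    by simp
  have "wedge_power (twoform v + s) (Suc (Suc k)) = (twoform v + s) \<and>\<^sub>s
      (wedge_power s (Suc k) + real (Suc k) *\<^sub>R (twoform v \<and>\<^sub>s wedge_power s k))"
    using Suc by (simp only: wedge_power.simps(2)[of _ "Suc k"])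
  also have "\<dots> = wedge_power s (Suc (Suc k)) + twoform v \<and>\<^sub>s wedge_power s (Suc k) +
     real (Suc k) *\<^sub>R (twoform v \<and>\<^sub>s wedge_power s (Suc k))"
    by (simp add: wedge.add_left wedge.add_right wedge.scaleR_right twoform_left_commute[of s])
  also have "real (Suc k) *\<^sub>R (twoform v \<and>\<^sub>s wedge_power s (Suc k)) =
      real (Suc (Suc k)) *\<^sub>R (twoform v \<and>\<^sub>s wedge_power s (Suc k)) - twoform v \<and>\<^sub>s wedge_power s (Suc k)"
    by (subst (2) of_nat_Suc) (simp only: scaleR_add_left scaleR_one add_diff_cancel_left')
  finally show ?case by (simp only: add_diff_assoc)
qed

lemma divpow_add_twoform:
  "divpow (twoform v + s) (Suc k) = divpow s (Suc k) + twoform v \<and>\<^sub>s divpow s k"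
proof -
  have "inverse (fact (Suc k)) * real (Suc k) = inverse (fact k)"
    by (simp add: divide_simps)
  then show ?thesis
    unfolding divpow_def wedge_power_add_twoform
    by (simp add: scaleR_add_right wedge.scaleR_right del: fact_Suc of_nat_Suc wedge_power.simps)
qed

lemma divpow_zero_Suc: "divpow 0 (Suc k) = 0"
  by (simp add: divpow_def wedge.zero_left)

lemma divpow_sum_twoforms_eq_0: "length vs < k \<Longrightarrow> divpow (sum_twoforms vs) k = 0"
proof (induction vs arbitrary: k)
  case Nil
  then show ?case by (cases k) (auto simp: divpow_zero_Suc)
next
  case (Cons v vs)
  then show ?case by (cases k) (auto simp: divpow_add_twoform wedge.zero_right)
qed

text \<open>Each summand squares to zero, so the top divided power contains every summand exactly
  once; the factorial cancels the number of orderings.\<close>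

lemma divpow_sum_twoforms: "divpow (sum_twoforms vs) (length vs) = prod_twoforms vs"
  by (induction vs) (simp_all add: divpow_add_twoform divpow_sum_twoforms_eq_0)

lemma xform_prod_twoforms: "v \<in> set vs \<Longrightarrow> xform v \<and>\<^sub>s prod_twoforms vs = 0"
  and xiform_prod_twoforms: "v \<in> set vs \<Longrightarrow> xiform v \<and>\<^sub>s prod_twoforms vs = 0"
  by (induction vs) (auto simp: wedge.zero_right xform_twoform_commute xiform_twoform_commute)

lemma prod_twoforms_central: "prod_twoforms vs \<and>\<^sub>s a = a \<and>\<^sub>s prod_twoforms vs"
proof (induction vs arbitrary: a)
  case (Cons v vs)
  have "prod_twoforms (v # vs) \<and>\<^sub>s a = twoform v \<and>\<^sub>s a \<and>\<^sub>s prod_twoforms vs"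
    using Cons[of a] by (simp add: wedge_assoc)
  then show ?case by (simp add: twoform_left_commute[of a])
qed simp

text \<open>The product on the left annihilates each of its own factors, hence every term in which
  the power uses a summand of \<open>sum_twoforms vs\<close>.\<close>

lemma prod_twoforms_divpow_add:
  "prod_twoforms vs \<and>\<^sub>s divpow (sum_twoforms vs + s) k = prod_twoforms vs \<and>\<^sub>s divpow s k"
proof (induction vs)
  case (Cons v vs)
  have "divpow (sum_twoforms (v # vs) + s) k = divpow (sum_twoforms vs + s) k +
      (case k of 0 \<Rightarrow> 0 | Suc j \<Rightarrow> twoform v \<and>\<^sub>s divpow (sum_twoforms vs + s) j)"
    by (cases k) (simp_all add: add.assoc divpow_add_twoform)
  moreover have "prod_twoforms (v # vs) \<and>\<^sub>s twoform v \<and>\<^sub>s a = 0" for a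
    by (simp add: wedge_assoc twoform_left_commute[of "prod_twoforms vs"])
  ultimately have "prod_twoforms (v # vs) \<and>\<^sub>s divpow (sum_twoforms (v # vs) + s) k =
      prod_twoforms (v # vs) \<and>\<^sub>s divpow (sum_twoforms vs + s) k"
    by (cases k) (simp_all only: wedge.add_right nat.case wedge.zero_right add_0_right)
  then show ?case using Cons by (simp add: wedge_assoc)
qed simp

text \<open>The elementary symmetric polynomial of degree \<open>length vs - 1\<close> in the
  two-forms: the sum of all products with one factor left out.\<close>

fun omit_one :: "(real ^ 'n::{finite,wellorder}) list \<Rightarrow> 'n superalg" where
  "omit_one [] = 0"
| "omit_one (v # vs) = prod_twoforms vs + twoform v \<and>\<^sub>s omit_one vs"

lemma divpow_sum_twoforms_pred:
  "vs \<noteq> [] \<Longrightarrow> divpow (sum_twoforms vs) (length vs - 1) = omit_one vs"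
proof (induction vs)
  case (Cons v vs)
  show ?case
  proof (cases vs)
    case Nil
    then show ?thesis by (simp add: wedge.zero_right)
  next
    case (Cons w ws)
    then have "length vs = Suc (length vs - 1)" by simp
    then have "divpow (twoform v + sum_twoforms vs) (length vs) =
        divpow (sum_twoforms vs) (length vs) + twoform v \<and>\<^sub>s divpow (sum_twoforms vs) (length vs - 1)"
      using divpow_add_twoform[of v "sum_twoforms vs" "length vs - 1"] by simp
    then show ?thesis
      using Cons.IH Cons divpow_sum_twoforms[of vs] by simp
  qed
qed simp

text \<open>A summand survives only if it contains neither the factor of \<open>b\<close> nor that
  of \<open>c\<close>. As only one factor is missing, this forces \<open>b = c\<close>, and the
  multiplication restores the missing factor.\<close>

lemma xform_xiform_omit_one:
  assumes "distinct vs" "b \<in> set vs" "c \<in> set vs"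
  shows "xform b \<and>\<^sub>s xiform c \<and>\<^sub>s omit_one vs = (if b = c then prod_twoforms vs else 0)"
  using assms
proof (induction vs)
  case (Cons v vs)
  have 0: "xform b \<and>\<^sub>s xiform c \<and>\<^sub>s omit_one (v # vs) = xform b \<and>\<^sub>s xiform c \<and>\<^sub>s prod_twoforms vs +
      twoform v \<and>\<^sub>s xform b \<and>\<^sub>s xiform c \<and>\<^sub>s omit_one vs"
    by (simp add: wedge.add_right xform_twoform_commute xiform_twoform_commute del: twoform_xform)
  consider "b = v" "c = v" | "b = v" "c \<in> set vs" | "c = v" "b \<in> set vs" | "b \<in> set vs" "c \<in> set vs"
    using Cons.prems by auto
  then show ?case
  proof cases
    case 1
    then show ?thesis unfolding 0
      by (simp add: wedge.zero_right) (simp add: twoform_def wedge_assoc)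
  next
    case 2
    then have "b \<noteq> c" using Cons.prems by auto
    then show ?thesis unfolding 0 using 2
      by (simp add: xiform_prod_twoforms wedge.zero_right)
  next
    case 3
    then have "b \<noteq> c" using Cons.prems by auto
    have "xform b \<and>\<^sub>s xiform c \<and>\<^sub>s prod_twoforms vs = - (xiform c \<and>\<^sub>s xform b \<and>\<^sub>s prod_twoforms vs)"
      by (simp add: wedge_assoc[symmetric] xform_xiform_anticommute wedge.minus_left)
    moreover have "twoform v \<and>\<^sub>s xform b \<and>\<^sub>s xiform c \<and>\<^sub>s omit_one vs = 0"
      using 3 by simp
    ultimately show ?thesis unfolding 0 using 3 \<open>b \<noteq> c\<close>
      by (simp add: xform_prod_twoforms wedge.zero_right)
  next
    case 4
    then show ?thesis unfolding 0 using Cons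
      by (simp add: xiform_prod_twoforms wedge.zero_right)
  qed
qed simp

subsection \<open>Orthonormal bases\<close>

definition orthonormal_list :: "(real ^ 'n) list \<Rightarrow> bool" where
  "orthonormal_list bs \<longleftrightarrow> distinct bs \<and>
     (\<forall>a\<in>set bs. \<forall>b\<in>set bs. a \<bullet> b = (if a = b then 1 else 0))"

text \<open>For an orthonormal list this is the matrix of the orthogonal projection onto its
  span.\<close>

definition outer_sum :: "(real ^ 'n) list \<Rightarrow> real ^ 'n ^ 'n" where
  "outer_sum vs = (\<chi> k l. \<Sum>v\<in>set vs. v $ k * v $ l)"

lemma outer_sum_props:
  fixes bs :: "(real ^ 'n) list"
  assumes on: "orthonormal_list bs"
  shows "transpose (outer_sum bs) = outer_sum bs" "outer_sum bs ** outer_sum bs = outer_sum bs"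
    "trace (outer_sum bs) = length bs"
proof -
  let ?R = "outer_sum bs"
  have ip: "(\<Sum>j\<in>UNIV. a $ j * b $ j) = (if a = b then 1 else 0)" if "a \<in> set bs" "b \<in> set bs" for a b
    using on that unfolding orthonormal_list_def by (auto simp: inner_vec_def)
  show "transpose ?R = ?R"
    by (simp add: outer_sum_def transpose_def mult.commute)
  show "?R ** ?R = ?R"
  proof (simp add: vec_eq_iff, intro allI)
    fix k l
    have "(?R ** ?R) $ k $ l = (\<Sum>j\<in>UNIV. \<Sum>a\<in>set bs. \<Sum>b\<in>set bs. a $ k * b $ l * (a $ j * b $ j))"
      by (simp add: outer_sum_def matrix_matrix_mult_def sum_product algebra_simps)
    also have "\<dots> = (\<Sum>a\<in>set bs. \<Sum>b\<in>set bs. a $ k * b $ l * (\<Sum>j\<in>UNIV. a $ j * b $ j))"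
      by (subst sum.swap, rule sum.cong[OF refl], subst sum.swap) (simp add: sum_distrib_left)
    also have "\<dots> = (\<Sum>a\<in>set bs. \<Sum>b\<in>set bs. if b = a then a $ k * b $ l else 0)"
      by (intro sum.cong refl) (auto simp: ip)
    also have "\<dots> = ?R $ k $ l" by (simp add: outer_sum_def sum.delta)
    finally show "(?R ** ?R) $ k $ l = ?R $ k $ l" .
  qed
  have "trace ?R = (\<Sum>b\<in>set bs. \<Sum>k\<in>UNIV. b $ k * b $ k)"
    unfolding trace_def outer_sum_def by (subst sum.swap) simp
  also have "\<dots> = (\<Sum>b\<in>set bs. 1)" by (intro sum.cong refl) (simp add: ip)
  also have "\<dots> = real (card (set bs))" by simp
  finally show "trace ?R = length bs"
    using on by (simp add: orthonormal_list_def distinct_card)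
qed

text \<open>The outer sum is a projection whose trace is the full dimension, hence the
  identity.\<close>

lemma orthonormal_list_complete:
  fixes bs :: "(real ^ 'n) list"
  assumes on: "orthonormal_list bs" and len: "length bs = CARD('n)"
  shows "(\<Sum>b\<in>set bs. b $ k * b $ l) = (if k = l then 1 else 0)"
proof -
  have "outer_sum bs = mat 1"
    using outer_sum_props[OF on] len by (intro symmetric_idempotent_full_trace) auto
  then have "outer_sum bs $ k $ l = mat 1 $ k $ l" by simp
  then show ?thesis by (simp add: outer_sum_def mat_def)
qed

lemma twoform_eq: "twoform v = (\<Sum>k\<in>UNIV. \<Sum>l\<in>UNIV. (v $ k * v $ l) *\<^sub>R sbasis {k} {l})"
  by (simp add: twoform_def xform_wedge_xiform)

definition bilin_form :: "real ^ 'n::_ ^ 'n::{finite,wellorder} \<Rightarrow> 'n superalg" where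
  "bilin_form Q = (\<Sum>k\<in>UNIV. \<Sum>l\<in>UNIV. Q $ k $ l *\<^sub>R sbasis {k} {l})"

lemma sum_twoforms_eq_bilin_form:
  assumes "distinct vs"
  shows "sum_twoforms vs = bilin_form (outer_sum vs)"
proof -
  have "sum_twoforms vs = (\<Sum>v\<in>set vs. twoform v)"
    using assms by (simp add: sum_twoforms_def sum_list_distinct_conv_sum_set)
  also have "\<dots> = (\<Sum>k\<in>UNIV. \<Sum>v\<in>set vs. \<Sum>l\<in>UNIV. (v $ k * v $ l) *\<^sub>R sbasis {k} {l})"
    unfolding twoform_eq by (rule sum.swap)
  also have "\<dots> = (\<Sum>k\<in>UNIV. \<Sum>l\<in>UNIV. \<Sum>v\<in>set vs. (v $ k * v $ l) *\<^sub>R sbasis {k} {l})"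
    by (intro sum.cong refl) (rule sum.swap)
  finally show ?thesis by (simp add: bilin_form_def outer_sum_def scaleR_sum_left)
qed

lemma \<beta>_eq_bilin_form: "(\<beta> :: 'n::{finite,wellorder} superalg) = bilin_form (mat 1)"
proof -
  have "bilin_form (mat 1) = (\<Sum>k\<in>UNIV. \<Sum>l\<in>UNIV. if l = k then sbasis {k} {l} else (0::'n superalg))"
    unfolding bilin_form_def by (intro sum.cong refl) (auto simp: mat_def)
  then show ?thesis by (simp add: \<beta>_def dx_wedge_d\<xi> sum.delta)
qed

lemma sum_twoforms_orthonormal:
  assumes "orthonormal_list bs" "length bs = CARD('n)"
  shows "sum_twoforms bs = (\<beta> :: 'n::{finite,wellorder} superalg)"
proof -
  have "distinct bs" using assms by (simp add: orthonormal_list_def)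
  moreover have "outer_sum bs = mat 1"
    by (simp add: outer_sum_def orthonormal_list_complete[OF assms] mat_def vec_eq_iff)
  ultimately show ?thesis
    by (simp add: sum_twoforms_eq_bilin_form \<beta>_eq_bilin_form)
qed

lemma sum_atMost_half: "j * (j - Suc 0) div 2 + j = Suc j * j div 2"
  by (cases j) simp_all

text \<open>Moving a new pair in front of \<open>length ks\<close> sorted pairs costs one sign for
  each of them; the inversions in the two index sets coincide and cancel. The exponents sum to a
  triangular number.\<close>

lemma prod_twoforms_axis:
  fixes ks :: "'n::{finite,wellorder} list"
  assumes "distinct ks"
  shows "prod_twoforms (map (\<lambda>k. axis k 1) ks) =
    (- 1) ^ (length ks * (length ks - 1) div 2) *\<^sub>R sbasis (set ks) (set ks)"
  using assms
proof (induction ks)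
  case (Cons k ks)
  have "wedge_sign {k} {k} (set ks) (set ks) = (- 1) ^ length ks"
    using Cons.prems by (simp add: wedge_sign_def distinct_card power_add[symmetric] minus_one_power_iff)
  moreover have "(-1 :: real) ^ (length ks * (length ks - 1) div 2) * (-1) ^ length ks =
      (-1) ^ (Suc (length ks) * length ks div 2)"
    by (simp add: power_add[symmetric] sum_atMost_half)
  moreover have "twoform (axis k 1) = sbasis {k} {k}"
    by (simp only: twoform_def xform_axis xiform_axis dx_wedge_d\<xi>)
  ultimately show ?case
    using Cons by (simp add: wedge.scaleR_right sbasis_wedge)
qed simp

text \<open>\<open>\<beta>\<close> has the same shape in every orthonormal basis, so both products
  equal its top divided power. No determinant of a change of basis is involved.\<close>

lemma prod_twoforms_orthonormal:
  assumes "orthonormal_list bs" "length bs = CARD('n)"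
  shows "prod_twoforms bs =
    (- 1) ^ (CARD('n) * (CARD('n) - 1) div 2) *\<^sub>R (sbasis UNIV UNIV :: 'n::{finite,wellorder} superalg)"
proof -
  obtain ks :: "'n list" where ks: "set ks = UNIV" "distinct ks"
    using finite_distinct_list[of "UNIV :: 'n set"] by auto
  then have len: "length ks = CARD('n)" by (metis distinct_card)
  let ?as = "map (\<lambda>k. axis k 1) ks :: (real ^ 'n::_) list"
  have "distinct ?as" using ks by (auto simp: distinct_map inj_on_def axis_eq_axis)
  then have "orthonormal_list ?as"
    by (auto simp: orthonormal_list_def inner_axis_axis axis_eq_axis)
  then have "sum_twoforms ?as = \<beta>" by (intro sum_twoforms_orthonormal) (simp_all add: len)
  moreover have "sum_twoforms bs = \<beta>" using assms by (rule sum_twoforms_orthonormal)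
  ultimately have "prod_twoforms bs = prod_twoforms ?as"
    using divpow_sum_twoforms[of bs] divpow_sum_twoforms[of ?as] assms len by simp
  with prod_twoforms_axis[OF ks(2)] ks len show ?thesis by simp
qed

section \<open>The operator \<open>Jop\<close>, the normal form and frames adapted to it\<close>

lemma Jop_sbasis_x: "Jop (sbasis I {}) = sbasis {} I"
  by (auto simp: Jop_def sbasis_def vec_eq_iff axis_def)

lemma linear_Jop: "linear Jop"
  by (intro linearI) (simp_all add: Jop_def vec_eq_iff algebra_simps)

lemma Jop_xform [simp]: "Jop (xform v) = xiform v"
  by (simp add: xform_def xiform_def linear_sum[OF linear_Jop] linear_cmul[OF linear_Jop] Jop_sbasis_x)

text \<open>Multiplicativity of \<open>Jop\<close> is established for forms in the \<open>dx\<close>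
  alone, where no sign arises. The span is carried along because it must be preserved for the
  induction over a list of normals.\<close>

lemma span_x_wedge:
  assumes "a \<in> span (range (\<lambda>I. sbasis I {}))"
  shows "dx k \<and>\<^sub>s a \<in> span (range (\<lambda>I. sbasis I {}))"
    and "Jop (dx k \<and>\<^sub>s a) = d\<xi> k \<and>\<^sub>s Jop a"
proof -
  let ?X = "range (\<lambda>I. sbasis I {}) :: 'a superalg set"
  have "c *\<^sub>R sbasis K {} \<in> span ?X" for c K
    by (rule span_scale, rule span_base) simp
  then have basis: "dx k \<and>\<^sub>s sbasis I {} \<in> span ?X" "Jop (dx k \<and>\<^sub>s sbasis I {}) = d\<xi> k \<and>\<^sub>s Jop (sbasis I {})" for I
    by (simp_all add: sbasis_wedge Jop_sbasis_x linear_cmul[OF linear_Jop] linear_0[OF linear_Jop]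
        wedge_sign_def span_zero)
  have "dx k \<and>\<^sub>s a \<in> span ?X \<and> Jop (dx k \<and>\<^sub>s a) = d\<xi> k \<and>\<^sub>s Jop a"
    using assms
  proof (induction rule: span_induct_alt)
    case base
    then show ?case by (simp add: wedge.zero_right span_zero linear_0[OF linear_Jop])
  next
    case (step c b y)
    then obtain I where "b = sbasis I {}" by auto
    with step basis[of I] show ?case
      by (simp add: wedge.add_right wedge.scaleR_right linear_add[OF linear_Jop] linear_cmul[OF linear_Jop]
          span_add span_scale)
  qed
  then show "dx k \<and>\<^sub>s a \<in> span ?X" "Jop (dx k \<and>\<^sub>s a) = d\<xi> k \<and>\<^sub>s Jop a" by auto
qed

lemma Jop_wedge_list_xform:
  "wedge_list (map xform vs) \<in> span (range (\<lambda>I. sbasis I {})) \<and>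
   Jop (wedge_list (map xform vs)) = wedge_list (map xiform vs)"
proof (induction vs)
  case Nil
  then show ?case by (auto simp: wedge_list_def Jop_sbasis_x intro: span_base)
next
  case (Cons v vs)
  let ?w = "wedge_list (map xform vs)"
  have "wedge_list (map xform (v # vs)) = (\<Sum>k\<in>UNIV. v $ k *\<^sub>R (dx k \<and>\<^sub>s ?w))"
    by (simp add: wedge_list_def xform_def wedge.sum_left wedge.scaleR_left)
  moreover have "wedge_list (map xiform (v # vs)) = (\<Sum>k\<in>UNIV. v $ k *\<^sub>R (d\<xi> k \<and>\<^sub>s wedge_list (map xiform vs)))"
    by (simp add: wedge_list_def xiform_def wedge.sum_left wedge.scaleR_left)
  ultimately show ?case
    using Cons span_x_wedge[of ?w]
    by (auto simp: linear_sum[OF linear_Jop] linear_cmul[OF linear_Jop] intro!: span_sum span_scale)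
qed

lemma wedge_list_xform_xiform:
  "wedge_list (map xform vs) \<and>\<^sub>s xiform w = (- 1) ^ length vs *\<^sub>R (xiform w \<and>\<^sub>s wedge_list (map xform vs))"
proof (induction vs)
  case (Cons v vs)
  have "wedge_list (map xform (v # vs)) \<and>\<^sub>s xiform w = xform v \<and>\<^sub>s (wedge_list (map xform vs) \<and>\<^sub>s xiform w)"
    by (simp add: wedge_list_def wedge_assoc)
  also have "\<dots> = (- 1) ^ length vs *\<^sub>R ((xform v \<and>\<^sub>s xiform w) \<and>\<^sub>s wedge_list (map xform vs))"
    by (simp add: Cons wedge.scaleR_right wedge_assoc)
  also have "\<dots> = (- 1) ^ length (v # vs) *\<^sub>R (xiform w \<and>\<^sub>s wedge_list (map xform (v # vs)))"
    by (simp add: xform_xiform_anticommute wedge.minus_left wedge_assoc wedge_list_def)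
  finally show ?case .
qed (simp add: wedge_list_def)

text \<open>Interleaving the normals with their images under \<open>Jop\<close> moves each image
  across the remaining normals. The resulting sign is exactly the factor in the definition of the
  current, so it disappears here.\<close>

lemma normal_form_eq_prod_twoforms:
  "(- 1) ^ (length vs * (length vs - 1) div 2) *\<^sub>R
     (wedge_list (map xform vs) \<and>\<^sub>s Jop (wedge_list (map xform vs))) = prod_twoforms vs"
proof -
  have "wedge_list (map xform vs) \<and>\<^sub>s wedge_list (map xiform vs) =
    (- 1) ^ (length vs * (length vs - 1) div 2) *\<^sub>R prod_twoforms vs"
  proof (induction vs)
    case (Cons v vs)
    let ?x = "wedge_list (map xform vs)" and ?xi = "wedge_list (map xiform vs)"
    have "wedge_list (map xform (v # vs)) \<and>\<^sub>s wedge_list (map xiform (v # vs)) =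
      xform v \<and>\<^sub>s (?x \<and>\<^sub>s xiform v) \<and>\<^sub>s ?xi"
      by (simp add: wedge_list_def wedge_assoc)
    also have "\<dots> = (- 1) ^ length vs *\<^sub>R (twoform v \<and>\<^sub>s (?x \<and>\<^sub>s ?xi))"
      by (simp add: wedge_list_xform_xiform wedge.scaleR_left wedge.scaleR_right twoform_def wedge_assoc)
    also have "\<dots> = ((- 1) ^ length vs * (- 1) ^ (length vs * (length vs - 1) div 2)) *\<^sub>R
        prod_twoforms (v # vs)"
      by (simp add: Cons wedge.scaleR_right)
    also have "(- 1 :: real) ^ length vs * (- 1) ^ (length vs * (length vs - 1) div 2) =
        (- 1) ^ (length (v # vs) * (length (v # vs) - 1) div 2)"
      using sum_atMost_half[of "length vs"] by (simp add: power_add[symmetric] add.commute)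
    finally show ?case .
  qed (simp add: wedge_list_def)
  moreover have "(- 1 :: real) ^ k * (- 1) ^ k = 1" for k
    by (simp add: power_add[symmetric] minus_one_power_iff)
  ultimately show ?thesis using Jop_wedge_list_xform[of vs] by simp
qed

lemma orthonormal_list_expand:
  assumes "orthonormal_list bs" "length bs = CARD('n)"
  shows "axis k 1 = (\<Sum>b\<in>set bs. b $ k *\<^sub>R (b :: real ^ 'n))"
  using orthonormal_list_complete[OF assms, of k]
  by (auto simp: vec_eq_iff axis_def)

text \<open>\<open>\<beta>\<close> splits into a normal and a tangential sum. The product of the
  normals kills the former and completes the power of the latter to the product over the whole
  frame.\<close>

lemma prod_twoforms_wedge_divpow_\<beta>:
  assumes on: "orthonormal_list (ns @ ts)" and len: "length (ns @ ts) = CARD('n)"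
  shows "prod_twoforms ns \<and>\<^sub>s divpow \<beta> (length ts) =
    (- 1) ^ (CARD('n) * (CARD('n) - 1) div 2) *\<^sub>R (sbasis UNIV UNIV :: 'n::{finite,wellorder} superalg)"
proof -
  have \<beta>: "\<beta> = sum_twoforms ns + sum_twoforms ts"
    using sum_twoforms_orthonormal[OF on len] by (simp add: sum_twoforms_def)
  show ?thesis unfolding \<beta>
    using prod_twoforms_orthonormal[OF on len]
    by (simp add: prod_twoforms_divpow_add divpow_sum_twoforms prod_twoforms_append)
qed

text \<open>Expand \<open>dx k\<close> and \<open>d\<xi> l\<close> in the frame. A normal covector
  is killed by the product of the normals; among tangential ones only equal pairs complete the power
  of degree \<open>length ts - 1\<close>. The remaining coefficients are those of the tangential
  projection.\<close>

lemma dx_d\<xi>_wedge_prod_twoforms_divpow_\<beta>: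
  fixes ns ts :: "(real ^ 'n::{finite,wellorder}) list"
  assumes on: "orthonormal_list (ns @ ts)" and len: "length (ns @ ts) = CARD('n)" and "ts \<noteq> []"
  shows "dx k \<and>\<^sub>s d\<xi> l \<and>\<^sub>s prod_twoforms ns \<and>\<^sub>s divpow \<beta> (length ts - 1) =
    (\<Sum>t\<in>set ts. t $ k * t $ l) *\<^sub>R (- 1) ^ (CARD('n) * (CARD('n) - 1) div 2) *\<^sub>R sbasis UNIV UNIV"
proof -
  let ?V = "(- 1) ^ (CARD('n) * (CARD('n) - 1) div 2) *\<^sub>R (sbasis UNIV UNIV :: 'n superalg)"
  let ?o = "prod_twoforms ns \<and>\<^sub>s omit_one ts"
  have dis: "distinct ns" "distinct ts" "set ns \<inter> set ts = {}" using on by (auto simp: orthonormal_list_def)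
  have V: "prod_twoforms ns \<and>\<^sub>s prod_twoforms ts = ?V"
    using prod_twoforms_orthonormal[OF on len] by (simp add: prod_twoforms_append)
  have *: "prod_twoforms ns \<and>\<^sub>s divpow \<beta> (length ts - 1) = ?o"
  proof -
    have \<beta>: "\<beta> = sum_twoforms ns + sum_twoforms ts"
      using sum_twoforms_orthonormal[OF on len] by (simp add: sum_twoforms_def)
    show ?thesis unfolding \<beta> using divpow_sum_twoforms_pred[OF \<open>ts \<noteq> []\<close>] by (simp add: prod_twoforms_divpow_add)
  qed
  have bc: "xform b \<and>\<^sub>s xiform c \<and>\<^sub>s ?o = (if b \<in> set ts \<and> b = c then ?V else 0)"
    if mem: "b \<in> set (ns @ ts)" "c \<in> set (ns @ ts)" for b c
  proof -
    consider "c \<in> set ns" | "b \<in> set ns" "c \<in> set ts" | "b \<in> set ts" "c \<in> set ts" using mem by auto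
    then show ?thesis
    proof cases
      case 1
      then have "xiform c \<and>\<^sub>s ?o = 0"
        by (simp add: wedge_assoc[symmetric] xiform_prod_twoforms wedge.zero_left)
      then show ?thesis using 1 dis by (auto simp: wedge.zero_right)
    next
      case 2
      then have "xform b \<and>\<^sub>s ?o = 0"
        by (simp add: wedge_assoc[symmetric] xform_prod_twoforms wedge.zero_left)
      moreover have "xform b \<and>\<^sub>s xiform c \<and>\<^sub>s ?o = - (xiform c \<and>\<^sub>s xform b \<and>\<^sub>s ?o)"
        by (simp add: wedge_assoc[symmetric] xform_xiform_anticommute wedge.minus_left)
      ultimately show ?thesis using 2 dis by (auto simp: wedge.zero_right)
    next
      case 3
      have "xform b \<and>\<^sub>s xiform c \<and>\<^sub>s ?o = prod_twoforms ns \<and>\<^sub>s xform b \<and>\<^sub>s xiform c \<and>\<^sub>s omit_one ts"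
        by (metis prod_twoforms_central wedge_assoc)
      then show ?thesis
        using 3 xform_xiform_omit_one[OF dis(2) 3] V by (simp add: wedge.zero_right)
    qed
  qed
  have "dx k = (\<Sum>b\<in>set (ns @ ts). b $ k *\<^sub>R xform b)"
    using arg_cong[OF orthonormal_list_expand[OF on len, of k], of xform]
    by (simp only: xform_axis linear_sum[OF linear_xform] linear_cmul[OF linear_xform])
  moreover have "d\<xi> l = (\<Sum>b\<in>set (ns @ ts). b $ l *\<^sub>R xiform b)"
    using arg_cong[OF orthonormal_list_expand[OF on len, of l], of xiform]
    by (simp only: xiform_axis linear_sum[OF linear_xiform] linear_cmul[OF linear_xiform])
  ultimately have "dx k \<and>\<^sub>s d\<xi> l \<and>\<^sub>s ?o =
     (\<Sum>b\<in>set (ns @ ts). b $ k *\<^sub>R xform b) \<and>\<^sub>s (\<Sum>b\<in>set (ns @ ts). b $ l *\<^sub>R xiform b) \<and>\<^sub>s ?o"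
    by (simp only:)
  also have "\<dots> = (\<Sum>b\<in>set (ns @ ts). \<Sum>c\<in>set (ns @ ts). (b $ k * c $ l) *\<^sub>R (xform b \<and>\<^sub>s xiform c \<and>\<^sub>s ?o))"
    by (subst sum.swap) (simp only: wedge.sum_left wedge.sum_right wedge.scaleR_left wedge.scaleR_right
        scaleR_sum_right scaleR_scaleR mult.commute)
  also have "\<dots> = (\<Sum>b\<in>set (ns @ ts). \<Sum>c\<in>set (ns @ ts).
      if c = b then (if b \<in> set ts then (b $ k * b $ l) *\<^sub>R ?V else 0) else 0)"
    by (intro sum.cong refl) (simp add: bc)
  also have "\<dots> = (\<Sum>b\<in>set (ns @ ts). if b \<in> set ts then (b $ k * b $ l) *\<^sub>R ?V else 0)"
    by (intro sum.cong refl) (simp add: sum.delta)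
  also have "\<dots> = (\<Sum>b\<in>set ts. (b $ k * b $ l) *\<^sub>R ?V)"
    by (rule sum.mono_neutral_cong_right) auto
  finally show ?thesis by (simp only: * scaleR_sum_left)
qed

section \<open>Defining functions and parametrizations\<close>

definition grad :: "(real ^ 'n \<Rightarrow> real) \<Rightarrow> real ^ 'n \<Rightarrow> real ^ 'n" where
  "grad f x = (\<chi> k. partial k f x)"

lemma has_derivative_grad:
  "f differentiable (at x) \<Longrightarrow> (f has_derivative (\<lambda>h. grad f x \<bullet> h)) (at x)"
  using has_derivative_partials[of f x] by (simp add: grad_def inner_vec_def mult.commute)

lemma conormal_eq_xform:
  fixes \<rho> :: "real ^ 'n::{finite,wellorder} \<Rightarrow> real"
  assumes "\<rho> differentiable (at x)"
  shows "conormal \<rho> x = xform (grad \<rho> x)"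
proof -
  have "partial k (\<lambda>x. \<rho> x *\<^sub>R (sone :: 'n superalg)) x = partial k \<rho> x *\<^sub>R sone" for k :: 'n
    by (rule partial_bounded_linear[OF bounded_linear_scaleR_left assms])
  then show ?thesis
    by (simp add: conormal_def ext_d_def fun_form_def xform_def grad_def wedge.scaleR_right)
qed

lemma dual_vec_xform [simp]: "dual_vec (xform v) = v"
proof -
  have "xform v $ ({k}, {}) = (\<Sum>j\<in>UNIV. axis k 1 $ j *\<^sub>R v $ j)" for k
    unfolding xform_def by (auto simp: sbasis_def axis_def intro!: sum.cong)
  then show ?thesis by (simp add: dual_vec_def vec_eq_iff sum_axis_mult)
qed

lemma smooth_on_differentiable: "smooth_on U f \<Longrightarrow> x \<in> U \<Longrightarrow> f differentiable (at x)"
  unfolding smooth_on_def using Ck_on_differentiable by blast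

lemma smooth_on_Ck_on: "smooth_on U f \<Longrightarrow> Ck_on r U f"
  by (simp add: smooth_on_def)

lemma smooth_on_grad: "smooth_on U f \<Longrightarrow> Ck_on r U (grad f)"
  unfolding smooth_on_def grad_def by (intro Ck_on_vecI) (auto intro: Ck_on_partial)

lemma grad_mult:
  assumes "f differentiable (at x)" "g differentiable (at x)"
  shows "grad (\<lambda>x. f x * g x) x = f x *\<^sub>R grad g x + g x *\<^sub>R grad f x"
proof (simp add: vec_eq_iff grad_def, intro allI)
  fix k
  have "((\<lambda>x. f x * g x) has_derivative (\<lambda>h. f x * (grad g x \<bullet> h) + (grad f x \<bullet> h) * g x)) (at x)"
    by (intro has_derivative_mult has_derivative_grad assms)
  from partial_eqI[OF this, of k]
  show "partial k (\<lambda>x. f x * g x) x = f x * partial k g x + g x * partial k f x"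
    by (simp add: inner_axis grad_def)
qed

lemma grad_diff_sum:
  assumes "f differentiable (at x)" "\<And>i. i < q \<Longrightarrow> g i differentiable (at x)"
  shows "grad (\<lambda>x. f x - (\<Sum>i<q. g i x)) x = grad f x - (\<Sum>i<(q::nat). grad (g i) x)"
proof (simp add: vec_eq_iff grad_def, intro allI)
  fix k
  have "((\<lambda>x. f x - (\<Sum>i<q. g i x)) has_derivative (\<lambda>h. grad f x \<bullet> h - (\<Sum>i<q. grad (g i) x \<bullet> h))) (at x)"
    by (intro has_derivative_diff has_derivative_sum has_derivative_grad assms) auto
  from partial_eqI[OF this, of k]
  show "partial k (\<lambda>x. f x - (\<Sum>i<q. g i x)) x = partial k f x - (\<Sum>i<q. partial k (g i) x)"
    by (simp add: inner_axis grad_def)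
qed

lemma sum_conormal_eq:
  assumes "\<And>j. j < p \<Longrightarrow> \<rho> j differentiable (at x)"
  shows "(\<Sum>j<(p::nat). c j *\<^sub>R conormal (\<rho> j) x) = xform (\<Sum>j<p. c j *\<^sub>R grad (\<rho> j) x)"
  by (simp add: linear_sum[OF linear_xform] linear_cmul[OF linear_xform] conormal_eq_xform assms)

lemma xform_eq_0_iff [simp]: "xform v = 0 \<longleftrightarrow> v = 0"
  by (metis dual_vec_xform linear_0[OF linear_xform])

lemma defining_functions_alt:
  "defining_functions p M U \<rho> \<longleftrightarrow>
     open U \<and> (\<forall>j<p. smooth_on U (\<rho> j)) \<and> M \<inter> U = {x \<in> U. \<forall>j<p. \<rho> j x = 0} \<and>
     (\<forall>x\<in>M \<inter> U. \<forall>c. (\<Sum>j<p. c j *\<^sub>R grad (\<rho> j) x) = 0 \<longrightarrow> (\<forall>j<p. c j = 0))"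
proof -
  have "(\<Sum>j<p. c j *\<^sub>R conormal (\<rho> j) x) = 0 \<longleftrightarrow> (\<Sum>j<p. c j *\<^sub>R grad (\<rho> j) x) = 0"
    if "\<forall>j<p. smooth_on U (\<rho> j)" "x \<in> M \<inter> U" for c x
  proof -
    have "\<rho> j differentiable (at x)" if "j < p" for j
      using \<open>\<forall>j<p. smooth_on U (\<rho> j)\<close> \<open>x \<in> M \<inter> U\<close> that by (blast intro: smooth_on_differentiable)
    from sum_conormal_eq[of p \<rho> x c, OF this] show ?thesis by (simp only: xform_eq_0_iff)
  qed
  then show ?thesis unfolding defining_functions_def by (intro conj_cong refl) blast
qed

lemma dual_vec_conormal: "smooth_on U \<rho> \<Longrightarrow> x \<in> U \<Longrightarrow> dual_vec (conormal \<rho> x) = grad \<rho> x"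
  by (simp add: conormal_eq_xform smooth_on_differentiable)

lemma orthonormal_defining_alt:
  "orthonormal_defining p M U \<rho> \<longleftrightarrow> defining_functions p M U \<rho> \<and>
     (\<forall>x\<in>M \<inter> U. \<forall>i<p. \<forall>j<p. grad (\<rho> i) x \<bullet> grad (\<rho> j) x = (if i = j then 1 else 0))"
proof -
  have "dual_vec (conormal (\<rho> j) x) = grad (\<rho> j) x"
    if "defining_functions p M U \<rho>" "x \<in> M \<inter> U" "j < p" for x j
    using that unfolding defining_functions_def by (blast intro: dual_vec_conormal)
  then show ?thesis
    unfolding orthonormal_defining_def by (intro conj_cong refl ball_cong) simp
qed

subsection \<open>Gram--Schmidt orthonormalization of defining functions\<close>

text \<open>The coefficients \<open>c i\<close> are functions, but each multiplies a
  \<open>\<rho> i\<close> that vanishes on \<open>M\<close>. On \<open>M\<close> their derivatives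
  drop out and the gradients undergo ordinary Gram-Schmidt, so orthonormality is achieved at the
  points of \<open>M\<close>.\<close>

lemma gram_schmidt_step:
  assumes def: "defining_functions p M U \<rho>" and "q < p"
    and on: "\<And>x i j. x \<in> M \<inter> U \<Longrightarrow> i < q \<Longrightarrow> j < q \<Longrightarrow> grad (\<rho> i) x \<bullet> grad (\<rho> j) x = (if i = j then 1 else 0)"
  obtains U' \<rho>' where "M \<inter> U' = M \<inter> U" "defining_functions p M U' \<rho>'"
    "\<And>x i j. x \<in> M \<inter> U' \<Longrightarrow> i < Suc q \<Longrightarrow> j < Suc q \<Longrightarrow>
      grad (\<rho>' i) x \<bullet> grad (\<rho>' j) x = (if i = j then 1 else 0)"
proof -
  have U: "open U" and sm: "\<And>j. j < p \<Longrightarrow> smooth_on U (\<rho> j)"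
    and zero: "M \<inter> U = {x \<in> U. \<forall>j<p. \<rho> j x = 0}"
    and indep: "\<And>x c j. x \<in> M \<inter> U \<Longrightarrow> (\<Sum>j<p. c j *\<^sub>R grad (\<rho> j) x) = 0 \<Longrightarrow> j < p \<Longrightarrow> c j = 0"
    using def unfolding defining_functions_alt by blast+
  define c where "c i x = grad (\<rho> q) x \<bullet> grad (\<rho> i) x" for i x
  define w where "w x = \<rho> q x - (\<Sum>i<q. c i x * \<rho> i x)" for x
  define v where "v x = grad (\<rho> q) x - (\<Sum>i<q. c i x *\<^sub>R grad (\<rho> i) x)" for x
  \<comment> \<open>Independence of the gradients makes \<open>v\<close> nonzero on
    \<open>M\<close>, so shrinking to \<open>U'\<close> loses no point of \<open>M\<close>, while
    the normalizing factor \<open>s\<close> becomes smooth.\<close>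
  define U' where "U' = {x \<in> U. v x \<bullet> v x > 0}"
  define s where "s x = inverse (sqrt (v x \<bullet> v x))" for x
  define \<rho>' where "\<rho>' = \<rho>(q := (\<lambda>x. s x * w x))"
  have Ck: "Ck_on r U (\<rho> j)" "Ck_on r U (grad (\<rho> j))" if "j < p" for r j
    using sm[OF that] smooth_on_Ck_on smooth_on_grad by blast+
  have Ckc: "Ck_on r U (c i)" if "i < q" for r i
    unfolding c_def[abs_def] using that \<open>q < p\<close> by (intro Ck_on_inner U Ck) auto
  have Ckv: "Ck_on r U v" for r
    unfolding v_def[abs_def] using \<open>q < p\<close> by (intro Ck_on_diff Ck_on_sum Ck_on_scaleR U Ck Ckc) auto
  have Ckw: "Ck_on r U w" for r
    unfolding w_def[abs_def] using \<open>q < p\<close> by (intro Ck_on_diff Ck_on_sum Ck_on_mult U Ck Ckc) auto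
  have U': "open U'" unfolding U'_def
    using continuous_on_open_vimage[OF U, of "\<lambda>x. v x \<bullet> v x"] Ck_on_continuous[OF Ckv]
    by (auto intro!: continuous_open_preimage[OF _ U, of "\<lambda>x. v x \<bullet> v x" "{0<..}", unfolded vimage_def Int_def, simplified]
        continuous_intros)
  have sub: "U' \<subseteq> U" by (auto simp: U'_def)
  have Cks: "Ck_on r U' s" for r
    unfolding s_def[abs_def]
    by (intro Ck_on_inverse Ck_on_sqrt Ck_on_inner U' Ck_on_subset[OF Ckv sub]) (auto simp: U'_def)
  have vne: "v x \<noteq> 0" if "x \<in> M \<inter> U" for x
  proof
    assume "v x = 0"
    \<comment> \<open>\<open>v x\<close> is itself a combination of the gradients, with coefficient
      1 at \<open>q\<close>, and so cannot vanish.\<close>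
    define d where "d j = (if j = q then 1 else if j < q then - c j x else 0)" for j
    have "(\<Sum>j<p. d j *\<^sub>R grad (\<rho> j) x) = (\<Sum>j\<in>insert q {..<q}. d j *\<^sub>R grad (\<rho> j) x)"
      using \<open>q < p\<close> by (intro sum.mono_neutral_right) (auto simp: d_def)
    also have "\<dots> = v x"
      by (simp add: d_def v_def sum_negf)
    finally have "d q = 0" using indep[OF that _ \<open>q < p\<close>, of d] \<open>v x = 0\<close> by simp
    then show False by (simp add: d_def)
  qed
  have MU: "M \<inter> U' = M \<inter> U" using vne by (auto simp: U'_def)
  have gradq: "grad (\<rho>' q) x = s x *\<^sub>R v x" if "x \<in> M \<inter> U" for x
  proof -
    have x: "x \<in> U'" "x \<in> U" using that MU by auto
    have z: "\<rho> j x = 0" if "j < p" for j using \<open>x \<in> M \<inter> U\<close> zero that by auto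
    have d: "\<rho> j differentiable (at x)" if "j < p" for j using sm[OF that] x smooth_on_differentiable by blast
    have dc: "c i differentiable (at x)" if "i < q" for i using Ckc[OF that] x Ck_on_differentiable by blast
    \<comment> \<open>This removes the term with the gradient of \<open>s\<close> from the product
      rule.\<close>
    have "w x = 0" using z \<open>q < p\<close> by (simp add: w_def)
    then have "grad (\<rho>' q) x = s x *\<^sub>R grad w x"
      unfolding \<rho>'_def using x Ck_on_differentiable[OF Cks] Ck_on_differentiable[OF Ckw]
      by (simp add: grad_mult)
    also have "grad w x = grad (\<rho> q) x - (\<Sum>i<q. grad (\<lambda>x. c i x * \<rho> i x) x)"
      unfolding w_def[abs_def] using d dc \<open>q < p\<close> by (intro grad_diff_sum) auto
    also have "(\<Sum>i<q. grad (\<lambda>x. c i x * \<rho> i x) x) = (\<Sum>i<q. c i x *\<^sub>R grad (\<rho> i) x)"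
      using d dc z \<open>q < p\<close> by (intro sum.cong refl) (simp add: grad_mult)
    finally show ?thesis by (simp add: v_def)
  qed
  have spos: "s x > 0" if "x \<in> U'" for x using that by (simp add: s_def U'_def)
  show thesis
  proof (rule that[OF MU])
    show "defining_functions p M U' \<rho>'"
      unfolding defining_functions_alt
    proof (intro conjI U' allI impI ballI)
      fix j assume "j < p"
      show "smooth_on U' (\<rho>' j)"
        unfolding smooth_on_def \<rho>'_def
        using Ck_on_subset[OF Ckw sub] Ck_on_subset[OF Ck(1)[OF \<open>j < p\<close>] sub] Cks U'
        by (auto intro!: Ck_on_mult)
    next
      have "(\<forall>j<p. \<rho>' j x = 0) \<longleftrightarrow> (\<forall>j<p. \<rho> j x = 0)" if "x \<in> U'" for x
      proof -
        have "(\<forall>j<p. \<rho>' j x = 0) \<longleftrightarrow> (\<forall>j<p. j \<noteq> q \<longrightarrow> \<rho> j x = 0) \<and> w x = 0"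
          using spos[OF that] \<open>q < p\<close> by (auto simp: \<rho>'_def)
        also have "\<dots> \<longleftrightarrow> (\<forall>j<p. j \<noteq> q \<longrightarrow> \<rho> j x = 0) \<and> \<rho> q x = 0"
          using \<open>q < p\<close> by (intro conj_cong refl) (simp add: w_def)
        finally show ?thesis using \<open>q < p\<close> by auto
      qed
      then show "M \<inter> U' = {x \<in> U'. \<forall>j<p. \<rho>' j x = 0}"
        using zero MU sub by auto
    next
      fix x d j assume x: "x \<in> M \<inter> U'" and d: "(\<Sum>j<p. d j *\<^sub>R grad (\<rho>' j) x) = 0" and "j < p"
      have xU: "x \<in> M \<inter> U" using x MU by auto
      \<comment> \<open>The coefficients of the same vector in the old gradients. The system is
        triangular: \<open>e q = 0\<close> gives \<open>d q = 0\<close>, and then \<open>e\<close>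
        and \<open>d\<close> agree.\<close>
      define e where "e j = (if j = q then d q * s x else if j < q then d j - d q * s x * c j x else d j)" for j
      have split: "(\<Sum>j<p. a j) = a q + (\<Sum>j<q. a j) + (\<Sum>j\<in>{q<..<p}. a j)" for a :: "nat \<Rightarrow> real ^ 'a::_"
      proof -
        have "{..<p} = insert q ({..<q} \<union> {q<..<p})" using \<open>q < p\<close> by auto
        then show ?thesis by (simp add: sum.union_disjoint disjoint_iff)
      qed
      have "(\<Sum>j<p. e j *\<^sub>R grad (\<rho> j) x) = (\<Sum>j<p. d j *\<^sub>R grad (\<rho>' j) x)"
      proof -
        have 1: "(\<Sum>j<q. d j *\<^sub>R grad (\<rho>' j) x) = (\<Sum>j<q. d j *\<^sub>R grad (\<rho> j) x)"
          "(\<Sum>j\<in>{q<..<p}. d j *\<^sub>R grad (\<rho>' j) x) = (\<Sum>j\<in>{q<..<p}. e j *\<^sub>R grad (\<rho> j) x)"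
          by (intro sum.cong refl; simp add: \<rho>'_def e_def)+
        have 2: "(\<Sum>j<q. e j *\<^sub>R grad (\<rho> j) x) =
          (\<Sum>j<q. d j *\<^sub>R grad (\<rho> j) x) - d q *\<^sub>R s x *\<^sub>R (\<Sum>j<q. c j x *\<^sub>R grad (\<rho> j) x)"
          by (simp add: e_def scaleR_diff_left sum_subtractf scaleR_sum_right mult.assoc)
        have 3: "e q = d q * s x" by (simp add: e_def)
        show ?thesis unfolding split 1 2 3 gradq[OF xU] v_def
          by (simp add: scaleR_diff_right)
      qed
      then have e0: "e j = 0" if "j < p" for j using indep[OF xU _ that, of e] d by simp
      have "d q = 0" using e0[OF \<open>q < p\<close>] spos[of x] x by (simp add: e_def)
      then show "d j = 0" using e0[OF \<open>j < p\<close>] by (auto simp: e_def split: if_splits)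
    qed
  next
    fix x i j assume x: "x \<in> M \<inter> U'" and i: "i < Suc q" and j: "j < Suc q"
    have xU: "x \<in> M \<inter> U" using x MU by auto
    have vo: "v x \<bullet> grad (\<rho> i) x = 0" if "i < q" for i
    proof -
      have "v x \<bullet> grad (\<rho> i) x = c i x - (\<Sum>l<q. if l = i then c l x else 0)"
        unfolding v_def inner_diff_left inner_sum_left
        by (intro arg_cong2[of _ _ _ _ "(-)"] sum.cong) (auto simp: c_def on[OF xU] that)
      then show ?thesis using that by simp
    qed
    have vo2: "grad (\<rho> i) x \<bullet> v x = 0" if "i < q" for i
      using vo[OF that] by (simp only: inner_commute)
    have vv: "s x * (s x * (v x \<bullet> v x)) = 1"
      using x by (simp add: s_def U'_def mult.assoc[symmetric] flip: inverse_mult_distrib)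
    have other: "\<rho>' l = \<rho> l" if "l \<noteq> q" for l using that by (simp add: \<rho>'_def)
    show "grad (\<rho>' i) x \<bullet> grad (\<rho>' j) x = (if i = j then 1 else 0)"
    proof (cases "i = q"; cases "j = q")
      assume "i = q" "j = q"
      then show ?thesis using vv by (simp add: gradq[OF xU])
    next
      assume "i = q" "j \<noteq> q"
      then show ?thesis using vo j by (simp add: gradq[OF xU] other)
    next
      assume "i \<noteq> q" "j = q"
      then show ?thesis using vo2 i by (simp add: gradq[OF xU] other)
    next
      assume "i \<noteq> q" "j \<noteq> q"
      then show ?thesis using on[OF xU, of i j] i j by (simp add: other)
    qed
  qed
qed

lemma exists_orthonormal_defining:
  fixes M :: "(real ^ 'n::{finite,wellorder}) set"
  assumes M: "submanifold m M" and x: "x \<in> M"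
  obtains U \<rho> where "x \<in> U" "orthonormal_defining (CARD('n) - m) M U \<rho>"
proof -
  let ?p = "CARD('n) - m"
  have "\<exists>U \<rho>. x \<in> U \<and> defining_functions ?p M U \<rho> \<and>
      (\<forall>x\<in>M \<inter> U. \<forall>i<q. \<forall>j<q. grad (\<rho> i) x \<bullet> grad (\<rho> j) x = (if i = j then 1 else 0))"
    if "q \<le> ?p" for q
    using that
  proof (induction q)
    case 0
    then show ?case using M x by (auto simp: submanifold_def)
  next
    case (Suc q)
    then obtain U \<rho> where U: "x \<in> U" "defining_functions ?p M U \<rho>"
      "\<forall>x\<in>M \<inter> U. \<forall>i<q. \<forall>j<q. grad (\<rho> i) x \<bullet> grad (\<rho> j) x = (if i = j then 1 else 0)"
      by auto
    obtain U' \<rho>' where "M \<inter> U' = M \<inter> U" "defining_functions ?p M U' \<rho>'"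
      "\<And>x i j. x \<in> M \<inter> U' \<Longrightarrow> i < Suc q \<Longrightarrow> j < Suc q \<Longrightarrow>
        grad (\<rho>' i) x \<bullet> grad (\<rho>' j) x = (if i = j then 1 else 0)"
      by (rule gram_schmidt_step[OF U(2), of q]) (use U(3) Suc.prems in auto)
    then show ?case using U(1) x by blast
  qed
  from this[OF order_refl] show thesis using that unfolding orthonormal_defining_alt by blast
qed

subsection \<open>Orthonormal extension\<close>

text \<open>An orthonormal basis of the orthogonal complement completes the list; the dimension
  formula gives its length.\<close>

lemma orthonormal_list_extend:
  fixes ns :: "(real ^ 'n) list"
  assumes on: "orthonormal_list ns"
  obtains ts where "orthonormal_list (ns @ ts)" "length (ns @ ts) = CARD('n)"
    "span (set ts) = {v. \<forall>n\<in>set ns. n \<bullet> v = 0}"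
proof -
  let ?S = "{v. \<forall>n\<in>set ns. n \<bullet> v = 0}"
  have nrm: "norm n = 1" if "n \<in> set ns" for n
    using on that by (simp add: orthonormal_list_def norm_eq_sqrt_inner)
  have sub: "subspace ?S" by (auto simp: subspace_def inner_add_right)
  obtain B where B: "B \<subseteq> ?S" "pairwise orthogonal B" "\<And>x. x \<in> B \<Longrightarrow> norm x = 1"
    "independent B" "card B = dim ?S" "span B = ?S"
    using orthonormal_basis_subspace[OF sub] by blast
  have "finite B" using B(4) by (rule independent_imp_finite)
  then obtain ts where ts: "set ts = B" "distinct ts" using finite_distinct_list by blast
  have S: "?S = {y \<in> UNIV. \<forall>x\<in>span (set ns). orthogonal x y}"
  proof -
    have "orthogonal x y" if "y \<in> ?S" "x \<in> span (set ns)" for x y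
      using that(2) by (induction rule: span_induct_alt) (use that(1) in \<open>auto simp: orthogonal_def inner_add_left\<close>)
    then show ?thesis by (auto simp: orthogonal_def intro: span_base)
  qed
  have "dim ?S + dim (span (set ns)) = dim (UNIV :: (real ^ 'n) set)"
    unfolding S by (rule dim_subspace_orthogonal_to_vectors) auto
  moreover have "dim (span (set ns)) = length ns"
  proof -
    have "independent (set ns)"
    proof (rule pairwise_orthogonal_independent)
      show "pairwise orthogonal (set ns)"
        using on by (auto simp: pairwise_def orthogonal_def orthonormal_list_def)
      show "0 \<notin> set ns" using nrm by force
    qed
    then show ?thesis using on by (simp add: dim_span dim_eq_card_independent orthonormal_list_def distinct_card)
  qed
  ultimately have "length (ns @ ts) = CARD('n)"
    using B(5) ts distinct_card[OF ts(2)] by simp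
  moreover have "orthonormal_list (ns @ ts)"
  proof -
    have "a \<bullet> b = (if a = b then 1 else 0)" if "a \<in> B" "b \<in> B" for a b
    proof (cases "a = b")
      case True
      then show ?thesis using B(3)[OF that(1)] by (simp add: norm_eq_sqrt_inner)
    next
      case False
      then show ?thesis using B(2) that by (auto simp: pairwise_def orthogonal_def)
    qed
    moreover have "a \<bullet> b = 0" "b \<bullet> a = 0" if "a \<in> set ns" "b \<in> B" for a b
      using B(1) that by (auto simp: inner_commute)
    moreover have "set ns \<inter> B = {}"
    proof (rule ccontr)
      assume "set ns \<inter> B \<noteq> {}"
      then obtain a where "a \<in> set ns" "a \<in> B" by auto
      then have "a \<bullet> a = 0" using B(1) by blast
      then show False using nrm[OF \<open>a \<in> set ns\<close>] by simp
    qed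
    ultimately show ?thesis using on ts by (auto simp: orthonormal_list_def)
  qed
  ultimately show thesis using that[of ts] ts B(6) by simp
qed

lemma orthonormal_defining_list:
  assumes "orthonormal_defining p M U \<rho>" "x \<in> M" "x \<in> U"
  shows "orthonormal_list (map (\<lambda>j. grad (\<rho> j) x) [0..<p])"
proof -
  have ip: "grad (\<rho> i) x \<bullet> grad (\<rho> j) x = (if i = j then 1 else 0)" if "i < p" "j < p" for i j
    using assms that unfolding orthonormal_defining_alt by auto
  then have "inj_on (\<lambda>j. grad (\<rho> j) x) {0..<p}"
    by (intro inj_onI) (metis atLeastLessThan_iff zero_neq_one)
  then show ?thesis
    using ip by (auto simp: orthonormal_list_def distinct_map dest: inj_onD)
qed

subsection \<open>Local parametrizations\<close>

lemma Ck_on_det: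
  fixes A :: "real ^ 'n \<Rightarrow> real ^ 'k ^ 'k"
  assumes "open U" "\<And>i j. Ck_on r U (\<lambda>x. A x $ i $ j)"
  shows "Ck_on r U (\<lambda>x. det (A x))"
  unfolding det_def using assms by (intro Ck_on_sum Ck_on_mult Ck_on_prod Ck_on_const) auto

lemma Ck_on_matrix_inv:
  fixes A :: "real ^ 'n \<Rightarrow> real ^ 'k ^ 'k"
  assumes "open U" "\<And>i j. Ck_on r U (\<lambda>x. A x $ i $ j)" "\<And>x. x \<in> U \<Longrightarrow> det (A x) \<noteq> 0"
  shows "Ck_on r U (\<lambda>x. matrix_inv (A x) $ k $ l)"
proof (rule Ck_on_cong[OF assms(1)])
  show "Ck_on r U (\<lambda>x. det (\<chi> i j. if j = k then (if i = l then 1 else 0) else A x $ i $ j) / det (A x))"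
  proof (intro Ck_on_divide Ck_on_det assms)
    fix i j
    show "Ck_on r U (\<lambda>x. (\<chi> i j. if j = k then (if i = l then 1 else 0) else A x $ i $ j) $ i $ j)"
      using assms(2)[of i j] by (cases "j = k") (simp_all add: Ck_on_const)
  qed auto
qed (simp add: matrix_inv_cramer assms(3))

definition jac :: "(real ^ 'a \<Rightarrow> real ^ 'b) \<Rightarrow> real ^ 'a \<Rightarrow> real ^ 'a ^ 'b" where
  "jac f x = (\<chi> i j. partial j f x $ i)"

lemma jac_mult: "jac f x *v h = (\<Sum>k\<in>UNIV. h $ k *\<^sub>R partial k f x)"
  by (simp add: jac_def matrix_vector_mult_def vec_eq_iff mult.commute)

lemma has_derivative_jac: "f differentiable (at x) \<Longrightarrow> (f has_derivative (*v) (jac f x)) (at x)"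
  using has_derivative_partials[of f x] by (simp add: jac_mult[abs_def])

lemma frechet_derivative_jac:
  "f differentiable (at x) \<Longrightarrow> frechet_derivative f (at x) = (*v) (jac f x)"
  using frechet_derivative_at[OF has_derivative_jac] by metis

lemma column_jac: "column j (jac f x) = partial j f x"
  by (simp add: column_def jac_def)

lemma area_factor_eq: "f differentiable (at x) \<Longrightarrow> area_factor f x = area (jac f x)"
  by (simp add: area_factor_def frechet_derivative_jac area_def gram_def Let_def)

text \<open>The normalization of the Jacobian at \<open>x0\<close> lets the identity serve as the
  inverse of the derivative required by the inverse function theorem. The formula for
  \<open>jac g\<close> is what the regularity of charts is derived from.\<close>

lemma Ck_inverse_function:
  fixes f :: "real ^ 'n \<Rightarrow> real ^ 'n"
  assumes U: "open U" "x0 \<in> U" and f: "smooth_on U f" and D0: "jac f x0 = mat 1"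
  obtains U' V g where "open U'" "U' \<subseteq> U" "x0 \<in> U'" "open V" "f x0 \<in> V" "homeomorphism U' V f g"
    "\<And>y. y \<in> V \<Longrightarrow> g differentiable (at y)" "\<And>y. y \<in> V \<Longrightarrow> det (jac f (g y)) \<noteq> 0"
    "\<And>y. y \<in> V \<Longrightarrow> jac g y = matrix_inv (jac f (g y))"
proof -
  define f' where "f' x = Blinfun ((*v) (jac f x))" for x
  have f': "blinfun_apply (f' x) = (*v) (jac f x)" for x
    unfolding f'_def by (rule bounded_linear_Blinfun_apply) (rule matrix_vector_mul_bounded_linear)
  have d: "f differentiable (at x)" if "x \<in> U" for x
    using f that smooth_on_differentiable by blast
  have der: "(f has_derivative blinfun_apply (f' x)) (at x)" if "x \<in> U" for x
    unfolding f' using that by (intro has_derivative_jac d)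
  have "continuous_on U (partial k f)" for k
    using f Ck_on_continuous[OF Ck_on_partial] smooth_on_Ck_on by blast
  then have cont: "continuous_on U f'"
    by (intro continuous_on_blinfun_componentwise) (simp add: f' jac_mult continuous_on_sum continuous_on_scaleR continuous_on_const)
  have "id_blinfun o\<^sub>L f' x0 = id_blinfun"
    by (rule blinfun_eqI) (simp add: f' D0)
  from inverse_function_theorem[OF U(1) der cont U(2) this]
  obtain U' V g g' where g: "open U'" "U' \<subseteq> U" "x0 \<in> U'" "open V" "f x0 \<in> V" "homeomorphism U' V f g"
    "\<And>y. y \<in> V \<Longrightarrow> (g has_derivative (g' y)) (at y)"
    "\<And>y. y \<in> V \<Longrightarrow> g' y = inv (blinfun_apply (f' (g y)))"
    "\<And>y. y \<in> V \<Longrightarrow> bij (blinfun_apply (f' (g y)))" by blast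
  have dg: "g differentiable (at y)" if "y \<in> V" for y using g(7)[OF that] by (rule differentiableI)
  have nz: "det (jac f (g y)) \<noteq> 0" if "y \<in> V" for y
    using g(9)[OF that] det_nz_iff_inj[OF matrix_vector_mul_linear[of "jac f (g y)"]]
    unfolding f' by (simp add: bij_def)
  have "jac g y = matrix_inv (jac f (g y))" if "y \<in> V" for y
  proof -
    have "g' y = (*v) (jac g y)"
      using has_derivative_unique[OF g(7)[OF that] has_derivative_jac[OF dg[OF that]]] .
    then have *: "(*v) (jac g y) = inv ((*v) (jac f (g y)))" using g(8)[OF that] by (simp add: f')
    have "(jac g y ** jac f (g y)) *v h = mat 1 *v h" for h
      using g(9)[OF that] unfolding f'
      by (simp add: matrix_vector_mul_assoc[symmetric] fun_cong[OF *] bij_is_inj)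
    then have "jac g y ** jac f (g y) = mat 1" by (intro matrix_eq[THEN iffD2] allI)
    then show ?thesis using matrix_inv_eqI by metis
  qed
  with g dg nz show thesis using that by blast
qed

text \<open>Linear coordinates along the tangent space, together with the defining functions as
  normal coordinates, form a map that flattens \<open>M\<close>. Its local inverse, restricted to
  the tangent space, is the chart.\<close>

lemma exists_local_param:
  fixes M :: "(real ^ 'n::{finite,wellorder}) set"
  assumes def: "orthonormal_defining (CARD('n) - CARD('m::finite)) M U \<rho>"
    and x0: "x0 \<in> M" "x0 \<in> U" and le: "CARD('m) \<le> CARD('n)"
  obtains U' W and \<psi> :: "real ^ 'm \<Rightarrow> real ^ 'n::_" where "open U'" "U' \<subseteq> U" "x0 \<in> U'"
    "local_param M W \<psi>" "\<psi> ` W = M \<inter> U'"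
proof -
  let ?p = "CARD('n) - CARD('m)"
  define n where "n j = grad (\<rho> j) x0" for j
  define ns where "ns = map n [0..<?p]"
  have U: "open U" and sm: "\<And>j. j < ?p \<Longrightarrow> smooth_on U (\<rho> j)"
    and zero: "M \<inter> U = {x \<in> U. \<forall>j<?p. \<rho> j x = 0}"
    and nn: "\<And>i j. i < ?p \<Longrightarrow> j < ?p \<Longrightarrow> n i \<bullet> n j = (if i = j then 1 else 0)"
    using def x0 unfolding orthonormal_defining_alt defining_functions_alt n_def by auto
  have "orthonormal_list ns" unfolding ns_def n_def using def x0 by (rule orthonormal_defining_list)
  then obtain ts where on: "orthonormal_list (ns @ ts)" and len: "length (ns @ ts) = CARD('n)"
    by (rule orthonormal_list_extend)
  have disj: "distinct ts" "distinct ns" "set ns \<inter> set ts = {}" using on by (auto simp: orthonormal_list_def)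
  have "length ts = CARD('m)" using len le by (simp add: ns_def)
  then have "card (set ts) = CARD('m)" using disj distinct_card by metis
  then obtain e where e: "bij_betw e (UNIV :: 'm set) (set ts)"
    using finite_same_card_bij[of "UNIV :: 'm set" "set ts"] by auto
  have ee: "e i \<bullet> e j = (if i = j then 1 else 0)" for i j
  proof -
    have "e i \<in> set ts" "e j \<in> set ts" "e i = e j \<longleftrightarrow> i = j"
      using e by (auto simp: bij_betw_def inj_eq)
    then show ?thesis using on by (simp add: orthonormal_list_def)
  qed
  have tn: "t \<bullet> n j = 0" if "t \<in> set ts" "j < ?p" for t j
  proof -
    have "n j \<in> set ns" using that by (simp add: ns_def)
    moreover from this have "t \<noteq> n j" using disj(3) that by auto
    ultimately show ?thesis using on that by (simp add: orthonormal_list_def)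
  qed
  have en: "e i \<bullet> n j = 0" if "j < ?p" for i j
    using tn[of "e i" j] that bij_betwE[OF e] by blast
  \<comment> \<open>\<open>n j\<close> is the gradient of \<open>\<rho> j\<close> at
    \<open>x0\<close>, so the derivative of \<open>\<Phi>\<close> there is the expansion of a vector
    in an orthonormal basis, i.e. the identity.\<close>
  define \<Phi> where "\<Phi> x = (\<Sum>i\<in>UNIV. ((x - x0) \<bullet> e i) *\<^sub>R e i) + (\<Sum>j<?p. \<rho> j x *\<^sub>R n j)" for x
  have \<Phi>e: "\<Phi> x \<bullet> e i = (x - x0) \<bullet> e i" for x i
    by (simp add: \<Phi>_def inner_add_left inner_sum_left ee en inner_commute[of "n _"] if_distrib cong: if_cong)
  have \<Phi>n: "\<Phi> x \<bullet> n j = \<rho> j x" if "j < ?p" for x j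
  proof -
    have "\<Phi> x \<bullet> n j = (\<Sum>l<?p. if l = j then \<rho> l x else 0)"
      unfolding \<Phi>_def inner_add_left inner_sum_left
      using that by (simp add: en nn if_distrib cong: if_cong)
    then show ?thesis using that by simp
  qed
  have sm\<Phi>: "smooth_on U \<Phi>"
    unfolding smooth_on_def \<Phi>_def[abs_def] using sm
    by (auto intro!: Ck_on_add Ck_on_sum Ck_on_scaleR Ck_on_inner Ck_on_diff Ck_on_const Ck_on_ident U
        intro: smooth_on_Ck_on)
  have expand: "v = (\<Sum>i\<in>UNIV. (v \<bullet> e i) *\<^sub>R e i) + (\<Sum>j<?p. (v \<bullet> n j) *\<^sub>R n j)" for v
  proof -
    have "v = (\<Sum>b\<in>set (ns @ ts). (v \<bullet> b) *\<^sub>R b)"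
    proof (rule vec_eq_iff[THEN iffD2], rule allI)
      fix k
      have "(\<Sum>b\<in>set (ns @ ts). (v \<bullet> b) *\<^sub>R b) $ k = (\<Sum>b\<in>set (ns @ ts). \<Sum>l\<in>UNIV. v $ l * (b $ l * b $ k))"
        by (simp add: inner_vec_def sum_distrib_right mult.assoc)
      also have "\<dots> = (\<Sum>l\<in>UNIV. v $ l * (\<Sum>b\<in>set (ns @ ts). b $ l * b $ k))"
        by (subst sum.swap) (simp add: sum_distrib_left)
      also have "\<dots> = v $ k"
        unfolding orthonormal_list_complete[OF on len] by (simp add: if_distrib cong: if_cong)
      finally show "v $ k = (\<Sum>b\<in>set (ns @ ts). (v \<bullet> b) *\<^sub>R b) $ k" by simp
    qed
    also have "\<dots> = (\<Sum>b\<in>set ns. (v \<bullet> b) *\<^sub>R b) + (\<Sum>b\<in>set ts. (v \<bullet> b) *\<^sub>R b)"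
      using disj by (simp add: sum.union_disjoint)
    also have "(\<Sum>b\<in>set ts. (v \<bullet> b) *\<^sub>R b) = (\<Sum>i\<in>UNIV. (v \<bullet> e i) *\<^sub>R e i)"
      by (rule sum.reindex_bij_betw[OF e, symmetric])
    also have "(\<Sum>b\<in>set ns. (v \<bullet> b) *\<^sub>R b) = (\<Sum>j<?p. (v \<bullet> n j) *\<^sub>R n j)"
    proof -
      have "inj_on n {0..<?p}" using disj(2) by (simp add: ns_def distinct_map)
      then show ?thesis by (simp add: ns_def sum.reindex lessThan_atLeast0)
    qed
    finally show ?thesis by (simp add: add.commute)
  qed
  have "jac \<Phi> x0 = mat 1"
  proof -
    have "((\<lambda>x. (\<Sum>i\<in>UNIV. ((x - x0) \<bullet> e i) *\<^sub>R e i) + (\<Sum>j<?p. \<rho> j x *\<^sub>R n j)) has_derivative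
        (\<lambda>h. (\<Sum>i\<in>UNIV. (h \<bullet> e i) *\<^sub>R e i) + (\<Sum>j<?p. (grad (\<rho> j) x0 \<bullet> h) *\<^sub>R n j))) (at x0)"
      by (intro derivative_intros has_derivative_scaleR_left has_derivative_grad smooth_on_differentiable[OF sm] x0)
        (auto intro!: derivative_eq_intros)
    then have "(\<Phi> has_derivative (\<lambda>h. h)) (at x0)"
      using expand by (simp add: \<Phi>_def[abs_def] n_def inner_commute)
    from has_derivative_unique[OF this has_derivative_jac[OF smooth_on_differentiable[OF sm\<Phi> x0(2)]]]
    have "\<forall>h. jac \<Phi> x0 *v h = mat 1 *v h" by (simp add: fun_eq_iff)
    then show ?thesis by (rule matrix_eq[THEN iffD2])
  qed
  from Ck_inverse_function[OF U x0(2) sm\<Phi> this]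
  obtain U' V g where U': "open U'" "U' \<subseteq> U" "x0 \<in> U'" and V: "open V" "\<Phi> x0 \<in> V"
    and hom: "homeomorphism U' V \<Phi> g"
    and g: "\<And>y. y \<in> V \<Longrightarrow> g differentiable (at y)" "\<And>y. y \<in> V \<Longrightarrow> det (jac \<Phi> (g y)) \<noteq> 0"
    "\<And>y. y \<in> V \<Longrightarrow> jac g y = matrix_inv (jac \<Phi> (g y))" by blast
  define L :: "real ^ 'm \<Rightarrow> real ^ 'n::_" where "L u = (\<Sum>i\<in>UNIV. u $ i *\<^sub>R e i)" for u
  have Le: "L u \<bullet> e i = u $ i" for u i
    by (simp add: L_def inner_sum_left ee if_distrib cong: if_cong)
  have L: "linear L"
    by (auto intro!: linearI simp: L_def scaleR_add_left sum.distrib scaleR_sum_right)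
  then have contL: "continuous_on A L" for A by (simp add: linear_continuous_on linear_conv_bounded_linear)
  define W where "W = L -` V"
  have W: "open W" unfolding W_def by (intro open_vimage V contL)
  define \<psi> where "\<psi> u = g (L u)" for u
  have inU: "\<psi> u \<in> U'" "\<Phi> (\<psi> u) = L u" if "u \<in> W" for u
    using hom that unfolding homeomorphism_def \<psi>_def W_def by auto
  have dL: "L differentiable (at u)" for u using L by (simp add: linear_imp_differentiable)
  have d\<psi>: "\<psi> differentiable (at u)" if "u \<in> W" for u
    unfolding \<psi>_def[abs_def] using that g(1) dL differentiable_chain_at[of L u g] by (auto simp: W_def o_def)
  have partial\<psi>: "partial k \<psi> u = matrix_inv (jac \<Phi> (\<psi> u)) *v e k" if "u \<in> W" for k u
  proof -
    have "partial k L u = e k"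
      using partial_eqI[OF linear_imp_has_derivative[OF L], of k u]
      by (simp add: L_def sum_axis_scaleR)
    moreover have "partial k \<psi> u = (\<Sum>j\<in>UNIV. partial k L u $ j *\<^sub>R partial j g (L u))"
      unfolding \<psi>_def[abs_def] using that by (intro partial_compose g dL) (simp add: W_def)
    ultimately have "partial k \<psi> u = jac g (L u) *v e k" by (simp add: jac_mult)
    then show ?thesis using g(3)[of "L u"] that by (simp add: \<psi>_def W_def)
  qed
  \<comment> \<open>Bootstrapping: the partials of \<open>\<psi>\<close> are entries of the inverse
    Jacobian of the smooth \<open>\<Phi>\<close> taken at \<open>\<psi>\<close>, so each class of
    \<open>\<psi>\<close> yields the next.\<close>
  have "Ck_on r W \<psi>" for r
  proof (induction r)
    case 0
    have "continuous_on W \<psi>"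
      using d\<psi> by (intro continuous_at_imp_continuous_on) (auto intro: differentiable_imp_continuous_within)
    then show ?case by simp
  next
    case (Suc r)
    have entries: "Ck_on r W (\<lambda>u. jac \<Phi> (\<psi> u) $ i $ j)" for i j
    proof -
      have "Ck_on r W (\<lambda>u. partial j \<Phi> (\<psi> u))"
        using inU U'(2) smooth_on_Ck_on[OF sm\<Phi>, of "Suc r"]
        by (intro Ck_on_compose[OF W Suc, of U]) auto
      then show ?thesis by (simp add: jac_def Ck_on_nth W)
    qed
    have "Ck_on r W (\<lambda>u. matrix_inv (jac \<Phi> (\<psi> u)) *v e k)" for k
    proof (intro Ck_on_vecI W)
      fix i
      have nz: "det (jac \<Phi> (\<psi> u)) \<noteq> 0" if "u \<in> W" for u
        using g(2)[of "L u"] that by (simp add: \<psi>_def W_def)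
      have "Ck_on r W (\<lambda>u. \<Sum>l\<in>UNIV. matrix_inv (jac \<Phi> (\<psi> u)) $ i $ l * e k $ l)"
        by (intro Ck_on_sum Ck_on_mult Ck_on_const W Ck_on_matrix_inv entries nz)
      then show "Ck_on r W (\<lambda>u. (matrix_inv (jac \<Phi> (\<psi> u)) *v e k) $ i)"
        by (simp add: matrix_vector_mult_def)
    qed
    then have "Ck_on r W (partial k \<psi>)" for k
      by (rule Ck_on_cong[OF W, rotated]) (simp add: partial\<psi>)
    then show ?case using d\<psi> by simp
  qed
  then have sm\<psi>: "smooth_on W \<psi>" using W by (simp add: smooth_on_def)
  have img: "\<psi> ` W = M \<inter> U'"
  proof
    have "\<rho> j (\<psi> u) = 0" if "u \<in> W" "j < ?p" for u j
      using \<Phi>n[OF that(2), of "\<psi> u"] inU[OF that(1)] that by (simp add: L_def inner_sum_left en)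
    then show "\<psi> ` W \<subseteq> M \<inter> U'" using inU U' zero by blast
    show "M \<inter> U' \<subseteq> \<psi> ` W"
    proof
      fix y assume y: "y \<in> M \<inter> U'"
      then have "\<forall>j<?p. \<rho> j y = 0" using zero U' by blast
      then have "\<Phi> y = L (\<chi> i. \<Phi> y \<bullet> e i)"
        using expand[of "\<Phi> y"] \<Phi>n by (simp add: L_def)
      moreover have "\<Phi> y \<in> V" "g (\<Phi> y) = y" using hom y unfolding homeomorphism_def by auto
      ultimately have "\<psi> (\<chi> i. \<Phi> y \<bullet> e i) = y" "(\<chi> i. \<Phi> y \<bullet> e i) \<in> W"
        by (simp_all add: \<psi>_def W_def)
      then show "y \<in> \<psi> ` W" by (metis imageI)
    qed
  qed
  have "inj (frechet_derivative \<psi> (at u))" if "u \<in> W" for u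
  proof -
    have "jac \<psi> u *v h = matrix_inv (jac \<Phi> (\<psi> u)) *v L h" for h
      using that by (simp add: jac_mult partial\<psi> L_def linear_cmul[OF matrix_vector_mul_linear]
          linear_sum[OF matrix_vector_mul_linear])
    then have "jac \<Phi> (\<psi> u) *v (jac \<psi> u *v h) = L h" for h
      using g(2)[of "L u"] that by (simp add: matrix_vector_mul_assoc matrix_inv_mult \<psi>_def W_def)
    then have "h = (\<chi> i. (jac \<Phi> (\<psi> u) *v (jac \<psi> u *v h)) \<bullet> e i)" for h
      by (simp add: Le)
    then show ?thesis unfolding frechet_derivative_jac[OF d\<psi>[OF that]] by (metis injI)
  qed
  moreover have "openin (top_of_set M) (\<psi> ` W)"
    unfolding img using U'(1) by (rule openin_open_Int)
  moreover have "homeomorphism W (\<psi> ` W) \<psi> (\<lambda>y. \<chi> i. \<Phi> y \<bullet> e i)"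
  proof -
    have "continuous_on U' \<Phi>" using hom by (simp add: homeomorphism_def)
    then have "continuous_on (\<psi> ` W) (\<lambda>y. \<chi> i. \<Phi> y \<bullet> e i)"
      unfolding img by (intro continuous_intros) (auto intro: continuous_on_subset)
    moreover have "continuous_on W \<psi>" using smooth_on_Ck_on[OF sm\<psi>, of 0] by simp
    ultimately show ?thesis
      using inU by (auto simp: homeomorphism_def Le image_image)
  qed
  ultimately have "local_param M W \<psi>" unfolding local_param_def using sm\<psi> by blast
  then show thesis using that U' img by blast
qed

section \<open>Surface measure\<close>

text \<open>An open set is a countable union of compact sets, so relatively closed sets have Borel
  images. Injectivity makes the images commute with complements, and the claim spreads to the
  generated sigma-algebra.\<close>

lemma borel_injective_continuous_image:
  fixes \<phi> :: "'a::euclidean_space \<Rightarrow> 'b::euclidean_space"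
  assumes W: "open W" and cont: "continuous_on W \<phi>" and inj: "inj_on \<phi> W"
    and A: "A \<in> sets borel" "A \<subseteq> W"
  shows "\<phi> ` A \<in> sets borel"
proof -
  obtain C :: "nat \<Rightarrow> 'a set" where C: "\<And>n. compact (C n)" "\<And>n. C n \<subseteq> W" "\<Union>(range C) = W"
    using open_Union_compact_subsets[OF W] by metis
  have closed: "\<phi> ` (B \<inter> W) \<in> sets borel" if "closed B" for B
  proof -
    have "\<phi> ` (B \<inter> W) = (\<Union>n. \<phi> ` (B \<inter> C n))" using C(3) by auto
    moreover have "\<phi> ` (B \<inter> C n) \<in> sets borel" for n
      using C(1,2) that
      by (intro borel_compact compact_continuous_image continuous_on_subset[OF cont] closed_Int_compact) auto
    ultimately show ?thesis by auto
  qed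
  have "A \<in> sigma_sets UNIV (Collect closed)"
    using A(1) unfolding borel_eq_closed by (simp add: sets_measure_of)
  then have "\<phi> ` (A \<inter> W) \<in> sets borel"
  proof induction
    case (Compl B)
    have "\<phi> ` ((UNIV - B) \<inter> W) = \<phi> ` (UNIV \<inter> W) - \<phi> ` (B \<inter> W)"
      using inj by (auto simp: inj_on_def)
    then show ?case using Compl closed[of UNIV] by auto
  next
    case (Union B)
    have "\<phi> ` ((\<Union>i. B i) \<inter> W) = (\<Union>i. \<phi> ` (B i \<inter> W))" by auto
    then show ?case using Union by auto
  qed (auto intro: closed)
  then show ?thesis using A(2) by (simp add: Int_absorb2)
qed

text \<open>C^1 is the regularity available for charts carried along the flow; a continuous inverse
  is not asked for.\<close>

definition immersion :: "(real ^ 'm) set \<Rightarrow> (real ^ 'm \<Rightarrow> real ^ 'n) \<Rightarrow> bool" where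
  "immersion W \<phi> \<longleftrightarrow> open W \<and> Ck_on 1 W \<phi> \<and> inj_on \<phi> W \<and> (\<forall>u\<in>W. \<forall>v. jac \<phi> u *v v = 0 \<longrightarrow> v = 0)"

lemma Ck_on_1: "Ck_on 1 W \<phi> \<longleftrightarrow> (\<forall>x\<in>W. \<phi> differentiable (at x)) \<and> (\<forall>k. continuous_on W (partial k \<phi>))"
  by (simp add: One_nat_def)

lemma immersion_differentiable: "immersion W \<phi> \<Longrightarrow> u \<in> W \<Longrightarrow> \<phi> differentiable (at u)"
  by (simp add: immersion_def Ck_on_1)

lemma immersion_has_derivative: "immersion W \<phi> \<Longrightarrow> u \<in> W \<Longrightarrow> (\<phi> has_derivative (*v) (jac \<phi> u)) (at u)"
  by (intro has_derivative_jac immersion_differentiable)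

lemma immersion_continuous_on: "immersion W \<phi> \<Longrightarrow> continuous_on W \<phi>"
  by (intro continuous_at_imp_continuous_on)
    (auto intro: differentiable_imp_continuous_within immersion_differentiable)

lemma local_param_immersion:
  assumes "local_param M V \<kappa>"
  shows "immersion V \<kappa>"
proof -
  have sm: "smooth_on V \<kappa>" and inj: "\<And>u. u \<in> V \<Longrightarrow> inj (frechet_derivative \<kappa> (at u))"
    using assms by (auto simp: local_param_def)
  obtain \<theta> where "homeomorphism V (\<kappa> ` V) \<kappa> \<theta>" using assms by (auto simp: local_param_def)
  then have "inj_on \<kappa> V" unfolding homeomorphism_def by (metis inj_onI)
  moreover have "v = 0" if "u \<in> V" "jac \<kappa> u *v v = 0" for u v
    using inj[OF that(1)] that injD[of "(*v) (jac \<kappa> u)" v 0]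
    by (simp add: frechet_derivative_jac smooth_on_differentiable[OF sm])
  ultimately show ?thesis
    using sm smooth_on_Ck_on[OF sm] unfolding immersion_def smooth_on_def by blast
qed

lemma continuous_on_det:
  fixes A :: "'a::topological_space \<Rightarrow> real ^ 'k ^ 'k"
  assumes "\<And>i j. continuous_on S (\<lambda>x. A x $ i $ j)"
  shows "continuous_on S (\<lambda>x. det (A x))"
  unfolding det_def by (intro continuous_on_sum continuous_on_mult continuous_on_prod continuous_on_const assms)

lemma continuous_on_area:
  fixes A :: "'a::topological_space \<Rightarrow> real ^ 'm ^ 'n"
  assumes "\<And>i j. continuous_on S (\<lambda>x. A x $ i $ j)"
  shows "continuous_on S (\<lambda>x. area (A x))"
proof -
  have "continuous_on S (\<lambda>x. gram (A x) $ i $ j)" for i j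
    by (simp add: gram_def matrix_matrix_mult_def transpose_def)
      (intro continuous_on_sum continuous_on_mult assms)
  then show ?thesis unfolding area_def by (intro continuous_on_real_sqrt continuous_on_det)
qed

lemma immersion_area_continuous: "immersion W \<phi> \<Longrightarrow> continuous_on W (\<lambda>u. area (jac \<phi> u))"
  by (intro continuous_on_area)
    (auto simp: jac_def immersion_def Ck_on_1 intro: continuous_on_component)

lemma immersion_area_pos: "immersion W \<phi> \<Longrightarrow> u \<in> W \<Longrightarrow> area (jac \<phi> u) > 0"
  by (intro area_pos) (auto simp: immersion_def)

lemma immersion_subset: "immersion W \<phi> \<Longrightarrow> open W' \<Longrightarrow> W' \<subseteq> W \<Longrightarrow> immersion W' \<phi>"
  unfolding immersion_def by (blast intro: inj_on_subset Ck_on_subset)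

definition nn_area :: "(real ^ 'm \<Rightarrow> real ^ 'n) \<Rightarrow> (real ^ 'm) set \<Rightarrow> ennreal" where
  "nn_area \<phi> A = (\<integral>\<^sup>+u\<in>A. ennreal (area (jac \<phi> u)) \<partial>lborel)"

subsection \<open>Change of variables\<close>

text \<open>A bridge: the change of variables theorem speaks of absolute integrability for
  \<open>lebesgue\<close>, the surface measure of nonnegative integrals for
  \<open>lborel\<close>.\<close>

lemma absolutely_integrable_iff_nn_integral:
  fixes h :: "'a::euclidean_space \<Rightarrow> real"
  assumes S: "S \<in> sets borel" and h: "(\<lambda>x. indicator S x * h x) \<in> borel_measurable borel"
    and pos: "\<And>x. x \<in> S \<Longrightarrow> h x \<ge> 0"
  shows "h absolutely_integrable_on S \<longleftrightarrow> (\<integral>\<^sup>+x\<in>S. ennreal (h x) \<partial>lborel) < \<infinity>"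
    and "h absolutely_integrable_on S \<Longrightarrow> (\<integral>\<^sup>+x\<in>S. ennreal (h x) \<partial>lborel) = ennreal (integral S h)"
proof -
  have eq: "(\<integral>\<^sup>+x\<in>S. ennreal (h x) \<partial>lborel) = (\<integral>\<^sup>+x. ennreal (indicator S x * h x) \<partial>lborel)"
    by (intro nn_integral_cong) (auto simp: indicator_def)
  have nn: "indicator S x * h x \<ge> 0" for x using pos by (auto simp: indicator_def)
  have iff: "h absolutely_integrable_on S \<longleftrightarrow> integrable lborel (\<lambda>x. indicator S x * h x)"
    unfolding set_integrable_def using h by (simp add: integrable_completion)
  show "h absolutely_integrable_on S \<longleftrightarrow> (\<integral>\<^sup>+x\<in>S. ennreal (h x) \<partial>lborel) < \<infinity>"
    unfolding iff eq integrable_iff_bounded using h nn by simp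
  show "(\<integral>\<^sup>+x\<in>S. ennreal (h x) \<partial>lborel) = ennreal (integral S h)" if "h absolutely_integrable_on S"
  proof -
    have "(\<integral>\<^sup>+x\<in>S. ennreal (h x) \<partial>lborel) = ennreal (\<integral>x. indicator S x * h x \<partial>lborel)"
      unfolding eq using that nn by (intro nn_integral_eq_integral) (simp_all add: iff)
    also have "(\<integral>x. indicator S x * h x \<partial>lborel) = (\<integral>x. indicator S x * h x \<partial>lebesgue)"
      using h by (simp add: integral_completion)
    also have "\<dots> = integral S h"
      using set_lebesgue_integral_eq_integral(2)[OF that] by (simp add: set_lebesgue_integral_def)
    finally show ?thesis .
  qed
qed

text \<open>Values are wrapped into \<open>real ^ 1\<close> to match the vector-valued theorem.
  Since it gives an equivalence of integrability, in the remaining case both integrals are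
  infinite.\<close>

lemma nn_integral_change_of_variables:
  fixes h :: "real ^ 'm::{finite,wellorder} \<Rightarrow> real" and g :: "real ^ 'm::_ \<Rightarrow> real ^ 'm::_"
  assumes S: "S \<in> sets borel" and gS: "g ` S \<in> sets borel"
    and der: "\<And>x. x \<in> S \<Longrightarrow> (g has_derivative (*v) (T x)) (at x within S)" and inj: "inj_on g S"
    and h: "(\<lambda>y. indicator (g ` S) y * h y) \<in> borel_measurable borel"
    and hg: "(\<lambda>x. indicator S x * (\<bar>det (T x)\<bar> * h (g x))) \<in> borel_measurable borel"
    and pos: "\<And>y. y \<in> g ` S \<Longrightarrow> h y \<ge> 0"
  shows "(\<integral>\<^sup>+x\<in>S. ennreal (\<bar>det (T x)\<bar> * h (g x)) \<partial>lborel) = (\<integral>\<^sup>+y\<in>g ` S. ennreal (h y) \<partial>lborel)"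
proof -
  have lebS: "S \<in> sets lebesgue" using S by auto
  let ?k = "\<lambda>x. \<bar>det (T x)\<bar> * h (g x)"
  have cov: "?k absolutely_integrable_on S \<and> integral S ?k = b \<longleftrightarrow>
      h absolutely_integrable_on (g ` S) \<and> integral (g ` S) h = b" for b
  proof -
    have v: "(\<lambda>x. \<bar>det (matrix ((*v) (T x)))\<bar> *\<^sub>R (vec (h (g x)) :: real ^ 1)) = (\<lambda>x. vec (?k x))"
      by (simp add: fun_eq_iff vec_eq_iff)
    have ai: "(\<lambda>x. vec (k x) :: real ^ 1) absolutely_integrable_on A \<longleftrightarrow> k absolutely_integrable_on A" for k :: "real ^ 'm::_ \<Rightarrow> real" and A
      by (simp add: absolutely_integrable_on_1_iff)
    have int: "integral A (\<lambda>x. vec (k x) :: real ^ 1) = vec b \<longleftrightarrow> integral A k = b"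
      for k :: "real ^ 'm::_ \<Rightarrow> real" and A b
      by (simp add: integral_on_1_eq vec_eq_iff)
    show ?thesis
      using has_absolute_integral_change_of_variables[OF lebS der inj, of "\<lambda>y. vec (h y) :: real ^ 1" "vec b"]
      unfolding v ai int by simp
  qed
  have posS: "?k x \<ge> 0" if "x \<in> S" for x using pos that by auto
  note 1 = absolutely_integrable_iff_nn_integral[OF S hg posS]
  note 2 = absolutely_integrable_iff_nn_integral[OF gS h pos]
  show ?thesis
  proof (cases "?k absolutely_integrable_on S")
    case True
    then have "h absolutely_integrable_on (g ` S)" "integral (g ` S) h = integral S ?k"
      using cov[of "integral S ?k"] by auto
    then show ?thesis using 1(2)[OF _ True] 2(2) by simp
  next
    case False
    then have "\<not> h absolutely_integrable_on (g ` S)"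
      using cov[of "integral (g ` S) h"] by auto
    then have "\<not> (\<integral>\<^sup>+x\<in>S. ennreal (?k x) \<partial>lborel) < top" "\<not> (\<integral>\<^sup>+y\<in>g ` S. ennreal (h y) \<partial>lborel) < top"
      using False 1(1) 2(1) by simp_all
    then have "(\<integral>\<^sup>+x\<in>S. ennreal (?k x) \<partial>lborel) = top" "(\<integral>\<^sup>+y\<in>g ` S. ennreal (h y) \<partial>lborel) = top"
      using top.not_eq_extremum by blast+
    then show ?thesis by simp
  qed
qed

text \<open>
  \<open>w = \<tau> v - \<tau> u\<close> is recovered from \<open>\<phi> v - \<phi> u = \<kappa> (\<tau> v) - \<kappa> (\<tau> u)\<close> by a left inverse of the
  derivative of \<open>\<kappa>\<close>, up to an error \<open>o(w)\<close>.
\<close>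

lemma has_derivative_transition:
  fixes \<kappa> :: "'a::euclidean_space \<Rightarrow> 'b::euclidean_space" and \<phi> :: "'c::euclidean_space \<Rightarrow> 'b"
  assumes \<kappa>: "(\<kappa> has_derivative B) (at (\<tau> u))" and \<phi>: "(\<phi> has_derivative D) (at u)"
    and L: "bounded_linear L" "\<And>v. L (B v) = v"
    and W: "open W" "u \<in> W" and \<tau>: "continuous (at u) \<tau>" "\<And>v. v \<in> W \<Longrightarrow> \<kappa> (\<tau> v) = \<phi> v"
  shows "(\<tau> has_derivative (\<lambda>h. L (D h))) (at u)"
  unfolding has_derivative_within_alt
proof (intro conjI allI impI)
  show "bounded_linear (\<lambda>h. L (D h))"
    using bounded_linear_compose[OF L(1) has_derivative_bounded_linear[OF \<phi>]] .
  fix e :: real assume e: "e > 0"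
  obtain K where K: "K > 0" "\<And>w. norm (L w) \<le> norm w * K"
    using bounded_linear.pos_bounded[OF L(1)] by blast
  obtain C where C: "C > 0" "\<And>w. norm (D w) \<le> norm w * C"
    using bounded_linear.pos_bounded[OF has_derivative_bounded_linear[OF \<phi>]] by blast
  \<comment> \<open>The first bound absorbs half of \<open>norm w\<close> into the left-hand side;
    the second leaves an error of at most \<open>e / 2\<close>.\<close>
  define \<epsilon> where "\<epsilon> = min (1 / (2 * K)) (e / (4 * K * K * (C + 1)))"
  have \<epsilon>: "\<epsilon> > 0" "K * \<epsilon> \<le> 1 / 2" "K * \<epsilon> * (2 * K * (C + 1)) \<le> e / 2"
  proof -
    show "\<epsilon> > 0" using K C e by (simp add: \<epsilon>_def)
    have "K * \<epsilon> \<le> K * (1 / (2 * K))" unfolding \<epsilon>_def using K by (intro mult_left_mono) auto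
    then show "K * \<epsilon> \<le> 1 / 2" using K by simp
    have "K * \<epsilon> * (2 * K * (C + 1)) \<le> K * (e / (4 * K * K * (C + 1))) * (2 * K * (C + 1))"
      unfolding \<epsilon>_def using K C by (intro mult_right_mono mult_left_mono) auto
    also have "\<dots> = e / 2"
    proof -
      have "K * (e / (4 * K * K * c)) * (2 * K * c) = e / 2" if "c > 0" for c
        using K that by (simp add: field_simps)
      from this[of "C + 1"] show ?thesis using C by simp
    qed
    finally show "K * \<epsilon> * (2 * K * (C + 1)) \<le> e / 2" .
  qed
  obtain d1 where d1: "d1 > 0" "\<And>y. norm (y - \<tau> u) < d1 \<Longrightarrow>
      norm (\<kappa> y - \<kappa> (\<tau> u) - B (y - \<tau> u)) \<le> \<epsilon> * norm (y - \<tau> u)"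
    using \<kappa> \<epsilon>(1) unfolding has_derivative_within_alt by blast
  obtain d2 where d2: "d2 > 0" "\<And>v. dist v u < d2 \<Longrightarrow> dist (\<tau> v) (\<tau> u) < d1"
    using \<tau>(1) d1(1) unfolding continuous_at_eps_delta by blast
  define \<eta> where "\<eta> = min 1 (e / (2 * K))"
  have \<eta>: "\<eta> > 0" "\<eta> \<le> 1" "K * \<eta> \<le> e / 2"
  proof -
    have "K * \<eta> \<le> K * (e / (2 * K))" unfolding \<eta>_def using K by (intro mult_left_mono) auto
    then show "K * \<eta> \<le> e / 2" using K by simp
  qed (use K e in \<open>auto simp: \<eta>_def\<close>)
  obtain d3 where d3: "d3 > 0" "\<And>v. norm (v - u) < d3 \<Longrightarrow>
      norm (\<phi> v - \<phi> u - D (v - u)) \<le> \<eta> * norm (v - u)"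
    using \<phi> \<eta>(1) unfolding has_derivative_within_alt by blast
  obtain d4 where d4: "d4 > 0" "ball u d4 \<subseteq> W" using W open_contains_ball by blast
  show "\<exists>d>0. \<forall>v\<in>UNIV. norm (v - u) < d \<longrightarrow> norm (\<tau> v - \<tau> u - L (D (v - u))) \<le> e * norm (v - u)"
  proof (intro exI[of _ "min d2 (min d3 d4)"] conjI ballI impI)
    fix v assume v: "norm (v - u) < min d2 (min d3 d4)"
    define w where "w = \<tau> v - \<tau> u"
    define x where "x = norm (v - u)"
    have "v \<in> W" using v d4 by (auto simp: dist_norm norm_minus_commute subset_iff)
    then have eq: "\<kappa> (\<tau> v) - \<kappa> (\<tau> u) = \<phi> v - \<phi> u" using \<tau>(2) W(2) by simp
    have r1: "norm (\<phi> v - \<phi> u - B w) \<le> \<epsilon> * norm w"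
      using d1(2)[of "\<tau> v"] d2(2)[of v] v eq by (simp add: w_def dist_norm)
    have r3: "norm (\<phi> v - \<phi> u - D (v - u)) \<le> \<eta> * x" using d3(2) v by (simp add: x_def)
    interpret L: bounded_linear L by fact
    have 1: "norm (L (\<phi> v - \<phi> u) - w) \<le> K * \<epsilon> * norm w"
    proof -
      have "L (\<phi> v - \<phi> u) - w = L (\<phi> v - \<phi> u - B w)" by (simp add: L.diff L(2))
      then have "norm (L (\<phi> v - \<phi> u) - w) \<le> norm (\<phi> v - \<phi> u - B w) * K" using K(2) by simp
      also have "\<dots> \<le> \<epsilon> * norm w * K" using r1 K(1) by (intro mult_right_mono) auto
      finally show ?thesis by (simp add: mult_ac)
    qed
    have "norm (\<phi> v - \<phi> u) \<le> norm (D (v - u)) + \<eta> * x"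
      using r3 norm_triangle_sub[of "\<phi> v - \<phi> u" "D (v - u)"] by linarith
    also have "\<dots> \<le> x * C + 1 * x"
      using C(2)[of "v - u"] \<eta>(2) mult_right_mono[OF \<eta>(2), of x] by (simp add: x_def)
    finally have "norm (\<phi> v - \<phi> u) * K \<le> (x * C + 1 * x) * K"
      using K(1) by (intro mult_right_mono) auto
    then have 2: "norm (L (\<phi> v - \<phi> u)) \<le> K * (C + 1) * x"
      using K(2)[of "\<phi> v - \<phi> u"] by (simp add: algebra_simps)
    have "norm w \<le> norm (L (\<phi> v - \<phi> u)) + norm (L (\<phi> v - \<phi> u) - w)"
      using norm_triangle_sub[of w "L (\<phi> v - \<phi> u)"] by (simp add: norm_minus_commute)
    also have "\<dots> \<le> K * (C + 1) * x + 1 / 2 * norm w"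
      using 1 2 mult_right_mono[OF \<epsilon>(2) norm_ge_zero[of w]] by linarith
    \<comment> \<open>A Lipschitz bound for \<open>\<tau>\<close> at \<open>u\<close>, after
      absorbing the half. It turns an error relative to \<open>norm w\<close> into one relative to
      \<open>x\<close>.\<close>
    finally have 3: "norm w \<le> 2 * K * (C + 1) * x" by simp
    have "norm (L (\<phi> v - \<phi> u) - L (D (v - u))) \<le> norm (\<phi> v - \<phi> u - D (v - u)) * K"
      using K(2) by (simp add: L.diff[symmetric])
    also have "\<dots> \<le> \<eta> * x * K" using r3 K(1) by (intro mult_right_mono) auto
    also have "\<dots> \<le> e / 2 * x" using mult_right_mono[OF \<eta>(3), of x] by (simp add: x_def mult_ac)
    finally have 4: "norm (L (\<phi> v - \<phi> u) - L (D (v - u))) \<le> e / 2 * x" .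
    have "K * \<epsilon> * norm w \<le> K * \<epsilon> * (2 * K * (C + 1) * x)"
      using 3 K(1) \<epsilon>(1) by (intro mult_left_mono) auto
    also have "\<dots> \<le> e / 2 * x" using mult_right_mono[OF \<epsilon>(3), of x] by (simp add: x_def mult_ac)
    finally have "norm (L (\<phi> v - \<phi> u) - w) \<le> e / 2 * x" using 1 by linarith
    then have "norm (w - L (D (v - u))) \<le> e / 2 * x + e / 2 * x"
      using 4 norm_triangle_ineq[of "w - L (\<phi> v - \<phi> u)" "L (\<phi> v - \<phi> u) - L (D (v - u))"]
      by (simp add: norm_minus_commute)
    then show "norm (\<tau> v - \<tau> u - L (D (v - u))) \<le> e * norm (v - u)" by (simp add: w_def x_def)
  qed (use d2 d3 d4 in auto)
qed

lemma set_measurable_area: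
  assumes "immersion W \<phi>" "A \<in> sets borel" "A \<subseteq> W"
  shows "(\<lambda>u. indicator A u * area (jac \<phi> u)) \<in> borel_measurable borel"
proof -
  have "continuous_on A (\<lambda>u. area (jac \<phi> u))"
    using immersion_area_continuous[OF assms(1)] assms(3) by (rule continuous_on_subset)
  from borel_measurable_continuous_on_indicator[OF assms(2) this] show ?thesis
    by simp
qed

text \<open>The transition map \<open>\<tau>\<close> is the inverse of \<open>\<kappa>\<close> after
  \<open>\<phi>\<close>. The Jacobian of \<open>\<phi>\<close> factors through that of
  \<open>\<kappa>\<close>, so the area densities differ by \<open>\<bar>det (T u)\<bar>\<close>,
  exactly the factor in the change of variables.\<close>

lemma chart_transition:
  fixes \<kappa> :: "real ^ 'm::{finite,wellorder} \<Rightarrow> real ^ 'n" and \<phi> :: "real ^ 'm::_ \<Rightarrow> real ^ 'n"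
  assumes \<kappa>: "local_param M V \<kappa>" and \<phi>: "immersion W \<phi>" "\<phi> ` W \<subseteq> M"
    and A: "A \<in> sets borel" "A \<subseteq> W" "\<phi> ` A \<subseteq> \<kappa> ` V"
  obtains A' where "A' \<in> sets borel" "A' \<subseteq> V" "\<kappa> ` A' = \<phi> ` A" "nn_area \<kappa> A' = nn_area \<phi> A"
proof -
  have im\<kappa>: "immersion V \<kappa>" using \<kappa> by (rule local_param_immersion)
  obtain \<theta> where \<theta>: "homeomorphism V (\<kappa> ` V) \<kappa> \<theta>" using \<kappa> by (auto simp: local_param_def)
  obtain O' where O': "open O'" "\<kappa> ` V = M \<inter> O'" using \<kappa> by (auto simp: local_param_def openin_open)
  have cont\<phi>: "continuous_on W \<phi>" and W: "open W" and inj\<phi>: "inj_on \<phi> W"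
    using \<phi> immersion_continuous_on by (auto simp: immersion_def)
  define W' where "W' = W \<inter> \<phi> -` O'"
  have W': "open W'" unfolding W'_def using cont\<phi> W O'(1) by (rule continuous_open_preimage)
  have W'W: "W' \<subseteq> W" and AW': "A \<subseteq> W'" and \<phi>W': "\<phi> ` W' \<subseteq> \<kappa> ` V"
    using A O' \<phi>(2) by (auto simp: W'_def)
  define \<tau> where "\<tau> u = \<theta> (\<phi> u)" for u
  have \<tau>: "\<tau> u \<in> V" "\<kappa> (\<tau> u) = \<phi> u" if "u \<in> W'" for u
  proof -
    have "\<phi> u \<in> \<kappa> ` V" using \<phi>W' that by blast
    then show "\<tau> u \<in> V" "\<kappa> (\<tau> u) = \<phi> u"
      using \<theta> unfolding homeomorphism_def \<tau>_def by auto
  qed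
  have cont\<tau>: "continuous_on W' \<tau>" unfolding \<tau>_def[abs_def]
    by (rule continuous_on_compose2[OF homeomorphism_cont2[OF \<theta>] continuous_on_subset[OF cont\<phi> W'W] \<phi>W'])
  have inj\<tau>: "inj_on \<tau> W'" 
  proof (rule inj_onI)
    fix u v assume uv: "u \<in> W'" "v \<in> W'" "\<tau> u = \<tau> v"
    then have "\<phi> u = \<phi> v" using \<tau>(2)[of u] \<tau>(2)[of v] by simp
    then show "u = v" using inj_onD[OF inj\<phi>] uv W'W by blast
  qed
  define B where "B u = jac \<kappa> (\<tau> u)" for u
  \<comment> \<open>The first two factors form the left inverse of \<open>B u\<close> given by the
    normal equations.\<close>
  define T where "T u = matrix_inv (gram (B u)) ** transpose (B u) ** jac \<phi> u" for u
  have Binj: "v = 0" if "u \<in> W'" "B u *v v = 0" for u v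
    using im\<kappa> \<tau>(1)[OF that(1)] that(2) by (auto simp: immersion_def B_def)
  have det: "det (gram (B u)) \<noteq> 0" if "u \<in> W'" for u using det_gram_pos[of "B u"] Binj[OF that] by force
  have der: "(\<tau> has_derivative (*v) (T u)) (at u)" if "u \<in> W'" for u
  proof -
    have "(\<tau> has_derivative (\<lambda>h. (matrix_inv (gram (B u)) ** transpose (B u)) *v (jac \<phi> u *v h))) (at u)"
    proof (rule has_derivative_transition[where B = "(*v) (B u)" and D = "(*v) (jac \<phi> u)" and \<kappa> = \<kappa>
          and L = "(*v) (matrix_inv (gram (B u)) ** transpose (B u))", OF _ _ _ _ W' that])
      show "(\<kappa> has_derivative (*v) (B u)) (at (\<tau> u))" "(\<phi> has_derivative (*v) (jac \<phi> u)) (at u)"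
        using immersion_has_derivative[OF im\<kappa>] immersion_has_derivative[OF \<phi>(1)] \<tau>(1)[OF that] that W'W
        by (auto simp: B_def)
      show "continuous (at u) \<tau>" using cont\<tau> W' that continuous_on_eq_continuous_at by blast
      show "(matrix_inv (gram (B u)) ** transpose (B u)) *v (B u *v v) = v" for v
        using matrix_inv_mult(2)[OF det[OF that]]
        by (simp add: matrix_vector_mul_assoc gram_def matrix_mul_assoc[symmetric])
    qed (auto simp: \<tau> matrix_vector_mul_bounded_linear)
    then show ?thesis by (simp add: T_def matrix_vector_mul_assoc)
  qed
  have BT: "jac \<phi> u = B u ** T u" if "u \<in> W'" for u
  proof -
    have "((\<lambda>u. \<kappa> (\<tau> u)) has_derivative (\<lambda>h. B u *v (T u *v h))) (at u)"
      using has_derivative_compose[OF der[OF that] immersion_has_derivative[OF im\<kappa> \<tau>(1)[OF that]]]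
      by (simp add: B_def)
    then have "(\<phi> has_derivative (\<lambda>h. B u *v (T u *v h))) (at u)"
      by (rule has_derivative_transform_within_open[OF _ W' that]) (simp add: \<tau>)
    from has_derivative_unique[OF this immersion_has_derivative[OF \<phi>(1)]]
    have "\<forall>h. jac \<phi> u *v h = (B u ** T u) *v h"
      using that W'W by (auto simp: fun_eq_iff matrix_vector_mul_assoc)
    then show ?thesis by (rule matrix_eq[THEN iffD2])
  qed
  have meas: "\<tau> ` A \<in> sets borel"
    by (rule borel_injective_continuous_image[OF W' cont\<tau> inj\<tau> A(1) AW'])
  have sub: "\<tau> ` A \<subseteq> V" using \<tau> AW' by auto
  have areaBT: "\<bar>det (T u)\<bar> * area (jac \<kappa> (\<tau> u)) = area (jac \<phi> u)" if "u \<in> A" for u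
    using BT[of u] that AW' by (auto simp: area_matrix_mult B_def)
  have "(\<integral>\<^sup>+u\<in>A. ennreal (\<bar>det (T u)\<bar> * area (jac \<kappa> (\<tau> u))) \<partial>lborel) =
      (\<integral>\<^sup>+y\<in>\<tau> ` A. ennreal (area (jac \<kappa> y)) \<partial>lborel)"
  proof (rule nn_integral_change_of_variables[OF A(1) meas])
    show "(\<tau> has_derivative (*v) (T u)) (at u within A)" if "u \<in> A" for u
      using der that AW' by (blast intro: has_derivative_at_withinI)
    show "inj_on \<tau> A" using inj\<tau> AW' by (rule inj_on_subset)
    show "(\<lambda>y. indicator (\<tau> ` A) y * area (jac \<kappa> y)) \<in> borel_measurable borel"
      using im\<kappa> meas sub by (rule set_measurable_area)
    have "(\<lambda>x. indicator A x * area (jac \<phi> x)) \<in> borel_measurable borel"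
      using \<phi>(1) A(1,2) by (rule set_measurable_area)
    also have "(\<lambda>x. indicator A x * area (jac \<phi> x)) =
        (\<lambda>x. indicator A x * (\<bar>det (T x)\<bar> * area (jac \<kappa> (\<tau> x))))"
      by (auto simp: fun_eq_iff indicator_def areaBT)
    finally show "(\<lambda>x. indicator A x * (\<bar>det (T x)\<bar> * area (jac \<kappa> (\<tau> x)))) \<in> borel_measurable borel" .
    show "area (jac \<kappa> y) \<ge> 0" if "y \<in> \<tau> ` A" for y
      using immersion_area_pos[OF im\<kappa>, of y] that sub by auto
  qed
  moreover have "(\<integral>\<^sup>+u\<in>A. ennreal (\<bar>det (T u)\<bar> * area (jac \<kappa> (\<tau> u))) \<partial>lborel) = nn_area \<phi> A"
    unfolding nn_area_def by (intro nn_integral_cong) (auto simp: indicator_def areaBT)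
  ultimately have "nn_area \<kappa> (\<tau> ` A) = nn_area \<phi> A" by (simp add: nn_area_def)
  moreover have "\<kappa> ` (\<tau> ` A) = \<phi> ` A" using \<tau>(2) AW' by (force simp: image_image)
  ultimately show thesis using that meas sub by blast
qed

subsection \<open>Existence and the area formula\<close>

definition is_surface_measure ::
  "'m::{finite,wellorder} itself \<Rightarrow> (real ^ 'n::finite) set \<Rightarrow> (real ^ 'n) measure \<Rightarrow> bool" where
  "is_surface_measure _ M \<mu> \<longleftrightarrow> sets \<mu> = sets (restrict_space borel M) \<and>
     (\<forall>V (\<psi> :: real ^ 'm::_ \<Rightarrow> real ^ 'n). local_param M V \<psi> \<longrightarrow>
        (\<forall>A\<in>sets borel. A \<subseteq> V \<longrightarrow>
           emeasure \<mu> (\<psi> ` A) = (\<integral>\<^sup>+u\<in>A. ennreal (area_factor \<psi> u) \<partial>lborel)))"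

lemma local_param_subset: "local_param M V \<psi> \<Longrightarrow> \<psi> ` V \<subseteq> M"
  unfolding local_param_def by (blast dest: openin_imp_subset)

lemma nn_area_eq_area_factor:
  assumes "immersion V \<psi>" "A \<subseteq> V"
  shows "(\<integral>\<^sup>+u\<in>A. ennreal (area_factor \<psi> u) \<partial>lborel) = nn_area \<psi> A"
  unfolding nn_area_def using assms
  by (intro nn_integral_cong) (auto simp: indicator_def area_factor_eq immersion_differentiable)

lemma borel_closed_restrict: "closed M \<Longrightarrow> A \<in> sets (restrict_space borel M) \<longleftrightarrow> A \<in> sets borel \<and> A \<subseteq> M"
  by (subst sets_restrict_space_iff) auto

lemma immersion_preimage_borel:
  assumes "immersion W \<phi>" "B \<in> sets borel"
  shows "{u \<in> W. \<phi> u \<in> B} \<in> sets borel"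
proof -
  have W: "W \<in> sets borel" using assms(1) by (auto simp: immersion_def)
  have "\<phi> \<in> borel_measurable (restrict_space borel W)"
    using immersion_continuous_on[OF assms(1)] by (rule borel_measurable_continuous_on_restrict)
  from measurable_sets[OF this assms(2)] have "\<phi> -` B \<inter> W \<in> sets (restrict_space borel W)"
    by (simp add: space_restrict_space)
  then have "\<phi> -` B \<inter> W \<in> sets borel" using W by (simp add: sets_restrict_space_iff)
  moreover have "\<phi> -` B \<inter> W = {u \<in> W. \<phi> u \<in> B}" by auto
  ultimately show ?thesis by simp
qed

definition area_measure :: "(real ^ 'm) set \<Rightarrow> (real ^ 'm \<Rightarrow> real ^ 'n) \<Rightarrow> (real ^ 'm) measure" where
  "area_measure W \<phi> = density lborel (\<lambda>u. ennreal (indicator W u * area (jac \<phi> u)))"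

lemma emeasure_area_measure:
  assumes "immersion W \<phi>" "A \<in> sets borel" "A \<subseteq> W"
  shows "emeasure (area_measure W \<phi>) A = nn_area \<phi> A"
proof -
  have "W \<in> sets borel" using assms(1) by (auto simp: immersion_def)
  then have "emeasure (area_measure W \<phi>) A = (\<integral>\<^sup>+u. ennreal (indicator W u * area (jac \<phi> u)) * indicator A u \<partial>lborel)"
    unfolding area_measure_def
    using assms set_measurable_area[OF assms(1)] by (subst emeasure_density) auto
  also have "\<dots> = nn_area \<phi> A"
    unfolding nn_area_def using assms(3) by (intro nn_integral_cong) (auto simp: indicator_def)
  finally show ?thesis .
qed

lemma sets_area_measure [simp]: "sets (area_measure W \<phi>) = sets borel"
  by (simp add: area_measure_def)

text \<open>By the Lindelof property. Countability allows the surface measure to be assembled by a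
  series over charts.\<close>

lemma countable_atlas:
  fixes M :: "(real ^ 'n::{finite,wellorder}) set"
  assumes "submanifold CARD('m::finite) M"
  obtains V and \<kappa> :: "nat \<Rightarrow> real ^ 'm \<Rightarrow> real ^ 'n::_" where
    "\<forall>i. local_param M (V i) (\<kappa> i)" "M = (\<Union>i. \<kappa> i ` V i)"
proof -
  have "\<exists>U' W (\<psi> :: real ^ 'm \<Rightarrow> real ^ 'n::_). open U' \<and> x \<in> U' \<and> local_param M W \<psi> \<and> \<psi> ` W = M \<inter> U'"
    if x: "x \<in> M" for x
  proof -
    have le: "CARD('m) \<le> CARD('n)" using assms by (simp add: submanifold_def)
    obtain U \<rho> where U: "x \<in> U" "orthonormal_defining (CARD('n) - CARD('m)) M U \<rho>"
      using exists_orthonormal_defining[OF assms x] by blast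
    obtain U' W and \<psi> :: "real ^ 'm \<Rightarrow> real ^ 'n::_" where "open U'" "U' \<subseteq> U" "x \<in> U'"
      "local_param M W \<psi>" "\<psi> ` W = M \<inter> U'"
      using exists_local_param[OF U(2) x U(1) le] .
    then show ?thesis by blast
  qed
  then obtain U' W and \<psi> :: "real ^ 'n::_ \<Rightarrow> real ^ 'm \<Rightarrow> real ^ 'n::_" where
    ch: "\<And>x. x \<in> M \<Longrightarrow> open (U' x) \<and> x \<in> U' x \<and> local_param M (W x) (\<psi> x) \<and> \<psi> x ` W x = M \<inter> U' x"
    by metis
  have "\<exists>C\<subseteq>M. countable C \<and> M \<subseteq> (\<Union>x\<in>C. U' x)"
  proof -
    obtain \<D> where \<D>: "\<D> \<subseteq> U' ` M" "countable \<D>" "\<Union>\<D> = \<Union>(U' ` M)"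
      using Lindelof[of "U' ` M"] ch by auto
    then obtain C where C: "countable C" "C \<subseteq> M" "\<D> = U' ` C"
      using countable_subset_image[of \<D> U' M] by auto
    have "M \<subseteq> \<Union>(U' ` M)"
    proof
      fix x assume "x \<in> M"
      then show "x \<in> \<Union>(U' ` M)" using ch[of x] by auto
    qed
    then have "M \<subseteq> \<Union>(U' ` C)" using \<D>(3) C(3) by simp
    then show ?thesis using C by (intro exI[of _ C]) simp
  qed
  then obtain C where C: "C \<subseteq> M" "countable C" "M \<subseteq> (\<Union>x\<in>C. U' x)" by blast
  show thesis
  proof (cases "C = {}")
    case True
    then have M: "M = {}" using C by auto
    \<comment> \<open>The empty submanifold still needs a sequence of charts; the chart with empty
      domain serves.\<close>
    have "local_param M {} (\<lambda>_ :: real ^ 'm. 0)"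
      unfolding M local_param_def smooth_on_def
      by (auto simp: homeomorphism_def intro: Ck_on_const)
    then show thesis using that[of "\<lambda>_. {}" "\<lambda>_ _. 0"] M by simp
  next
    case False
    define x where "x i = from_nat_into C i" for i
    have x: "range x = C" using False C(2) by (simp add: x_def[abs_def] range_from_nat_into)
    show thesis
    proof (rule that[of "\<lambda>i. W (x i)" "\<lambda>i. \<psi> (x i)"])
      show "\<forall>i. local_param M (W (x i)) (\<psi> (x i))" using ch x C(1) by blast
      have "\<psi> (x i) ` W (x i) = M \<inter> U' (x i)" for i using ch x C(1) by blast
      then show "M = (\<Union>i. \<psi> (x i) ` W (x i))" using C(3) x by fastforce
    qed
  qed
qed

text \<open>Both the existence of the surface measure and the area formula reduce to this decomposition.\<close>

lemma nn_area_decomposition: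
  fixes \<kappa> :: "nat \<Rightarrow> real ^ 'm::{finite,wellorder} \<Rightarrow> real ^ 'n" and \<phi> :: "real ^ 'm::_ \<Rightarrow> real ^ 'n"
  assumes \<kappa>: "\<And>i. local_param M (V i) (\<kappa> i)" "M = (\<Union>i. \<kappa> i ` V i)"
    and \<phi>: "immersion W \<phi>" "\<phi> ` W \<subseteq> M" and A: "A \<in> sets borel" "A \<subseteq> W"
  defines "E \<equiv> \<lambda>i. \<kappa> i ` V i - (\<Union>j<i. \<kappa> j ` V j)"
  obtains A' where "\<And>i. A' i \<in> sets borel" "\<And>i. A' i \<subseteq> V i" "\<And>i. \<kappa> i ` A' i = \<phi> ` A \<inter> E i"
    "(\<Sum>i. nn_area (\<kappa> i) (A' i)) = nn_area \<phi> A"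
proof -
  have im: "immersion (V i) (\<kappa> i)" for i using \<kappa>(1) by (rule local_param_immersion)
  have borel\<kappa>: "\<kappa> i ` V i \<in> sets borel" for i
    using im[of i] immersion_continuous_on[OF im[of i]]
    by (intro borel_injective_continuous_image[of "V i"]) (auto simp: immersion_def)
  then have E: "E i \<in> sets borel" for i by (auto simp: E_def)
  have disj: "i = j" if "x \<in> E i" "x \<in> E j" for x i j
    using that by (cases i j rule: linorder_cases) (auto simp: E_def)
  have cover: "M = (\<Union>i. E i)"
  proof -
    have "(\<Union>i. E i) = (\<Union>i. \<kappa> i ` V i)"
      using UN_disjointed_eq[of "\<lambda>i. \<kappa> i ` V i"] by (simp add: E_def disjointed_def lessThan_atLeast0)
    then show ?thesis using \<kappa>(2) by simp
  qed
  define A1 where "A1 i = A \<inter> {u \<in> W. \<phi> u \<in> E i}" for i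
  have A1: "A1 i \<in> sets borel" "A1 i \<subseteq> W" "\<phi> ` A1 i \<subseteq> \<kappa> i ` V i" for i
    using A immersion_preimage_borel[OF \<phi>(1) E] by (auto simp: A1_def E_def)
  have "\<exists>A'. A' \<in> sets borel \<and> A' \<subseteq> V i \<and> \<kappa> i ` A' = \<phi> ` A1 i \<and> nn_area (\<kappa> i) A' = nn_area \<phi> (A1 i)" for i
    using chart_transition[OF \<kappa>(1) \<phi> A1] by metis
  then obtain A' where A': "\<And>i. A' i \<in> sets borel" "\<And>i. A' i \<subseteq> V i" "\<And>i. \<kappa> i ` A' i = \<phi> ` A1 i"
    "\<And>i. nn_area (\<kappa> i) (A' i) = nn_area \<phi> (A1 i)" by metis
  have "(\<Sum>i. nn_area (\<kappa> i) (A' i)) = (\<Sum>i. emeasure (area_measure W \<phi>) (A1 i))"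
    by (simp add: A'(4) emeasure_area_measure[OF \<phi>(1) A1(1,2)])
  also have "\<dots> = emeasure (area_measure W \<phi>) (\<Union>i. A1 i)"
    using A1(1) disj by (intro suminf_emeasure) (auto simp: disjoint_family_on_def A1_def)
  also have "(\<Union>i. A1 i) = A"
    using A(2) \<phi>(2) cover by (auto simp: A1_def)
  also have "emeasure (area_measure W \<phi>) A = nn_area \<phi> A"
    using \<phi>(1) A by (rule emeasure_area_measure)
  finally have sum: "(\<Sum>i. nn_area (\<kappa> i) (A' i)) = nn_area \<phi> A" .
  have "\<kappa> i ` A' i = \<phi> ` A \<inter> E i" for i
    unfolding A'(3) A1_def using A(2) by auto
  then show thesis using that A' sum by blast
qed

text \<open>\<open>M\<close> is cut into the disjoint Borel pieces \<open>E i\<close>, each inside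
  one chart, and the measure is the sum of the areas of the preimages. Agreement with an arbitrary
  chart is the decomposition lemma.\<close>

lemma ex_surface_measure:
  fixes M :: "(real ^ 'n::{finite,wellorder}) set"
  assumes "submanifold CARD('m::{finite,wellorder}) M"
  shows "\<exists>\<mu>. is_surface_measure TYPE('m) M \<mu>"
proof -
  have closed: "closed M" using assms by (simp add: submanifold_def)
  obtain V and \<kappa> :: "nat \<Rightarrow> real ^ 'm::_ \<Rightarrow> real ^ 'n::_" where
    \<kappa>': "\<forall>i. local_param M (V i) (\<kappa> i)" "M = (\<Union>i. \<kappa> i ` V i)"
    using countable_atlas[OF assms] .
  note \<kappa> = spec[OF \<kappa>'(1)] \<kappa>'(2)
  have im: "immersion (V i) (\<kappa> i)" for i using \<kappa>(1) by (rule local_param_immersion)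
  define E where "E i = \<kappa> i ` V i - (\<Union>j<i. \<kappa> j ` V j)" for i
  have E: "E i \<in> sets borel" for i
  proof -
    have "\<kappa> i ` V i \<in> sets borel" for i
      using im[of i] immersion_continuous_on[OF im[of i]]
      by (intro borel_injective_continuous_image[of "V i"]) (auto simp: immersion_def)
    then show ?thesis by (auto simp: E_def)
  qed
  define pre where "pre i B = {u \<in> V i. \<kappa> i u \<in> B \<inter> E i}" for i B
  have pre: "pre i B \<in> sets borel" if "B \<in> sets borel" for i B
    unfolding pre_def using immersion_preimage_borel[OF im, of "B \<inter> E i" i] that E by auto
  \<comment> \<open>Writing the series over charts as an integral for the counting measure makes
    countable additivity an exchange of sum and integral.\<close>
  define m where "m B = (\<integral>\<^sup>+i. emeasure (area_measure (V i) (\<kappa> i)) (pre i B) \<partial>count_space UNIV)" for B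
  define \<mu> where "\<mu> = measure_of M (sets (restrict_space borel M)) m"
  have space: "space (restrict_space borel M) = M" by (simp add: space_restrict_space)
  have sets: "sets \<mu> = sets (restrict_space borel M)"
    unfolding \<mu>_def by (metis sets.sets_measure_of_eq space)
  have sa: "sigma_algebra M (sets (restrict_space borel M))"
    by (metis sets.sigma_algebra_axioms space)
  have em: "emeasure \<mu> B = m B" if "B \<in> sets borel" "B \<subseteq> M" for B
  proof (rule emeasure_measure_of[OF \<mu>_def])
    show "sets (restrict_space borel M) \<subseteq> Pow M" using closed by (auto simp: borel_closed_restrict)
    show "B \<in> sets \<mu>" using that closed by (simp add: sets borel_closed_restrict)
    show "positive (sets \<mu>) m"
      by (simp add: positive_def m_def pre_def)
    show "countably_additive (sets \<mu>) m"
    proof (rule countably_additiveI)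
      fix B :: "nat \<Rightarrow> (real ^ 'n::_) set"
      assume B: "range B \<subseteq> sets \<mu>" "disjoint_family B" "(\<Union>i. B i) \<in> sets \<mu>"
      have Bk: "B k \<in> sets borel" for k
        using subsetD[OF B(1) rangeI, of k] closed by (simp add: sets borel_closed_restrict)
      have "(\<Sum>k. m (B k)) = (\<integral>\<^sup>+i. (\<Sum>k. emeasure (area_measure (V i) (\<kappa> i)) (pre i (B k))) \<partial>count_space UNIV)"
        unfolding m_def by (rule nn_integral_suminf[symmetric]) simp
      also have "\<dots> = (\<integral>\<^sup>+i. emeasure (area_measure (V i) (\<kappa> i)) (pre i (\<Union>k. B k)) \<partial>count_space UNIV)"
      proof (rule nn_integral_cong)
        fix i
        have "(\<Sum>k. emeasure (area_measure (V i) (\<kappa> i)) (pre i (B k))) =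
            emeasure (area_measure (V i) (\<kappa> i)) (\<Union>k. pre i (B k))"
          using pre[OF Bk] B(2) by (intro suminf_emeasure) (auto simp: disjoint_family_on_def pre_def disjoint_iff)
        also have "(\<Union>k. pre i (B k)) = pre i (\<Union>k. B k)" by (auto simp: pre_def)
        finally show "(\<Sum>k. emeasure (area_measure (V i) (\<kappa> i)) (pre i (B k))) =
            emeasure (area_measure (V i) (\<kappa> i)) (pre i (\<Union>k. B k))" .
      qed
      finally show "(\<Sum>k. m (B k)) = m (\<Union>k. B k)" by (simp add: m_def)
    qed
  qed
  have "emeasure \<mu> (\<psi> ` A) = (\<integral>\<^sup>+u\<in>A. ennreal (area_factor \<psi> u) \<partial>lborel)"
    if lp: "local_param M W \<psi>" and A: "A \<in> sets borel" "A \<subseteq> W" for W A and \<psi> :: "real ^ 'm::_ \<Rightarrow> real ^ 'n::_"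
  proof -
    have \<psi>: "immersion W \<psi>" using lp by (rule local_param_immersion)
    have sub: "\<psi> ` W \<subseteq> M" using lp by (rule local_param_subset)
    obtain A' where A': "\<And>i. A' i \<in> sets borel" "\<And>i. A' i \<subseteq> V i" "\<And>i. \<kappa> i ` A' i = \<psi> ` A \<inter> E i"
      "(\<Sum>i. nn_area (\<kappa> i) (A' i)) = nn_area \<psi> A"
      by (rule nn_area_decomposition[OF \<kappa> \<psi> sub A, folded E_def]) (rule that; simp)
    have "pre i (\<psi> ` A) = A' i" for i
    proof -
      have "inj_on (\<kappa> i) (V i)" using im by (auto simp: immersion_def)
      then show ?thesis unfolding pre_def A'(3)[symmetric] using A'(2)[of i] by (auto dest: inj_onD)
    qed
    then have "m (\<psi> ` A) = (\<Sum>i. nn_area (\<kappa> i) (A' i))"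
      by (simp add: m_def nn_integral_count_space_nat emeasure_area_measure[OF im A'(1,2)])
    moreover have "\<psi> ` A \<in> sets borel"
      using \<psi> immersion_continuous_on[OF \<psi>] A
      by (intro borel_injective_continuous_image[of W]) (auto simp: immersion_def)
    moreover have "\<psi> ` A \<subseteq> M" using sub A by blast
    ultimately show ?thesis
      using em A'(4) nn_area_eq_area_factor[OF \<psi> A(2)] by simp
  qed
  then show ?thesis unfolding is_surface_measure_def using sets by blast
qed

lemma surface_measure:
  fixes M :: "(real ^ 'n::{finite,wellorder}) set"
  assumes "submanifold CARD('m::{finite,wellorder}) M"
  shows "is_surface_measure TYPE('m) M (surface_measure TYPE('m) M)"
  unfolding surface_measure_def
  using someI_ex[OF ex_surface_measure[OF assms, unfolded is_surface_measure_def]]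
  unfolding is_surface_measure_def .

lemma sets_surface_measure:
  fixes M :: "(real ^ 'n::{finite,wellorder}) set"
  assumes "submanifold CARD('m::{finite,wellorder}) M"
  shows "sets (surface_measure TYPE('m) M) = sets (restrict_space borel M)"
    and "space (surface_measure TYPE('m) M) = M"
proof -
  show 1: "sets (surface_measure TYPE('m) M) = sets (restrict_space borel M)"
    using surface_measure[OF assms] by (simp add: is_surface_measure_def)
  show "space (surface_measure TYPE('m) M) = M"
    using sets_eq_imp_space_eq[OF 1] by (simp add: space_restrict_space)
qed

text \<open>The defining property covers smooth charts only. Cutting the image along an atlas
  extends it to C^1 immersions, as needed for the flowed charts.\<close>

lemma emeasure_surface_measure:
  fixes M :: "(real ^ 'n::{finite,wellorder}) set" and \<phi> :: "real ^ 'm::{finite,wellorder} \<Rightarrow> real ^ 'n::_"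
  assumes M: "submanifold CARD('m) M"
    and \<phi>: "immersion W \<phi>" "\<phi> ` W \<subseteq> M" and A: "A \<in> sets borel" "A \<subseteq> W"
  shows "emeasure (surface_measure TYPE('m) M) (\<phi> ` A) = nn_area \<phi> A"
proof -
  let ?\<mu> = "surface_measure TYPE('m) M"
  have closed: "closed M" using M by (simp add: submanifold_def)
  obtain V and \<kappa> :: "nat \<Rightarrow> real ^ 'm::_ \<Rightarrow> real ^ 'n::_" where
    \<kappa>': "\<forall>i. local_param M (V i) (\<kappa> i)" "M = (\<Union>i. \<kappa> i ` V i)"
    using countable_atlas[OF M] .
  note \<kappa> = spec[OF \<kappa>'(1)] \<kappa>'(2)
  have im: "immersion (V i) (\<kappa> i)" for i using \<kappa>(1) by (rule local_param_immersion)
  define E where "E i = \<kappa> i ` V i - (\<Union>j<i. \<kappa> j ` V j)" for i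
  obtain A' where A': "\<And>i. A' i \<in> sets borel" "\<And>i. A' i \<subseteq> V i" "\<And>i. \<kappa> i ` A' i = \<phi> ` A \<inter> E i"
    "(\<Sum>i. nn_area (\<kappa> i) (A' i)) = nn_area \<phi> A"
    by (rule nn_area_decomposition[OF \<kappa> \<phi> A, folded E_def]) (rule that; simp)
  have em: "emeasure ?\<mu> (\<kappa> i ` A' i) = nn_area (\<kappa> i) (A' i)" for i
    using surface_measure[OF M] \<kappa>(1)[of i] A'(1,2)[of i] nn_area_eq_area_factor[OF im A'(2)[of i]]
    unfolding is_surface_measure_def by simp
  have disj: "i = j" if "x \<in> E i" "x \<in> E j" for x i j
    using that by (cases i j rule: linorder_cases) (auto simp: E_def)
  have cover: "M \<subseteq> (\<Union>i. E i)"
    using UN_disjointed_eq[of "\<lambda>i. \<kappa> i ` V i"] \<kappa>(2)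
    by (simp add: E_def disjointed_def lessThan_atLeast0)
  have "\<kappa> i ` A' i \<in> sets ?\<mu>" for i
  proof -
    have "\<kappa> i ` A' i \<in> sets borel"
      using im[of i] immersion_continuous_on[OF im[of i]] A'(1,2)[of i]
      by (intro borel_injective_continuous_image[of "V i"]) (auto simp: immersion_def)
    moreover have "\<kappa> i ` A' i \<subseteq> M" using A'(2)[of i] \<kappa>(2) by auto
    ultimately show ?thesis using closed by (simp add: sets_surface_measure[OF M] borel_closed_restrict)
  qed
  then have "(\<Sum>i. emeasure ?\<mu> (\<kappa> i ` A' i)) = emeasure ?\<mu> (\<Union>i. \<kappa> i ` A' i)"
    using disj by (intro suminf_emeasure) (auto simp: disjoint_family_on_def A'(3))
  moreover have "(\<Union>i. \<kappa> i ` A' i) = \<phi> ` A"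
  proof -
    have "\<phi> ` A \<subseteq> (\<Union>i. E i)"
      using subset_trans[OF image_mono[OF A(2)] subset_trans[OF \<phi>(2) cover]] .
    then show ?thesis unfolding A'(3) Int_UN_distrib[symmetric] by (rule Int_absorb2)
  qed
  ultimately show ?thesis using em A'(4) by simp
qed

text \<open>The image measure needs a total map into \<open>M\<close>; \<open>m0\<close> is an
  arbitrary value outside \<open>W\<close>, where \<open>area_measure\<close> has density 0.\<close>

lemma surface_measure_density_distr:
  fixes M :: "(real ^ 'n::{finite,wellorder}) set" and \<phi> :: "real ^ 'm::{finite,wellorder} \<Rightarrow> real ^ 'n::_"
  assumes M: "submanifold CARD('m) M"
    and \<phi>: "immersion W \<phi>" "\<phi> ` W \<subseteq> M" and m0: "m0 \<in> M"
  shows "density (surface_measure TYPE('m) M) (indicator (\<phi> ` W)) =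
    distr (area_measure W \<phi>) (restrict_space borel M) (\<lambda>u. if u \<in> W then \<phi> u else m0)"
    (is "?L = distr _ ?N ?\<phi>")
    and "(\<lambda>u. if u \<in> W then \<phi> u else m0) \<in> borel \<rightarrow>\<^sub>M restrict_space borel M"
proof -
  let ?\<mu> = "surface_measure TYPE('m) M"
  have closed: "closed M" using M by (simp add: submanifold_def)
  have W: "open W" "W \<in> sets borel" using \<phi>(1) by (auto simp: immersion_def)
  have img: "\<phi> ` W \<in> sets borel"
    using \<phi>(1) immersion_continuous_on[OF \<phi>(1)]
    by (intro borel_injective_continuous_image[of W]) (auto simp: immersion_def)
  then have img\<mu>: "\<phi> ` W \<in> sets ?\<mu>" using \<phi>(2) closed by (simp add: sets_surface_measure[OF M] borel_closed_restrict)
  show meas: "?\<phi> \<in> borel \<rightarrow>\<^sub>M ?N"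
  proof (rule measurable_restrict_space2)
    show "?\<phi> \<in> space borel \<rightarrow> M" using \<phi>(2) m0 by (auto simp: image_subset_iff)
    show "?\<phi> \<in> borel_measurable borel"
      using immersion_continuous_on[OF \<phi>(1)] W(2)
      by (intro borel_measurable_continuous_on_if) auto
  qed
  show "?L = distr (area_measure W \<phi>) ?N ?\<phi>"
  proof (rule measure_eqI)
    show "sets ?L = sets (distr (area_measure W \<phi>) ?N ?\<phi>)" by (simp add: sets_surface_measure[OF M])
    fix B assume "B \<in> sets ?L"
    then have B: "B \<in> sets ?\<mu>" "B \<in> sets borel" "B \<subseteq> M" "B \<in> sets ?N"
      using closed by (auto simp: sets_surface_measure[OF M] borel_closed_restrict)
    let ?A = "{u \<in> W. \<phi> u \<in> B}"
    have A: "?A \<in> sets borel" using immersion_preimage_borel[OF \<phi>(1) B(2)] .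
    have "emeasure ?L B = (\<integral>\<^sup>+x. indicator (\<phi> ` W) x * indicator B x \<partial>?\<mu>)"
      using img\<mu> B(1) by (intro emeasure_density) auto
    also have "\<dots> = (\<integral>\<^sup>+x. indicator (\<phi> ` ?A) x \<partial>?\<mu>)"
      by (intro nn_integral_cong) (auto simp: indicator_def)
    also have "\<dots> = emeasure ?\<mu> (\<phi> ` ?A)"
    proof (rule nn_integral_indicator)
      have "\<phi> ` ?A = \<phi> ` W \<inter> B" by auto
      then show "\<phi> ` ?A \<in> sets ?\<mu>" using img\<mu> B(1) by auto
    qed
    also have "\<dots> = nn_area \<phi> ?A" using A by (intro emeasure_surface_measure[OF M \<phi>]) auto
    also have "\<dots> = emeasure (area_measure W \<phi>) ?A" using A by (intro emeasure_area_measure[OF \<phi>(1), symmetric]) auto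
    also have "\<dots> = emeasure (area_measure W \<phi>) (?\<phi> -` B)"
    proof -
      have pre: "?\<phi> -` B \<in> sets borel" using measurable_sets[OF meas B(4)] by simp
      show ?thesis unfolding area_measure_def
        using A pre set_measurable_area[OF \<phi>(1) W(2) order_refl]
        by (subst (1 2) emeasure_density) (auto intro!: nn_integral_cong simp: indicator_def)
    qed
    also have "\<dots> = emeasure (distr (area_measure W \<phi>) ?N ?\<phi>) B"
      using meas B(4) by (subst emeasure_distr) (auto simp: area_measure_def)
    finally show "emeasure ?L B = emeasure (distr (area_measure W \<phi>) ?N ?\<phi>) B" .
  qed
qed

lemma integral_surface_measure:
  fixes M :: "(real ^ 'n::{finite,wellorder}) set" and \<phi> :: "real ^ 'm::{finite,wellorder} \<Rightarrow> real ^ 'n::_"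
    and f :: "real ^ 'n::_ \<Rightarrow> real"
  assumes M: "submanifold CARD('m) M"
    and \<phi>: "immersion W \<phi>" "\<phi> ` W \<subseteq> M"
    and f: "f \<in> borel_measurable (restrict_space borel M)" "\<And>x. x \<in> M \<Longrightarrow> x \<notin> \<phi> ` W \<Longrightarrow> f x = 0"
  shows "(LINT x|surface_measure TYPE('m) M. f x) = (LINT u|lborel. indicator W u * (f (\<phi> u) * area (jac \<phi> u)))"
    and "integrable (surface_measure TYPE('m) M) f \<longleftrightarrow>
      integrable lborel (\<lambda>u. indicator W u * (f (\<phi> u) * area (jac \<phi> u)))"
proof -
  let ?\<mu> = "surface_measure TYPE('m) M" and ?N = "restrict_space borel M"
  note ss = sets_surface_measure[OF M]
  have closed: "closed M" using M by (simp add: submanifold_def)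
  have f\<mu>: "f \<in> borel_measurable ?\<mu>" using f(1) ss(1) by (simp cong: measurable_cong_sets)
  have goal: "(LINT x|?\<mu>. f x) = (LINT u|lborel. indicator W u * (f (\<phi> u) * area (jac \<phi> u))) \<and>
    (integrable ?\<mu> f \<longleftrightarrow> integrable lborel (\<lambda>u. indicator W u * (f (\<phi> u) * area (jac \<phi> u))))"
  \<comment> \<open>The empty case is separate because it offers no default point
    \<open>m0\<close>.\<close>
  proof (cases "M = {}")
    case True
    then have "space ?\<mu> = {}" "W = {}" using ss(2) \<phi>(2) by auto
    then show ?thesis
      by (simp add: Bochner_Integration.integral_empty integrable_iff_bounded f\<mu> nn_integral_empty)
  next
    case False
    then obtain m0 where m0: "m0 \<in> M" by auto
    let ?\<phi> = "\<lambda>u. if u \<in> W then \<phi> u else m0"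
    let ?d = "\<lambda>u. indicator W u * area (jac \<phi> u)"
    have W: "W \<in> sets borel" using \<phi>(1) by (auto simp: immersion_def)
    have d: "?d \<in> borel_measurable borel" using set_measurable_area[OF \<phi>(1) W] by simp
    have dnn: "?d u \<ge> 0" for u using immersion_area_pos[OF \<phi>(1), of u] by (auto simp: indicator_def)
    note dd = surface_measure_density_distr[OF M \<phi> m0]
    have meas: "?\<phi> \<in> area_measure W \<phi> \<rightarrow>\<^sub>M ?N" using dd(2) by (simp add: area_measure_def)
    have fm: "(\<lambda>u. f (?\<phi> u)) \<in> borel_measurable lborel" using measurable_compose[OF dd(2) f(1)] by simp
    have img: "\<phi> ` W \<in> sets ?\<mu>"
    proof -
      have "\<phi> ` W \<in> sets borel"
        using \<phi>(1) W immersion_continuous_on[OF \<phi>(1)]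
        by (intro borel_injective_continuous_image[of W]) (auto simp: immersion_def)
      then show ?thesis using \<phi>(2) closed by (simp add: ss borel_closed_restrict)
    qed
    have eq1: "indicator (\<phi> ` W) x *\<^sub>R f x = f x" if "x \<in> space ?\<mu>" for x
      using f(2)[of x] that ss(2) by (auto simp: indicator_def)
    have eq2: "?d u *\<^sub>R f (?\<phi> u) = indicator W u * (f (\<phi> u) * area (jac \<phi> u))" for u
      by (simp add: indicator_def)
    have dens: "density ?\<mu> (\<lambda>x. ennreal (indicator (\<phi> ` W) x)) = density ?\<mu> (indicator (\<phi> ` W))"
      by (simp add: ennreal_indicator)
    have "(LINT x|?\<mu>. f x) = (LINT x|?\<mu>. indicator (\<phi> ` W) x *\<^sub>R f x)"
      by (intro Bochner_Integration.integral_cong refl) (simp only: eq1)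
    also have "\<dots> = (LINT x|density ?\<mu> (indicator (\<phi> ` W)). f x)"
      unfolding dens[symmetric] using img f\<mu> by (intro integral_density[symmetric]) auto
    also have "\<dots> = (LINT u|area_measure W \<phi>. f (?\<phi> u))"
      unfolding dd(1) by (rule integral_distr[OF meas f(1)])
    also have "\<dots> = (LINT u|lborel. ?d u *\<^sub>R f (?\<phi> u))"
      unfolding area_measure_def using d dnn fm by (intro integral_density) auto
    finally have int: "(LINT x|?\<mu>. f x) = (LINT u|lborel. indicator W u * (f (\<phi> u) * area (jac \<phi> u)))"
      by (simp only: eq2)
    have "integrable ?\<mu> f \<longleftrightarrow> integrable ?\<mu> (\<lambda>x. indicator (\<phi> ` W) x *\<^sub>R f x)"
      by (intro Bochner_Integration.integrable_cong refl) (simp only: eq1)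
    also have "\<dots> \<longleftrightarrow> integrable (density ?\<mu> (indicator (\<phi> ` W))) f"
      unfolding dens[symmetric] using img f\<mu> by (intro integrable_density[symmetric]) auto
    also have "\<dots> \<longleftrightarrow> integrable (area_measure W \<phi>) (\<lambda>u. f (?\<phi> u))"
      unfolding dd(1) by (rule integrable_distr_eq[OF meas f(1)])
    also have "\<dots> \<longleftrightarrow> integrable lborel (\<lambda>u. ?d u *\<^sub>R f (?\<phi> u))"
      unfolding area_measure_def using d dnn fm by (intro integrable_density) auto
    finally have "integrable ?\<mu> f \<longleftrightarrow> integrable lborel (\<lambda>u. indicator W u * (f (\<phi> u) * area (jac \<phi> u)))"
      by (simp only: eq2)
    with int show ?thesis by blast
  qed
  then show "(LINT x|?\<mu>. f x) = (LINT u|lborel. indicator W u * (f (\<phi> u) * area (jac \<phi> u)))"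
    "integrable ?\<mu> f \<longleftrightarrow> integrable lborel (\<lambda>u. indicator W u * (f (\<phi> u) * area (jac \<phi> u)))" by blast+
qed

text \<open>A chart image of a small ball is a neighbourhood in \<open>M\<close> of finite area, and
  finitely many such neighbourhoods cover a compact part.\<close>

lemma emeasure_surface_measure_compact:
  fixes M :: "(real ^ 'n::{finite,wellorder}) set"
  assumes M: "submanifold CARD('m::{finite,wellorder}) M" and K: "compact K"
  shows "emeasure (surface_measure TYPE('m) M) (M \<inter> K) < \<infinity>"
proof -
  let ?\<mu> = "surface_measure TYPE('m) M"
  have closed: "closed M" using M by (simp add: submanifold_def)
  obtain V and \<kappa> :: "nat \<Rightarrow> real ^ 'm::_ \<Rightarrow> real ^ 'n::_" where
    \<kappa>': "\<forall>i. local_param M (V i) (\<kappa> i)" "M = (\<Union>i. \<kappa> i ` V i)"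
    using countable_atlas[OF M] .
  note \<kappa> = spec[OF \<kappa>'(1)] \<kappa>'(2)
  have im: "immersion (V i) (\<kappa> i)" for i using \<kappa>(1) by (rule local_param_immersion)
  have "\<exists>U. open U \<and> x \<in> U \<and> M \<inter> U \<in> sets ?\<mu> \<and> emeasure ?\<mu> (M \<inter> U) < \<infinity>" if "x \<in> M" for x
  proof -
    have "x \<in> (\<Union>i. \<kappa> i ` V i)" using \<kappa>(2) that by blast
    then obtain i u where u: "u \<in> V i" "x = \<kappa> i u" by auto
    obtain O' \<theta> where O': "open O'" "\<kappa> i ` V i = M \<inter> O'" and \<theta>: "homeomorphism (V i) (\<kappa> i ` V i) (\<kappa> i) \<theta>"
      using \<kappa>(1)[of i] by (auto simp: local_param_def openin_open)
    have V: "open (V i)" using im[of i] by (simp add: immersion_def)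
    \<comment> \<open>The closed ball must fit into the chart domain, so that the area density is
      bounded on it.\<close>
    obtain r where r: "r > 0" "cball u r \<subseteq> V i" using V u(1) open_contains_cball by blast
    have "openin (top_of_set (\<kappa> i ` V i)) (\<kappa> i ` ball u r)"
      using r by (intro homeomorphism_imp_open_map[OF \<theta>] open_openin_trans[OF V] ) (auto intro: order_trans[OF ball_subset_cball])
    then obtain O2 where O2: "open O2" "\<kappa> i ` ball u r = \<kappa> i ` V i \<inter> O2" by (auto simp: openin_open)
    define U where "U = O' \<inter> O2"
    have MU: "M \<inter> U = \<kappa> i ` ball u r" using O2 O' by (auto simp: U_def)
    have "emeasure ?\<mu> (M \<inter> U) = nn_area (\<kappa> i) (ball u r)"
      unfolding MU using r \<kappa>(2) by (intro emeasure_surface_measure[OF M im]) (auto intro: order_trans[OF ball_subset_cball])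
    also have "\<dots> < \<infinity>"
    proof -
      have "continuous_on (cball u r) (\<lambda>u. area (jac (\<kappa> i) u))"
        using immersion_area_continuous[OF im] r(2) by (rule continuous_on_subset)
      then have "compact ((\<lambda>u. area (jac (\<kappa> i) u)) ` cball u r)" by (rule compact_continuous_image) simp
      then obtain C where C: "\<And>v. v \<in> cball u r \<Longrightarrow> norm (area (jac (\<kappa> i) v)) \<le> C"
        using compact_imp_bounded bounded_iff by (metis (no_types, lifting) image_eqI)
      have "nn_area (\<kappa> i) (ball u r) \<le> (\<integral>\<^sup>+v. ennreal C * indicator (ball u r) v \<partial>lborel)"
        unfolding nn_area_def
        using order_trans[OF abs_ge_self C[unfolded real_norm_def]]
        by (intro nn_integral_mono) (auto simp: indicator_def intro!: ennreal_leI)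
      also have "\<dots> = ennreal C * emeasure lborel (ball u r)" by (simp add: nn_integral_cmult_indicator)
      also have "\<dots> < \<infinity>" using emeasure_lborel_ball_finite[of u r] by (simp add: ennreal_mult_less_top)
      finally show ?thesis .
    qed
    finally have fin: "emeasure ?\<mu> (M \<inter> U) < \<infinity>" .
    have "x \<in> U" using u r O2(2) O'(2) by (force simp: U_def)
    moreover have "open U" using O' O2 by (auto simp: U_def)
    moreover from this have "M \<inter> U \<in> sets ?\<mu>"
      using closed by (simp add: sets_surface_measure[OF M] borel_closed_restrict)
    ultimately show ?thesis using fin by blast
  qed
  then obtain U where U: "\<And>x. x \<in> M \<Longrightarrow> open (U x) \<and> x \<in> U x \<and> M \<inter> U x \<in> sets ?\<mu> \<and> emeasure ?\<mu> (M \<inter> U x) < \<infinity>"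
    by metis
  have "compact (M \<inter> K)" using closed K by (simp add: closed_Int_compact)
  then obtain C where C: "C \<subseteq> M" "finite C" "M \<inter> K \<subseteq> (\<Union>x\<in>C. U x)"
    by (rule compactE_image[of _ M U]) (use U in auto)
  have "emeasure ?\<mu> (M \<inter> K) \<le> emeasure ?\<mu> (\<Union>x\<in>C. M \<inter> U x)"
  proof (rule emeasure_mono)
    show "M \<inter> K \<subseteq> (\<Union>x\<in>C. M \<inter> U x)" using C(3) by blast
    show "(\<Union>x\<in>C. M \<inter> U x) \<in> sets ?\<mu>" using C U by (intro sets.finite_UN) auto
  qed
  also have "\<dots> \<le> (\<Sum>x\<in>C. emeasure ?\<mu> (M \<inter> U x))"
    using C U by (intro emeasure_subadditive_finite) auto
  also have "\<dots> < \<infinity>" using C U by (auto simp: ennreal_sum_less_top subset_iff)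
  finally show ?thesis .
qed

section \<open>Tangential divergence and mean curvature\<close>

text \<open>The function \<open>\<rho> j\<close> vanishes along \<open>\<phi>\<close>, so its
  derivative along \<open>\<phi>\<close> is 0.\<close>

lemma orthonormal_defining_tangent:
  assumes def: "orthonormal_defining p M U \<rho>"
    and \<phi>: "open W" "\<And>u. u \<in> W \<Longrightarrow> \<phi> differentiable (at u)" "\<phi> ` W \<subseteq> M" and u: "u \<in> W" "\<phi> u \<in> U" and j: "j < p"
  shows "grad (\<rho> j) (\<phi> u) \<bullet> partial k \<phi> u = 0"
proof -
  have U: "open U" and sm: "smooth_on U (\<rho> j)" and zero: "M \<inter> U = {x \<in> U. \<forall>j<p. \<rho> j x = 0}"
    using def j unfolding orthonormal_defining_def defining_functions_def by auto
  have "continuous_on W \<phi>"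
    using \<phi>(2) by (intro continuous_at_imp_continuous_on) (auto intro: differentiable_imp_continuous_within)
  then have W': "open (W \<inter> \<phi> -` U)" using \<phi>(1) U by (rule continuous_open_preimage)
  have d: "\<rho> j differentiable (at (\<phi> u))" using sm u(2) by (rule smooth_on_differentiable)
  have dc: "((\<lambda>u. \<rho> j (\<phi> u)) has_derivative (\<lambda>h. \<Sum>k\<in>UNIV. h $ k *\<^sub>R
      (\<Sum>i\<in>UNIV. partial k \<phi> u $ i *\<^sub>R partial i (\<rho> j) (\<phi> u)))) (at u)"
    using d \<phi>(2)[OF u(1)] by (rule has_derivative_compose_partials)
  have "partial k (\<lambda>u. \<rho> j (\<phi> u)) u = partial k (\<lambda>_. 0) u"
  proof (rule partial_cong_open[OF W'])
    show "u \<in> W \<inter> \<phi> -` U" using u by simp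
    show "(\<lambda>u. \<rho> j (\<phi> u)) differentiable (at u)" using dc by (rule differentiableI)
    fix y assume "y \<in> W \<inter> \<phi> -` U"
    then have "\<phi> y \<in> M \<inter> U" using \<phi>(3) by auto
    then show "\<rho> j (\<phi> y) = 0" using zero j by auto
  qed
  moreover have "partial k (\<lambda>_. 0 :: real) u = 0" by (simp add: partial_def)
  ultimately have "(\<Sum>i\<in>UNIV. partial k \<phi> u $ i *\<^sub>R partial i (\<rho> j) (\<phi> u)) = 0"
    using partial_compose[OF d \<phi>(2)[OF u(1)], of k] by simp
  then show ?thesis by (simp add: grad_def inner_vec_def mult.commute)
qed

text \<open>The two projections annihilate each other, hence their sum is again a projection, with
  trace the full dimension. This links charts to defining functions.\<close>

lemma tproj_plus_normal:
  fixes \<phi> :: "real ^ 'm \<Rightarrow> real ^ 'n::{finite,wellorder}"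
  assumes def: "orthonormal_defining (CARD('n) - CARD('m)) M U \<rho>" and le: "CARD('m) \<le> CARD('n)"
    and \<phi>: "immersion W \<phi>" "\<phi> ` W \<subseteq> M" and u: "u \<in> W" "\<phi> u \<in> U"
  shows "tproj (jac \<phi> u) + outer_sum (map (\<lambda>j. grad (\<rho> j) (\<phi> u)) [0..<CARD('n) - CARD('m)]) = mat 1"
proof -
  let ?p = "CARD('n) - CARD('m)"
  let ?ns = "map (\<lambda>j. grad (\<rho> j) (\<phi> u)) [0..<?p]"
  let ?A = "jac \<phi> u" and ?P = "tproj (jac \<phi> u)" and ?Q = "outer_sum ?ns"
  have "\<phi> u \<in> M" using \<phi>(2) u by auto
  then have on: "orthonormal_list ?ns" using def u(2) by (intro orthonormal_defining_list)
  note Q = outer_sum_props[OF on]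
  have "det (gram ?A) > 0" using \<phi>(1) u(1) by (intro det_gram_pos) (auto simp: immersion_def)
  then have "det (gram ?A) \<noteq> 0" by simp
  note P = tproj_props[OF this]
  have "transpose ?A *v n = 0" if n: "n \<in> set ?ns" for n
  proof -
    obtain j where j: "j < ?p" "n = grad (\<rho> j) (\<phi> u)" using n by auto
    have "grad (\<rho> j) (\<phi> u) \<bullet> partial k \<phi> u = 0" for k
      using \<phi> immersion_differentiable[OF \<phi>(1)] u j(1)
      by (intro orthonormal_defining_tangent[OF def]) (auto simp: immersion_def)
    then show ?thesis
      by (simp add: vec_eq_iff matrix_vector_mult_def transpose_def j(2) inner_vec_def jac_def mult.commute)
  qed
  then have Pn: "?P *v n = 0" if "n \<in> set ?ns" for n
    using that by (simp add: tproj_def matrix_vector_mul_assoc[symmetric])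
  have PQ: "?P ** ?Q = 0"
  proof (simp add: vec_eq_iff, intro allI)
    fix k i
    have "(?P ** ?Q) $ k $ i = (\<Sum>l\<in>UNIV. \<Sum>v\<in>set ?ns. ?P $ k $ l * v $ l * v $ i)"
      by (simp only: matrix_matrix_mult_def outer_sum_def vec_lambda_beta sum_distrib_left mult.assoc)
    also have "\<dots> = (\<Sum>v\<in>set ?ns. (?P *v v) $ k * v $ i)"
      by (subst sum.swap) (simp only: matrix_vector_mult_def vec_lambda_beta sum_distrib_right)
    also have "\<dots> = 0" using Pn by (intro sum.neutral) simp
    finally show "(?P ** ?Q) $ k $ i = 0" .
  qed
  have "?Q ** ?P = transpose (?P ** ?Q)" by (simp only: matrix_transpose_mul P(1) Q(1))
  also have "\<dots> = 0" unfolding PQ by (simp add: transpose_def vec_eq_iff)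
  finally have QP: "?Q ** ?P = 0" .
  show ?thesis
  proof (rule symmetric_idempotent_full_trace)
    have "transpose (?P + ?Q) = transpose ?P + transpose ?Q" by (simp add: transpose_def vec_eq_iff)
    then show "transpose (?P + ?Q) = ?P + ?Q" by (simp only: P(1) Q(1))
    have "(?P + ?Q) ** (?P + ?Q) = ?P ** ?P + ?P ** ?Q + (?Q ** ?P + ?Q ** ?Q)"
      by (simp add: matrix_matrix_mult_def vec_eq_iff distrib_left distrib_right sum.distrib)
    then show "(?P + ?Q) ** (?P + ?Q) = ?P + ?Q" by (simp only: PQ QP P(2) Q(2)) simp
    show "trace (?P + ?Q) = CARD('n)" using le by (simp add: trace_add P(4) Q(3))
  qed
qed

text \<open>So \<open>F_j\<close> is the Hessian of the defining function.\<close>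

lemma bilin_of_ext_d_conormal:
  fixes \<rho> :: "real ^ 'n::{finite,wellorder} \<Rightarrow> real"
  assumes \<rho>: "smooth_on U \<rho>" and x: "x \<in> U"
  shows "bilin_of (ext_d (\<lambda>y. Jop (conormal \<rho> y)) x) v w =
    (\<Sum>k\<in>UNIV. \<Sum>l\<in>UNIV. partial k (partial l \<rho>) x * v $ k * w $ l)"
proof -
  have U: "open U" using \<rho> by (simp add: smooth_on_def)
  have dgrad: "grad \<rho> differentiable (at x)"
    using smooth_on_grad[OF \<rho>, of "Suc 0"] x Ck_on_differentiable by blast
  have bl: "bounded_linear (xiform :: real ^ 'n::_ \<Rightarrow> 'n superalg)"
    using linear_xiform by (simp add: linear_conv_bounded_linear)
  have p: "partial k (\<lambda>y. Jop (conormal \<rho> y)) x = xiform (partial k (grad \<rho>) x)" for k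
  proof -
    have "partial k (\<lambda>y. xiform (grad \<rho> y)) x = partial k (\<lambda>y. Jop (conormal \<rho> y)) x"
    proof (rule partial_cong_open[OF U x])
      show "(\<lambda>y. xiform (grad \<rho> y)) differentiable (at x)"
        using bounded_linear.has_derivative[OF bl has_derivative_partials[OF dgrad]] by (rule differentiableI)
    qed (simp add: conormal_eq_xform smooth_on_differentiable[OF \<rho>])
    then show ?thesis using partial_bounded_linear[OF bl dgrad] by simp
  qed
  have comp: "partial k (grad \<rho>) x $ l = partial k (partial l \<rho>) x" for k l
    using partial_nth[OF dgrad, of k l] by (simp add: grad_def)
  have "ext_d (\<lambda>y. Jop (conormal \<rho> y)) x = (\<Sum>k\<in>UNIV. \<Sum>l\<in>UNIV. partial k (partial l \<rho>) x *\<^sub>R sbasis {k} {l})"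
    unfolding ext_d_def p
    by (simp add: xiform_def wedge.sum_right wedge.scaleR_right dx_wedge_d\<xi> comp)
  moreover have "(\<Sum>k\<in>UNIV. \<Sum>l\<in>UNIV. a k l *\<^sub>R (sbasis {k} {l} :: 'n superalg)) $ ({i}, {j}) = a i j" for a i j
  proof -
    have "(sbasis {k} {l} :: 'n superalg) $ ({i}, {j}) = (if l = j then (if k = i then 1 else 0) else 0)" for k l
      by (auto simp: sbasis_def axis_def)
    note sb = this
    have "(\<Sum>k\<in>UNIV. \<Sum>l\<in>UNIV. a k l *\<^sub>R (sbasis {k} {l} :: 'n superalg)) $ ({i}, {j}) =
        (\<Sum>k\<in>UNIV. \<Sum>l\<in>UNIV. a k l * (sbasis {k} {l} :: 'n superalg) $ ({i}, {j}))" by simp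
    also have "\<dots> = (\<Sum>k\<in>UNIV. \<Sum>l\<in>UNIV. if l = j then (if k = i then a k l else 0) else 0)"
      by (intro sum.cong refl) (simp add: sb)
    finally show ?thesis by simp
  qed
  ultimately show ?thesis by (simp add: bilin_of_def)
qed

text \<open>The choices in the definition are opened up: the trace of the Hessian over any
  orthonormal basis of the tangent space is its contraction with the tangential projection, which
  the chart computes.\<close>

lemma mean_curvature_vector_chart:
  fixes \<phi> :: "real ^ 'm \<Rightarrow> real ^ 'n::{finite,wellorder}"
  assumes M: "submanifold CARD('m) M" and \<phi>: "immersion W \<phi>" "\<phi> ` W \<subseteq> M" and u: "u \<in> W"
  defines "p \<equiv> CARD('n) - CARD('m)"
  obtains U \<rho> where "\<phi> u \<in> U" "orthonormal_defining p M U \<rho>"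
    "mean_curvature_vector CARD('m) M (\<phi> u) =
      (\<Sum>j<p. (\<Sum>k\<in>UNIV. \<Sum>l\<in>UNIV. tproj (jac \<phi> u) $ k $ l * partial k (partial l (\<rho> j)) (\<phi> u)) *\<^sub>R grad (\<rho> j) (\<phi> u))"
proof -
  let ?x = "\<phi> u" and ?P = "tproj (jac \<phi> u)"
  have le: "CARD('m) \<le> CARD('n)" using M by (simp add: submanifold_def)
  have x: "?x \<in> M" using \<phi>(2) u by auto
  define Q where "Q h \<longleftrightarrow> (\<exists>U \<rho>. ?x \<in> U \<and> orthonormal_defining p M U \<rho> \<and>
       h = (\<Sum>j<p. mean_curvature_component p \<rho> j ?x *\<^sub>R dual_vec (conormal (\<rho> j) ?x)))" for h
  have "\<exists>h. Q h" unfolding Q_def p_def using exists_orthonormal_defining[OF M x] by metis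
  then have "Q (SOME h. Q h)" by (rule someI_ex)
  then have "Q (mean_curvature_vector CARD('m) M ?x)"
    unfolding mean_curvature_vector_def Let_def Q_def[abs_def] p_def .
  then obtain U \<rho> where U: "?x \<in> U" and def: "orthonormal_defining p M U \<rho>" and
    H: "mean_curvature_vector CARD('m) M ?x =
      (\<Sum>j<p. mean_curvature_component p \<rho> j ?x *\<^sub>R dual_vec (conormal (\<rho> j) ?x))"
    unfolding Q_def by blast
  have sm: "smooth_on U (\<rho> j)" if "j < p" for j
    using def that unfolding orthonormal_defining_def defining_functions_def by auto
  have dual: "dual_vec (conormal (\<rho> j) ?x) = grad (\<rho> j) ?x" if "j < p" for j
    using sm[OF that] U by (rule dual_vec_conormal)
  define ns where "ns = map (\<lambda>j. grad (\<rho> j) ?x) [0..<p]"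
  have on: "orthonormal_list ns" unfolding ns_def using def x U by (rule orthonormal_defining_list)
  obtain ts where ts: "orthonormal_list (ns @ ts)" "length (ns @ ts) = CARD('n)"
    "span (set ts) = {v. \<forall>n\<in>set ns. n \<bullet> v = 0}"
    using orthonormal_list_extend[OF on] by blast
  have T: "tangent_space p \<rho> ?x = {v. \<forall>n\<in>set ns. n \<bullet> v = 0}"
    unfolding tangent_space_def ns_def by (auto simp: dual)
  have comp: "mean_curvature_component p \<rho> j ?x =
      (\<Sum>k\<in>UNIV. \<Sum>l\<in>UNIV. ?P $ k $ l * partial k (partial l (\<rho> j)) ?x)" if j: "j < p" for j
  proof -
    define b where "b = bilin_of (ext_d (\<lambda>y. Jop (conormal (\<rho> j) y)) ?x)"
    define R where "R r \<longleftrightarrow> (\<exists>B. pairwise orthogonal B \<and> (\<forall>e\<in>B. norm e = 1) \<and>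
      span B = tangent_space p \<rho> ?x \<and> r = (\<Sum>e\<in>B. b e e))" for r
    have nrm: "norm e = 1" if "e \<in> set ts" for e
      using ts(1) that by (auto simp: orthonormal_list_def norm_eq_sqrt_inner)
    have po: "pairwise orthogonal (set ts)"
      using ts(1) by (auto simp: orthonormal_list_def pairwise_def orthogonal_def)
    have "\<exists>r. R r"
      unfolding R_def T ts(3)[symmetric] using nrm po by blast
    then have "R (SOME r. R r)" by (rule someI_ex)
    then have "R (mean_curvature_component p \<rho> j ?x)"
      unfolding mean_curvature_component_def trace_on_def R_def[abs_def] b_def .
    then obtain B where B: "pairwise orthogonal B" "\<And>e. e \<in> B \<Longrightarrow> norm e = 1"
      "span B = {v. \<forall>n\<in>set ns. n \<bullet> v = 0}" "mean_curvature_component p \<rho> j ?x = (\<Sum>e\<in>B. b e e)"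
      unfolding R_def T by blast
    have ind: "independent B" using B(1,2) by (intro pairwise_orthogonal_independent) force+
    then have "finite B" by (rule independent_imp_finite)
    then obtain bl where bl: "set bl = B" "distinct bl" using finite_distinct_list by blast
    have "independent (set ts)" using po nrm by (intro pairwise_orthogonal_independent) force+
    then have "card B = card (set ts)" using ind B(3) ts(3) by (metis dim_span dim_eq_card_independent)
    then have len: "length (ns @ bl) = CARD('n)"
      using ts(1,2) bl distinct_card[of bl] distinct_card[of ts] by (simp add: orthonormal_list_def)
    have BB: "a \<bullet> c = (if a = c then 1 else 0)" if "a \<in> B" "c \<in> B" for a c
    proof (cases "a = c")
      case True
      then show ?thesis using B(2)[OF that(1)] by (simp add: norm_eq_sqrt_inner)
    next
      case False
      then show ?thesis using B(1) that by (auto simp: pairwise_def orthogonal_def)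
    qed
    have nB: "a \<bullet> c = 0 \<and> c \<bullet> a = 0 \<and> a \<noteq> c" if "a \<in> set ns" "c \<in> B" for a c
    proof -
      have "c \<in> span B" using that(2) by (rule span_base)
      then have "a \<bullet> c = 0" using B(3) that(1) by blast
      moreover have "c \<bullet> c = 1" using BB that(2) by simp
      ultimately show ?thesis by (auto simp: inner_commute)
    qed
    have onB: "orthonormal_list (ns @ bl)"
      using on bl BB nB unfolding orthonormal_list_def by (auto simp: disjoint_iff)
    have disj: "set ns \<inter> B = {}" using nB by blast
    \<comment> \<open>Whatever basis \<open>trace_on\<close> picked, its outer sum is the complement
      of that of the normals, hence \<open>?P\<close>.\<close>
    have "outer_sum ns + outer_sum bl = outer_sum (ns @ bl)"
      unfolding outer_sum_def using bl(1) disj \<open>finite B\<close> by (simp add: vec_eq_iff sum.union_disjoint)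
    also have "\<dots> = mat 1" using orthonormal_list_complete[OF onB len]
      by (simp add: outer_sum_def mat_def vec_eq_iff)
    finally have "outer_sum ns + outer_sum bl = mat 1" .
    moreover have "?P + outer_sum ns = mat 1"
      unfolding ns_def p_def using def[unfolded p_def] le \<phi> u U by (rule tproj_plus_normal)
    ultimately have P: "outer_sum bl = ?P" by (metis add.commute add_right_imp_eq)
    have "(\<Sum>e\<in>B. b e e) = (\<Sum>e\<in>B. \<Sum>k\<in>UNIV. \<Sum>l\<in>UNIV. partial k (partial l (\<rho> j)) ?x * (e $ k * e $ l))"
      unfolding b_def bilin_of_ext_d_conormal[OF sm[OF j] U] by (simp add: mult.assoc)
    also have "\<dots> = (\<Sum>k\<in>UNIV. \<Sum>e\<in>B. \<Sum>l\<in>UNIV. partial k (partial l (\<rho> j)) ?x * (e $ k * e $ l))"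
      by (rule sum.swap)
    also have "\<dots> = (\<Sum>k\<in>UNIV. \<Sum>l\<in>UNIV. \<Sum>e\<in>B. partial k (partial l (\<rho> j)) ?x * (e $ k * e $ l))"
      by (intro sum.cong refl) (rule sum.swap)
    also have "\<dots> = (\<Sum>k\<in>UNIV. \<Sum>l\<in>UNIV. ?P $ k $ l * partial k (partial l (\<rho> j)) ?x)"
      unfolding P[symmetric] outer_sum_def bl(1) by (simp add: sum_distrib_left mult.commute)
    finally show ?thesis using B(4) by simp
  qed
  show thesis
  proof (rule that[OF U def])
    show "mean_curvature_vector CARD('m) M ?x =
      (\<Sum>j<p. (\<Sum>k\<in>UNIV. \<Sum>l\<in>UNIV. ?P $ k $ l * partial k (partial l (\<rho> j)) ?x) *\<^sub>R grad (\<rho> j) ?x)"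
      unfolding H by (intro sum.cong refl) (simp add: comp dual)
  qed
qed

lemma tproj_nth:
  "tproj A $ k $ l = (\<Sum>i\<in>UNIV. \<Sum>j\<in>UNIV. matrix_inv (gram A) $ i $ j * (column i A $ k * column j A $ l))"
proof -
  have "tproj A $ k $ l = (\<Sum>j\<in>UNIV. \<Sum>i\<in>UNIV. matrix_inv (gram A) $ i $ j * (column i A $ k * column j A $ l))"
    by (simp add: tproj_def matrix_matrix_mult_def transpose_def column_def sum_distrib_right sum_distrib_left
        algebra_simps)
  then show ?thesis by (subst sum.swap) simp
qed

text \<open>For a normal field \<open>Z\<close>, the derivative of \<open>Z \<bullet> \<partial>\<^sub>i\<phi> = 0\<close> moves the divergence onto \<open>\<partial>\<^sub>j\<partial>\<^sub>i\<phi>\<close>.\<close>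

lemma tdiv_normal_field:
  fixes \<phi> Z :: "real ^ 'm \<Rightarrow> real ^ 'n::{finite,wellorder}"
  assumes M: "submanifold CARD('m) M" and \<phi>: "immersion W \<phi>" "\<phi> ` W \<subseteq> M" and C2: "Ck_on 2 W \<phi>"
    and Z: "\<And>v i. v \<in> W \<Longrightarrow> Z v \<bullet> partial i \<phi> v = 0" "Z differentiable (at u)" and u: "u \<in> W"
  shows "tdiv (jac \<phi> u) (jac Z u) = Z u \<bullet> mean_curvature_vector CARD('m) M (\<phi> u)"
proof -
  let ?p = "CARD('n) - CARD('m)" and ?P = "tproj (jac \<phi> u)" and ?g = "matrix_inv (gram (jac \<phi> u))"
  have le: "CARD('m) \<le> CARD('n)" using M by (simp add: submanifold_def)
  have W: "open W" using \<phi>(1) by (simp add: immersion_def)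
  have d\<phi>: "\<phi> differentiable (at v)" "partial i \<phi> differentiable (at v)" if "v \<in> W" for v i
    using C2 that by (auto simp: numeral_2_eq_2)
  have C2': "Ck_on 2 W \<phi>" "\<And>v. v \<in> W \<Longrightarrow> \<phi> differentiable (at v)" using C2 d\<phi> by auto
  obtain U \<rho> where U: "\<phi> u \<in> U" and def: "orthonormal_defining ?p M U \<rho>" and
    H: "mean_curvature_vector CARD('m) M (\<phi> u) =
      (\<Sum>j<?p. (\<Sum>k\<in>UNIV. \<Sum>l\<in>UNIV. ?P $ k $ l * partial k (partial l (\<rho> j)) (\<phi> u)) *\<^sub>R grad (\<rho> j) (\<phi> u))"
    using mean_curvature_vector_chart[OF M \<phi> u] .
  have opU: "open U" and sm: "\<And>j. j < ?p \<Longrightarrow> smooth_on U (\<rho> j)"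
    using def unfolding orthonormal_defining_def defining_functions_def by auto
  define W' where "W' = W \<inter> \<phi> -` U"
  have W': "open W'" "u \<in> W'" "W' \<subseteq> W" "\<phi> ` W' \<subseteq> U"
    unfolding W'_def using continuous_open_preimage[OF immersion_continuous_on[OF \<phi>(1)] W opU] u U by auto
  \<comment> \<open>The product rule for \<open>Y \<bullet> partial k \<phi> = 0\<close>. It is used
    for the given field \<open>Z\<close> and for the unit normals.\<close>
  have perp: "Y u \<bullet> partial i (partial k \<phi>) u = - (partial i Y u \<bullet> partial k \<phi> u)"
    if "\<And>v. v \<in> W' \<Longrightarrow> Y v \<bullet> partial k \<phi> v = 0" "Y differentiable (at u)" for Y i k
  proof -
    have D: "((\<lambda>v. Y v \<bullet> partial k \<phi> v) has_derivative (\<lambda>h. Y u \<bullet> (\<Sum>i\<in>UNIV. h $ i *\<^sub>R partial i (partial k \<phi>) u) +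
        (\<Sum>i\<in>UNIV. h $ i *\<^sub>R partial i Y u) \<bullet> partial k \<phi> u)) (at u)"
      using that(2) d\<phi>[OF u] by (intro has_derivative_inner has_derivative_partials)
    have "partial i (\<lambda>v. Y v \<bullet> partial k \<phi> v) u = partial i (\<lambda>_. 0) u"
      using that(1) D by (intro partial_cong_open[OF W'(1,2)]) (auto simp: differentiable_def)
    then have "Y u \<bullet> partial i (partial k \<phi>) u + partial i Y u \<bullet> partial k \<phi> u = 0"
      using partial_eqI[OF D, of i] by (simp add: sum_axis_scaleR partial_def)
    then show ?thesis by simp
  qed
  \<comment> \<open>The normal components of the second derivatives of \<open>\<phi>\<close> are
    minus the Hessians on tangent vectors; contracted with \<open>?g\<close> they give minus
    \<open>H_j\<close>. The second minus sign comes from \<open>perp\<close> for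
    \<open>Z\<close>.\<close>
  have nij: "grad (\<rho> j) (\<phi> u) \<bullet> partial i (partial k \<phi>) u =
      - (\<Sum>q\<in>UNIV. \<Sum>l\<in>UNIV. partial i \<phi> u $ q * partial k \<phi> u $ l * partial q (partial l (\<rho> j)) (\<phi> u))"
    if j: "j < ?p" for j i k
  proof -
    have dg: "grad (\<rho> j) differentiable (at (\<phi> u))"
      using smooth_on_grad[OF sm[OF j], of "Suc 0"] U Ck_on_differentiable by blast
    have dY: "(\<lambda>v. grad (\<rho> j) (\<phi> v)) differentiable (at u)"
      using has_derivative_compose_partials[OF dg d\<phi>(1)[OF u]] by (rule differentiableI)
    have "grad (\<rho> j) (\<phi> v) \<bullet> partial k \<phi> v = 0" if "v \<in> W'" for v
      using that W' by (intro orthonormal_defining_tangent[OF def W C2'(2) \<phi>(2) _ _ j]) auto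
    from perp[OF this dY, of i]
    have "grad (\<rho> j) (\<phi> u) \<bullet> partial i (partial k \<phi>) u =
        - ((\<Sum>q\<in>UNIV. partial i \<phi> u $ q *\<^sub>R partial q (grad (\<rho> j)) (\<phi> u)) \<bullet> partial k \<phi> u)"
      unfolding partial_compose[OF dg d\<phi>(1)[OF u]] .
    moreover have "partial q (grad (\<rho> j)) (\<phi> u) $ l = partial q (partial l (\<rho> j)) (\<phi> u)" for q l
      using partial_nth[OF dg, of q l] by (simp add: grad_def)
    ultimately show ?thesis
      by (subst sum.swap) (simp add: inner_sum_left inner_vec_def sum_distrib_left mult_ac)
  qed
  have sumg: "(\<Sum>i\<in>UNIV. \<Sum>k\<in>UNIV. ?g $ i $ k * (grad (\<rho> j) (\<phi> u) \<bullet> partial i (partial k \<phi>) u)) =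
      - (\<Sum>q\<in>UNIV. \<Sum>l\<in>UNIV. ?P $ q $ l * partial q (partial l (\<rho> j)) (\<phi> u))" (is "?lhs = - ?rhs")
    if j: "j < ?p" for j
  proof -
    let ?T = "\<lambda>i k q l. ?g $ i $ k * (partial i \<phi> u $ q * partial k \<phi> u $ l) * partial q (partial l (\<rho> j)) (\<phi> u)"
    have "?lhs = - (\<Sum>i\<in>UNIV. \<Sum>k\<in>UNIV. \<Sum>q\<in>UNIV. \<Sum>l\<in>UNIV. ?T i k q l)"
      by (simp add: nij[OF j] sum_negf sum_distrib_left mult.assoc)
    also have "(\<Sum>i\<in>UNIV. \<Sum>k\<in>UNIV. \<Sum>q\<in>UNIV. \<Sum>l\<in>UNIV. ?T i k q l) = (\<Sum>i\<in>UNIV. \<Sum>q\<in>UNIV. \<Sum>k\<in>UNIV. \<Sum>l\<in>UNIV. ?T i k q l)"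
      by (intro sum.cong refl) (rule sum.swap)
    also have "\<dots> = (\<Sum>q\<in>UNIV. \<Sum>i\<in>UNIV. \<Sum>k\<in>UNIV. \<Sum>l\<in>UNIV. ?T i k q l)" by (rule sum.swap)
    also have "\<dots> = (\<Sum>q\<in>UNIV. \<Sum>i\<in>UNIV. \<Sum>l\<in>UNIV. \<Sum>k\<in>UNIV. ?T i k q l)"
      by (intro sum.cong refl) (rule sum.swap)
    also have "\<dots> = (\<Sum>q\<in>UNIV. \<Sum>l\<in>UNIV. \<Sum>i\<in>UNIV. \<Sum>k\<in>UNIV. ?T i k q l)"
      by (intro sum.cong refl) (rule sum.swap)
    also have "\<dots> = ?rhs"
      by (simp add: tproj_nth column_jac sum_distrib_right)
    finally show ?thesis .
  qed
  let ?ns = "map (\<lambda>j. grad (\<rho> j) (\<phi> u)) [0..<?p]"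
  have on: "orthonormal_list ?ns"
    using \<phi>(2) u by (intro orthonormal_defining_list[OF def _ U]) auto
  then have inj: "inj_on (\<lambda>j. grad (\<rho> j) (\<phi> u)) {0..<?p}" by (simp add: orthonormal_list_def distinct_map)
  have ZP: "?P *v Z u = 0"
  proof -
    have "transpose (jac \<phi> u) *v Z u = 0"
      using Z(1)[OF u] by (simp add: vec_eq_iff matrix_vector_mult_def transpose_def inner_vec_def jac_def mult.commute)
    then show ?thesis by (simp add: tproj_def matrix_vector_mul_assoc[symmetric])
  qed
  have Zexp: "Z u = (\<Sum>j<?p. (Z u \<bullet> grad (\<rho> j) (\<phi> u)) *\<^sub>R grad (\<rho> j) (\<phi> u))"
  proof -
    have "Z u = (?P + outer_sum ?ns) *v Z u"
      unfolding tproj_plus_normal[OF def le \<phi> u U] by simp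
    also have "\<dots> = outer_sum ?ns *v Z u" by (simp only: matrix_vector_mult_add_rdistrib ZP add_0_left)
    also have "\<dots> = (\<Sum>v\<in>set ?ns. (Z u \<bullet> v) *\<^sub>R v)"
    proof (rule vec_eq_iff[THEN iffD2], rule allI)
      fix k
      have "(outer_sum ?ns *v Z u) $ k = (\<Sum>l\<in>UNIV. \<Sum>v\<in>set ?ns. (Z u $ l * v $ l) * v $ k)"
        unfolding matrix_vector_mult_def outer_sum_def vec_lambda_beta sum_distrib_right
        by (intro sum.cong refl) (simp only: mult_ac)
      also have "\<dots> = (\<Sum>v\<in>set ?ns. (Z u \<bullet> v) * v $ k)"
        by (subst sum.swap) (simp only: inner_vec_def inner_real_def sum_distrib_right)
      finally show "(outer_sum ?ns *v Z u) $ k = (\<Sum>v\<in>set ?ns. (Z u \<bullet> v) *\<^sub>R v) $ k"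
        by (simp only: sum_component vector_scaleR_component real_scaleR_def)
    qed
    also have "\<dots> = (\<Sum>j<?p. (Z u \<bullet> grad (\<rho> j) (\<phi> u)) *\<^sub>R grad (\<rho> j) (\<phi> u))"
      using sum.reindex[OF inj, of "\<lambda>v. (Z u \<bullet> v) *\<^sub>R v"] by (simp add: lessThan_atLeast0)
    finally show ?thesis .
  qed
  have "tdiv (jac \<phi> u) (jac Z u) = (\<Sum>i\<in>UNIV. \<Sum>k\<in>UNIV. ?g $ i $ k * (partial i Z u \<bullet> partial k \<phi> u))"
    by (simp add: tdiv_sum column_jac inner_commute)
  also have "\<dots> = (\<Sum>i\<in>UNIV. \<Sum>k\<in>UNIV. ?g $ i $ k * - (Z u \<bullet> partial i (partial k \<phi>) u))"
    using perp[of Z, OF Z(1) Z(2)] W'(3) by (simp add: subset_iff)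
  also have "\<dots> = - (\<Sum>i\<in>UNIV. \<Sum>k\<in>UNIV. \<Sum>j<?p. (Z u \<bullet> grad (\<rho> j) (\<phi> u)) *
      (?g $ i $ k * (grad (\<rho> j) (\<phi> u) \<bullet> partial i (partial k \<phi>) u)))"
  proof -
    have e: "Z u \<bullet> y = (\<Sum>j<?p. (Z u \<bullet> grad (\<rho> j) (\<phi> u)) * (grad (\<rho> j) (\<phi> u) \<bullet> y))" for y
      by (subst Zexp) (simp only: inner_sum_left inner_scaleR_left)
    have f: "c * (Z u \<bullet> y) = (\<Sum>j<?p. (Z u \<bullet> grad (\<rho> j) (\<phi> u)) * (c * (grad (\<rho> j) (\<phi> u) \<bullet> y)))" for c y
    proof -
      have "c * (Z u \<bullet> y) = c * (\<Sum>j<?p. (Z u \<bullet> grad (\<rho> j) (\<phi> u)) * (grad (\<rho> j) (\<phi> u) \<bullet> y))"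
        by (rule arg_cong[OF e])
      also have "\<dots> = (\<Sum>j<?p. (Z u \<bullet> grad (\<rho> j) (\<phi> u)) * (c * (grad (\<rho> j) (\<phi> u) \<bullet> y)))"
        by (simp add: sum_distrib_left mult.left_commute)
      finally show ?thesis .
    qed
    show ?thesis
      unfolding mult_minus_right sum_negf by (intro arg_cong[of _ _ uminus] sum.cong refl f)
  qed
  also have "\<dots> = - (\<Sum>i\<in>UNIV. \<Sum>j<?p. \<Sum>k\<in>UNIV. (Z u \<bullet> grad (\<rho> j) (\<phi> u)) *
      (?g $ i $ k * (grad (\<rho> j) (\<phi> u) \<bullet> partial i (partial k \<phi>) u)))"
    by (intro arg_cong[of _ _ uminus] sum.cong refl) (rule sum.swap)
  also have "\<dots> = - (\<Sum>j<?p. \<Sum>i\<in>UNIV. \<Sum>k\<in>UNIV. (Z u \<bullet> grad (\<rho> j) (\<phi> u)) *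
      (?g $ i $ k * (grad (\<rho> j) (\<phi> u) \<bullet> partial i (partial k \<phi>) u)))"
    by (intro arg_cong[of _ _ uminus]) (rule sum.swap)
  also have "\<dots> = (\<Sum>j<?p. (Z u \<bullet> grad (\<rho> j) (\<phi> u)) *
      - (\<Sum>i\<in>UNIV. \<Sum>k\<in>UNIV. ?g $ i $ k * (grad (\<rho> j) (\<phi> u) \<bullet> partial i (partial k \<phi>) u)))"
    by (simp only: sum_distrib_left[symmetric] mult_minus_right sum_negf)
  also have "\<dots> = Z u \<bullet> mean_curvature_vector CARD('m) M (\<phi> u)"
    unfolding H by (simp add: inner_sum_right sumg mult.commute)
  finally show ?thesis .
qed

subsection \<open>The divergence theorem in a parametrization\<close>

text \<open>The mean value inequality on the convex set \<open>S\<close> bounds the difference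
  quotients by \<open>g\<close>, so dominated convergence applies along any sequence. Working within
  \<open>S\<close> includes one-sided derivatives.\<close>

lemma DERIV_integral_dominated:
  fixes q :: "real \<Rightarrow> 'a \<Rightarrow> real"
  assumes S: "convex S" "t0 \<in> S"
    and int: "\<And>t. t \<in> S \<Longrightarrow> integrable M (q t)"
    and der: "\<And>t u. t \<in> S \<Longrightarrow> u \<in> space M \<Longrightarrow> ((\<lambda>t. q t u) has_real_derivative q' t u) (at t within S)"
    and bd: "\<And>t u. t \<in> S \<Longrightarrow> u \<in> space M \<Longrightarrow> \<bar>q' t u\<bar> \<le> g u" and g: "integrable M g"
  shows "((\<lambda>t. LINT u|M. q t u) has_real_derivative (LINT u|M. q' t0 u)) (at t0 within S)"
  unfolding has_field_derivative_iff tendsto_at_iff_sequentially comp_def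
proof (intro allI impI)
  fix X assume X: "\<forall>i. X i \<in> S - {t0}" "X \<longlonglongrightarrow> t0"
  have "(\<lambda>i. LINT u|M. (q (X i) u - q t0 u) / (X i - t0)) \<longlonglongrightarrow> (LINT u|M. q' t0 u)"
  proof (rule integral_dominated_convergence[where w = g])
    show "integrable M g" by fact
    show meas: "(\<lambda>u. (q (X i) u - q t0 u) / (X i - t0)) \<in> borel_measurable M" for i
      using int[of "X i"] int[OF S(2)] X(1) by auto
    have lim: "(\<lambda>i. (q (X i) u - q t0 u) / (X i - t0)) \<longlonglongrightarrow> q' t0 u" if "u \<in> space M" for u
      using der[OF S(2) that] X
      unfolding has_field_derivative_iff tendsto_at_iff_sequentially comp_def by blast
    show "q' t0 \<in> borel_measurable M" by (rule borel_measurable_LIMSEQ_metric[OF meas lim])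
    show "AE u in M. (\<lambda>i. (q (X i) u - q t0 u) / (X i - t0)) \<longlonglongrightarrow> q' t0 u"
      using lim by (rule AE_I2)
    show "AE u in M. norm ((q (X i) u - q t0 u) / (X i - t0)) \<le> g u" for i
    proof (rule AE_I2)
      fix u assume u: "u \<in> space M"
      have "norm (q (X i) u - q t0 u) \<le> g u * norm (X i - t0)"
        using X(1) S u bd by (intro field_differentiable_bound[where f' = "\<lambda>t. q' t u" and S = S]) (auto intro: der)
      moreover have "X i - t0 \<noteq> 0" using X(1) by auto
      ultimately show "norm ((q (X i) u - q t0 u) / (X i - t0)) \<le> g u"
        by (simp add: divide_le_eq abs_divide)
    qed
  qed
  moreover have "(LINT u|M. (q (X i) u - q t0 u) / (X i - t0)) = ((LINT u|M. q (X i) u) - (LINT u|M. q t0 u)) / (X i - t0)" for i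
    using int[of "X i"] int[OF S(2)] X(1) by simp
  ultimately show "(\<lambda>i. ((LINT u|M. q (X i) u) - (LINT u|M. q t0 u)) / (X i - t0)) \<longlonglongrightarrow> (LINT u|M. q' t0 u)"
    by (simp only:)
qed

lemma integrable_continuous_compact_support:
  fixes f :: "'a::euclidean_space \<Rightarrow> real"
  assumes "continuous_on UNIV f" "compact K" "\<And>x. x \<notin> K \<Longrightarrow> f x = 0"
  shows "integrable lborel f"
proof -
  have "set_integrable lborel K f"
    unfolding set_integrable_def using assms(2) continuous_on_subset[OF assms(1) subset_UNIV]
    by (rule borel_integrable_compact)
  moreover have "(\<lambda>x. indicator K x *\<^sub>R f x) = f" using assms(3) by (auto simp: fun_eq_iff indicator_def)
  ultimately show ?thesis by (simp add: set_integrable_def)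
qed

text \<open>By translation invariance \<open>\<integral> w(u + t e\<^sub>k) du\<close> does not depend on \<open>t\<close>.\<close>

lemma integral_partial_eq_0:
  fixes w :: "real ^ 'm \<Rightarrow> real"
  assumes w: "Ck_on 1 UNIV w" and K: "compact K" "\<And>x. x \<notin> K \<Longrightarrow> w x = 0"
  shows "(LINT u|lborel. partial k w u) = 0"
proof -
  let ?e = "axis k 1 :: real ^ 'm"
  have d: "w differentiable (at u)" for u using w by (auto simp: Ck_on_1)
  have c: "continuous_on UNIV (partial k w)" using w by (auto simp: Ck_on_1)
  have cw: "continuous_on UNIV w" using Ck_on_continuous[OF w] .
  have p0: "partial k w x = 0" if "x \<notin> K" for x
  proof -
    have "partial k w x = partial k (\<lambda>_. 0) x"
      using that K compact_imp_closed[OF K(1)] by (intro partial_cong_open[of "- K"] d) auto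
    then show ?thesis by (simp add: partial_def)
  qed
  obtain R where R: "\<And>x. x \<in> K \<Longrightarrow> norm x \<le> R" using compact_imp_bounded[OF K(1)] bounded_iff by blast
  \<comment> \<open>Translations by \<open>t\<close> with \<open>\<bar>t\<bar> \<le> 1\<close> keep
    the support in this ball, which gives one integrable bound for all these
    \<open>t\<close>.\<close>
  let ?B = "cball (0 :: real ^ 'm) (R + 1)"
  have far: "u + t *\<^sub>R ?e \<notin> K" if "u \<notin> ?B" "\<bar>t\<bar> \<le> 1" for u t
  proof
    assume "u + t *\<^sub>R ?e \<in> K"
    then have "norm (u + t *\<^sub>R ?e) \<le> R" by (rule R)
    moreover have "norm u \<le> norm (u + t *\<^sub>R ?e) + norm (t *\<^sub>R ?e)"
      by (metis add_diff_cancel norm_triangle_ineq4)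
    moreover have "norm (t *\<^sub>R ?e) \<le> 1" using that(2) by (simp add: norm_axis_1)
    ultimately show False using that(1) by simp
  qed
  have "compact (partial k w ` K)" using K(1) c by (intro compact_continuous_image continuous_on_subset[OF c]) auto
  then obtain C where C: "\<And>x. x \<in> K \<Longrightarrow> \<bar>partial k w x\<bar> \<le> C"
    using compact_imp_bounded bounded_iff by (metis (no_types, lifting) image_eqI real_norm_def)
  have C0: "\<bar>partial k w x\<bar> \<le> max C 0" for x
    using C[of x] p0[of x] by (cases "x \<in> K") auto
  define q where "q t u = w (u + t *\<^sub>R ?e)" for t u
  have der: "((\<lambda>t. q t u) has_real_derivative partial k w (u + t *\<^sub>R ?e)) (at t within {-1..1})" for t u
    unfolding q_def has_real_derivative_iff_has_vector_derivative
    by (rule has_vector_derivative_at_within[OF has_vector_derivative_along_axis[where f = w, OF d]])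
  have iw: "integrable lborel w" using cw K by (rule integrable_continuous_compact_support)
  have qint: "integrable lborel (q t)" "(LINT u|lborel. q t u) = (LINT u|lborel. w u)" for t
  proof -
    let ?c = "t *\<^sub>R ?e"
    have m: "(+) ?c \<in> lborel \<rightarrow>\<^sub>M borel" "w \<in> borel_measurable borel"
      using borel_measurable_continuous_onI[OF cw] by auto
    have q: "q t = (\<lambda>u. w (?c + u))" by (simp add: q_def fun_eq_iff add.commute)
    show "integrable lborel (q t)"
      unfolding q using integrable_distr_eq[OF m] iw by (simp add: lborel_distr_plus)
    show "(LINT u|lborel. q t u) = (LINT u|lborel. w u)"
      unfolding q using integral_distr[OF m] by (simp add: lborel_distr_plus)
  qed
  have "((\<lambda>t. LINT u|lborel. q t u) has_real_derivative (LINT u|lborel. partial k w (u + 0 *\<^sub>R ?e))) (at 0 within {-1..1})"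
  proof (rule DERIV_integral_dominated[where g = "\<lambda>u. max C 0 * indicator ?B u" and q' = "\<lambda>t u. partial k w (u + t *\<^sub>R ?e)"])
    show "\<bar>partial k w (u + t *\<^sub>R ?e)\<bar> \<le> max C 0 * indicator ?B u" if "t \<in> {-1..1}" for t u
      using C0[of "u + t *\<^sub>R ?e"] p0[OF far[of u t]] that by (cases "u \<in> ?B") (auto simp: indicator_def)
    show "integrable lborel (\<lambda>u. max C 0 * indicator ?B u)"
      using emeasure_lborel_cball_finite[of "0 :: real ^ 'm" "R + 1"]
      by (intro integrable_mult_right integrable_real_indicator) auto
  qed (auto simp: qint der)
  then have "((\<lambda>t. LINT u|lborel. w u) has_real_derivative (LINT u|lborel. partial k w u)) (at (0::real) within {-1..1})"
    by (simp only: qint) simp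
  then have "((\<lambda>t. LINT u|lborel. w u) has_real_derivative (LINT u|lborel. partial k w u)) (at (0::real))"
    by (simp add: at_within_interior[of "0::real" "{-1..1}"])
  then show ?thesis using DERIV_unique DERIV_const by blast
qed

lemma tdiv_mult_self:
  fixes A :: "real ^ 'm ^ 'n"
  assumes "det (gram A) \<noteq> 0"
  shows "tdiv A (A ** C) = trace C"
proof -
  have "matrix_inv (gram A) ** (transpose A ** (A ** C)) = (matrix_inv (gram A) ** gram A) ** C"
    by (simp add: gram_def matrix_mul_assoc)
  then show ?thesis using matrix_inv_mult(2)[OF assms] by (simp add: tdiv_def)
qed

lemma tdiv_add: "tdiv A (B + C) = tdiv A B + tdiv A C"
  by (simp add: tdiv_def matrix_add_ldistrib trace_add)

lemma linear_tdiv: "linear (tdiv A)"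
  by (intro linearI tdiv_add) (simp add: tdiv_sum column_def inner_vec_def sum_distrib_left algebra_simps)

lemma Ck_on_area_jac:
  assumes \<phi>: "immersion W \<phi>" and C2: "Ck_on 2 W \<phi>"
  shows "Ck_on 1 W (\<lambda>u. area (jac \<phi> u))"
proof -
  have W: "open W" using \<phi> by (simp add: immersion_def)
  have C1: "Ck_on 1 W (partial i \<phi>)" for i using C2 by (simp add: numeral_2_eq_2)
  have "Ck_on 1 W (\<lambda>u. gram (jac \<phi> u) $ i $ j)" for i j
    unfolding gram_nth column_jac using C1 by (intro Ck_on_inner W)
  then show ?thesis
    unfolding area_def using \<phi>
    by (intro Ck_on_sqrt Ck_on_det W det_gram_pos) (auto simp: immersion_def)
qed

text \<open>Along a coordinate line the derivative of \<open>jac \<phi>\<close> is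
  \<open>jac (partial k \<phi>)\<close> by symmetry of second derivatives, so the variation of area
  applies to the coordinate fields.\<close>

lemma partial_area_jac:
  assumes \<phi>: "immersion W \<phi>" and C2: "Ck_on 2 W \<phi>" and u: "u \<in> W"
  shows "partial k (\<lambda>u. area (jac \<phi> u)) u = area (jac \<phi> u) * tdiv (jac \<phi> u) (jac (partial k \<phi>) u)"
proof -
  have W: "open W" using \<phi> by (simp add: immersion_def)
  have C1: "Ck_on 1 W (partial i \<phi>)" for i using C2 by (simp add: numeral_2_eq_2)
  let ?e = "axis k 1 :: real ^ 'a"
  have d2: "partial j \<phi> differentiable (at u)" for j using C1[of j] u by (simp add: Ck_on_1)
  have "((\<lambda>s. jac \<phi> (u + s *\<^sub>R ?e) $ i $ j) has_real_derivative jac (partial k \<phi>) u $ i $ j) (at 0)" for i j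
  proof -
    have "((\<lambda>s. partial j \<phi> (u + s *\<^sub>R ?e)) has_vector_derivative partial k (partial j \<phi>) (u + 0 *\<^sub>R ?e)) (at 0)"
      using d2 by (intro has_vector_derivative_along_axis[where f = "partial j \<phi>"]) simp
    then have "((\<lambda>s. partial j \<phi> (u + s *\<^sub>R ?e)) has_derivative (\<lambda>h. h *\<^sub>R partial k (partial j \<phi>) u)) (at 0)"
      by (simp add: has_vector_derivative_def)
    from bounded_linear.has_derivative[OF bounded_linear_vec_nth[of i] this]
    show ?thesis
      using partial_commute[OF W u C2, of j k]
      by (simp add: jac_def has_field_derivative_def mult_commute_abs)
  qed
  from area_derivative[of "\<lambda>s. jac \<phi> (u + s *\<^sub>R ?e)", OF this] \<phi> u
  have "((\<lambda>s. area (jac \<phi> (u + s *\<^sub>R ?e))) has_real_derivative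
      area (jac \<phi> u) * tdiv (jac \<phi> u) (jac (partial k \<phi>) u)) (at 0)"
    by (simp add: immersion_def)
  moreover have "((\<lambda>s. area (jac \<phi> (u + s *\<^sub>R ?e))) has_real_derivative partial k (\<lambda>u. area (jac \<phi> u)) u) (at 0)"
  proof -
    have "(\<lambda>u. area (jac \<phi> u)) differentiable (at (u + 0 *\<^sub>R ?e))"
      using Ck_on_area_jac[OF \<phi> C2] u by (simp add: Ck_on_1)
    from has_vector_derivative_along_axis[OF this]
    show ?thesis by (simp add: has_real_derivative_iff_has_vector_derivative)
  qed
  ultimately show ?thesis
    by (rule DERIV_unique[symmetric])
qed

text \<open>The classical coordinate formula for the Riemannian divergence: the area density times
  the divergence is the Euclidean divergence of the density times \<open>\<zeta>\<close>.\<close>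

lemma tdiv_tangential_field:
  fixes \<phi> :: "real ^ 'm \<Rightarrow> real ^ 'n" and \<zeta> :: "real ^ 'm \<Rightarrow> real ^ 'm"
  assumes \<phi>: "immersion W \<phi>" and C2: "Ck_on 2 W \<phi>" and \<zeta>: "Ck_on 1 W \<zeta>" and u: "u \<in> W"
  shows "area (jac \<phi> u) * tdiv (jac \<phi> u) (jac (\<lambda>u. jac \<phi> u *v \<zeta> u) u) =
    (\<Sum>k\<in>UNIV. partial k (\<lambda>u. area (jac \<phi> u) * \<zeta> u $ k) u)"
proof -
  have W: "open W" using \<phi> by (simp add: immersion_def)
  have d2: "partial j \<phi> differentiable (at u)" for j using C2 u by (auto simp: numeral_2_eq_2)
  have d\<zeta>: "\<zeta> differentiable (at u)" using \<zeta> u by (simp add: Ck_on_1)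
  have d\<zeta>k: "(\<lambda>u. \<zeta> u $ k) differentiable (at u)" for k
    using bounded_linear.has_derivative[OF bounded_linear_vec_nth has_derivative_partials[OF d\<zeta>]]
    by (rule differentiableI)
  have p\<zeta>: "partial j (\<lambda>u. \<zeta> u $ k) u = partial j \<zeta> u $ k" for j k by (rule partial_nth[OF d\<zeta>])
  define C where "C = (\<chi> k j. partial j \<zeta> u $ k)"
  have der: "((\<lambda>u. jac \<phi> u *v \<zeta> u) has_derivative (\<lambda>h. \<Sum>k\<in>UNIV. \<zeta> u $ k *\<^sub>R (\<Sum>j\<in>UNIV. h $ j *\<^sub>R partial j (partial k \<phi>) u) +
      (\<Sum>j\<in>UNIV. h $ j *\<^sub>R partial j (\<lambda>u. \<zeta> u $ k) u) *\<^sub>R partial k \<phi> u)) (at u)"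
    unfolding jac_mult by (intro has_derivative_sum has_derivative_scaleR has_derivative_partials d\<zeta>k d2)
  have jacY: "jac (\<lambda>u. jac \<phi> u *v \<zeta> u) u = (\<Sum>k\<in>UNIV. \<zeta> u $ k *\<^sub>R jac (partial k \<phi>) u) + jac \<phi> u ** C"
  proof -
    have "partial j (\<lambda>u. jac \<phi> u *v \<zeta> u) u = (\<Sum>k\<in>UNIV. \<zeta> u $ k *\<^sub>R partial j (partial k \<phi>) u + partial j \<zeta> u $ k *\<^sub>R partial k \<phi> u)" for j
      using partial_eqI[OF der, of j] by (simp add: sum_axis_scaleR sum_axis_mult p\<zeta>)
    then show ?thesis
      by (simp add: vec_eq_iff jac_def C_def matrix_matrix_mult_def sum.distrib mult.commute)
  qed
  have det: "det (gram (jac \<phi> u)) \<noteq> 0"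
    using det_gram_pos[of "jac \<phi> u"] \<phi> u by (force simp: immersion_def)
  have "tdiv (jac \<phi> u) (jac (\<lambda>u. jac \<phi> u *v \<zeta> u) u) =
      (\<Sum>k\<in>UNIV. \<zeta> u $ k * tdiv (jac \<phi> u) (jac (partial k \<phi>) u)) + (\<Sum>k\<in>UNIV. partial k \<zeta> u $ k)"
    unfolding jacY tdiv_add tdiv_mult_self[OF det] linear_sum[OF linear_tdiv] linear_cmul[OF linear_tdiv]
    by (simp add: trace_def C_def)
  moreover have "partial k (\<lambda>u. area (jac \<phi> u) * \<zeta> u $ k) u =
      area (jac \<phi> u) * (\<zeta> u $ k * tdiv (jac \<phi> u) (jac (partial k \<phi>) u)) + area (jac \<phi> u) * partial k \<zeta> u $ k" for k
  proof -
    have da: "(\<lambda>u. area (jac \<phi> u)) differentiable (at u)"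
      using Ck_on_area_jac[OF \<phi> C2] u by (simp add: Ck_on_1)
    have "((\<lambda>u. area (jac \<phi> u) * \<zeta> u $ k) has_derivative
        (\<lambda>h. area (jac \<phi> u) * (\<Sum>j\<in>UNIV. h $ j *\<^sub>R partial j (\<lambda>u. \<zeta> u $ k) u) +
          (\<Sum>j\<in>UNIV. h $ j *\<^sub>R partial j (\<lambda>u. area (jac \<phi> u)) u) * \<zeta> u $ k)) (at u)"
      by (intro has_derivative_mult has_derivative_partials da d\<zeta>k)
    from partial_eqI[OF this, of k] show ?thesis
      by (simp add: sum_axis_mult p\<zeta> partial_area_jac[OF \<phi> C2 u])
  qed
  ultimately show ?thesis by (simp add: sum.distrib sum_distrib_left distrib_left)
qed

text \<open>Split \<open>Z\<close> into a tangential and a normal part. The tangential part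
  contributes an integral of partials of compactly supported functions, which is 0; the normal part
  contributes \<open>N \<bullet> H = Z \<bullet> H\<close>.\<close>

lemma divergence_theorem_chart:
  fixes \<phi> Z :: "real ^ 'm \<Rightarrow> real ^ 'n::{finite,wellorder}" and H :: "real ^ 'n::_ \<Rightarrow> real ^ 'n::_"
  assumes M: "submanifold CARD('m) M" and \<phi>: "immersion W \<phi>" "\<phi> ` W \<subseteq> M" and C2: "Ck_on 2 W \<phi>"
    and Z: "Ck_on 1 W Z" and K: "compact K" "K \<subseteq> W" "\<And>u. u \<in> W \<Longrightarrow> u \<notin> K \<Longrightarrow> Z u = 0"
    and H: "continuous_on UNIV H" "\<And>u. u \<in> W \<Longrightarrow> H (\<phi> u) = mean_curvature_vector CARD('m) M (\<phi> u)"
      "\<And>u k. u \<in> W \<Longrightarrow> H (\<phi> u) \<bullet> partial k \<phi> u = 0"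
  shows "(LINT u|lborel. indicator W u * (area (jac \<phi> u) * tdiv (jac \<phi> u) (jac Z u))) =
    (LINT u|lborel. indicator W u * (area (jac \<phi> u) * (Z u \<bullet> H (\<phi> u))))"
proof -
  have W: "open W" using \<phi>(1) by (simp add: immersion_def)
  let ?A = "jac \<phi>" and ?g = "\<lambda>u. matrix_inv (gram (jac \<phi> u))"
  have C1: "Ck_on 1 W (partial i \<phi>)" for i using C2 by (simp add: numeral_2_eq_2)
  have det: "det (gram (?A u)) \<noteq> 0" if "u \<in> W" for u
    using det_gram_pos[of "?A u"] \<phi>(1) that by (force simp: immersion_def)
  have g1: "Ck_on 1 W (\<lambda>u. ?g u $ i $ j)" for i j
  proof (rule Ck_on_matrix_inv[OF W _ det])
    show "Ck_on 1 W (\<lambda>u. gram (?A u) $ i $ j)" for i j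
      unfolding gram_nth column_jac using C1 by (intro Ck_on_inner W)
  qed
  \<comment> \<open>The coordinates of the tangential projection of \<open>Z\<close> in the basis of
    partials of \<open>\<phi>\<close>.\<close>
  define \<zeta> where "\<zeta> u = (\<chi> i. \<Sum>j\<in>UNIV. ?g u $ i $ j * (partial j \<phi> u \<bullet> Z u))" for u
  have \<zeta>1: "Ck_on 1 W \<zeta>"
    unfolding \<zeta>_def[abs_def]
    using W by (intro Ck_on_vecI) (simp_all only: vec_lambda_beta, intro Ck_on_sum Ck_on_mult Ck_on_inner W g1 C1 Z)
  have A\<zeta>: "?A u *v \<zeta> u = tproj (?A u) *v Z u" for u
  proof -
    have 1: "(transpose (?A u) *v Z u) $ j = partial j \<phi> u \<bullet> Z u" for j
      by (simp add: matrix_vector_mult_def transpose_def jac_def inner_vec_def del: transpose_matrix_vector)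
    have "\<zeta> u = ?g u *v (transpose (?A u) *v Z u)"
      by (simp add: vec_eq_iff \<zeta>_def matrix_vector_mult_def[of "?g u"] 1 del: transpose_matrix_vector)
    then have "\<zeta> u = (?g u ** transpose (?A u)) *v Z u" by (simp only: matrix_vector_mul_assoc)
    then show ?thesis by (simp add: tproj_def matrix_vector_mul_assoc matrix_mul_assoc)
  qed
  define N where "N u = Z u - ?A u *v \<zeta> u" for u
  have AZ1: "Ck_on 1 W (\<lambda>u. ?A u *v \<zeta> u)"
    unfolding jac_mult by (intro Ck_on_sum Ck_on_scaleR Ck_on_nth W \<zeta>1 C1)
  have N1: "Ck_on 1 W N" unfolding N_def[abs_def] by (intro Ck_on_diff W Z AZ1)
  have Nperp: "N u \<bullet> partial i \<phi> u = 0" if "u \<in> W" for u i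
  proof -
    have "transpose (?A u) *v N u = 0"
      using tproj_props(5)[OF det[OF that]]
      by (simp add: N_def A\<zeta> matrix_vector_mult_diff_distrib matrix_vector_mul_assoc)
    then have "(transpose (?A u) *v N u) $ i = 0" by simp
    then show ?thesis by (simp add: matrix_vector_mult_def transpose_def jac_def inner_vec_def mult.commute)
  qed
  \<comment> \<open>Extension by zero is C^1 on the whole space, because \<open>W\<close> and the
    complement of \<open>K\<close> are open, cover everything, and \<open>w k\<close> vanishes on
    the latter.\<close>
  define w where "w k u = (if u \<in> W then area (?A u) * \<zeta> u $ k else 0)" for k u
  have \<zeta>0: "\<zeta> u = 0" if "u \<in> W" "u \<notin> K" for u
    using K(3)[OF that] by (simp add: \<zeta>_def) (simp add: zero_vec_def)
  have w0: "w k u = 0" if "u \<notin> K" for k u using \<zeta>0[of u] that by (simp add: w_def)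
  have cover: "W \<union> - K = UNIV" using K(2) by auto
  have opK: "open (- K)" using compact_imp_closed[OF K(1)] by auto
  have w1: "Ck_on 1 UNIV (w k)" for k
  proof -
    have 1: "Ck_on 1 W (w k)"
      by (rule Ck_on_cong[OF W, of "\<lambda>u. area (?A u) * \<zeta> u $ k"])
        (auto simp: w_def intro!: Ck_on_mult Ck_on_nth W \<zeta>1 Ck_on_area_jac[OF \<phi>(1) C2] simp del: One_nat_def)
    have 2: "Ck_on 1 (- K) (w k)"
      by (rule Ck_on_cong[OF opK _ Ck_on_const[of _ _ 0]]) (simp add: w0)
    show ?thesis
      using 1 2 unfolding Ck_on_1 cover[symmetric] by (auto intro: continuous_on_open_Un W opK)
  qed
  have pw: "partial k (w k) u = indicator W u * partial k (\<lambda>u. area (?A u) * \<zeta> u $ k) u" for k u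
  proof (cases "u \<in> W")
    case True
    have "partial k (w k) u = partial k (\<lambda>u. area (?A u) * \<zeta> u $ k) u"
      using w1[of k] True by (intro partial_cong_open[OF W]) (auto simp: w_def Ck_on_1)
    then show ?thesis using True by simp
  next
    case False
    have "partial k (w k) u = partial k (\<lambda>u. 0) u"
      using w1[of k] False K(2) w0 by (intro partial_cong_open[OF opK]) (auto simp: Ck_on_1)
    then show ?thesis using False by (simp add: partial_def)
  qed
  have iw: "integrable lborel (\<lambda>u. partial k (w k) u)" for k
  proof (rule integrable_continuous_compact_support[OF _ K(1)])
    show "continuous_on UNIV (partial k (w k))" using w1[of k] by (simp add: Ck_on_1)
    fix u assume "u \<notin> K"
    then have "partial k (w k) u = partial k (\<lambda>u. 0) u"
      using w1[of k] w0 by (intro partial_cong_open[OF opK]) (auto simp: Ck_on_1)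
    then show "partial k (w k) u = 0" by (simp add: partial_def)
  qed
  have point: "area (?A u) * tdiv (?A u) (jac Z u) =
      (\<Sum>k\<in>UNIV. partial k (\<lambda>u. area (?A u) * \<zeta> u $ k) u) + area (?A u) * (Z u \<bullet> H (\<phi> u))" if u: "u \<in> W" for u
  proof -
    have d: "(\<lambda>u. ?A u *v \<zeta> u) differentiable (at u)" "N differentiable (at u)"
      using AZ1 N1 u by (auto simp: Ck_on_1)
    have "((\<lambda>u. ?A u *v \<zeta> u + N u) has_derivative (\<lambda>h. (\<Sum>k\<in>UNIV. h $ k *\<^sub>R partial k (\<lambda>u. ?A u *v \<zeta> u) u) +
        (\<Sum>k\<in>UNIV. h $ k *\<^sub>R partial k N u))) (at u)"
      by (intro has_derivative_add has_derivative_partials d)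
    then have "partial k Z u = partial k (\<lambda>u. ?A u *v \<zeta> u) u + partial k N u" for k
      using partial_eqI[of "\<lambda>u. ?A u *v \<zeta> u + N u" _ u k] by (simp add: N_def sum_axis_scaleR)
    then have "jac Z u = jac (\<lambda>u. ?A u *v \<zeta> u) u + jac N u"
      by (simp add: jac_def vec_eq_iff)
    then have "tdiv (?A u) (jac Z u) = tdiv (?A u) (jac (\<lambda>u. ?A u *v \<zeta> u) u) + N u \<bullet> H (\<phi> u)"
      using tdiv_normal_field[OF M \<phi> C2 Nperp d(2) u] H(2)[OF u] by (simp add: tdiv_add)
    moreover have "N u \<bullet> H (\<phi> u) = Z u \<bullet> H (\<phi> u)"
      using H(3)[OF u] by (simp add: N_def inner_diff_left jac_mult inner_sum_left inner_commute[of "partial _ _ _"])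
    ultimately show ?thesis
      using tdiv_tangential_field[OF \<phi>(1) C2 \<zeta>1 u] by (simp add: distrib_left)
  qed
  have iH: "integrable lborel (\<lambda>u. indicator W u * (area (?A u) * (Z u \<bullet> H (\<phi> u))))"
  proof (rule integrable_continuous_compact_support[OF _ K(1)])
    have "continuous_on W (\<lambda>u. area (?A u) * (Z u \<bullet> H (\<phi> u)))"
      using immersion_area_continuous[OF \<phi>(1)] Ck_on_continuous[OF Z]
      by (intro continuous_intros continuous_on_compose2[OF H(1)] immersion_continuous_on[OF \<phi>(1)]) auto
    then have 1: "continuous_on W (\<lambda>u. indicator W u * (area (?A u) * (Z u \<bullet> H (\<phi> u))))"
      by (rule continuous_on_eq) simp
    have 2: "continuous_on (- K) (\<lambda>u. indicator W u * (area (?A u) * (Z u \<bullet> H (\<phi> u))))"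
      by (rule continuous_on_eq[OF continuous_on_const[of _ 0]]) (auto simp: indicator_def K(3))
    show "continuous_on UNIV (\<lambda>u. indicator W u * (area (?A u) * (Z u \<bullet> H (\<phi> u))))"
      using continuous_on_open_Un[OF W opK 1 2] by (simp add: cover)
    show "indicator W u * (area (?A u) * (Z u \<bullet> H (\<phi> u))) = 0" if "u \<notin> K" for u
      using K(3)[of u] that by (auto simp: indicator_def)
  qed
  have "(LINT u|lborel. indicator W u * (area (?A u) * tdiv (?A u) (jac Z u))) =
    (LINT u|lborel. (\<Sum>k\<in>UNIV. partial k (w k) u) + indicator W u * (area (?A u) * (Z u \<bullet> H (\<phi> u))))"
  proof (rule Bochner_Integration.integral_cong[OF refl])
    fix u
    show "indicator W u * (area (?A u) * tdiv (?A u) (jac Z u)) =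
      (\<Sum>k\<in>UNIV. partial k (w k) u) + indicator W u * (area (?A u) * (Z u \<bullet> H (\<phi> u)))"
      using point[of u] by (cases "u \<in> W") (simp_all add: pw)
  qed
  also have "\<dots> = (\<Sum>k\<in>UNIV. LINT u|lborel. partial k (w k) u) +
      (LINT u|lborel. indicator W u * (area (?A u) * (Z u \<bullet> H (\<phi> u))))"
    using iw iH by (subst Bochner_Integration.integral_add) (auto simp: Bochner_Integration.integral_sum)
  also have "(\<Sum>k\<in>UNIV. LINT u|lborel. partial k (w k) u) = 0"
    using w0 by (intro sum.neutral ballI integral_partial_eq_0[OF w1 K(1)])
  finally show ?thesis by simp
qed

section \<open>Short-time flows\<close>

lemma vector_derivative_bound:
  fixes w :: "real \<Rightarrow> 'a::real_normed_vector"
  assumes w: "\<And>t. t \<in> {a..b} \<Longrightarrow> (w has_vector_derivative w' t) (at t within {a..b})"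
    and B: "\<And>t. t \<in> {a..b} \<Longrightarrow> norm (w' t) \<le> B" and st: "s \<in> {a..b}" "t \<in> {a..b}"
  shows "norm (w t - w s) \<le> B * \<bar>t - s\<bar>"
proof -
  have "norm (w t - w s) \<le> B * norm (t - s)"
  proof (rule differentiable_bound[of "{a..b}" w "\<lambda>t h. h *\<^sub>R w' t"])
    show "(w has_derivative (\<lambda>h. h *\<^sub>R w' x)) (at x within {a..b})" if "x \<in> {a..b}" for x
      using w[OF that] by (simp add: has_vector_derivative_def)
    show "onorm (\<lambda>h. h *\<^sub>R w' x) \<le> B" if "x \<in> {a..b}" for x
      using mult_left_mono[OF B[OF that] abs_ge_zero] by (intro onorm_le) (simp add: mult.commute)
  qed (use st in auto)
  then show ?thesis by simp
qed

lemma gronwall_short: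
  fixes w :: "real \<Rightarrow> 'a::real_normed_vector"
  assumes w: "\<And>t. t \<in> {a..b} \<Longrightarrow> (w has_vector_derivative w' t) (at t within {a..b})"
    and bd: "\<And>t. t \<in> {a..b} \<Longrightarrow> norm (w' t) \<le> L * norm (w t) + c"
    and L: "L \<ge> 0" "L * (b - a) \<le> 1 / 2" and c: "c \<ge> 0" and st: "s \<in> {a..b}" "t \<in> {a..b}"
  shows "norm (w t) \<le> 2 * (norm (w s) + c * (b - a))"
proof -
  have "continuous_on {a..b} (\<lambda>t. norm (w t))"
    using w by (intro continuous_on_norm continuous_on_vector_derivative) blast
  then obtain r where r: "r \<in> {a..b}" "\<And>t. t \<in> {a..b} \<Longrightarrow> norm (w t) \<le> norm (w r)"
    using continuous_attains_sup[of "{a..b}" "\<lambda>t. norm (w t)"] st by auto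
  have "norm (w r - w s) \<le> (L * norm (w r) + c) * \<bar>r - s\<bar>"
  proof (rule vector_derivative_bound[OF w _ st(1) r(1)])
    show "norm (w' t) \<le> L * norm (w r) + c" if "t \<in> {a..b}" for t
      using bd[OF that] mult_left_mono[OF r(2)[OF that] L(1)] by linarith
  qed
  also have "\<dots> \<le> (L * norm (w r) + c) * (b - a)"
    using st r(1) L c by (intro mult_left_mono) auto
  also have "\<dots> = L * (b - a) * norm (w r) + c * (b - a)" by (simp add: algebra_simps)
  also have "\<dots> \<le> 1 / 2 * norm (w r) + c * (b - a)"
    using mult_right_mono[OF L(2) norm_ge_zero[of "w r"]] by linarith
  finally have *: "norm (w r - w s) \<le> 1 / 2 * norm (w r) + c * (b - a)" .
  have "x \<le> 2 * (y + e)" if "z \<le> 1 / 2 * x + e" "x \<le> y + z" for x y z e :: real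
    using that by simp
  from this[OF * norm_triangle_sub] have "norm (w r) \<le> 2 * (norm (w s) + c * (b - a))" .
  then show ?thesis using r(2)[OF st(2)] by linarith
qed

text \<open>Picard iteration in the supremum norm, a contraction with factor 1/2 by the smallness of
  \<open>L * (b - a)\<close>.\<close>

lemma linear_ode_short:
  fixes A :: "real \<Rightarrow> 'a::euclidean_space \<Rightarrow> 'a"
  assumes lin: "\<And>t. t \<in> {a..b} \<Longrightarrow> linear (A t)" and bd: "\<And>t x. t \<in> {a..b} \<Longrightarrow> norm (A t x) \<le> L * norm x"
    and cont: "\<And>v. continuous_on {a..b} v \<Longrightarrow> continuous_on {a..b} (\<lambda>t. A t (v t))"
    and L: "L \<ge> 0" "L * (b - a) \<le> 1 / 2" and 0: "0 \<in> {a..b}"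
  obtains v where "v 0 = v0" "\<And>t. t \<in> {a..b} \<Longrightarrow> (v has_vector_derivative A t (v t)) (at t within {a..b})"
proof -
  \<comment> \<open>The difference is the integral from 0 to \<open>t\<close>, for \<open>t\<close>
    of either sign.\<close>
  define F where "F \<phi> t = v0 + (integral {a..t} (\<lambda>s. A s (\<phi> s)) - integral {a..0} (\<lambda>s. A s (\<phi> s)))" for \<phi> t
  have F0: "F \<phi> 0 = v0" for \<phi> by (simp add: F_def)
  have DF: "(F \<phi> has_vector_derivative A t (\<phi> t)) (at t within {a..b})"
    if "continuous_on {a..b} \<phi>" "t \<in> {a..b}" for \<phi> t
    unfolding F_def[abs_def]
    using integral_has_vector_derivative[OF cont[OF that(1)] that(2)] by (auto intro!: derivative_eq_intros)
  have contF: "continuous_on {a..b} (F \<phi>)" if "continuous_on {a..b} \<phi>" for \<phi>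
    using DF[OF that] by (intro continuous_on_vector_derivative) blast
  \<comment> \<open>Extending constantly beyond \<open>{a..b}\<close> places the iteration in the
    complete space of bounded continuous functions on the line.\<close>
  have "\<exists>g. \<forall>t. apply_bcontfun g t = F (apply_bcontfun \<phi>) (clamp a b t)" for \<phi> :: "real \<Rightarrow>\<^sub>C 'a"
  proof -
    have "continuous_on (cbox a b) (F (apply_bcontfun \<phi>))" using contF[of "apply_bcontfun \<phi>"] by simp
    then show ?thesis by (rule continuous_on_cbox_bcontfunE) blast
  qed
  then obtain T where T: "\<And>\<phi> t. apply_bcontfun (T \<phi>) t = F (apply_bcontfun \<phi>) (clamp a b t)" by metis
  have ab: "a \<le> b" using 0 by simp
  have clamp: "clamp a b t \<in> {a..b}" for t using ab clamp_in_interval[of a b t] by simp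
  have "dist (T \<phi>) (T \<phi>') \<le> 1 / 2 * dist \<phi> \<phi>'" for \<phi> \<phi>'
  proof (rule dist_bound)
    fix t
    let ?d = "\<lambda>t. F (apply_bcontfun \<phi>) t - F (apply_bcontfun \<phi>') t"
    have "norm (?d (clamp a b t) - ?d 0) \<le> (L * dist \<phi> \<phi>') * \<bar>clamp a b t - 0\<bar>"
    proof (rule vector_derivative_bound[OF _ _ 0 clamp])
      fix s assume s: "s \<in> {a..b}"
      show "(?d has_vector_derivative A s (apply_bcontfun \<phi> s) - A s (apply_bcontfun \<phi>' s)) (at s within {a..b})"
        using s by (intro has_vector_derivative_diff DF) auto
      have "norm (A s (apply_bcontfun \<phi> s) - A s (apply_bcontfun \<phi>' s)) \<le> L * norm (apply_bcontfun \<phi> s - apply_bcontfun \<phi>' s)"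
        using bd[OF s] by (simp add: linear_diff[OF lin[OF s], symmetric])
      also have "\<dots> \<le> L * dist \<phi> \<phi>'"
        using dist_bounded[of \<phi> s \<phi>'] L(1) by (intro mult_left_mono) (auto simp: dist_norm)
      finally show "norm (A s (apply_bcontfun \<phi> s) - A s (apply_bcontfun \<phi>' s)) \<le> L * dist \<phi> \<phi>'" .
    qed
    also have "\<dots> \<le> (L * dist \<phi> \<phi>') * (b - a)"
      using clamp[of t] 0 L(1) by (intro mult_left_mono) auto
    also have "\<dots> \<le> 1 / 2 * dist \<phi> \<phi>'"
      using mult_right_mono[OF L(2) zero_le_dist[of \<phi> \<phi>']] by (simp add: mult_ac)
    finally show "dist (apply_bcontfun (T \<phi>) t) (apply_bcontfun (T \<phi>') t) \<le> 1 / 2 * dist \<phi> \<phi>'"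
      by (simp add: T F0 dist_norm)
  qed
  then have "\<exists>!\<phi>. T \<phi> = \<phi>" by (intro banach_fix_type[of "1 / 2"]) auto
  then obtain \<phi> where \<phi>: "T \<phi> = \<phi>" by blast
  have eq: "apply_bcontfun \<phi> t = F (apply_bcontfun \<phi>) t" if "t \<in> {a..b}" for t
    using T[of \<phi> t] \<phi> that by simp
  show thesis
  proof (rule that[of "F (apply_bcontfun \<phi>)"])
    show "F (apply_bcontfun \<phi>) 0 = v0" by (rule F0)
    show "(F (apply_bcontfun \<phi>) has_vector_derivative A t (F (apply_bcontfun \<phi>) t)) (at t within {a..b})"
      if "t \<in> {a..b}" for t
      using DF[of "apply_bcontfun \<phi>" t] that eq[OF that] by simp
  qed
qed

lemma norm_jac_mult_le: "norm (jac f x *v h) \<le> (\<Sum>k\<in>UNIV. norm (partial k f x)) * norm h"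
proof -
  have "norm (jac f x *v h) \<le> (\<Sum>k\<in>UNIV. norm (h $ k *\<^sub>R partial k f x))"
    unfolding jac_mult by (rule norm_sum)
  also have "\<dots> \<le> (\<Sum>k\<in>UNIV. norm (partial k f x) * norm h)"
  proof (intro sum_mono)
    fix k
    show "norm (h $ k *\<^sub>R partial k f x) \<le> norm (partial k f x) * norm h"
      using mult_right_mono[OF component_le_norm_cart[of h k] norm_ge_zero[of "partial k f x"]]
      by (simp add: mult.commute)
  qed
  finally show ?thesis by (simp add: sum_distrib_right)
qed

lemma continuous_bounded_on_compact:
  fixes f :: "'a::topological_space \<Rightarrow> 'b::real_normed_vector"
  assumes "compact K" "continuous_on K f"
  obtains B where "B \<ge> 0" "\<And>x. x \<in> K \<Longrightarrow> norm (f x) \<le> B"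
proof -
  have "bounded (f ` K)" using assms by (intro compact_imp_bounded compact_continuous_image)
  then obtain B where "\<forall>y\<in>f ` K. norm y \<le> B" unfolding bounded_iff by blast
  then show thesis using that[of "max B 0"] by fastforce
qed

lemma C1_lipschitz_on_compact:
  fixes g :: "real ^ 'n \<Rightarrow> real ^ 'k"
  assumes g: "Ck_on 1 UNIV g" and K: "compact K" "convex K"
  obtains L where "L \<ge> 0" "\<And>y h. y \<in> K \<Longrightarrow> norm (jac g y *v h) \<le> L * norm h"
    "\<And>y z. y \<in> K \<Longrightarrow> z \<in> K \<Longrightarrow> norm (g y - g z) \<le> L * norm (y - z)"
proof -
  have "continuous_on K (\<lambda>x. \<Sum>k\<in>UNIV. norm (partial k g x))"
    using g by (intro continuous_on_sum continuous_on_norm) (auto simp: Ck_on_1 intro: continuous_on_subset)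
  then obtain L where L: "L \<ge> 0" "\<And>x. x \<in> K \<Longrightarrow> norm (\<Sum>k\<in>UNIV. norm (partial k g x)) \<le> L"
    using continuous_bounded_on_compact[OF K(1)] by blast
  have bd: "norm (jac g y *v h) \<le> L * norm h" if "y \<in> K" for y h
  proof -
    have "(\<Sum>k\<in>UNIV. norm (partial k g y)) \<le> L" using L(2)[OF that] by simp
    from mult_right_mono[OF this norm_ge_zero[of h]] show ?thesis
      using norm_jac_mult_le[of g y h] by linarith
  qed
  have "norm (g y - g z) \<le> L * norm (y - z)" if "y \<in> K" "z \<in> K" for y z
  proof (rule differentiable_bound[OF K(2)])
    show "(g has_derivative (*v) (jac g x)) (at x within K)" for x
      using g by (intro has_derivative_at_withinI[OF has_derivative_jac]) (simp add: Ck_on_1)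
    show "onorm ((*v) (jac g x)) \<le> L" if "x \<in> K" for x using bd[OF that] by (rule onorm_le)
  qed (use that in auto)
  with L(1) bd show thesis using that by blast
qed

text \<open>A single constant for size, derivative and Lipschitz bounds, so that one condition on
  \<open>L * (b - a)\<close> serves every estimate.\<close>

definition field_bound :: "(real ^ 'n \<Rightarrow> real ^ 'n) \<Rightarrow> (real ^ 'n) set \<Rightarrow> real \<Rightarrow> bool" where
  "field_bound X K L \<longleftrightarrow> L \<ge> 0 \<and> (\<forall>y\<in>K. norm (X y) \<le> L) \<and> (\<forall>y\<in>K. \<forall>h. norm (jac X y *v h) \<le> L * norm h) \<and>
     (\<forall>y\<in>K. \<forall>z\<in>K. norm (X y - X z) \<le> L * norm (y - z)) \<and>
     (\<forall>y\<in>K. \<forall>z\<in>K. \<forall>h. norm (jac X y *v h - jac X z *v h) \<le> L * norm (y - z) * norm h)"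

lemma ex_field_bound:
  fixes X :: "real ^ 'n \<Rightarrow> real ^ 'n"
  assumes X: "Ck_on 2 UNIV X" and K: "compact K" "convex K"
  obtains L where "field_bound X K L"
proof -
  have X1: "Ck_on 1 UNIV X" "\<And>k. Ck_on 1 UNIV (partial k X)" using X Ck_on_mono[OF X, of 1] by (auto simp: numeral_2_eq_2)
  obtain L0 where L0: "L0 \<ge> 0" "\<And>y. y \<in> K \<Longrightarrow> norm (X y) \<le> L0"
    using continuous_bounded_on_compact[OF K(1), of X] continuous_on_subset[OF Ck_on_continuous[OF X]] by blast
  obtain L1 where L1: "L1 \<ge> 0" "\<And>y h. y \<in> K \<Longrightarrow> norm (jac X y *v h) \<le> L1 * norm h"
    "\<And>y z. y \<in> K \<Longrightarrow> z \<in> K \<Longrightarrow> norm (X y - X z) \<le> L1 * norm (y - z)"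
    using C1_lipschitz_on_compact[OF X1(1) K] by blast
  have "\<exists>L\<ge>0. \<forall>y\<in>K. \<forall>z\<in>K. norm (partial k X y - partial k X z) \<le> L * norm (y - z)" for k
    using C1_lipschitz_on_compact[OF X1(2)[of k] K] by metis
  then obtain Lk where Lk: "\<And>k. Lk k \<ge> 0" "\<And>k y z. y \<in> K \<Longrightarrow> z \<in> K \<Longrightarrow> norm (partial k X y - partial k X z) \<le> Lk k * norm (y - z)"
    by metis
  define L2 where "L2 = (\<Sum>k\<in>UNIV. Lk k)"
  have L2: "L2 \<ge> 0" using Lk(1) by (auto simp: L2_def intro: sum_nonneg)
  have jl: "norm (jac X y *v h - jac X z *v h) \<le> L2 * norm (y - z) * norm h" if "y \<in> K" "z \<in> K" for y z h
  proof -
    have "jac X y *v h - jac X z *v h = (\<Sum>k\<in>UNIV. h $ k *\<^sub>R (partial k X y - partial k X z))"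
      by (simp add: jac_mult sum_subtractf scaleR_diff_right)
    also have "norm \<dots> \<le> (\<Sum>k\<in>UNIV. norm (h $ k *\<^sub>R (partial k X y - partial k X z)))" by (rule norm_sum)
    also have "\<dots> \<le> (\<Sum>k\<in>UNIV. norm h * (Lk k * norm (y - z)))"
      unfolding norm_scaleR
      by (intro sum_mono mult_mono Lk(2) that) (auto simp: component_le_norm_cart)
    also have "\<dots> = L2 * norm (y - z) * norm h"
      by (simp add: L2_def sum_distrib_left sum_distrib_right mult_ac)
    finally show ?thesis .
  qed
  define L where "L = max L0 (max L1 L2)"
  have le: "L0 \<le> L" "L1 \<le> L" "L2 \<le> L" by (auto simp: L_def)
  have "field_bound X K L"
    unfolding field_bound_def
  proof (intro conjI ballI allI)
    show "L \<ge> 0" using L0(1) le by linarith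
    show "norm (X y) \<le> L" if "y \<in> K" for y using L0(2)[OF that] le by linarith
    show "norm (jac X y *v h) \<le> L * norm h" if "y \<in> K" for y h
      using L1(2)[OF that, of h] mult_right_mono[OF le(2) norm_ge_zero[of h]] by linarith
    show "norm (X y - X z) \<le> L * norm (y - z)" if "y \<in> K" "z \<in> K" for y z
      using L1(3)[OF that] mult_right_mono[OF le(2) norm_ge_zero[of "y - z"]] by linarith
    show "norm (jac X y *v h - jac X z *v h) \<le> L * norm (y - z) * norm h" if "y \<in> K" "z \<in> K" for y z h
      using jl[OF that, of h] mult_right_mono[OF mult_right_mono[OF le(3) norm_ge_zero[of "y - z"]] norm_ge_zero[of h]]
      by linarith
  qed
  then show thesis by (rule that)
qed

text \<open>The mean value inequality for \<open>X\<close> minus its linear part at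
  \<open>y\<close>; on the segment the derivative of the difference is bounded through the Lipschitz
  estimate for \<open>jac X\<close>.\<close>

lemma field_bound_taylor:
  fixes X :: "real ^ 'n \<Rightarrow> real ^ 'n"
  assumes X: "\<And>x. X differentiable (at x)" and fb: "field_bound X K L" and K: "convex K" and yz: "y \<in> K" "z \<in> K"
  shows "norm (X z - X y - jac X y *v (z - y)) \<le> L * norm (z - y) * norm (z - y)"
proof -
  let ?g = "\<lambda>x. X x - jac X y *v x"
  have seg: "closed_segment y z \<subseteq> K" using K yz by (simp add: closed_segment_subset)
  have "norm (?g z - ?g y) \<le> (L * norm (z - y)) * norm (z - y)"
  proof (rule differentiable_bound[of "closed_segment y z" ?g "\<lambda>x h. jac X x *v h - jac X y *v h"])
    show "(?g has_derivative (\<lambda>h. jac X x *v h - jac X y *v h)) (at x within closed_segment y z)" for x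
      by (intro has_derivative_diff has_derivative_at_withinI[OF has_derivative_jac[OF X]]
          bounded_linear_imp_has_derivative matrix_vector_mul_bounded_linear)
    show "onorm (\<lambda>h. jac X x *v h - jac X y *v h) \<le> L * norm (z - y)" if "x \<in> closed_segment y z" for x
    proof (rule onorm_le)
      fix h
      have "norm (jac X x *v h - jac X y *v h) \<le> L * norm (x - y) * norm h"
        using fb seg that yz by (auto simp: field_bound_def)
      also have "\<dots> \<le> L * norm (z - y) * norm h"
        using fb segment_bound(1)[OF that] by (intro mult_right_mono mult_left_mono) (auto simp: field_bound_def norm_minus_commute)
      finally show "norm (jac X x *v h - jac X y *v h) \<le> L * norm (z - y) * norm h" .
    qed
  qed auto
  moreover have "?g z - ?g y = X z - X y - jac X y *v (z - y)" by (simp add: matrix_vector_mult_diff_distrib)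
  ultimately show ?thesis by simp
qed

section \<open>Differentiability of integral curves in the initial point, over a short time\<close>

locale short_flow =
  fixes X :: "real ^ 'n \<Rightarrow> real ^ 'n" and K :: "(real ^ 'n) set" and L a b :: real
    and W :: "(real ^ 'm) set" and Y :: "real \<Rightarrow> real ^ 'm \<Rightarrow> real ^ 'n"
  assumes X: "Ck_on 2 UNIV X" and K: "convex K" and fb: "field_bound X K L"
    and ab: "a \<le> 0" "0 \<le> b" "L * (b - a) \<le> 1 / 2"
    and im: "immersion W (Y 0)"
    and YK: "\<And>t u. t \<in> {a..b} \<Longrightarrow> u \<in> W \<Longrightarrow> Y t u \<in> K"
    and DY: "\<And>t u. t \<in> {a..b} \<Longrightarrow> u \<in> W \<Longrightarrow> ((\<lambda>t. Y t u) has_vector_derivative X (Y t u)) (at t within {a..b})"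
begin

lemma L0: "L \<ge> 0" using fb by (simp add: field_bound_def)

lemma dX: "X differentiable (at x)"
  using X by (simp add: numeral_2_eq_2)

lemma cont_jac: "continuous_on UNIV (\<lambda>x. jac X x $ i $ j)"
  unfolding jac_def using Ck_on_continuous[OF Ck_on_partial, of 1 UNIV X] X
  by (auto simp: numeral_2_eq_2 intro!: continuous_on_component)

text \<open>Gronwall for the difference of two integral curves. Both orders of \<open>s\<close> and
  \<open>t\<close> are used: forward for Lipschitz dependence, backward for injectivity.\<close>

lemma Y_dist:
  assumes "u \<in> W" "v \<in> W" "s \<in> {a..b}" "t \<in> {a..b}"
  shows "norm (Y t u - Y t v) \<le> 2 * norm (Y s u - Y s v)"
proof -
  have "norm (Y t u - Y t v) \<le> 2 * (norm (Y s u - Y s v) + 0 * (b - a))"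
  proof (rule gronwall_short[where w' = "\<lambda>t. X (Y t u) - X (Y t v)" and L = L])
    show "((\<lambda>t. Y t u - Y t v) has_vector_derivative X (Y t u) - X (Y t v)) (at t within {a..b})" if "t \<in> {a..b}" for t
      using that assms by (intro has_vector_derivative_diff DY)
    show "norm (X (Y t u) - X (Y t v)) \<le> L * norm (Y t u - Y t v) + 0" if "t \<in> {a..b}" for t
      using fb YK[OF that] assms by (simp add: field_bound_def)
  qed (use assms L0 ab in auto)
  then show ?thesis by simp
qed

lemma cont_Y: "u \<in> W \<Longrightarrow> continuous_on {a..b} (\<lambda>t. Y t u)"
  using DY by (intro continuous_on_vector_derivative) blast

text \<open>The matrix solution of the variational equation along the curve of \<open>u\<close>,
  chosen column by column; \<open>jac_Y\<close> identifies it with the Jacobian of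
  \<open>Y t\<close>.\<close>

definition \<Phi> :: "real \<Rightarrow> real ^ 'm \<Rightarrow> real ^ 'm ^ 'n" where
  "\<Phi> t u = (\<chi> i j. (SOME v. v 0 = partial j (Y 0) u \<and>
     (\<forall>t\<in>{a..b}. (v has_vector_derivative jac X (Y t u) *v v t) (at t within {a..b}))) t $ i)"

lemma D\<Phi>:
  assumes u: "u \<in> W"
  shows "\<Phi> 0 u = jac (Y 0) u"
    and "t \<in> {a..b} \<Longrightarrow> ((\<lambda>t. \<Phi> t u *v h) has_vector_derivative jac X (Y t u) *v (\<Phi> t u *v h)) (at t within {a..b})"
proof -
  define P where "P j v \<longleftrightarrow> v 0 = partial j (Y 0) u \<and>
     (\<forall>t\<in>{a..b}. (v has_vector_derivative jac X (Y t u) *v v t) (at t within {a..b}))" for j v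
  have "\<exists>v. P j v" for j
  proof -
    obtain v where "v 0 = partial j (Y 0) u"
      "\<And>t. t \<in> {a..b} \<Longrightarrow> (v has_vector_derivative jac X (Y t u) *v (v t)) (at t within {a..b})"
    proof (rule linear_ode_short[of a b "\<lambda>t. (*v) (jac X (Y t u))" L "partial j (Y 0) u"])
      show "linear ((*v) (jac X (Y t u)))" for t by (rule matrix_vector_mul_linear)
      show "norm (jac X (Y t u) *v x) \<le> L * norm x" if "t \<in> {a..b}" for t x
        using fb YK[OF that u] by (simp add: field_bound_def)
      show "continuous_on {a..b} (\<lambda>t. jac X (Y t u) *v v t)" if "continuous_on {a..b} v" for v
      proof -
        have c: "continuous_on {a..b} (\<lambda>t. jac X (Y t u) $ i $ j)" for i j
          using continuous_on_compose2[OF cont_jac[of i j] cont_Y[OF u]] by simp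
        show ?thesis
          unfolding matrix_vector_mult_def
          by (intro continuous_on_vec_lambda continuous_on_sum continuous_on_mult c continuous_on_component[OF that])
      qed
    qed (use L0 ab in auto)
    then show ?thesis unfolding P_def by blast
  qed
  then have some: "P j (SOME v. P j v)" for j by (rule someI_ex)
  define V where "V j = (SOME v. P j v)" for j
  have V: "V j 0 = partial j (Y 0) u"
    "t \<in> {a..b} \<Longrightarrow> (V j has_vector_derivative jac X (Y t u) *v V j t) (at t within {a..b})" for j t
    using some[of j] unfolding V_def P_def by blast+
  have \<Phi>: "\<Phi> t u = (\<chi> i j. V j t $ i)" for t
    by (simp add: \<Phi>_def V_def P_def)
  show "\<Phi> 0 u = jac (Y 0) u" by (simp add: \<Phi> V(1) jac_def)
  have mult: "\<Phi> t u *v h = (\<Sum>j\<in>UNIV. h $ j *\<^sub>R V j t)" for t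
    by (simp add: \<Phi> matrix_vector_mult_def vec_eq_iff mult.commute)
  show "((\<lambda>t. \<Phi> t u *v h) has_vector_derivative jac X (Y t u) *v (\<Phi> t u *v h)) (at t within {a..b})"
    if "t \<in> {a..b}"
  proof -
    have "((\<lambda>t. \<Sum>j\<in>UNIV. h $ j *\<^sub>R V j t) has_vector_derivative (\<Sum>j\<in>UNIV. h $ j *\<^sub>R (jac X (Y t u) *v V j t))) (at t within {a..b})"
      by (intro has_vector_derivative_sum bounded_linear.has_vector_derivative[OF bounded_linear_scaleR_right] V(2) that)
    then show ?thesis
      unfolding mult by (simp add: linear_sum[OF matrix_vector_mul_linear] linear_cmul[OF matrix_vector_mul_linear])
  qed
qed

lemma \<Phi>_norm:
  assumes u: "u \<in> W" and st: "s \<in> {a..b}" "t \<in> {a..b}"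
  shows "norm (\<Phi> t u *v h) \<le> 2 * norm (\<Phi> s u *v h)"
proof -
  have "norm (\<Phi> t u *v h) \<le> 2 * (norm (\<Phi> s u *v h) + 0 * (b - a))"
  proof (rule gronwall_short[where L = L, OF D\<Phi>(2)[OF u]])
    show "norm (jac X (Y t u) *v (\<Phi> t u *v h)) \<le> L * norm (\<Phi> t u *v h) + 0" if "t \<in> {a..b}" for t
      using fb YK[OF that u] by (simp add: field_bound_def)
  qed (use st L0 ab in auto)
  then show ?thesis by simp
qed

text \<open>The error \<open>?w\<close> satisfies the variational equation up to the Taylor
  remainder of \<open>X\<close>, which is quadratic in \<open>v - u\<close>. Gronwall keeps the
  error as small as at time 0, plus a quadratic term.\<close>

lemma Y_has_derivative:
  assumes u: "u \<in> W" and t: "t \<in> {a..b}"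
  shows "(Y t has_derivative (*v) (\<Phi> t u)) (at u)"
  unfolding has_derivative_within_alt
proof (intro conjI allI impI)
  show "bounded_linear ((*v) (\<Phi> t u))" by (rule matrix_vector_mul_bounded_linear)
  fix e :: real assume e: "e > 0"
  let ?D = "(*v) (jac (Y 0) u)"
  have D0: "(Y 0 has_derivative ?D) (at u)" using im u by (rule immersion_has_derivative)
  obtain C where C: "C > 0" "\<And>w. norm (?D w) \<le> norm w * C"
    using bounded_linear.pos_bounded[OF has_derivative_bounded_linear[OF D0]] by blast
  \<comment> \<open>Gronwall doubles the initial error, so \<open>e / 4\<close> uses up half of
    \<open>e\<close>; the bound 1 makes \<open>Y 0\<close> Lipschitz at \<open>u\<close> with
    constant \<open>C + 1\<close>.\<close>
  define e1 where "e1 = min 1 (e / 4)"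
  have e1: "e1 > 0" "e1 \<le> 1" "e1 \<le> e / 4" using e by (auto simp: e1_def)
  obtain d1 where d1: "d1 > 0" "\<And>v. norm (v - u) < d1 \<Longrightarrow>
      norm (Y 0 v - Y 0 u - ?D (v - u)) \<le> e1 * norm (v - u)"
    using D0 e1(1) unfolding has_derivative_within_alt by blast
  have "open W" using im by (simp add: immersion_def)
  then obtain d2 where d2: "d2 > 0" "ball u d2 \<subseteq> W" using u open_contains_ball by blast
  \<comment> \<open>The quadratic term is at most 4 times the square of \<open>(C + 1) * x\<close>;
    for \<open>x\<close> below \<open>d3\<close> it uses up the other half of
    \<open>e\<close>.\<close>
  define d3 where "d3 = e / (8 * (C + 1) * (C + 1))"
  have d3: "d3 > 0" using e C(1) by (simp add: d3_def)
  show "\<exists>d>0. \<forall>v\<in>UNIV. norm (v - u) < d \<longrightarrow> norm (Y t v - Y t u - \<Phi> t u *v (v - u)) \<le> e * norm (v - u)"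
  proof (intro exI[of _ "min d1 (min d2 d3)"] conjI ballI impI)
    fix v assume v: "norm (v - u) < min d1 (min d2 d3)"
    define x where "x = norm (v - u)"
    have vW: "v \<in> W" using v d2(2) by (auto simp: subset_iff dist_norm norm_minus_commute)
    let ?w = "\<lambda>t. Y t v - Y t u - \<Phi> t u *v (v - u)"
    let ?r = "\<lambda>t. X (Y t v) - X (Y t u) - jac X (Y t u) *v (Y t v - Y t u)"
    \<comment> \<open>The Taylor remainder at any time, expressed at time 0: the factor 2 of
      \<open>Y_dist\<close> enters squared.\<close>
    let ?c = "4 * L * (norm (Y 0 v - Y 0 u) * norm (Y 0 v - Y 0 u))"
    have "norm (?w t) \<le> 2 * (norm (?w 0) + ?c * (b - a))"
    proof (rule gronwall_short[where L = L and w' = "\<lambda>t. X (Y t v) - X (Y t u) - jac X (Y t u) *v (\<Phi> t u *v (v - u))"])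
      fix s assume s: "s \<in> {a..b}"
      show "(?w has_vector_derivative X (Y s v) - X (Y s u) - jac X (Y s u) *v (\<Phi> s u *v (v - u))) (at s within {a..b})"
        using s u vW by (intro has_vector_derivative_diff DY D\<Phi>)
      have eq: "X (Y s v) - X (Y s u) - jac X (Y s u) *v (\<Phi> s u *v (v - u)) = jac X (Y s u) *v ?w s + ?r s"
        by (simp add: matrix_vector_mult_diff_distrib)
      have 1: "norm (jac X (Y s u) *v ?w s) \<le> L * norm (?w s)"
        using fb YK[OF s u] by (simp add: field_bound_def)
      have "norm (?r s) \<le> L * norm (Y s v - Y s u) * norm (Y s v - Y s u)"
        by (rule field_bound_taylor[OF dX fb K YK[OF s u] YK[OF s vW]])
      also have "\<dots> \<le> L * (2 * norm (Y 0 v - Y 0 u)) * (2 * norm (Y 0 v - Y 0 u))"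
        using Y_dist[OF vW u _ s, of 0] L0 ab by (intro mult_mono mult_nonneg_nonneg) auto
      finally have "norm (?r s) \<le> ?c" by simp
      then show "norm (X (Y s v) - X (Y s u) - jac X (Y s u) *v (\<Phi> s u *v (v - u))) \<le> L * norm (?w s) + ?c"
        unfolding eq using 1 norm_triangle_ineq[of "jac X (Y s u) *v ?w s" "?r s"] by linarith
    qed (use L0 ab t in auto)
    also have "norm (?w 0) \<le> e1 * x"
      using d1(2)[of v] v D\<Phi>(1)[OF u] by (simp add: x_def)
    also have "?c * (b - a) \<le> 2 * ((C + 1) * (C + 1)) * x * x"
    proof -
      have "norm (Y 0 v - Y 0 u) \<le> norm (?D (v - u)) + e1 * x"
        using d1(2)[of v] v norm_triangle_sub[of "Y 0 v - Y 0 u" "?D (v - u)"] by (simp add: x_def)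
      also have "\<dots> \<le> (C + 1) * x"
        using C(2)[of "v - u"] mult_right_mono[OF e1(2), of x] by (simp add: x_def algebra_simps)
      finally have n: "norm (Y 0 v - Y 0 u) \<le> (C + 1) * x" .
      have "?c * (b - a) = 4 * (L * (b - a)) * (norm (Y 0 v - Y 0 u) * norm (Y 0 v - Y 0 u))" by simp
      also have "\<dots> \<le> 4 * (1 / 2) * (((C + 1) * x) * ((C + 1) * x))"
        using ab L0 n C(1) by (intro mult_mono mult_nonneg_nonneg) (auto simp: x_def)
      finally show ?thesis by (simp add: mult_ac)
    qed
    also have "2 * (e1 * x + 2 * ((C + 1) * (C + 1)) * x * x) \<le> e * x"
    proof -
      have "((C + 1) * (C + 1)) * x \<le> ((C + 1) * (C + 1)) * d3"
        using v C(1) by (intro mult_left_mono) (auto simp: x_def)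
      also have "\<dots> = e / 8"
      proof -
        have "(c * c) * (e / (8 * c * c)) = e / 8" if "c > 0" for c using that by simp
        from this[of "C + 1"] show ?thesis using C(1) by (simp add: d3_def)
      qed
      finally have "2 * e1 + 4 * ((C + 1) * (C + 1) * x) \<le> e" using e1(3) by linarith
      from mult_right_mono[OF this, of x] show ?thesis by (simp add: x_def algebra_simps)
    qed
    finally show "norm (?w t) \<le> e * norm (v - u)" by (simp add: x_def)
  qed (use d1 d2 d3 in auto)
qed

lemma jac_Y: "u \<in> W \<Longrightarrow> t \<in> {a..b} \<Longrightarrow> jac (Y t) u = \<Phi> t u"
proof -
  assume *: "u \<in> W" "t \<in> {a..b}"
  have "Y t differentiable (at u)" using Y_has_derivative[OF *] by (rule differentiableI)
  from has_derivative_unique[OF has_derivative_jac[OF this] Y_has_derivative[OF *]]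
  have "\<forall>h. jac (Y t) u *v h = \<Phi> t u *v h" by (simp add: fun_eq_iff)
  then show ?thesis by (rule matrix_eq[THEN iffD2])
qed

text \<open>Gronwall for the difference of two solutions of the variational equation: the source
  term comes from the Lipschitz bound for \<open>jac X\<close> and tends to 0 with
  \<open>Y 0 v - Y 0 u\<close>.\<close>

lemma continuous_on_\<Phi>:
  assumes t: "t \<in> {a..b}"
  shows "continuous_on W (\<lambda>u. \<Phi> t u *v h)"
  unfolding continuous_on_def
proof
  fix u assume u: "u \<in> W"
  have "((\<lambda>v. 2 * (norm (jac (Y 0) v *v h - jac (Y 0) u *v h) + (4 * L * norm (jac (Y 0) u *v h) * norm (Y 0 v - Y 0 u)) * (b - a)))
      \<longlongrightarrow> 2 * (norm (jac (Y 0) u *v h - jac (Y 0) u *v h) + (4 * L * norm (jac (Y 0) u *v h) * norm (Y 0 u - Y 0 u)) * (b - a)))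
      (at u within W)"
  proof (intro tendsto_intros)
    show "(Y 0 \<longlongrightarrow> Y 0 u) (at u within W)"
      using immersion_continuous_on[OF im] u by (simp add: continuous_on_def)
    have "continuous_on W (\<lambda>v. jac (Y 0) v *v h)"
      unfolding jac_mult using im by (intro continuous_intros) (auto simp: immersion_def Ck_on_1)
    then show "((\<lambda>v. jac (Y 0) v *v h) \<longlongrightarrow> jac (Y 0) u *v h) (at u within W)"
      using u by (simp add: continuous_on_def)
  qed
  then have lim: "((\<lambda>v. 2 * (norm (jac (Y 0) v *v h - jac (Y 0) u *v h) + (4 * L * norm (jac (Y 0) u *v h) * norm (Y 0 v - Y 0 u)) * (b - a)))
      \<longlongrightarrow> 0) (at u within W)" by simp
  have "((\<lambda>v. \<Phi> t v *v h - \<Phi> t u *v h) \<longlongrightarrow> 0) (at u within W)"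
  proof (rule Lim_null_comparison[OF _ lim])
    have "norm (\<Phi> t v *v h - \<Phi> t u *v h) \<le>
      2 * (norm (jac (Y 0) v *v h - jac (Y 0) u *v h) + (4 * L * norm (jac (Y 0) u *v h) * norm (Y 0 v - Y 0 u)) * (b - a))"
      if v: "v \<in> W" for v
    proof -
      let ?c = "4 * L * norm (jac (Y 0) u *v h) * norm (Y 0 v - Y 0 u)"
      let ?w = "\<lambda>t. \<Phi> t v *v h - \<Phi> t u *v h"
      have "norm (?w t) \<le> 2 * (norm (?w 0) + ?c * (b - a))"
      proof (rule gronwall_short[where L = L and w' = "\<lambda>t. jac X (Y t v) *v (\<Phi> t v *v h) - jac X (Y t u) *v (\<Phi> t u *v h)"])
        fix s assume s: "s \<in> {a..b}"
        show "(?w has_vector_derivative jac X (Y s v) *v (\<Phi> s v *v h) - jac X (Y s u) *v (\<Phi> s u *v h)) (at s within {a..b})"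
          using s u v by (intro has_vector_derivative_diff D\<Phi>)
        let ?y = "\<Phi> s u *v h"
        have eq: "jac X (Y s v) *v (\<Phi> s v *v h) - jac X (Y s u) *v ?y =
            jac X (Y s v) *v ?w s + (jac X (Y s v) *v ?y - jac X (Y s u) *v ?y)"
          by (simp add: matrix_vector_mult_diff_distrib)
        have 1: "norm (jac X (Y s v) *v ?w s) \<le> L * norm (?w s)"
          using fb YK[OF s v] by (simp add: field_bound_def)
        have "norm (jac X (Y s v) *v ?y - jac X (Y s u) *v ?y) \<le> L * norm (Y s v - Y s u) * norm ?y"
          using fb YK[OF s v] YK[OF s u] by (simp add: field_bound_def)
        also have "\<dots> \<le> L * (2 * norm (Y 0 v - Y 0 u)) * (2 * norm (jac (Y 0) u *v h))"
          using Y_dist[OF v u _ s, of 0] \<Phi>_norm[OF u _ s, of 0 h] D\<Phi>(1)[OF u] L0 ab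
          by (intro mult_mono mult_nonneg_nonneg) auto
        finally have "norm (jac X (Y s v) *v ?y - jac X (Y s u) *v ?y) \<le> ?c" by (simp add: mult_ac)
        then show "norm (jac X (Y s v) *v (\<Phi> s v *v h) - jac X (Y s u) *v ?y) \<le> L * norm (?w s) + ?c"
          unfolding eq using 1 norm_triangle_ineq[of "jac X (Y s v) *v ?w s" "jac X (Y s v) *v ?y - jac X (Y s u) *v ?y"]
          by linarith
      qed (use L0 ab t in auto)
      then show ?thesis by (simp add: D\<Phi>(1)[OF u] D\<Phi>(1)[OF v])
    qed
    then show "\<forall>\<^sub>F v in at u within W. norm (\<Phi> t v *v h - \<Phi> t u *v h) \<le>
      2 * (norm (jac (Y 0) v *v h - jac (Y 0) u *v h) + (4 * L * norm (jac (Y 0) u *v h) * norm (Y 0 v - Y 0 u)) * (b - a))"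
      by (simp add: eventually_at_filter)
  qed
  then show "((\<lambda>u. \<Phi> t u *v h) \<longlongrightarrow> \<Phi> t u *v h) (at u within W)" by (rule LIM_zero_cancel)
qed

text \<open>Injectivity of the map and of its derivative are pulled back to time 0 by
  \<open>Y_dist\<close> and \<open>\<Phi>_norm\<close>.\<close>

lemma immersion_Y:
  assumes t: "t \<in> {a..b}"
  shows "immersion W (Y t)"
  unfolding immersion_def
proof (intro conjI ballI allI impI)
  show "open W" using im by (simp add: immersion_def)
  have "continuous_on W (partial k (Y t))" for k
  proof (rule continuous_on_eq[OF continuous_on_\<Phi>[OF t, of "axis k 1"]])
    fix u assume "u \<in> W"
    then have "\<Phi> t u *v axis k 1 = jac (Y t) u *v axis k 1" by (simp add: jac_Y[OF _ t])
    then show "\<Phi> t u *v axis k 1 = partial k (Y t) u" by (simp add: jac_mult sum_axis_scaleR)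
  qed
  moreover have "Y t differentiable (at u)" if "u \<in> W" for u
    using Y_has_derivative[OF that t] by (rule differentiableI)
  ultimately show "Ck_on 1 W (Y t)" by (simp add: Ck_on_1)
  show "inj_on (Y t) W"
  proof (rule inj_onI)
    fix u v assume *: "u \<in> W" "v \<in> W" "Y t u = Y t v"
    then have "Y 0 u = Y 0 v" using Y_dist[OF *(1,2) t, of 0] ab by simp
    then show "u = v" using im * by (auto simp: immersion_def dest: inj_onD)
  qed
  fix u v assume u: "u \<in> W" and v: "jac (Y t) u *v v = 0"
  then have "jac (Y 0) u *v v = 0"
    using \<Phi>_norm[OF u t, of 0 v] ab by (simp add: jac_Y[OF u t] D\<Phi>(1)[OF u])
  then show "v = 0" using im u by (simp add: immersion_def)
qed

end

section \<open>The first variation formula\<close>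

text \<open>
  The orthogonal projection onto the tangent space of \<open>M\<close> at \<open>x\<close>; by \<open>tangent_projection_chart\<close>
  it does not depend on the choice of the defining functions.
\<close>

definition tangent_projection ::
  "nat \<Rightarrow> (real ^ 'n::{finite,wellorder}) set \<Rightarrow> real ^ 'n::_ \<Rightarrow> real ^ 'n::_ ^ 'n::_" where
  "tangent_projection m M x = (SOME P. \<exists>U \<rho>. x \<in> U \<and> orthonormal_defining (CARD('n) - m) M U \<rho> \<and>
     P = mat 1 - outer_sum (map (\<lambda>j. grad (\<rho> j) x) [0..<CARD('n) - m]))"

lemma tangent_projection_chart:
  fixes \<phi> :: "real ^ 'm \<Rightarrow> real ^ 'n::{finite,wellorder}"
  assumes M: "submanifold CARD('m) M" and \<phi>: "immersion W \<phi>" "\<phi> ` W \<subseteq> M" and u: "u \<in> W"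
  shows "tangent_projection CARD('m) M (\<phi> u) = tproj (jac \<phi> u)"
proof -
  let ?p = "CARD('n) - CARD('m)"
  have le: "CARD('m) \<le> CARD('n)" using M by (simp add: submanifold_def)
  have x: "\<phi> u \<in> M" using \<phi>(2) u by auto
  define Q where "Q P \<longleftrightarrow> (\<exists>U \<rho>. \<phi> u \<in> U \<and> orthonormal_defining ?p M U \<rho> \<and>
     P = mat 1 - outer_sum (map (\<lambda>j. grad (\<rho> j) (\<phi> u)) [0..<?p]))" for P
  have "\<exists>P. Q P" unfolding Q_def using exists_orthonormal_defining[OF M x] by metis
  then have "Q (SOME P. Q P)" by (rule someI_ex)
  then have "Q (tangent_projection CARD('m) M (\<phi> u))"
    unfolding tangent_projection_def Q_def[abs_def] .
  then obtain U \<rho> where U: "\<phi> u \<in> U" "orthonormal_defining ?p M U \<rho>" and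
    P: "tangent_projection CARD('m) M (\<phi> u) = mat 1 - outer_sum (map (\<lambda>j. grad (\<rho> j) (\<phi> u)) [0..<?p])"
    unfolding Q_def by blast
  show ?thesis
    unfolding P tproj_plus_normal[OF U(2) le \<phi> u U(1), symmetric] by simp
qed

lemma ex_chart:
  fixes M :: "(real ^ 'n::{finite,wellorder}) set"
  assumes M: "submanifold CARD('m::finite) M" and x: "x \<in> M"
  obtains U W \<theta> and \<phi> :: "real ^ 'm \<Rightarrow> real ^ 'n::_" where "open U" "x \<in> U" "immersion W \<phi>" "smooth_on W \<phi>"
    "\<phi> ` W = M \<inter> U" "homeomorphism W (\<phi> ` W) \<phi> \<theta>"
proof -
  have le: "CARD('m) \<le> CARD('n)" using M by (simp add: submanifold_def)
  obtain U \<rho> where U: "x \<in> U" "orthonormal_defining (CARD('n) - CARD('m)) M U \<rho>"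
    using exists_orthonormal_defining[OF M x] by blast
  obtain U' W and \<phi> :: "real ^ 'm \<Rightarrow> real ^ 'n::_" where U': "open U'" "U' \<subseteq> U" "x \<in> U'"
    "local_param M W \<phi>" "\<phi> ` W = M \<inter> U'"
    using exists_local_param[OF U(2) x U(1) le] .
  obtain \<theta> where "homeomorphism W (\<phi> ` W) \<phi> \<theta>" using U'(4) by (auto simp: local_param_def)
  moreover have "smooth_on W \<phi>" using U'(4) by (simp add: local_param_def)
  ultimately show thesis using that U' local_param_immersion[OF U'(4)] by blast
qed

text \<open>A chart around the point yields the same matrix for the chosen and for the given
  defining functions.\<close>

lemma tangent_projection_eq:
  fixes M :: "(real ^ 'n::{finite,wellorder}) set"
  assumes M: "submanifold CARD('m::finite) M"
    and def: "orthonormal_defining (CARD('n) - CARD('m)) M U \<rho>" and x: "x \<in> M" "x \<in> U"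
  shows "tangent_projection CARD('m) M x =
    mat 1 - outer_sum (map (\<lambda>j. grad (\<rho> j) x) [0..<CARD('n) - CARD('m)])"
proof -
  have le: "CARD('m) \<le> CARD('n)" using M by (simp add: submanifold_def)
  obtain U' W \<theta> and \<phi> :: "real ^ 'm \<Rightarrow> real ^ 'n::_" where ch: "open U'" "x \<in> U'" "immersion W \<phi>" "smooth_on W \<phi>"
    "\<phi> ` W = M \<inter> U'" "homeomorphism W (\<phi> ` W) \<phi> \<theta>"
    using ex_chart[OF M x(1)] .
  have "x \<in> \<phi> ` W" using ch x by simp
  then obtain u where u: "u \<in> W" "x = \<phi> u" by auto
  have sub: "\<phi> ` W \<subseteq> M" using ch by simp
  have "\<phi> u \<in> U" using x u by simp
  from tproj_plus_normal[OF def le ch(3) sub u(1) this] tangent_projection_chart[OF M ch(3) sub u(1)]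
  show ?thesis using u(2) by (metis add_diff_cancel_right')
qed

lemma continuous_on_tangent_projection:
  fixes M :: "(real ^ 'n::{finite,wellorder}) set"
  assumes M: "submanifold CARD('m::finite) M"
  shows "continuous_on M (\<lambda>x. tangent_projection CARD('m) M x $ k $ l)"
  unfolding continuous_on_eq_continuous_within
proof
  let ?p = "CARD('n) - CARD('m)"
  fix x assume x: "x \<in> M"
  obtain U \<rho> where U: "x \<in> U" and def: "orthonormal_defining ?p M U \<rho>"
    using exists_orthonormal_defining[OF M x] by blast
  have opU: "open U" and sm: "\<And>j. j < ?p \<Longrightarrow> smooth_on U (\<rho> j)"
    using def unfolding orthonormal_defining_def defining_functions_def by auto
  have eq: "tangent_projection CARD('m) M y $ k $ l =
      mat 1 $ k $ l - (\<Sum>j<?p. grad (\<rho> j) y $ k * grad (\<rho> j) y $ l)" if "y \<in> M \<inter> U" for y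
  proof -
    have y: "y \<in> M" "y \<in> U" using that by auto
    have "inj_on (\<lambda>j. grad (\<rho> j) y) {0..<?p}"
      using orthonormal_defining_list[OF def y] by (simp add: orthonormal_list_def distinct_map)
    from sum.reindex[OF this, of "\<lambda>v. v $ k * v $ l"] show ?thesis
      unfolding tangent_projection_eq[OF M def y] by (simp add: outer_sum_def lessThan_atLeast0)
  qed
  have "continuous_on (M \<inter> U) (\<lambda>y. mat 1 $ k $ l - (\<Sum>j<?p. grad (\<rho> j) y $ k * grad (\<rho> j) y $ l))"
    using Ck_on_continuous[OF smooth_on_grad[OF sm]]
    by (intro continuous_intros) (auto intro: continuous_on_subset)
  then have "continuous_on (M \<inter> U) (\<lambda>y. tangent_projection CARD('m) M y $ k $ l)"
    by (rule continuous_on_eq) (simp add: eq)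
  then have "continuous (at x within M \<inter> U) (\<lambda>y. tangent_projection CARD('m) M y $ k $ l)"
    using x U by (simp add: continuous_on_eq_continuous_within)
  moreover have "at x within M \<inter> U = at x within M"
    using opU U by (intro at_within_nhd[of x U]) auto
  ultimately show "continuous (at x within M) (\<lambda>y. tangent_projection CARD('m) M y $ k $ l)"
    by (simp only: continuous_within)
qed

lemma integrable_surface_measure_compact:
  fixes M :: "(real ^ 'n::{finite,wellorder}) set" and g :: "real ^ 'n::_ \<Rightarrow> 'b::euclidean_space"
  assumes M: "submanifold CARD('m::{finite,wellorder}) M" and g: "continuous_on M g"
    and K: "compact K" "\<And>x. x \<in> M \<Longrightarrow> x \<notin> K \<Longrightarrow> g x = 0"
  shows "g \<in> borel_measurable (restrict_space borel M)" "integrable (surface_measure TYPE('m) M) g"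
proof -
  let ?\<mu> = "surface_measure TYPE('m) M"
  note ss = sets_surface_measure[OF M]
  show gm: "g \<in> borel_measurable (restrict_space borel M)"
    using g by (rule borel_measurable_continuous_on_restrict)
  have closed: "closed M" using M by (simp add: submanifold_def)
  have cK: "compact (M \<inter> K)" using closed K(1) by (simp add: closed_Int_compact)
  obtain B where B: "B \<ge> 0" "\<And>x. x \<in> M \<inter> K \<Longrightarrow> norm (g x) \<le> B"
    using continuous_bounded_on_compact[OF cK continuous_on_subset[OF g]] by auto
  have set: "M \<inter> K \<in> sets ?\<mu>" using closed cK by (simp add: ss borel_closed_restrict borel_compact)
  show "integrable ?\<mu> g"
  proof (rule Bochner_Integration.integrable_bound)
    show "integrable ?\<mu> (\<lambda>x. B * indicator (M \<inter> K) x)"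
      using emeasure_surface_measure_compact[OF M K(1)] set
      by (intro integrable_mult_right integrable_real_indicator) (auto simp: less_top)
    show "g \<in> borel_measurable ?\<mu>" using gm ss(1) by (simp cong: measurable_cong_sets)
    show "AE x in ?\<mu>. norm (g x) \<le> norm (B * indicator (M \<inter> K) x)"
      using B K(2) ss(2) by (intro AE_I2) (auto simp: indicator_def)
  qed
qed

text \<open>A curve of speed at most \<open>L\<close> inside a ball cannot leave it in a short time.\<close>

lemma curve_trapped:
  fixes c :: "real \<Rightarrow> real ^ 'n"
  assumes c: "\<And>t. t \<in> {a..b} \<Longrightarrow> (c has_vector_derivative X (c t)) (at t within {a..b})"
    and X: "\<And>y. y \<in> cball x0 R \<Longrightarrow> norm (X y) \<le> L" and L: "L \<ge> 0"
    and st: "s \<in> {a..b}" "t \<in> {a..b}" and R: "norm (c s - x0) + L * (b - a) < R"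
  shows "norm (c t - x0) \<le> norm (c s - x0) + L * (b - a)"
proof -
  \<comment> \<open>Running from \<open>s\<close> to \<open>t\<close> over the unit interval treats
    both time directions at once.\<close>
  define \<gamma> where "\<gamma> l = s + l * (t - s)" for l
  have \<gamma>: "\<gamma> l \<in> {a..b}" if "l \<in> {0..1}" for l
  proof -
    have "\<gamma> l = (1 - l) * s + l * t" by (simp add: \<gamma>_def algebra_simps)
    moreover have "(1 - l) * s + l * t \<in> {a..b}"
      using convexD_alt[of "{a..b}" s t l] st that by simp
    ultimately show ?thesis by simp
  qed
  define C where "C l = c (\<gamma> l)" for l
  have DC: "(C has_vector_derivative (t - s) *\<^sub>R X (C l)) (at l within S)" if "l \<in> S" "S \<subseteq> {0..1}" for l S
  proof -
    have "(\<gamma> has_vector_derivative (t - s)) (at l within S)"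
      unfolding \<gamma>_def[abs_def] by (auto intro!: derivative_eq_intros simp: has_real_derivative_iff_has_vector_derivative[symmetric])
    moreover have "(c has_vector_derivative X (c (\<gamma> l))) (at (\<gamma> l) within \<gamma> ` S)"
      using \<gamma> that by (intro has_vector_derivative_within_subset[OF c]) auto
    ultimately have "((c \<circ> \<gamma>) has_vector_derivative (t - s) *\<^sub>R X (c (\<gamma> l))) (at l within S)"
      by (rule vector_diff_chain_within)
    then show ?thesis by (simp add: C_def[abs_def] o_def)
  qed
  define e where "e l = norm (C l - x0)" for l
  have "continuous_on {0..1} C" using DC by (intro continuous_on_vector_derivative) blast
  then have ce: "continuous_on {0..1} e" unfolding e_def[abs_def] by (intro continuous_intros)
  have e0: "e 0 = norm (c s - x0)" by (simp add: e_def C_def \<gamma>_def)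
  have step: "norm (C l - C 0) \<le> L * (b - a)" if l: "l \<in> {0..1}" and le: "\<And>l'. l' \<in> {0..l} \<Longrightarrow> e l' \<le> R" for l
  proof -
    have "norm (C l - C 0) \<le> (\<bar>t - s\<bar> * L) * \<bar>l - 0\<bar>"
    proof (rule vector_derivative_bound[where a = 0 and b = l])
      show "(C has_vector_derivative (t - s) *\<^sub>R X (C l')) (at l' within {0..l})" if "l' \<in> {0..l}" for l'
        using that l by (intro DC) auto
      show "norm ((t - s) *\<^sub>R X (C l')) \<le> \<bar>t - s\<bar> * L" if "l' \<in> {0..l}" for l'
        using X[of "C l'"] le[OF that] by (simp add: e_def dist_norm norm_minus_commute mult_left_mono)
    qed (use l in auto)
    also have "\<dots> \<le> (\<bar>t - s\<bar> * L) * 1" using l L by (intro mult_left_mono) auto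
    also have "\<dots> \<le> L * (b - a)" using st L by (simp add: mult.commute mult_right_mono mult_left_mono abs_le_iff)
    finally show ?thesis .
  qed
  have tri: "e l \<le> e 0 + norm (C l - C 0)" for l
    using norm_triangle_ineq[of "C l - C 0" "C 0 - x0"] by (simp add: e_def add.commute)
  have small: "e l < R" if "l \<in> {0..1}" for l
  proof (rule ccontr)
    assume "\<not> e l < R"
    then have "l \<in> {l \<in> {0..1}. R \<le> e l}" using that by simp
    moreover have "compact {l \<in> {0..1}. R \<le> e l}"
    proof -
      have "closed ({0..1} \<inter> e -` {R..})" using ce by (intro continuous_closed_preimage) auto
      then have "compact ({0..1} \<inter> ({0..1} \<inter> e -` {R..}))" by (intro compact_Int_closed) auto
      moreover have "{0..1} \<inter> ({0..1} \<inter> e -` {R..}) = {l \<in> {0..1}. R \<le> e l}" by auto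
      ultimately show ?thesis by simp
    qed
    \<comment> \<open>The first exit time. Up to it the bound on \<open>X\<close> holds, so the
      curve has moved by at most \<open>L * (b - a)\<close> and cannot have reached distance
      \<open>R\<close>.\<close>
    ultimately obtain l1 where l1: "l1 \<in> {0..1}" "R \<le> e l1" "\<And>l. l \<in> {0..1} \<Longrightarrow> R \<le> e l \<Longrightarrow> l1 \<le> l"
      using compact_attains_inf[of "{l \<in> {0..1}. R \<le> e l}"] by auto
    have "e 0 < R" using R e0 L st by (smt (verit) atLeastAtMost_iff mult_nonneg_nonneg)
    have "e l1 \<le> R"
    proof (rule ccontr)
      assume "\<not> e l1 \<le> R"
      then obtain l2 where "0 \<le> l2" "l2 \<le> l1" "e l2 = R"
        using IVT'[of e 0 R l1] \<open>e 0 < R\<close> l1(1) continuous_on_subset[OF ce, of "{0..l1}"] by auto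
      then show False using l1(3)[of l2] l1(1) \<open>\<not> e l1 \<le> R\<close> by auto
    qed
    then have "e l' \<le> R" if "l' \<in> {0..l1}" for l'
      using l1(3)[of l'] that l1(1) by (cases "l' = l1") force+
    from step[OF l1(1) this] tri[of l1] R e0 l1(2) show False by linarith
  qed
  have "norm (C 1 - C 0) \<le> L * (b - a)" using small by (intro step) (auto intro: less_imp_le)
  then have "e 1 \<le> e 0 + L * (b - a)" using tri[of 1] by linarith
  then show ?thesis by (simp add: e_def C_def \<gamma>_def)
qed

lemma norm_matrix_le: "norm A \<le> (\<Sum>i\<in>UNIV. \<Sum>j\<in>UNIV. \<bar>A $ i $ j\<bar>)" for A :: "real ^ 'm ^ 'n"
proof -
  have "norm A \<le> (\<Sum>i\<in>UNIV. norm (A $ i))"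
    unfolding norm_vec_def[of A] by (rule L2_set_le_sum) simp
  also have "\<dots> \<le> (\<Sum>i\<in>UNIV. \<Sum>j\<in>UNIV. \<bar>A $ i $ j\<bar>)" by (intro sum_mono norm_le_l1_cart)
  finally show ?thesis .
qed

text \<open>Compactness of the time interval is needed for the estimates. Where \<open>I\<close> has
  no points on one side of 0, the endpoint on that side is 0, and the derivative within
  \<open>I\<close> stays one-sided.\<close>

lemma interval_neighbourhood:
  fixes I :: "real set"
  assumes I: "is_interval I" "0 \<in> I" and d: "d > 0"
  obtains a b where "a \<le> 0" "0 \<le> b" "b - a \<le> d" "{a..b} \<subseteq> I" "at 0 within {a..b} = at 0 within I"
proof -
  define a where "a = (if \<exists>x\<in>I. x < 0 then max (SOME x. x \<in> I \<and> x < 0) (- (d / 2)) else 0)"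
  define b where "b = (if \<exists>x\<in>I. x > 0 then min (SOME x. x \<in> I \<and> x > 0) (d / 2) else 0)"
  define a0 where "a0 = (SOME x. x \<in> I \<and> x < 0)"
  define b0 where "b0 = (SOME x. x \<in> I \<and> x > 0)"
  have a0: "a0 \<in> I \<and> a0 < 0" if "\<exists>x\<in>I. x < 0" unfolding a0_def by (rule someI_ex) (use that in blast)
  have b0: "b0 \<in> I \<and> b0 > 0" if "\<exists>x\<in>I. x > 0" unfolding b0_def by (rule someI_ex) (use that in blast)
  have mem: "x \<in> I" if "y \<in> I" "z \<in> I" "y \<le> x" "x \<le> z" for x y z
    using I(1) that unfolding is_interval_1 by blast
  have a: "a \<le> 0 \<and> - (d / 2) \<le> a \<and> a \<in> I"
  proof (cases "\<exists>x\<in>I. x < 0")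
    case True
    then have "a = max a0 (- (d / 2))" by (simp add: a_def a0_def)
    then show ?thesis using a0[OF True] d mem[of a0 0 a] I(2) by (simp add: max_def split: if_splits)
  qed (use I(2) d in \<open>simp add: a_def\<close>)
  have b: "0 \<le> b \<and> b \<le> d / 2 \<and> b \<in> I"
  proof (cases "\<exists>x\<in>I. x > 0")
    case True
    then have "b = min b0 (d / 2)" by (simp add: b_def b0_def)
    then show ?thesis using b0[OF True] d mem[of 0 b0 b] I(2) by (simp add: min_def split: if_splits)
  qed (use I(2) d in \<open>simp add: b_def\<close>)
  have sub: "{a..b} \<subseteq> I" using mem[of a b] a b by auto
  define S where "S = {(if a < 0 then a else - 1)<..<(if 0 < b then b else 1)}"
  have "at 0 within {a..b} = at 0 within I"
  proof (rule at_within_nhd[of 0 S])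
    show "0 \<in> S" "open S" using a b by (auto simp: S_def)
    have neg: "a < 0" if "x \<in> I" "x < 0" for x
      using a0 that d by (auto simp: a_def a0_def[symmetric])
    have pos: "0 < b" if "x \<in> I" "0 < x" for x
      using b0 that d by (auto simp: b_def b0_def[symmetric])
    have "x \<in> {a..b}" if "x \<in> I" "x \<in> S" for x
      using that neg[of x] pos[of x] a b
      by (cases "x < 0"; cases "0 < x") (auto simp: S_def split: if_splits)
    then show "{a..b} \<inter> S - {0} = I \<inter> S - {0}" using sub by auto
  qed
  then show thesis using that[of a b] a b sub by auto
qed

subsection \<open>First variation of functions with small support\<close>

lemma jac_compose:
  assumes "f differentiable (at (g x))" "g differentiable (at x)"
  shows "jac (\<lambda>x. f (g x)) x = jac f (g x) ** jac g x"
  by (simp add: jac_def partial_compose[OF assms] matrix_matrix_mult_def vec_eq_iff mult.commute)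

lemma jac_uminus:
  "f differentiable (at x) \<Longrightarrow> jac (\<lambda>x. - f x) x = - jac f x"
  using partial_bounded_linear[OF bounded_linear_minus[OF bounded_linear_ident], of f x]
  by (simp add: jac_def vec_eq_iff)

lemma mean_curvature_vector_normal:
  fixes \<phi> :: "real ^ 'm \<Rightarrow> real ^ 'n::{finite,wellorder}"
  assumes M: "submanifold CARD('m) M" and \<phi>: "immersion W \<phi>" "\<phi> ` W \<subseteq> M" and u: "u \<in> W"
  shows "mean_curvature_vector CARD('m) M (\<phi> u) \<bullet> partial k \<phi> u = 0"
proof -
  let ?p = "CARD('n) - CARD('m)"
  obtain U \<rho> where U: "\<phi> u \<in> U" "orthonormal_defining ?p M U \<rho>" and
    H: "mean_curvature_vector CARD('m) M (\<phi> u) =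
      (\<Sum>j<?p. (\<Sum>k\<in>UNIV. \<Sum>l\<in>UNIV. tproj (jac \<phi> u) $ k $ l * partial k (partial l (\<rho> j)) (\<phi> u)) *\<^sub>R grad (\<rho> j) (\<phi> u))"
    using mean_curvature_vector_chart[OF M \<phi> u] .
  have W: "open W" using \<phi>(1) by (simp add: immersion_def)
  have "grad (\<rho> j) (\<phi> u) \<bullet> partial k \<phi> u = 0" if "j < ?p" for j
    by (rule orthonormal_defining_tangent[OF U(2) W immersion_differentiable[OF \<phi>(1)] \<phi>(2) u U(1) that])
  then show ?thesis unfolding H by (simp add: inner_sum_left)
qed

text \<open>The bound does not involve \<open>A\<close>, because entries of projections are at most
  1. It dominates the variation of area uniformly in time and chart point.\<close>

lemma abs_tdiv_le:
  fixes A :: "real ^ 'm ^ 'n"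
  assumes "det (gram A) \<noteq> 0"
  shows "\<bar>tdiv A (B ** A)\<bar> \<le> (\<Sum>k\<in>UNIV. \<Sum>l\<in>UNIV. \<bar>B $ l $ k\<bar>)"
proof -
  have "\<bar>tdiv A (B ** A)\<bar> \<le> (\<Sum>k\<in>UNIV. \<bar>\<Sum>l\<in>UNIV. tproj A $ k $ l * B $ l $ k\<bar>)"
    unfolding tdiv_matrix_mult by (rule sum_abs)
  also have "\<dots> \<le> (\<Sum>k\<in>UNIV. \<Sum>l\<in>UNIV. \<bar>tproj A $ k $ l * B $ l $ k\<bar>)"
    by (intro sum_mono sum_abs)
  also have "\<dots> \<le> (\<Sum>k\<in>UNIV. \<Sum>l\<in>UNIV. \<bar>B $ l $ k\<bar>)"
  proof (intro sum_mono)
    fix k l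
    have "\<bar>tproj A $ k $ l\<bar> \<le> 1"
      using tproj_props(1,2)[OF assms] by (rule symmetric_idempotent_entry_le_1)
    from mult_right_mono[OF this abs_ge_zero[of "B $ l $ k"]]
    show "\<bar>tproj A $ k $ l * B $ l $ k\<bar> \<le> \<bar>B $ l $ k\<bar>" by (simp add: abs_mult)
  qed
  finally show ?thesis .
qed

context short_flow
begin

lemma \<Phi>_injective: "u \<in> W \<Longrightarrow> t \<in> {a..b} \<Longrightarrow> \<Phi> t u *v v = 0 \<Longrightarrow> v = 0"
  using immersion_Y[of t] jac_Y[of u t] by (simp add: immersion_def)

lemma area_\<Phi>_derivative:
  assumes u: "u \<in> W" and t: "t \<in> {a..b}"
  shows "((\<lambda>t. area (\<Phi> t u)) has_real_derivative area (\<Phi> t u) * tdiv (\<Phi> t u) (jac X (Y t u) ** \<Phi> t u))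
    (at t within {a..b})"
proof (rule area_derivative)
  fix i j
  have "((\<lambda>t. \<Phi> t u *v axis j 1) has_derivative (\<lambda>h. h *\<^sub>R (jac X (Y t u) *v (\<Phi> t u *v axis j 1)))) (at t within {a..b})"
    using D\<Phi>(2)[OF u t] unfolding has_vector_derivative_def .
  from bounded_linear.has_derivative[OF bounded_linear_vec_nth[of i] this]
  show "((\<lambda>t. \<Phi> t u $ i $ j) has_real_derivative (jac X (Y t u) ** \<Phi> t u) $ i $ j) (at t within {a..b})"
    unfolding matrix_vector_mul_assoc
    by (simp add: matrix_vector_mult_basis column_def has_field_derivative_def mult_commute_abs)
qed (rule \<Phi>_injective[OF u t])

text \<open>The entries of \<open>\<Phi>\<close> are at most twice those at time 0, hence lie in a
  fixed ball, on which \<open>area\<close> is bounded.\<close>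

lemma area_\<Phi>_bounded:
  assumes K0: "compact K0" "W \<subseteq> K0" and c: "\<And>k. continuous_on K0 (partial k (Y 0))"
  obtains B where "B \<ge> 0" "\<And>t u. t \<in> {a..b} \<Longrightarrow> u \<in> W \<Longrightarrow> \<bar>area (\<Phi> t u)\<bar> \<le> B"
proof -
  have "continuous_on K0 (\<lambda>u. \<Sum>k\<in>UNIV. norm (partial k (Y 0) u))"
    using c by (intro continuous_on_sum continuous_on_norm)
  then obtain C where C: "C \<ge> 0" "\<And>u. u \<in> K0 \<Longrightarrow> norm (\<Sum>k\<in>UNIV. norm (partial k (Y 0) u)) \<le> C"
    using continuous_bounded_on_compact[OF K0(1)] by blast
  define r where "r = (\<Sum>i\<in>(UNIV :: 'n set). \<Sum>j\<in>(UNIV :: 'm set). 2 * C)"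
  have "continuous_on (cball 0 r) (\<lambda>A :: real ^ 'm ^ 'n. area A)"
    by (intro continuous_on_area continuous_on_component continuous_on_id)
  then obtain B where B: "B \<ge> 0" "\<And>A :: real ^ 'm ^ 'n. A \<in> cball 0 r \<Longrightarrow> norm (area A) \<le> B"
    using continuous_bounded_on_compact[OF compact_cball] by blast
  have "\<bar>area (\<Phi> t u)\<bar> \<le> B" if t: "t \<in> {a..b}" and u: "u \<in> W" for t u
  proof -
    have "\<bar>\<Phi> t u $ i $ j\<bar> \<le> 2 * C" for i j
    proof -
      have "\<bar>\<Phi> t u $ i $ j\<bar> \<le> norm (\<Phi> t u *v axis j 1)"
        using component_le_norm_cart[of "\<Phi> t u *v axis j 1" i] by (simp add: matrix_vector_mult_basis column_def)
      also have "\<dots> \<le> 2 * norm (\<Phi> 0 u *v axis j 1)" using u t ab by (intro \<Phi>_norm) auto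
      also have "\<Phi> 0 u *v axis j 1 = partial j (Y 0) u"
        by (simp add: D\<Phi>(1)[OF u] jac_mult sum_axis_scaleR)
      also have "norm (partial j (Y 0) u) \<le> (\<Sum>k\<in>UNIV. norm (partial k (Y 0) u))"
        by (rule member_le_sum) auto
      also have "\<dots> \<le> C" using C(2)[of u] K0(2) u by auto
      finally show ?thesis by simp
    qed
    then have "norm (\<Phi> t u) \<le> r"
      unfolding r_def by (intro order_trans[OF norm_matrix_le] sum_mono)
    then show ?thesis using B(2)[of "\<Phi> t u"] by simp
  qed
  with B(1) show thesis by (rule that)
qed

end

text \<open>The radius precedes \<open>f\<close>, so a cover by such balls can be fixed before
  \<open>f\<close> is split. The centre \<open>x0\<close> is arbitrary, as the support of a general
  \<open>f\<close> also has points off \<open>M 0\<close>.\<close>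

lemma first_variation_local:
  fixes M :: "real \<Rightarrow> (real ^ 'n::{finite,wellorder}) set" and H :: "real ^ 'n::_ \<Rightarrow> real ^ 'n::_"
    and F :: "real \<Rightarrow> real ^ 'n::_ \<Rightarrow> real ^ 'n::_"
  assumes I: "is_interval I" "0 \<in> I"
    and M: "\<And>t. t \<in> I \<Longrightarrow> submanifold CARD('m::{finite,wellorder}) (M t)"
    and H: "Ck_on 2 UNIV H" "\<And>x. x \<in> M 0 \<Longrightarrow> H x = mean_curvature_vector CARD('m) (M 0) x"
    and F: "\<And>x. x \<in> M 0 \<Longrightarrow> F 0 x = x"
      "\<And>x t. x \<in> M 0 \<Longrightarrow> t \<in> I \<Longrightarrow> ((\<lambda>s. F s x) has_vector_derivative - H (F t x)) (at t within I)"
      "\<And>t. t \<in> I \<Longrightarrow> F t ` M 0 = M t"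
  shows "\<exists>r>0. \<forall>f. Ck_on 2 UNIV f \<longrightarrow> (\<forall>x. x \<notin> cball x0 r \<longrightarrow> f x = 0) \<longrightarrow>
    ((\<lambda>t. LINT x|surface_measure TYPE('m) (M t). f x) has_real_derivative
      - (LINT x|surface_measure TYPE('m) (M 0). f x * (norm (H x))\<^sup>2)
      - (LINT x|surface_measure TYPE('m) (M 0).
          (\<Sum>k\<in>UNIV. \<Sum>l\<in>UNIV. tangent_projection CARD('m) (M 0) x $ k $ l * partial k (partial l f) x))) (at 0 within I)"
proof -
  note M0 = M[OF I(2)]
  have closed: "closed (M 0)" using M0 by (simp add: submanifold_def)
  have "\<exists>U W0 \<theta> (\<psi> :: real ^ 'm::_ \<Rightarrow> real ^ 'n::_). open U \<and> x0 \<in> U \<and> immersion W0 \<psi> \<and> Ck_on 2 W0 \<psi> \<and>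
      \<psi> ` W0 = M 0 \<inter> U \<and> homeomorphism W0 (\<psi> ` W0) \<psi> \<theta>"
  proof (cases "x0 \<in> M 0")
    case True
    then show ?thesis using ex_chart[OF M0 True] smooth_on_Ck_on by metis
  next
    case False
    \<comment> \<open>Away from the closed set \<open>M 0\<close> a neighbourhood misses it, and the
      empty chart lets the same argument run.\<close>
    have "immersion {} (\<lambda>_ :: real ^ 'm::_. 0 :: real ^ 'n::_)" by (simp add: immersion_def Ck_on_const)
    moreover have "homeomorphism {} ((\<lambda>_. 0) ` {}) (\<lambda>_ :: real ^ 'm::_. 0 :: real ^ 'n::_) (\<lambda>_. 0)"
      by (simp add: homeomorphism_def)
    ultimately show ?thesis using False closed
      by (intro exI[of _ "- M 0"] exI[of _ "{}"] exI[of _ "\<lambda>_. 0"]) (auto intro: Ck_on_const)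
  qed
  then obtain U W0 \<theta> and \<psi> :: "real ^ 'm::_ \<Rightarrow> real ^ 'n::_" where U: "open U" "x0 \<in> U" and im0: "immersion W0 \<psi>"
    and C20: "Ck_on 2 W0 \<psi>" and img0: "\<psi> ` W0 = M 0 \<inter> U" and hom: "homeomorphism W0 (\<psi> ` W0) \<psi> \<theta>" by blast
  obtain R where R: "R > 0" "cball x0 R \<subseteq> U" using U open_contains_cball by blast
  \<comment> \<open>\<open>f\<close> lives in radius \<open>r\<close>, the chart covers starting
    points in radius \<open>2 * r\<close>, and curves move by less than \<open>r\<close>, so they
    stay in the ball \<open>K\<close> of radius \<open>R\<close>.\<close>
  define r where "r = R / 4"
  have r: "r > 0" "cball x0 (2 * r) \<subseteq> U" "cball x0 r \<subseteq> ball x0 (2 * r)" using R by (auto simp: r_def)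
  define K where "K = cball x0 R"
  have K: "compact K" "convex K" by (simp_all add: K_def)
  define X where "X x = - H x" for x
  have X2: "Ck_on 2 UNIV X" unfolding X_def[abs_def] using H(1) by (intro Ck_on_uminus) auto
  obtain L where fb: "field_bound X K L" using ex_field_bound[OF X2 K] .
  then have L: "L \<ge> 0" "\<And>y. y \<in> K \<Longrightarrow> norm (X y) \<le> L" by (auto simp: field_bound_def)
  \<comment> \<open>1/2 is for the Gronwall estimates, \<open>r / 2\<close> keeps the displacement
    below \<open>r\<close>, and \<open>L + 1\<close> avoids division by 0.\<close>
  define d where "d = min (1 / 2) (r / 2) / (L + 1)"
  have d: "d > 0" using L r by (simp add: d_def)
  obtain a b where ab: "a \<le> 0" "0 \<le> b" "b - a \<le> d" "{a..b} \<subseteq> I" "at 0 within {a..b} = at 0 within I"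
    using interval_neighbourhood[OF I d] .
  have "L * (b - a) \<le> (L + 1) * d" using L ab by (intro mult_mono) auto
  also have "\<dots> = min (1 / 2) (r / 2)" using L by (simp add: d_def)
  finally have Lab: "L * (b - a) \<le> 1 / 2" "L * (b - a) < r" using r by auto
  \<comment> \<open>A compact set between \<open>W\<close> and \<open>W0\<close>: it gives bounds
    for the chart on \<open>W\<close> and makes \<open>W\<close> of finite measure.\<close>
  define K0 where "K0 = \<theta> ` (M 0 \<inter> cball x0 (2 * r))"
  have \<theta>\<psi>: "\<theta> (\<psi> u) = u" if "u \<in> W0" for u using hom that by (simp add: homeomorphism_def)
  have \<theta>W: "\<theta> y \<in> W0 \<and> \<psi> (\<theta> y) = y" if "y \<in> M 0 \<inter> U" for y
    using that unfolding img0[symmetric] by (auto simp: \<theta>\<psi>)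
  have comp\<theta>: "compact (\<theta> ` (M 0 \<inter> cball x0 s))" if "s \<le> 2 * r" for s
  proof (rule compact_continuous_image)
    show "compact (M 0 \<inter> cball x0 s)" using closed by (simp add: closed_Int_compact)
    have "M 0 \<inter> cball x0 s \<subseteq> \<psi> ` W0" unfolding img0 using r(2) that by auto
    then show "continuous_on (M 0 \<inter> cball x0 s) \<theta>" by (rule continuous_on_subset[OF homeomorphism_cont2[OF hom]])
  qed
  have K0: "compact K0" "K0 \<subseteq> W0"
    unfolding K0_def using comp\<theta>[of "2 * r"] \<theta>W r(2) by auto
  define W where "W = W0 \<inter> \<psi> -` ball x0 (2 * r)"
  have W: "open W" unfolding W_def
    using immersion_continuous_on[OF im0] im0 by (intro continuous_open_preimage) (auto simp: immersion_def)
  have WW0: "W \<subseteq> W0" by (auto simp: W_def)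
  have im: "immersion W \<psi>" using im0 W WW0 by (rule immersion_subset)
  have C2: "Ck_on 2 W \<psi>" using C20 WW0 by (rule Ck_on_subset)
  have sub: "\<psi> ` W \<subseteq> M 0" using img0 WW0 by auto
  have WK0: "W \<subseteq> K0"
  proof
    fix u assume u: "u \<in> W"
    then have "\<psi> u \<in> M 0 \<inter> cball x0 (2 * r)" using sub by (auto simp: W_def)
    then show "u \<in> K0" unfolding K0_def using \<theta>\<psi>[of u] u WW0 by (metis imageI subsetD)
  qed
  define K1 where "K1 = \<theta> ` (M 0 \<inter> cball x0 r)"
  have inW: "\<theta> y \<in> W \<and> \<psi> (\<theta> y) = y" if "y \<in> M 0" "y \<in> ball x0 (2 * r)" for y
    using \<theta>W[of y] that subsetD[OF r(2), of y] by (auto simp: W_def)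
  have K1: "compact K1" "K1 \<subseteq> W"
    unfolding K1_def using comp\<theta>[of r] inW r by auto
  have outK1: "\<psi> u \<notin> cball x0 r" if "u \<in> W" "u \<notin> K1" for u
  proof
    assume "\<psi> u \<in> cball x0 r"
    then have "\<theta> (\<psi> u) \<in> K1" unfolding K1_def using sub that(1) by blast
    then show False using \<theta>\<psi>[of u] that WW0 by auto
  qed
  have offW: "y \<notin> cball x0 r" if "y \<in> M 0" "y \<notin> \<psi> ` W" for y
    using inW[of y] that r(3) by (metis imageI subsetD)
  \<comment> \<open>\<open>F 0\<close> is the identity only on \<open>M 0\<close>; forcing the value
    at time 0 gives \<open>Y 0 = \<psi>\<close> as functions, so derivatives can be transferred
    without a domain.\<close>
  define Y where "Y t u = (if t = 0 then \<psi> u else F t (\<psi> u))" for t u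
  have Y0: "Y 0 = \<psi>" by (simp add: Y_def fun_eq_iff)
  have YF: "Y t u = F t (\<psi> u)" if "u \<in> W" for t u
    using F(1)[of "\<psi> u"] sub that by (auto simp: Y_def)
  have DF: "((\<lambda>t. F t x) has_vector_derivative X (F t x)) (at t within {a..b})" if "x \<in> M 0" "t \<in> {a..b}" for x t
    unfolding X_def using that ab(4) by (intro has_vector_derivative_within_subset[OF F(2)]) auto
  have trapped: "norm (F t x - x0) \<le> norm (F s x - x0) + L * (b - a)"
    if "x \<in> M 0" "s \<in> {a..b}" "t \<in> {a..b}" "norm (F s x - x0) + L * (b - a) < R" for x s t
    by (rule curve_trapped[where c = "\<lambda>t. F t x" and X = X and R = R, OF DF[OF that(1)] _ L(1) that(2,3,4)])
      (use L(2) in \<open>auto simp: K_def\<close>)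
  have YK: "Y t u \<in> K" if t: "t \<in> {a..b}" and u: "u \<in> W" for t u
  proof -
    have x: "\<psi> u \<in> M 0" using sub u by auto
    have "norm (F 0 (\<psi> u) - x0) < 2 * r"
      using u F(1)[OF x] by (simp add: W_def dist_norm norm_minus_commute)
    then have "norm (F t (\<psi> u) - x0) \<le> R"
      using trapped[OF x _ t, of 0] ab Lab r by (simp add: r_def)
    then show ?thesis using YF[OF u] by (simp add: K_def dist_norm norm_minus_commute)
  qed
  interpret sf: short_flow X K L a b W Y
  proof
    show "immersion W (Y 0)" using im by (simp add: Y0)
    show "((\<lambda>t. Y t u) has_vector_derivative X (Y t u)) (at t within {a..b})" if "t \<in> {a..b}" "u \<in> W" for t u
      using DF[of "\<psi> u" t] sub that by (auto simp: YF)
  qed (use X2 K fb ab Lab YK in auto)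
  have \<Phi>0: "sf.\<Phi> 0 u = jac \<psi> u" if "u \<in> W" for u using sf.D\<Phi>(1)[OF that] by (simp add: Y0)
  have c\<psi>: "continuous_on K0 (partial k (Y 0))" for k
  proof -
    have "continuous_on W0 (partial k \<psi>)" using im0 by (simp add: immersion_def Ck_on_1)
    then show ?thesis unfolding Y0 using K0(2) by (rule continuous_on_subset)
  qed
  obtain B3 where B3: "B3 \<ge> 0" "\<And>t u. t \<in> {a..b} \<Longrightarrow> u \<in> W \<Longrightarrow> \<bar>area (sf.\<Phi> t u)\<bar> \<le> B3"
    by (rule sf.area_\<Phi>_bounded[OF K0(1) WK0 c\<psi>]) (rule that; simp)
  have "continuous_on K (\<lambda>y. \<Sum>k\<in>UNIV. \<Sum>l\<in>UNIV. \<bar>jac X y $ l $ k\<bar>)"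
    using continuous_on_subset[OF sf.cont_jac subset_UNIV] by (intro continuous_on_sum continuous_on_rabs)
  then obtain B2 where B2: "B2 \<ge> 0" "\<And>y. y \<in> K \<Longrightarrow> norm (\<Sum>k\<in>UNIV. \<Sum>l\<in>UNIV. \<bar>jac X y $ l $ k\<bar>) \<le> B2"
    using continuous_bounded_on_compact[OF K(1)] by blast
  have dH: "H differentiable (at x)" for x using H(1) by (simp add: numeral_2_eq_2)
  have cH: "continuous_on UNIV H" using H(1) by (rule Ck_on_continuous)
  have Hperp: "H (\<psi> v) \<bullet> partial i \<psi> v = 0" if "v \<in> W" for v i
    using mean_curvature_vector_normal[OF M0 im sub that, of i] H(2)[of "\<psi> v"] sub that by auto
  have finW: "emeasure lborel W < \<infinity>"
    using emeasure_mono[OF WK0, of lborel] emeasure_compact_finite[OF K0(1)] K0(1)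
    by (auto simp: borel_compact intro: le_less_trans)
  show ?thesis
  proof (intro exI[of _ r] conjI allI impI)
    show "r > 0" by fact
    fix f :: "real ^ 'n::_ \<Rightarrow> real" assume f: "Ck_on 2 UNIV f" and f0': "\<forall>x. x \<notin> cball x0 r \<longrightarrow> f x = 0"
    have f0: "f x = 0" if "x \<notin> cball x0 r" for x using f0' that by blast
    let ?g = "grad f"
    have df: "f differentiable (at x)" for x using f by (simp add: numeral_2_eq_2)
    have cf: "continuous_on UNIV f" using f by (rule Ck_on_continuous)
    have g1: "Ck_on 1 UNIV ?g"
      unfolding grad_def using f by (intro Ck_on_vecI) (auto simp: numeral_2_eq_2)
    have dg: "?g differentiable (at x)" for x using g1 by (simp add: Ck_on_1)
    have cg: "continuous_on UNIV ?g" using g1 by (rule Ck_on_continuous)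
    have pg: "partial k ?g x $ l = partial k (partial l f) x" for k l x
      using partial_nth[OF dg, of k l] by (simp add: grad_def)
    have c2: "continuous_on UNIV (partial k (partial l f))" for k l
    proof -
      have "continuous_on UNIV (\<lambda>x. partial k ?g x $ l)"
        using g1 by (intro continuous_on_component) (simp add: Ck_on_1)
      then show ?thesis by (simp add: pg)
    qed
    have op: "open (- cball x0 r)" by auto
    have g0: "?g x = 0" if "x \<notin> cball x0 r" for x
    proof -
      have "partial k f x = partial k (\<lambda>_. 0) x" for k
        using that f0 by (intro partial_cong_open[OF op _ _ df]) auto
      then show ?thesis by (simp add: grad_def vec_eq_iff partial_def)
    qed
    have h0: "partial k (partial l f) x = 0" if "x \<notin> cball x0 r" for x k l
    proof -
      have "partial k ?g x = partial k (\<lambda>_. 0) x"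
        using that g0 by (intro partial_cong_open[OF op _ _ dg]) auto
      then show ?thesis unfolding pg[symmetric] by (simp add: partial_def)
    qed
    obtain B0 where B0: "B0 \<ge> 0" "\<And>y. y \<in> K \<Longrightarrow> norm (f y) \<le> B0"
      using continuous_bounded_on_compact[OF K(1) continuous_on_subset[OF cf subset_UNIV]] by blast
    obtain B1 where B1: "B1 \<ge> 0" "\<And>y. y \<in> K \<Longrightarrow> norm (?g y) \<le> B1"
      using continuous_bounded_on_compact[OF K(1) continuous_on_subset[OF cg subset_UNIV]] by blast
    define q where "q t u = indicator W u * (f (Y t u) * area (sf.\<Phi> t u))" for t u
    define q' where "q' t u = indicator W u * ((?g (Y t u) \<bullet> X (Y t u)) * area (sf.\<Phi> t u) +
      (area (sf.\<Phi> t u) * tdiv (sf.\<Phi> t u) (jac X (Y t u) ** sf.\<Phi> t u)) * f (Y t u))" for t u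
    have int_eq: "(LINT x|surface_measure TYPE('m) (M t). f x) = (LINT u|lborel. q t u)" if t: "t \<in> {a..b}" for t
    proof -
      have tI: "t \<in> I" using t ab(4) by auto
      have "(LINT x|surface_measure TYPE('m) (M t). f x) =
          (LINT u|lborel. indicator W u * (f (Y t u) * area (jac (Y t) u)))"
      proof (rule integral_surface_measure(1)[OF M[OF tI] sf.immersion_Y[OF t]])
        show "Y t ` W \<subseteq> M t" using F(3)[OF tI] sub by (auto simp: YF)
        show "f \<in> borel_measurable (restrict_space borel (M t))"
          using continuous_on_subset[OF cf subset_UNIV] by (rule borel_measurable_continuous_on_restrict)
        fix y assume y: "y \<in> M t" "y \<notin> Y t ` W"
        \<comment> \<open>A point of \<open>M t\<close> in the support of \<open>f\<close>, followed
          back to time 0, moves by less than \<open>r\<close> and thus starts in the chart.\<close>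
        show "f y = 0"
        proof (rule ccontr)
          assume "f y \<noteq> 0"
          then have yr: "norm (y - x0) \<le> r" using f0[of y] by (auto simp: dist_norm norm_minus_commute)
          obtain x where x: "x \<in> M 0" "y = F t x" using F(3)[OF tI] y(1) by auto
          have "norm (F 0 x - x0) \<le> norm (F t x - x0) + L * (b - a)"
            using yr x Lab r ab by (intro trapped[OF x(1) t]) (auto simp: r_def)
          then have "x \<in> ball x0 (2 * r)"
            using yr x Lab F(1)[OF x(1)] by (simp add: dist_norm norm_minus_commute)
          then have "\<theta> x \<in> W" "\<psi> (\<theta> x) = x" using inW[OF x(1)] by auto
          then have "Y t (\<theta> x) = y" using x by (simp add: YF)
          then show False using y(2) \<open>\<theta> x \<in> W\<close> by auto
        qed
      qed
      also have "\<dots> = (LINT u|lborel. q t u)"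
        unfolding q_def using sf.jac_Y[OF _ t]
        by (intro Bochner_Integration.integral_cong refl) (auto simp: indicator_def)
      finally show ?thesis .
    qed
    have bint: "integrable lborel (\<lambda>u. B * indicator W u)" for B :: real
      using finW W by (intro integrable_mult_right integrable_real_indicator) auto
    have "((\<lambda>t. LINT u|lborel. q t u) has_real_derivative (LINT u|lborel. q' 0 u)) (at 0 within {a..b})"
    \<comment> \<open>The constants bound the gradient of \<open>f\<close> (\<open>B1\<close>), the
      speed (\<open>L\<close>), the area density (\<open>B3\<close>), the divergence
      (\<open>B2\<close>) and \<open>f\<close> itself (\<open>B0\<close>).\<close>
    proof (rule DERIV_integral_dominated[where g = "\<lambda>u. (B1 * L * B3 + B3 * B2 * B0) * indicator W u"])
      show "convex {a..b}" "0 \<in> {a..b}" using ab by auto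
      show "integrable lborel (\<lambda>u. (B1 * L * B3 + B3 * B2 * B0) * indicator W u)" by (rule bint)
      fix t assume t: "t \<in> {a..b}"
      show "integrable lborel (q t)"
      proof (rule Bochner_Integration.integrable_bound[OF bint[of "B0 * B3"]])
        have "continuous_on W (\<lambda>u. f (Y t u) * area (jac (Y t) u))"
          using sf.immersion_Y[OF t] immersion_continuous_on
          by (intro continuous_intros immersion_area_continuous continuous_on_compose2[OF cf]) auto
        then have "(\<lambda>u. indicator W u *\<^sub>R (f (Y t u) * area (jac (Y t) u))) \<in> borel_measurable borel"
          using W by (intro borel_measurable_continuous_on_indicator) auto
        also have "(\<lambda>u. indicator W u *\<^sub>R (f (Y t u) * area (jac (Y t) u))) = q t"
          using sf.jac_Y[OF _ t] by (auto simp: q_def fun_eq_iff indicator_def)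
        finally show "q t \<in> borel_measurable lborel" by simp
        have "\<bar>f (Y t u) * area (sf.\<Phi> t u)\<bar> \<le> B0 * B3" if "u \<in> W" for u
          unfolding abs_mult using B0 B3 YK[OF t that] that t by (intro mult_mono) auto
        then show "AE u in lborel. norm (q t u) \<le> norm (B0 * B3 * indicator W u)"
          by (intro AE_I2) (simp add: q_def indicator_def order_trans[OF _ abs_ge_self])
      qed
      fix u :: "real ^ 'm::_"
      show "((\<lambda>t. q t u) has_real_derivative q' t u) (at t within {a..b})"
      proof (cases "u \<in> W")
        case True
        have "((\<lambda>t. Y t u) has_derivative (\<lambda>h. h *\<^sub>R X (Y t u))) (at t within {a..b})"
          using sf.DY[OF t True] by (simp add: has_vector_derivative_def)
        from has_derivative_compose[OF this has_derivative_grad[OF df]]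
        have "((\<lambda>t. f (Y t u)) has_real_derivative (?g (Y t u) \<bullet> X (Y t u))) (at t within {a..b})"
          by (simp add: has_field_derivative_def mult_commute_abs)
        from DERIV_mult[OF this sf.area_\<Phi>_derivative[OF True t]]
        show ?thesis using True by (simp add: q_def q'_def)
      qed (simp add: q_def q'_def)
      show "\<bar>q' t u\<bar> \<le> (B1 * L * B3 + B3 * B2 * B0) * indicator W u"
      proof (cases "u \<in> W")
        case True
        note y = YK[OF t True]
        have 1: "\<bar>?g (Y t u) \<bullet> X (Y t u)\<bar> \<le> B1 * L"
          using Cauchy_Schwarz_ineq2[of "?g (Y t u)" "X (Y t u)"] mult_mono[OF B1(2)[OF y] L(2)[OF y] B1(1) norm_ge_zero]
          by linarith
        have nz: "det (gram (sf.\<Phi> t u)) \<noteq> 0"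
          using det_gram_pos[of "sf.\<Phi> t u"] sf.\<Phi>_injective[OF True t] by force
        have 2: "\<bar>tdiv (sf.\<Phi> t u) (jac X (Y t u) ** sf.\<Phi> t u)\<bar> \<le> B2"
          using abs_tdiv_le[OF nz, of "jac X (Y t u)"] B2(2)[OF y] by simp
        have "\<bar>(?g (Y t u) \<bullet> X (Y t u)) * area (sf.\<Phi> t u)\<bar> \<le> B1 * L * B3"
          unfolding abs_mult using 1 B3(2)[OF t True] B1(1) L(1) B3(1) by (intro mult_mono) auto
        moreover have "\<bar>(area (sf.\<Phi> t u) * tdiv (sf.\<Phi> t u) (jac X (Y t u) ** sf.\<Phi> t u)) * f (Y t u)\<bar> \<le> B3 * B2 * B0"
          unfolding abs_mult using 2 B3(2)[OF t True] B0(2)[OF y] B2(1) B3(1) by (intro mult_mono) auto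
        ultimately show ?thesis using True unfolding q'_def by simp
      qed (simp add: q'_def)
    qed
    then have "((\<lambda>t. LINT x|surface_measure TYPE('m) (M t). f x) has_real_derivative (LINT u|lborel. q' 0 u)) (at 0 within {a..b})"
      by (rule has_field_derivative_transform_within[where d = 1]) (use int_eq ab in auto)
    then have der: "((\<lambda>t. LINT x|surface_measure TYPE('m) (M t). f x) has_real_derivative (LINT u|lborel. q' 0 u)) (at 0 within I)"
      by (simp only: ab(5))
    let ?G1 = "\<lambda>x. ?g x \<bullet> H x" and ?G2 = "\<lambda>x. f x * (norm (H x))\<^sup>2"
    let ?G3 = "\<lambda>x. \<Sum>k\<in>UNIV. \<Sum>l\<in>UNIV. tangent_projection CARD('m) (M 0) x $ k $ l * partial k (partial l f) x"
    let ?J = "\<lambda>G u. indicator W u * (G (\<psi> u) * area (jac \<psi> u))"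
    \<comment> \<open>At time 0 the field is \<open>- H\<close>, and \<open>H\<close> along the
      chart is normal, so its divergence is \<open>H \<bullet> H\<close>.\<close>
    have q'0: "q' 0 u = - (?J ?G1 u) - ?J ?G2 u" for u
    proof (cases "u \<in> W")
      case True
      have dHu: "(\<lambda>u. H (\<psi> u)) differentiable (at u)"
        using has_derivative_compose_partials[OF dH immersion_differentiable[OF im True]] by (rule differentiableI)
      have "jac X (\<psi> u) ** jac \<psi> u = - (jac H (\<psi> u) ** jac \<psi> u)"
        unfolding X_def[abs_def] jac_uminus[OF dH] by (simp add: matrix_matrix_mult_def vec_eq_iff sum_negf)
      also have "\<dots> = - jac (\<lambda>u. H (\<psi> u)) u"
        by (simp add: jac_compose[OF dH immersion_differentiable[OF im True]])
      finally have "tdiv (jac \<psi> u) (jac X (\<psi> u) ** jac \<psi> u) = - tdiv (jac \<psi> u) (jac (\<lambda>u. H (\<psi> u)) u)"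
        by (simp add: linear_neg[OF linear_tdiv])
      also have "\<dots> = - (norm (H (\<psi> u)))\<^sup>2"
        using tdiv_normal_field[OF M0 im sub C2 Hperp dHu True] H(2)[of "\<psi> u"] sub True
        by (auto simp: power2_norm_eq_inner)
      finally show ?thesis using True by (simp add: q'_def Y0 \<Phi>0 X_def)
    qed (simp add: q'_def)
    have G: "continuous_on (M 0) ?G1" "continuous_on (M 0) ?G2" "continuous_on (M 0) ?G3"
      by (intro continuous_on_sum continuous_on_mult continuous_on_inner continuous_on_power continuous_on_norm
        continuous_on_subset[OF cH subset_UNIV] continuous_on_subset[OF cg subset_UNIV]
        continuous_on_subset[OF cf subset_UNIV] continuous_on_subset[OF c2 subset_UNIV]
        continuous_on_tangent_projection[OF M0])+
    have Gz: "?G1 x = 0" "?G2 x = 0" "?G3 x = 0" if "x \<notin> cball x0 r" for x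
      using f0[OF that] g0[OF that] h0[OF that] by simp_all
    have surf: "(LINT x|surface_measure TYPE('m) (M 0). G x) = (LINT u|lborel. ?J G u)" "integrable lborel (?J G)"
      if c: "continuous_on (M 0) G" and z: "\<And>x. x \<notin> cball x0 r \<Longrightarrow> G x = 0" for G :: "real ^ 'n::_ \<Rightarrow> real"
    proof -
      note i = integrable_surface_measure_compact[OF M0 c compact_cball[of x0 r] z]
      note s = integral_surface_measure[OF M0 im sub i(1) z[OF offW]]
      show "(LINT x|surface_measure TYPE('m) (M 0). G x) = (LINT u|lborel. ?J G u)" by (rule s(1))
      show "integrable lborel (?J G)" using s(2) i(2) by blast
    qed
    have "(LINT u|lborel. q' 0 u) = - (LINT u|lborel. ?J ?G1 u) - (LINT u|lborel. ?J ?G2 u)"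
      unfolding q'0 using surf(2)[OF G(1) Gz(1)] surf(2)[OF G(2) Gz(2)]
      by (subst Bochner_Integration.integral_diff) auto
    also have "(LINT u|lborel. ?J ?G2 u) = (LINT x|surface_measure TYPE('m) (M 0). ?G2 x)"
      by (rule surf(1)[OF G(2) Gz(2), symmetric])
    also have "(LINT u|lborel. ?J ?G1 u) = (LINT x|surface_measure TYPE('m) (M 0). ?G3 x)"
    proof -
      \<comment> \<open>The gradient vanishes outside radius \<open>r\<close>, so on
        \<open>W\<close> this field is supported in the compact \<open>K1\<close>.\<close>
      let ?Z = "\<lambda>u. ?g (\<psi> u)"
      have Z1: "Ck_on 1 W ?Z"
        using Ck_on_mono[OF C2, of 1] by (intro Ck_on_compose[OF W _ subset_UNIV g1]) simp
      have "(LINT u|lborel. indicator W u * (area (jac \<psi> u) * tdiv (jac \<psi> u) (jac ?Z u))) =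
          (LINT u|lborel. indicator W u * (area (jac \<psi> u) * (?Z u \<bullet> H (\<psi> u))))"
      proof (rule divergence_theorem_chart[OF M0 im sub C2 Z1 K1 _ cH _ Hperp])
        show "?Z u = 0" if "u \<in> W" "u \<notin> K1" for u using g0[OF outK1[OF that]] .
        show "H (\<psi> u) = mean_curvature_vector CARD('m) (M 0) (\<psi> u)" if "u \<in> W" for u
          using H(2) sub that by auto
      qed
      also have "\<dots> = (LINT u|lborel. ?J ?G1 u)" by (simp only: mult.commute[of "area _"])
      finally have "(LINT u|lborel. ?J ?G1 u) =
          (LINT u|lborel. indicator W u * (area (jac \<psi> u) * tdiv (jac \<psi> u) (jac ?Z u)))" by simp
      also have "\<dots> = (LINT u|lborel. ?J ?G3 u)"
      proof (rule Bochner_Integration.integral_cong[OF refl])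
        fix u
        show "indicator W u * (area (jac \<psi> u) * tdiv (jac \<psi> u) (jac ?Z u)) = ?J ?G3 u"
        proof (cases "u \<in> W")
          case True
          have "tdiv (jac \<psi> u) (jac ?Z u) = ?G3 (\<psi> u)"
            unfolding jac_compose[OF dg immersion_differentiable[OF im True]] tdiv_matrix_mult
              tangent_projection_chart[OF M0 im sub True]
            by (simp add: jac_def[of ?g] pg)
          then show ?thesis by simp
        qed simp
      qed
      also have "\<dots> = (LINT x|surface_measure TYPE('m) (M 0). ?G3 x)"
        by (rule surf(1)[OF G(3) Gz(3), symmetric])
      finally show ?thesis .
    qed
    finally have "(LINT u|lborel. q' 0 u) = - (LINT x|surface_measure TYPE('m) (M 0). ?G2 x) -
        (LINT x|surface_measure TYPE('m) (M 0). ?G3 x)" by simp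
    with der show "((\<lambda>t. LINT x|surface_measure TYPE('m) (M t). f x) has_real_derivative
      - (LINT x|surface_measure TYPE('m) (M 0). ?G2 x) - (LINT x|surface_measure TYPE('m) (M 0). ?G3 x)) (at 0 within I)"
      by simp
  qed
qed

subsection \<open>Partition of unity\<close>

text \<open>At 0 the function is \<open>s\<close> times a continuous function vanishing there, since
  the exponent is at least 2.\<close>

lemma DERIV_max_power:
  "((\<lambda>s. max 0 s ^ Suc (Suc q)) has_real_derivative real (Suc (Suc q)) * max 0 s ^ Suc q) (at (s :: real))"
proof -
  consider "s > 0" | "s < 0" | "s = 0" by linarith
  then show ?thesis
  proof cases
    case 1
    have "((\<lambda>s. s ^ Suc (Suc q)) has_real_derivative real (Suc (Suc q)) * max 0 s ^ Suc q) (at s)"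
      using 1 DERIV_pow[of "Suc (Suc q)" s UNIV] by simp
    then show ?thesis
      by (rule has_field_derivative_transform_within_open[where S = "{0<..}"]) (use 1 in auto)
  next
    case 2
    have "((\<lambda>s. 0) has_real_derivative real (Suc (Suc q)) * max 0 s ^ Suc q) (at s)"
      using 2 by simp
    then show ?thesis
      by (rule has_field_derivative_transform_within_open[where S = "{..<0}"]) (use 2 in auto)
  next
    case 3
    have "((\<lambda>s :: real. max 0 s ^ Suc (Suc q)) has_real_derivative 0) (at 0)"
      unfolding CARAT_DERIV
      by (intro exI[of _ "\<lambda>s. max 0 s ^ Suc q"] conjI allI continuous_intros) (auto simp: max_def)
    then show ?thesis using 3 by simp
  qed
qed

text \<open>A derivative lowers the exponent by one, so the power \<open>Suc r\<close> of the
  positive part has \<open>r\<close> continuous derivatives. Such cutoffs of finite class replace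
  smooth bump functions.\<close>

lemma Ck_on_max_power:
  fixes g :: "real ^ 'n \<Rightarrow> real"
  assumes U: "open U" and "Ck_on r U g"
  shows "Ck_on r U (\<lambda>x. max 0 (g x) ^ Suc r)"
  using assms(2)
proof (induction r)
  case 0
  then show ?case by (auto intro!: continuous_intros)
next
  case (Suc r)
  have d: "((\<lambda>x. max 0 (g x) ^ Suc (Suc r)) has_derivative
      (\<lambda>h. real (Suc (Suc r)) * max 0 (g x) ^ Suc r * (\<Sum>k\<in>UNIV. h $ k *\<^sub>R partial k g x))) (at x)" if "x \<in> U" for x
    using has_derivative_compose[OF has_derivative_partials[OF Ck_on_differentiable[OF Suc.prems that]]
      DERIV_max_power[of r "g x", unfolded has_field_derivative_def]] .
  have p: "partial k (\<lambda>x. max 0 (g x) ^ Suc (Suc r)) x =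
      real (Suc (Suc r)) * max 0 (g x) ^ Suc r * partial k g x" if "x \<in> U" for x k
    using partial_eqI[OF d[OF that], of k] by (simp only: sum_axis_scaleR)
  have g: "Ck_on r U g" "Ck_on r U (partial k g)" for k using Suc.prems Ck_on_Suc_imp[OF Suc.prems] by auto
  have c: "Ck_on r U (\<lambda>x. real (Suc (Suc r)) * max 0 (g x) ^ Suc r * partial k g x)" for k
    by (intro Ck_on_mult U Ck_on_const Suc.IH g)
  have "Ck_on r U (partial k (\<lambda>x. max 0 (g x) ^ Suc (Suc r)))" for k
    by (rule Ck_on_cong[OF U p[symmetric] c])
  then show ?case using d by (auto intro: differentiableI simp del: power_Suc)
qed

lemma Ck_on_Un: "open U \<Longrightarrow> open V \<Longrightarrow> Ck_on r U f \<Longrightarrow> Ck_on r V f \<Longrightarrow> Ck_on r (U \<union> V) f"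
  by (induction r arbitrary: f) (auto intro: continuous_on_open_Un)

lemma Ck_partition:
  fixes f :: "real ^ 'n \<Rightarrow> real"
  assumes f: "Ck_on r UNIV f" and K: "compact K" "\<And>x. x \<notin> K \<Longrightarrow> f x = 0"
    and \<delta>: "\<And>x. \<delta> x > 0"
  obtains A h where "finite A" "\<forall>a. Ck_on r UNIV (h a)" "\<forall>a x. x \<notin> cball a (\<delta> a) \<longrightarrow> h a x = 0"
    "f = (\<lambda>x. \<Sum>a\<in>A. h a x)"
proof -
  have "K \<subseteq> (\<Union>a\<in>K. ball a (\<delta> a))" using \<delta> by auto
  then obtain A where A: "A \<subseteq> K" "finite A" "K \<subseteq> (\<Union>a\<in>A. ball a (\<delta> a))"
    using compactE_image[OF K(1), of K "\<lambda>a. ball a (\<delta> a)"] by auto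
  \<comment> \<open>A bump that is positive exactly in the open ball around
    \<open>a\<close>.\<close>
  define b where "b a x = max 0 ((\<delta> a)\<^sup>2 - (x - a) \<bullet> (x - a)) ^ Suc r" for a x
  define B where "B x = (\<Sum>a\<in>A. b a x)" for x
  have b: "Ck_on r UNIV (b a)" for a
    unfolding b_def by (intro Ck_on_max_power Ck_on_diff Ck_on_inner Ck_on_const Ck_on_ident open_UNIV)
  have B: "Ck_on r UNIV B" unfolding B_def using b by (intro Ck_on_sum open_UNIV)
  have b0: "b a x \<ge> 0" for a x by (simp add: b_def)
  have bout: "b a x = 0" if "x \<notin> cball a (\<delta> a)" for a x
  proof -
    have "(\<delta> a)\<^sup>2 \<le> (norm (x - a))\<^sup>2"
      using that \<delta>[of a] by (intro power_mono) (auto simp: dist_norm norm_minus_commute)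
    then show ?thesis by (simp add: b_def power2_norm_eq_inner)
  qed
  have bin: "b a x > 0" if "x \<in> ball a (\<delta> a)" for a x
  proof -
    have "(norm (x - a))\<^sup>2 < (\<delta> a)\<^sup>2"
      using that by (intro power_strict_mono) (auto simp: dist_norm norm_minus_commute)
    then show ?thesis unfolding b_def by (simp add: power2_norm_eq_inner)
  qed
  have Bpos: "B x \<noteq> 0" if x: "x \<in> K" for x
  proof -
    obtain a where a: "a \<in> A" "x \<in> ball a (\<delta> a)" using A(3) x by auto
    have "b a x \<le> B x" unfolding B_def using a A(2) b0 by (intro member_le_sum) auto
    then show ?thesis using bin[OF a(2)] by linarith
  qed
  \<comment> \<open>\<open>B\<close> is nonzero on \<open>K\<close>; off \<open>K\<close> the factor
    \<open>f x\<close> is 0. Hence \<open>h a\<close> is of class C^r on two open sets covering the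
    space.\<close>
  define h where "h a x = f x * (b a x / B x)" for a x
  define V where "V = {x. B x \<noteq> 0}"
  have V: "open V" unfolding V_def
    using Ck_on_continuous[OF B] by (intro open_Collect_neq continuous_on_const)
  have VK: "open (- K)" "V \<union> - K = UNIV" using compact_imp_closed[OF K(1)] Bpos by (auto simp: V_def)
  have "Ck_on r UNIV (h a)" for a
  proof -
    have "Ck_on r V (h a)"
      unfolding h_def using Ck_on_subset[OF f subset_UNIV] Ck_on_subset[OF b subset_UNIV] Ck_on_subset[OF B subset_UNIV] V
      by (intro Ck_on_mult Ck_on_divide) (auto simp: V_def)
    moreover have "Ck_on r (- K) (h a)"
      by (rule Ck_on_cong[OF VK(1) _ Ck_on_const[of r _ 0]]) (use K(2) in \<open>auto simp: h_def\<close>)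
    ultimately show ?thesis using Ck_on_Un[OF V VK(1)] VK(2) by metis
  qed
  moreover have "h a x = 0" if "x \<notin> cball a (\<delta> a)" for a x using bout[OF that] by (simp add: h_def)
  moreover have "f x = (\<Sum>a\<in>A. h a x)" for x
  proof -
    have "(\<Sum>a\<in>A. h a x) = f x * (B x / B x)"
      unfolding h_def sum_distrib_left[symmetric] sum_divide_distrib[symmetric] B_def[symmetric] ..
    then show ?thesis using Bpos[of x] K(2)[of x] by (cases "x \<in> K") auto
  qed
  ultimately show thesis using A(2) by (intro that[of A h]) auto
qed

lemma partial_sum:
  assumes "\<And>a. a \<in> A \<Longrightarrow> h a differentiable (at x)"
  shows "partial k (\<lambda>x. \<Sum>a\<in>A. h a x) x = (\<Sum>a\<in>A. partial k (h a) x)"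
  using partial_eqI[OF has_derivative_sum[OF has_derivative_partials[OF assms]], of A "\<lambda>a. a" k]
  by (simp add: sum_axis_scaleR)

lemma partial_eq_0_outside:
  assumes "compact K" "\<And>x. x \<notin> K \<Longrightarrow> f x = 0" "x \<notin> K"
  shows "partial k f x = 0"
proof -
  have "open (- K)" using compact_imp_closed[OF assms(1)] by auto
  then have "partial k (\<lambda>_. 0) x = partial k f x"
    using assms by (intro partial_cong_open[of "- K"]) auto
  then show ?thesis by (simp add: partial_def)
qed

text \<open>All three integrals are linear in \<open>f\<close>, so the local formula, applied to the
  finitely many pieces of a partition with the radii it provides, sums up.\<close>

lemma first_variation:
  fixes M :: "real \<Rightarrow> (real ^ 'n::{finite,wellorder}) set" and H :: "real ^ 'n::_ \<Rightarrow> real ^ 'n::_"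
    and F :: "real \<Rightarrow> real ^ 'n::_ \<Rightarrow> real ^ 'n::_"
  assumes I: "is_interval I" "0 \<in> I"
    and M: "\<And>t. t \<in> I \<Longrightarrow> submanifold CARD('m::{finite,wellorder}) (M t)"
    and H: "Ck_on 2 UNIV H" "\<And>x. x \<in> M 0 \<Longrightarrow> H x = mean_curvature_vector CARD('m) (M 0) x"
    and F: "\<And>x. x \<in> M 0 \<Longrightarrow> F 0 x = x"
      "\<And>x t. x \<in> M 0 \<Longrightarrow> t \<in> I \<Longrightarrow> ((\<lambda>s. F s x) has_vector_derivative - H (F t x)) (at t within I)"
      "\<And>t. t \<in> I \<Longrightarrow> F t ` M 0 = M t"
    and f: "Ck_on 2 UNIV f" and K: "compact K" "\<And>x. x \<notin> K \<Longrightarrow> f x = 0"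
  shows "((\<lambda>t. LINT x|surface_measure TYPE('m) (M t). f x) has_real_derivative
      - (LINT x|surface_measure TYPE('m) (M 0). f x * (norm (H x))\<^sup>2)
      - (LINT x|surface_measure TYPE('m) (M 0).
          (\<Sum>k\<in>UNIV. \<Sum>l\<in>UNIV. tangent_projection CARD('m) (M 0) x $ k $ l * partial k (partial l f) x))) (at 0 within I)"
proof -
  let ?\<mu> = "\<lambda>t. surface_measure TYPE('m) (M t)"
  let ?G2 = "\<lambda>f x. f x * (norm (H x))\<^sup>2"
  let ?G3 = "\<lambda>f x. \<Sum>k\<in>UNIV. \<Sum>l\<in>UNIV. tangent_projection CARD('m) (M 0) x $ k $ l * partial k (partial l f) x"
  have "\<forall>x0. \<exists>r>0. \<forall>f. Ck_on 2 UNIV f \<longrightarrow> (\<forall>x. x \<notin> cball x0 r \<longrightarrow> f x = 0) \<longrightarrow>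
    ((\<lambda>t. LINT x|?\<mu> t. f x) has_real_derivative - (LINT x|?\<mu> 0. ?G2 f x) - (LINT x|?\<mu> 0. ?G3 f x)) (at 0 within I)"
    by (rule allI, rule first_variation_local[OF I M H F])
  from choice[OF this] obtain \<delta> where \<delta>': "\<forall>x0. \<delta> x0 > 0 \<and> (\<forall>f. Ck_on 2 UNIV f \<longrightarrow> (\<forall>x. x \<notin> cball x0 (\<delta> x0) \<longrightarrow> f x = 0) \<longrightarrow>
    ((\<lambda>t. LINT x|?\<mu> t. f x) has_real_derivative - (LINT x|?\<mu> 0. ?G2 f x) - (LINT x|?\<mu> 0. ?G3 f x)) (at 0 within I))" ..
  have \<delta>: "\<delta> x0 > 0" for x0 using \<delta>' by simp
  have loc: "((\<lambda>t. LINT x|?\<mu> t. f x) has_real_derivative - (LINT x|?\<mu> 0. ?G2 f x) - (LINT x|?\<mu> 0. ?G3 f x)) (at 0 within I)"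
    if "Ck_on 2 UNIV f" "\<And>x. x \<notin> cball x0 (\<delta> x0) \<Longrightarrow> f x = 0" for x0 f
    by (rule \<delta>'[rule_format, THEN conjunct2, rule_format]) (use that in auto)
  obtain A h where A: "finite A" and h': "\<forall>a. Ck_on 2 UNIV (h a)" "\<forall>a x. x \<notin> cball a (\<delta> a) \<longrightarrow> h a x = 0"
    and feq: "f = (\<lambda>x. \<Sum>a\<in>A. h a x)"
    using Ck_partition[OF f K \<delta>] .
  have h: "Ck_on 2 UNIV (h a)" "x \<notin> cball a (\<delta> a) \<Longrightarrow> h a x = 0" for a x
    using h' by (simp_all del: Ck_on.simps)
  have fh: "f x = (\<Sum>a\<in>A. h a x)" for x unfolding feq ..
  have dh: "h a differentiable (at x)" "partial l (h a) differentiable (at x)" for a l x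
    using h(1)[of a] by (auto simp: numeral_2_eq_2)
  have pl: "partial l f = (\<lambda>x. \<Sum>a\<in>A. partial l (h a) x)" for l
    unfolding feq using dh(1) by (intro ext partial_sum)
  have pkl: "partial k (partial l f) x = (\<Sum>a\<in>A. partial k (partial l (h a)) x)" for k l x
    unfolding pl using dh(2) by (intro partial_sum)
  have "continuous_on UNIV (partial k (partial l (h a)))" for a k l
    using h(1)[of a] by (auto simp: numeral_2_eq_2)
  from continuous_on_subset[OF Ck_on_continuous[OF h(1)] subset_UNIV] continuous_on_subset[OF this subset_UNIV]
  have ch: "continuous_on S (h a)" "continuous_on S (partial k (partial l (h a)))" for S a k l .
  have z: "partial k (partial l (h a)) x = 0" if "x \<notin> cball a (\<delta> a)" for k l a x
    by (rule partial_eq_0_outside[OF compact_cball partial_eq_0_outside[OF compact_cball h(2)] that])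
  note cH = continuous_on_subset[OF Ck_on_continuous[OF H(1)] subset_UNIV]
  have i1: "integrable (?\<mu> t) (h a)" if "t \<in> I" for t a
    by (rule integrable_surface_measure_compact(2)[OF M[OF that] ch(1) compact_cball h(2)])
  have i2: "integrable (?\<mu> 0) (?G2 (h a))" for a
  proof (rule integrable_surface_measure_compact(2)[OF M[OF I(2)] _ compact_cball])
    show "continuous_on (M 0) (?G2 (h a))"
      by (intro continuous_on_mult continuous_on_power continuous_on_norm ch cH)
    show "?G2 (h a) x = 0" if "x \<notin> cball a (\<delta> a)" for x using h(2)[OF that] by simp
  qed
  have i3: "integrable (?\<mu> 0) (?G3 (h a))" for a
  proof (rule integrable_surface_measure_compact(2)[OF M[OF I(2)] _ compact_cball])
    show "continuous_on (M 0) (?G3 (h a))"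
      by (intro continuous_on_sum continuous_on_mult ch continuous_on_tangent_projection[OF M[OF I(2)]])
    show "?G3 (h a) x = 0" if "x \<notin> cball a (\<delta> a)" for x using z[OF that] by simp
  qed
  have s1: "(LINT x|?\<mu> t. f x) = (\<Sum>a\<in>A. LINT x|?\<mu> t. h a x)" if "t \<in> I" for t
    unfolding fh using i1[OF that] by (rule Bochner_Integration.integral_sum)
  have s2: "(LINT x|?\<mu> 0. ?G2 f x) = (\<Sum>a\<in>A. LINT x|?\<mu> 0. ?G2 (h a) x)"
    unfolding fh sum_distrib_right using i2 by (rule Bochner_Integration.integral_sum)
  have G3: "?G3 f x = (\<Sum>a\<in>A. ?G3 (h a) x)" for x
    unfolding pkl sum_distrib_left by (simp add: sum.swap[where B = A])
  have s3: "(LINT x|?\<mu> 0. ?G3 f x) = (\<Sum>a\<in>A. LINT x|?\<mu> 0. ?G3 (h a) x)"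
    unfolding G3 using i3 by (rule Bochner_Integration.integral_sum)
  have "((\<lambda>t. \<Sum>a\<in>A. LINT x|?\<mu> t. h a x) has_real_derivative
      (\<Sum>a\<in>A. - (LINT x|?\<mu> 0. ?G2 (h a) x) - (LINT x|?\<mu> 0. ?G3 (h a) x))) (at 0 within I)"
    by (intro DERIV_sum loc h)
  then have "((\<lambda>t. LINT x|?\<mu> t. f x) has_real_derivative
      (\<Sum>a\<in>A. - (LINT x|?\<mu> 0. ?G2 (h a) x) - (LINT x|?\<mu> 0. ?G3 (h a) x))) (at 0 within I)"
    by (rule has_field_derivative_transform_within[where d = 1]) (use s1 I(2) in auto)
  then show ?thesis unfolding s2 s3 by (simp add: sum_subtractf sum_negf)
qed

section \<open>The currents of a submanifold\<close>

definition signed_normal_form :: "nat \<Rightarrow> (real ^ 'n::{finite,wellorder}) set \<Rightarrow> 'n superform" where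
  "signed_normal_form p M x = (- 1) ^ (p * (p - 1) div 2) *\<^sub>R normal_form p M x"

lemma signed_normal_form_eq_prod_twoforms:
  fixes M :: "(real ^ 'n::{finite,wellorder}) set"
  assumes M: "submanifold m M" and x: "x \<in> M"
  obtains U \<rho> where "x \<in> U" "orthonormal_defining (CARD('n) - m) M U \<rho>"
    "signed_normal_form (CARD('n) - m) M x = prod_twoforms (map (\<lambda>j. grad (\<rho> j) x) [0..<CARD('n) - m])"
proof -
  let ?p = "CARD('n) - m"
  define Q where "Q \<omega> \<longleftrightarrow> (\<exists>U \<rho> \<nu>. x \<in> U \<and> orthonormal_defining ?p M U \<rho> \<and>
     \<nu> = wedge_list (map (\<lambda>j. conormal (\<rho> j) x) [0..<?p]) \<and> \<omega> = \<nu> \<and>\<^sub>s Jop \<nu>)" for \<omega>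
  obtain U \<rho> where "x \<in> U" "orthonormal_defining ?p M U \<rho>" using exists_orthonormal_defining[OF M x] .
  then have "\<exists>\<omega>. Q \<omega>" unfolding Q_def by (intro exI conjI) (assumption | rule refl)+
  then have "Q (SOME \<omega>. Q \<omega>)" by (rule someI_ex)
  then have "Q (normal_form ?p M x)" unfolding normal_form_def Q_def[abs_def] .
  then obtain U \<rho> \<nu> where U: "x \<in> U" "orthonormal_defining ?p M U \<rho>"
    and \<nu>: "\<nu> = wedge_list (map (\<lambda>j. conormal (\<rho> j) x) [0..<?p])" "normal_form ?p M x = \<nu> \<and>\<^sub>s Jop \<nu>"
    unfolding Q_def by (elim exE conjE)
  have "conormal (\<rho> j) x = xform (grad (\<rho> j) x)" if "j < ?p" for j
    using U that unfolding orthonormal_defining_def defining_functions_def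
    by (blast intro: conormal_eq_xform smooth_on_differentiable)
  then have "\<nu> = wedge_list (map xform (map (\<lambda>j. grad (\<rho> j) x) [0..<?p]))"
    unfolding \<nu>(1) by (intro arg_cong[of _ _ wedge_list]) simp
  with normal_form_eq_prod_twoforms[of "map (\<lambda>j. grad (\<rho> j) x) [0..<?p]"]
  have "signed_normal_form ?p M x = prod_twoforms (map (\<lambda>j. grad (\<rho> j) x) [0..<?p])"
    unfolding signed_normal_form_def \<nu>(2) by simp
  with U show thesis by (rule that)
qed

lemma signed_normal_form_frame:
  fixes M :: "(real ^ 'n::{finite,wellorder}) set"
  assumes M: "submanifold CARD('m::finite) M" and x: "x \<in> M"
  obtains ns ts where "orthonormal_list (ns @ ts)" "length (ns @ ts) = CARD('n)" "length ts = CARD('m)"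
    "signed_normal_form (CARD('n) - CARD('m)) M x = prod_twoforms ns"
    "outer_sum ts = tangent_projection CARD('m) M x"
    "outer_sum ns = mat 1 - tangent_projection CARD('m) M x"
proof -
  let ?p = "CARD('n) - CARD('m)"
  have le: "CARD('m) \<le> CARD('n)" using M by (simp add: submanifold_def)
  obtain U \<rho> where U: "x \<in> U" "orthonormal_defining ?p M U \<rho>"
    and eq: "signed_normal_form ?p M x = prod_twoforms (map (\<lambda>j. grad (\<rho> j) x) [0..<?p])"
    using signed_normal_form_eq_prod_twoforms[OF M x] .
  let ?ns = "map (\<lambda>j. grad (\<rho> j) x) [0..<?p]"
  obtain ts where ts: "orthonormal_list (?ns @ ts)" "length (?ns @ ts) = CARD('n)"
    "span (set ts) = {v. \<forall>n\<in>set ?ns. n \<bullet> v = 0}"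
    using orthonormal_list_extend[OF orthonormal_defining_list[OF U(2) x U(1)]] .
  have P: "tangent_projection CARD('m) M x = mat 1 - outer_sum ?ns"
    by (rule tangent_projection_eq[OF M U(2) x U(1)])
  have dis: "set ?ns \<inter> set ts = {}" using ts(1) by (auto simp: orthonormal_list_def)
  have "outer_sum ?ns + outer_sum ts = mat 1"
  proof -
    have "(outer_sum ?ns + outer_sum ts) $ k $ l = (\<Sum>b\<in>set (?ns @ ts). b $ k * b $ l)" for k l
      unfolding set_append using dis by (subst sum.union_disjoint) (auto simp: outer_sum_def)
    then show ?thesis
      by (simp only: vec_eq_iff orthonormal_list_complete[OF ts(1,2)]) (simp add: mat_def)
  qed
  then have Pts: "outer_sum ts = tangent_projection CARD('m) M x"
    unfolding P by (simp only: eq_diff_eq add.commute)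
  have "outer_sum ?ns = mat 1 - tangent_projection CARD('m) M x" unfolding P by simp
  moreover have "length ts = CARD('m)" using ts(2) le by simp
  ultimately show thesis by (intro that[OF ts(1,2) _ eq Pts])
qed

text \<open>The form is chosen separately at every point. Expressing it through the tangential
  projection shows that it is nevertheless continuous on \<open>M\<close>.\<close>

lemma signed_normal_form_divpow:
  fixes M :: "(real ^ 'n::{finite,wellorder}) set"
  assumes M: "submanifold CARD('m::finite) M" and x: "x \<in> M"
  shows "signed_normal_form (CARD('n) - CARD('m)) M x =
    divpow (bilin_form (mat 1 - tangent_projection CARD('m) M x)) (CARD('n) - CARD('m))"
proof -
  obtain ns ts where f: "orthonormal_list (ns @ ts)" "length (ns @ ts) = CARD('n)" "length ts = CARD('m)"
    "signed_normal_form (CARD('n) - CARD('m)) M x = prod_twoforms ns"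
    "outer_sum ts = tangent_projection CARD('m) M x"
    "outer_sum ns = mat 1 - tangent_projection CARD('m) M x"
    using signed_normal_form_frame[OF M x] .
  have "distinct ns" using f(1) by (simp add: orthonormal_list_def)
  moreover have "length ns = CARD('n) - CARD('m)" using f(2,3) by simp
  ultimately show ?thesis
    using divpow_sum_twoforms[of ns] unfolding f(4) f(6)[symmetric]
    by (simp add: sum_twoforms_eq_bilin_form)
qed

lemma continuous_on_divpow:
  "continuous_on S f \<Longrightarrow> continuous_on S (\<lambda>x. divpow (f x) k)"
proof -
  assume f: "continuous_on S f"
  have "continuous_on S (\<lambda>x. wedge_power (f x) k)"
    by (induction k) (auto intro: wedge.continuous_on f)
  then show ?thesis unfolding divpow_def by (intro continuous_on_scaleR continuous_on_const)
qed

lemma continuous_on_signed_normal_form: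
  fixes M :: "(real ^ 'n::{finite,wellorder}) set"
  assumes M: "submanifold CARD('m::finite) M"
  shows "continuous_on M (signed_normal_form (CARD('n) - CARD('m)) M)"
proof -
  have "continuous_on M (\<lambda>x. divpow (bilin_form (mat 1 - tangent_projection CARD('m) M x)) (CARD('n) - CARD('m)))"
    unfolding bilin_form_def vector_minus_component
    by (intro continuous_on_divpow continuous_on_sum continuous_on_scaleR continuous_on_diff continuous_on_const
      continuous_on_tangent_projection[OF M])
  then show ?thesis
    by (rule continuous_on_eq) (rule signed_normal_form_divpow[OF M, symmetric])
qed

text \<open>This sign is the one in \<open>superintegral\<close>, so the two cancel and a
  submanifold current of top degree acts as plain surface integration.\<close>

lemma top_coefficient_volume:
  fixes M :: "(real ^ 'n::{finite,wellorder}) set"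
  assumes M: "submanifold CARD('m::finite) M" and x: "x \<in> M"
  shows "(signed_normal_form (CARD('n) - CARD('m)) M x \<and>\<^sub>s divpow \<beta> CARD('m)) $ (UNIV, UNIV) =
    (- 1) ^ (CARD('n) * (CARD('n) - 1) div 2)"
proof -
  obtain ns ts where f: "orthonormal_list (ns @ ts)" "length (ns @ ts) = CARD('n)" "length ts = CARD('m)"
    "signed_normal_form (CARD('n) - CARD('m)) M x = prod_twoforms ns"
    "outer_sum ts = tangent_projection CARD('m) M x"
    "outer_sum ns = mat 1 - tangent_projection CARD('m) M x"
    using signed_normal_form_frame[OF M x] .
  show ?thesis
    using prod_twoforms_wedge_divpow_\<beta>[OF f(1,2)] unfolding f(3,4)
    by (simp add: sbasis_def)
qed

lemma top_coefficient_tangent_projection: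
  fixes M :: "(real ^ 'n::{finite,wellorder}) set"
  assumes M: "submanifold CARD('m::finite) M" and x: "x \<in> M"
  shows "(dx k \<and>\<^sub>s d\<xi> l \<and>\<^sub>s signed_normal_form (CARD('n) - CARD('m)) M x \<and>\<^sub>s divpow \<beta> (CARD('m) - 1)) $ (UNIV, UNIV) =
    (- 1) ^ (CARD('n) * (CARD('n) - 1) div 2) * tangent_projection CARD('m) M x $ k $ l"
proof -
  obtain ns ts where f: "orthonormal_list (ns @ ts)" "length (ns @ ts) = CARD('n)" "length ts = CARD('m)"
    "signed_normal_form (CARD('n) - CARD('m)) M x = prod_twoforms ns"
    "outer_sum ts = tangent_projection CARD('m) M x"
    "outer_sum ns = mat 1 - tangent_projection CARD('m) M x"
    using signed_normal_form_frame[OF M x] .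
  have "ts \<noteq> []" using f(3) by auto
  from dx_d\<xi>_wedge_prod_twoforms_divpow_\<beta>[OF f(1,2) this, of k l]
  show ?thesis unfolding f(3,4) f(5)[symmetric]
    by (simp add: sbasis_def outer_sum_def)
qed

lemma sum_sbasis_wedge_expansion:
  "(\<Sum>(I, J)\<in>UNIV. (c $ (I, J) *\<^sub>R a) \<and>\<^sub>s sbasis I J) = a \<and>\<^sub>s c"
  for a c :: "'n::{finite,wellorder} superalg"
proof -
  have "a \<and>\<^sub>s c = a \<and>\<^sub>s (\<Sum>P\<in>UNIV. c $ P *\<^sub>R sbasis (fst P) (snd P))"
    using superalg_basis_expansion[of c] by (rule arg_cong)
  also have "\<dots> = (\<Sum>P\<in>UNIV. (c $ P *\<^sub>R a) \<and>\<^sub>s sbasis (fst P) (snd P))"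
    by (simp add: wedge.sum_right wedge.scaleR_left wedge.scaleR_right)
  finally show ?thesis by (simp add: case_prod_beta)
qed

text \<open>The powers of \<open>\<beta>\<close> have constant coefficients; these leave the
  integral, and the sum over basis forms reassembles into one wedge product.\<close>

lemma submanifold_current_beta_eq:
  fixes M :: "(real ^ 'n::{finite,wellorder}) set"
  shows "submanifold_current_beta TYPE('m::{finite,wellorder}) M k \<phi> =
    (LINT x|surface_measure TYPE('m) M. \<phi> x *\<^sub>R signed_normal_form (CARD('n) - CARD('m)) M x) \<and>\<^sub>s divpow \<beta> k"
  unfolding submanifold_current_beta_def submanifold_current_def current_wedge_def fmult_def form_measure_def
    Let_def divpow_def[symmetric] signed_normal_form_def[symmetric] scaleR_scaleR[symmetric] integral_scaleR_right
  by (rule sum_sbasis_wedge_expansion)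

lemma submanifold_current_beta_0 [simp]:
  "submanifold_current_beta T M k (\<lambda>_. 0) = 0"
  by (simp add: submanifold_current_beta_def submanifold_current_def current_wedge_def fmult_def form_measure_def
    Let_def wedge.zero_left)

text \<open>Linear maps between finite-dimensional spaces are bounded and commute with the integral,
  so only the value of the functional on the form at each point matters.\<close>

lemma linear_functional_submanifold_current_beta:
  fixes M :: "(real ^ 'n::{finite,wellorder}) set" and \<Lambda> :: "'n superalg \<Rightarrow> real"
  assumes M: "submanifold CARD('m::{finite,wellorder}) M" and \<phi>: "continuous_on M \<phi>"
    and K: "compact K" "\<And>x. x \<notin> K \<Longrightarrow> \<phi> x = 0" and \<Lambda>: "linear \<Lambda>"
    and g: "\<And>x. x \<in> M \<Longrightarrow> \<Lambda> (signed_normal_form (CARD('n) - CARD('m)) M x \<and>\<^sub>s divpow \<beta> k) = g x"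
  shows "\<Lambda> (submanifold_current_beta TYPE('m) M k \<phi>) = (LINT x|surface_measure TYPE('m) M. \<phi> x * g x)"
proof -
  let ?\<omega> = "signed_normal_form (CARD('n) - CARD('m)) M"
  have bl: "bounded_linear (\<lambda>a. \<Lambda> (a \<and>\<^sub>s divpow \<beta> k))"
    using linear_compose[OF linear_wedge_left \<Lambda>] by (simp add: o_def linear_conv_bounded_linear)
  have "integrable (surface_measure TYPE('m) M) (\<lambda>x. \<phi> x *\<^sub>R ?\<omega> x)"
    by (rule integrable_surface_measure_compact(2)[OF M _ K(1)])
      (auto intro!: continuous_on_scaleR \<phi> continuous_on_signed_normal_form[OF M] simp: K(2))
  from integral_bounded_linear[OF bl this]
  have "\<Lambda> (submanifold_current_beta TYPE('m) M k \<phi>) = (LINT x|surface_measure TYPE('m) M. \<Lambda> ((\<phi> x *\<^sub>R ?\<omega> x) \<and>\<^sub>s divpow \<beta> k))"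
    unfolding submanifold_current_beta_eq by (rule sym)
  also have "\<dots> = (LINT x|surface_measure TYPE('m) M. \<phi> x * g x)"
    by (intro Bochner_Integration.integral_cong refl)
      (simp add: sets_surface_measure(2)[OF M] wedge.scaleR_left linear_scale[OF \<Lambda>] g)
  finally show ?thesis .
qed

lemma test_form_0_0:
  assumes "test_form 0 0 (\<alpha> :: 'n::{finite,wellorder} superform)"
  shows "smooth_on UNIV (\<lambda>x. \<alpha> x $ ({}, {}))"
    and "\<exists>K. compact K \<and> (\<forall>x. x \<notin> K \<longrightarrow> \<alpha> x $ ({}, {}) = 0)"
    and "(I, J) \<noteq> ({}, {}) \<Longrightarrow> \<alpha> x $ (I, J) = 0"
proof -
  have 1: "smooth_on UNIV \<alpha>" and 2: "\<exists>K. compact K \<and> (\<forall>x. x \<notin> K \<longrightarrow> \<alpha> x = 0)"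
    and 3: "\<And>x I J. \<alpha> x $ (I, J) \<noteq> 0 \<Longrightarrow> card I = 0 \<and> card J = 0"
    using assms unfolding test_form_def by simp_all
  show "smooth_on UNIV (\<lambda>x. \<alpha> x $ ({}, {}))"
    using 1 unfolding smooth_on_def by (simp add: Ck_on_nth)
  show "\<exists>K. compact K \<and> (\<forall>x. x \<notin> K \<longrightarrow> \<alpha> x $ ({}, {}) = 0)"
    using 2 by (metis zero_index)
  show "\<alpha> x $ (I, J) = 0" if "(I, J) \<noteq> ({}, {})"
    using 3[of x I J] that by (cases "\<alpha> x $ (I, J) = 0") auto
qed

text \<open>A form of bidegree (0, 0) has a single coefficient. The other coefficients are the zero
  function, and since linearity is not built into the type \<open>supercurrent\<close>,
  \<open>T\<close> must be known to vanish there.\<close>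

lemma current_act_test_form_0_0:
  fixes \<alpha> :: "'n::{finite,wellorder} superform"
  assumes \<alpha>: "test_form 0 0 \<alpha>" and T: "T (\<lambda>_. 0) = 0"
  shows "current_act T \<alpha> = (- 1) ^ (CARD('n) * (CARD('n) - 1) div 2) * T (\<lambda>x. \<alpha> x $ ({}, {})) $ (UNIV, UNIV)"
proof -
  have "(\<Sum>P\<in>UNIV. T (\<lambda>x. \<alpha> x $ P) \<and>\<^sub>s sbasis (fst P) (snd P)) =
      (\<Sum>P\<in>{({}, {})}. T (\<lambda>x. \<alpha> x $ P) \<and>\<^sub>s sbasis (fst P) (snd P))"
  proof (rule sum.mono_neutral_right)
    show "\<forall>P\<in>UNIV - {({}, {})}. T (\<lambda>x. \<alpha> x $ P) \<and>\<^sub>s sbasis (fst P) (snd P) = 0"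
    proof
      fix P assume "P \<in> UNIV - {({} :: 'n set, {} :: 'n set)}"
      then have "(\<lambda>x. \<alpha> x $ P) = (\<lambda>_. 0)" using test_form_0_0(3)[OF \<alpha>, of "fst P" "snd P"] by auto
      then show "T (\<lambda>x. \<alpha> x $ P) \<and>\<^sub>s sbasis (fst P) (snd P) = 0" by (simp add: T wedge.zero_left)
    qed
  qed auto
  then show ?thesis
    by (simp add: current_act_def superintegral_def current_wedge_def fmult_def case_prod_beta)
qed

lemma current_d_dsharp:
  "current_d (current_dsharp T) \<phi> = (\<Sum>k\<in>UNIV. \<Sum>l\<in>UNIV. dx k \<and>\<^sub>s d\<xi> l \<and>\<^sub>s T (partial l (partial k \<phi>)))"
  by (simp add: current_d_def current_dsharp_def current_partial_def wedge.sum_right wedge.minus_right sum_negf)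

theorem theorem8p2:
  fixes I :: "real set"
    and M :: "real \<Rightarrow> (real ^ 'n::{finite,wellorder}) set"
  assumes "is_interval I" and "0 \<in> I" and "I \<noteq> {0}"
    and "mean_curvature_flow CARD('m::{finite,wellorder}) I M"
  shows "has_current_derivative CARD('n) CARD('n)
     (\<lambda>t. submanifold_current_beta TYPE('m) (M t) CARD('m))
     (\<lambda>\<phi>. - fmult (\<lambda>x. (norm (mean_curvature_vector CARD('m) (M 0) x))\<^sup>2)
                (submanifold_current_beta TYPE('m) (M 0) CARD('m)) \<phi>
           - current_d (current_dsharp
                (submanifold_current_beta TYPE('m) (M 0) (CARD('m) - 1))) \<phi>)
     (at 0 within I)"
  unfolding has_current_derivative_def
proof (intro allI impI)
  let ?h = "\<lambda>x. (norm (mean_curvature_vector CARD('m) (M 0) x))\<^sup>2"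
  let ?S = "\<lambda>t. submanifold_current_beta TYPE('m) (M t) :: nat \<Rightarrow> 'n supercurrent"
  let ?\<mu> = "\<lambda>t. surface_measure TYPE('m) (M t)"
  let ?P = "tangent_projection CARD('m) (M 0)"
  let ?T' = "\<lambda>\<phi>. - fmult ?h (?S 0 CARD('m)) \<phi> - current_d (current_dsharp (?S 0 (CARD('m) - 1))) \<phi>"
  fix \<alpha> :: "'n superform"
  assume "test_form (CARD('n) - CARD('n)) (CARD('n) - CARD('n)) \<alpha>"
  then have \<alpha>: "test_form 0 0 \<alpha>" by simp
  define f where "f = (\<lambda>x. \<alpha> x $ ({}, {}))"
  \<comment> \<open>The sign of \<open>superintegral\<close>; it recurs in the top coefficients, and
    \<open>\<epsilon>\<epsilon>\<close> removes it.\<close>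
  define \<epsilon> :: real where "\<epsilon> = (- 1) ^ (CARD('n) * (CARD('n) - 1) div 2)"
  have \<epsilon>\<epsilon>: "\<epsilon> * \<epsilon> = 1" by (simp add: \<epsilon>_def power_add[symmetric])
  have sm: "smooth_on UNIV f" unfolding f_def by (rule test_form_0_0(1)[OF \<alpha>])
  then have f2: "Ck_on 2 UNIV f" by (rule smooth_on_Ck_on)
  obtain K where K: "compact K" and f0: "\<And>x. x \<notin> K \<Longrightarrow> f x = 0"
    using test_form_0_0(2)[OF \<alpha>] unfolding f_def by auto
  have M: "submanifold CARD('m) (M t)" if "t \<in> I" for t
    using assms(4) that by (simp add: mean_curvature_flow_def)
  obtain H F where smH: "smooth_on UNIV H"
    and H': "\<forall>t\<in>I. \<forall>x\<in>M t. H x = mean_curvature_vector CARD('m) (M t) x"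
    and F': "\<forall>x\<in>M 0. F 0 x = x \<and> (\<forall>t\<in>I. ((\<lambda>s. F s x) has_vector_derivative - H (F t x)) (at t within I))"
    and F'': "\<forall>t\<in>I. F t ` M 0 = M t"
    using assms(4) unfolding mean_curvature_flow_def by (elim conjE exE)
  have H: "H x = mean_curvature_vector CARD('m) (M 0) x" if "x \<in> M 0" for x using H' assms(2) that by blast
  have F0: "F 0 x = x" if "x \<in> M 0" for x using F' that by blast
  have F1: "((\<lambda>s. F s x) has_vector_derivative - H (F t x)) (at t within I)" if "x \<in> M 0" "t \<in> I" for x t
    using F' that by blast
  have F2: "F t ` M 0 = M t" if "t \<in> I" for t using F'' that by blast
  have H2: "Ck_on 2 UNIV H" using smH by (rule smooth_on_Ck_on)
  note M0 = M[OF assms(2)]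
  have cf: "continuous_on S f" for S
    using continuous_on_subset[OF Ck_on_continuous[OF f2] subset_UNIV] .
  have c2': "continuous_on UNIV (partial l (partial k f))" for k l
    using f2 by (auto simp: numeral_2_eq_2)
  have c2: "continuous_on S (partial l (partial k f))" for S k l
    using continuous_on_subset[OF c2' subset_UNIV] .
  have z2: "partial l (partial k f) x = 0" if "x \<notin> K" for k l x
    by (rule partial_eq_0_outside[OF K partial_eq_0_outside[OF K f0] that])
  have lin1: "linear (\<lambda>a. \<epsilon> * a $ (UNIV, UNIV))" for \<epsilon> :: real
    by (auto intro!: linearI simp: algebra_simps)
  have lin2: "linear (\<lambda>a. \<epsilon> * (dx k \<and>\<^sub>s d\<xi> l \<and>\<^sub>s a) $ (UNIV, UNIV))" for k l :: 'n
    using linear_compose[OF linear_compose[OF linear_wedge_right linear_wedge_right] lin1[of \<epsilon>], of "dx k" "d\<xi> l"]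
    by (simp add: o_def)
  have act: "\<epsilon> * ?S t CARD('m) \<phi> $ (UNIV, UNIV) = (LINT x|?\<mu> t. \<phi> x)"
    if "t \<in> I" "continuous_on (M t) \<phi>" "\<And>x. x \<notin> K \<Longrightarrow> \<phi> x = 0" for t \<phi>
  proof -
    have "\<epsilon> * ?S t CARD('m) \<phi> $ (UNIV, UNIV) = (LINT x|?\<mu> t. \<phi> x * 1)"
      by (rule linear_functional_submanifold_current_beta[OF M[OF that(1)] that(2) K _ lin1], erule that(3))
        (simp only: top_coefficient_volume[OF M[OF that(1)]] \<epsilon>_def[symmetric] \<epsilon>\<epsilon>)
    then show ?thesis by simp
  qed
  have actS: "\<epsilon> * (dx k \<and>\<^sub>s d\<xi> l \<and>\<^sub>s ?S 0 (CARD('m) - 1) (partial l (partial k f))) $ (UNIV, UNIV) =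
      (LINT x|?\<mu> 0. partial l (partial k f) x * ?P x $ k $ l)" for k l
  proof (rule linear_functional_submanifold_current_beta[OF M0 c2 K z2 lin2])
    fix x assume "x \<in> M 0"
    then show "\<epsilon> * (dx k \<and>\<^sub>s d\<xi> l \<and>\<^sub>s signed_normal_form (CARD('n) - CARD('m)) (M 0) x \<and>\<^sub>s divpow \<beta> (CARD('m) - 1)) $ (UNIV, UNIV) =
        ?P x $ k $ l"
      unfolding top_coefficient_tangent_projection[OF M0 \<open>x \<in> M 0\<close>] \<epsilon>_def[symmetric] mult.assoc[symmetric] \<epsilon>\<epsilon> by simp
  qed
  have "?T' (\<lambda>_. 0) = 0"
  proof -
    have "partial k (\<lambda>_ :: real ^ 'n::_. 0 :: real) = (\<lambda>_. 0)" for k by (simp add: partial_def fun_eq_iff)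
    then show ?thesis by (simp add: fmult_def current_d_dsharp wedge.zero_right)
  qed
  from current_act_test_form_0_0[OF \<alpha>, of ?T', OF this]
  have "current_act ?T' \<alpha> = - (\<epsilon> * ?S 0 CARD('m) (\<lambda>x. ?h x * f x) $ (UNIV, UNIV)) -
      (\<Sum>k\<in>UNIV. \<Sum>l\<in>UNIV. \<epsilon> * (dx k \<and>\<^sub>s d\<xi> l \<and>\<^sub>s ?S 0 (CARD('m) - 1) (partial l (partial k f))) $ (UNIV, UNIV))"
    unfolding f_def[symmetric] \<epsilon>_def[symmetric]
    by (simp add: fmult_def current_d_dsharp algebra_simps sum_distrib_left)
  also have "\<epsilon> * ?S 0 CARD('m) (\<lambda>x. ?h x * f x) $ (UNIV, UNIV) = (LINT x|?\<mu> 0. ?h x * f x)"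
  proof (rule act[OF assms(2)])
    \<comment> \<open>Continuity of the chosen mean curvature vector is taken from the ambient field
      \<open>H\<close> that coincides with it on \<open>M 0\<close>.\<close>
    have "continuous_on (M 0) (\<lambda>x. (norm (H x))\<^sup>2 * f x)"
      using continuous_on_subset[OF Ck_on_continuous[OF H2] subset_UNIV]
      by (intro continuous_on_mult continuous_on_power continuous_on_norm cf)
    then show "continuous_on (M 0) (\<lambda>x. ?h x * f x)"
      by (rule continuous_on_eq) (simp add: H)
  qed (simp add: f0)
  also have "\<dots> = (LINT x|?\<mu> 0. f x * (norm (H x))\<^sup>2)"
    by (intro Bochner_Integration.integral_cong refl) (simp add: sets_surface_measure(2)[OF M0] H)
  also have "(\<Sum>k\<in>UNIV. \<Sum>l\<in>UNIV. \<epsilon> * (dx k \<and>\<^sub>s d\<xi> l \<and>\<^sub>s ?S 0 (CARD('m) - 1) (partial l (partial k f))) $ (UNIV, UNIV)) =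
      (LINT x|?\<mu> 0. (\<Sum>k\<in>UNIV. \<Sum>l\<in>UNIV. ?P x $ k $ l * partial k (partial l f) x))"
  proof -
    have i: "integrable (?\<mu> 0) (\<lambda>x. ?P x $ k $ l * partial k (partial l f) x)" for k l
      by (rule integrable_surface_measure_compact(2)[OF M0 _ K])
        (auto intro!: continuous_on_mult c2 continuous_on_tangent_projection[OF M0] simp: z2)
    \<comment> \<open>Moving \<open>d\<close> and \<open>d^#\<close> onto the test function reverses
      the order of the two derivatives; symmetry restores the order of the variation
      formula.\<close>
    have "(LINT x|?\<mu> 0. partial l (partial k f) x * ?P x $ k $ l) = (LINT x|?\<mu> 0. ?P x $ k $ l * partial k (partial l f) x)" for k l
      by (intro Bochner_Integration.integral_cong refl)
        (simp add: partial_commute_real[where j = l and k = k, OF open_UNIV UNIV_I f2])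
    then show ?thesis
      unfolding actS using i by (simp add: Bochner_Integration.integral_sum)
  qed
  finally have R: "current_act ?T' \<alpha> = - (LINT x|?\<mu> 0. f x * (norm (H x))\<^sup>2) -
      (LINT x|?\<mu> 0. (\<Sum>k\<in>UNIV. \<Sum>l\<in>UNIV. ?P x $ k $ l * partial k (partial l f) x))" .
  have L: "current_act (?S t CARD('m)) \<alpha> = (LINT x|?\<mu> t. f x)" if "t \<in> I" for t
    using current_act_test_form_0_0[OF \<alpha>, of "?S t CARD('m)"] act[OF that cf f0]
    unfolding f_def[symmetric] \<epsilon>_def[symmetric] by simp
  have "((\<lambda>t. LINT x|?\<mu> t. f x) has_real_derivative current_act ?T' \<alpha>) (at 0 within I)"
    unfolding R by (rule first_variation[OF assms(1,2) M H2 H F0 F1 F2 f2 K f0])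
  then show "((\<lambda>t. current_act (?S t CARD('m)) \<alpha>) has_real_derivative current_act ?T' \<alpha>) (at 0 within I)"
    by (rule has_field_derivative_transform_within[where d = 1]) (use L assms(2) in auto)
qed

end
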